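(* Let $1<p,q<\infty$, let $\mu\in A_p$ and $\lambda\in A_q$ be weights on $\mathbb{R}^d$, and set $\frac1r:=\frac1q-\frac1p$, $\frac\alpha d:=\frac1p-\frac1q$ and $\nu^{\frac1p+\frac1{q'}}:=\mu^{\frac1p}\lambda^{-\frac1q}$. Then there are a constant $C>0$, depending only on $p,q,d$, and a constant $c_{\mu,\lambda}>0$, depending only on $p,q,d,\mu,\lambda$, such that for all $b\in L^1_{\mathrm{loc}}(\mathbb{R}^d)$ $$\|\Pi_b\|_{L^p(\mu)\to L^q(\lambda)}\le C\,[\mu]_{A_p}^{\frac1{p-1}}[\lambda]_{A_q}\cdot\begin{cases}\|b\|_{\mathrm{BMO}^\alpha_\nu}&\text{if }p\le q,\\ [\nu]_{A_\infty}^{1/r}\,\|M^{\#}_\nu b\|_{L^r(\nu)}&\text{if }p>q,\end{cases}$$ and $$\|\Pi_b\|_{L^p(\mu)\to L^q(\lambda)}\ge c_{\mu,\lambda}\cdot\begin{cases}\|b\|_{\mathrm{BMO}^\alpha_\nu}&\text{if }p\le q,\\ \|M^{\#}_\nu b\|_{L^r(\nu)}&\text{if }p>q.\end{cases}$$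
   Context: A dyadic lattice $\mathcal D=\bigcup_{k\in\mathbb Z}\mathcal D_k$ on $\mathbb{R}^d$ is fixed: $\mathcal D_k$ is a partition of $\mathbb{R}^d$ into (axis-parallel) cubes of side length $2^{-k}$ and $\mathcal D_{k+1}$ refines $\mathcal D_k$. For $Q\in\mathcal D$, $\widehat Q$ is the smallest $R\in\mathcal D$ with $Q\subsetneq R$. All suprema over cubes below are over $Q\in\mathcal D$. $\langle f\rangle_Q:=\frac1{|Q|}\int_Qf\,dx$; $p'$ is the conjugate exponent. A weight is a locally integrable $w:\mathbb{R}^d\to(0,\infty)$; $w(E):=\int_Ew\,dx$; $\|f\|_{L^p(w)}:=(\int|f|^pw\,dx)^{1/p}$. $[w]_{A_p}:=\sup_{Q}\langle w\rangle_Q\langle w^{-p'/p}\rangle_Q^{p/p'}$ for $p\in(1,\infty)$, and $[w]_{A_\infty}:=\sup_{Q}\frac1{w(Q)}\int_Q\sup_{R\in\mathcal D,\,x\in R\subseteq Q}\frac{w(R)}{|R|}\,dx$; $w\in A_p$ means $[w]_{A_p}<\infty$. $\|b\|_{\mathrm{BMO}^\alpha_\nu}:=\sup_Q\frac1{\nu(Q)^{1+\alpha/d}}\int_Q|b-\langle b\rangle_Q|\,dx$ and $M^{\#}_\nu b:=\sup_Q\frac{\mathbf 1_Q}{\nu(Q)}\int_Q|b-\langle b\rangle_Q|\,dx$. Paraproduct: $D_Qb:=\sum_{R\in\mathcal D:\widehat R=Q}\langle b\rangle_R\mathbf 1_R-\langle b\rangle_Q\mathbf 1_Q$ and $\Pi_bf:=\sum_{Q\in\mathcal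 D}D_Qb\,\langle f\rangle_Q$ for $f\in L^\infty_c$ (bounded, compactly supported). $\Pi_b$ is well defined if for each $f\in L^\infty_c$ this sum converges unconditionally in $L^1(K)$ for every compact $K$. $\|\Pi_b\|_{L^p(\mu)\to L^q(\lambda)}$ is the least $N$ with $\|\Pi_bf\|_{L^q(\lambda)}\le N\|f\|_{L^p(\mu)}$ for all $f\in L^\infty_c$; it is $+\infty$ if there is no such $N$ or if $\Pi_b$ is not well defined. *)

theory Defs
  imports "HOL-Analysis.Analysis" "HOL-Library.Disjoint_Sets"
begin

text \<open>
  Suprema, integrals of nonnegative functions and norms take values in \<^typ>\<open>ennreal\<close>, so that
  they may be infinite.  The dimension is \<^term>\<open>CARD('n)\<close>; integration is with respect to
  the completed Lebesgue measure.  Functions whose averages are taken are valued in a type \<open>'k\<close>,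
  to be instantiated by the real or the complex numbers.
\<close>

text \<open>Only used with \<^term>\<open>a > 0\<close>; then \<open>0\<close> is sent to \<open>0\<close> and \<open>\<infinity>\<close> to \<open>\<infinity>\<close>.\<close>

definition ennpowr :: "ennreal \<Rightarrow> real \<Rightarrow> ennreal" where
  "ennpowr x a = (if x = \<infinity> then \<infinity> else ennreal (enn2real x powr a))"

definition conj_exp :: "real \<Rightarrow> real" where
  "conj_exp p = p / (p - 1)"


subsection \<open>Dyadic lattices\<close>

text \<open>A cube is a product of \<open>d\<close> intervals of length \<open>l\<close>. No choice is made of which faces
  belong to it, so the usual half-open cubes are included.\<close>

definition is_cube :: "real \<Rightarrow> (real^'n) set \<Rightarrow> bool" where
  "is_cube l Q \<longleftrightarrow> l > 0 \<and> is_interval Q \<and>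
     (\<exists>a. box a (\<chi> i. a $ i + l) \<subseteq> Q \<and> Q \<subseteq> cbox a (\<chi> i. a $ i + l))"

definition dyadic_lattice :: "(real^'n) set set \<Rightarrow> bool" where
  "dyadic_lattice D \<longleftrightarrow> (\<exists>Dk :: int \<Rightarrow> (real^'n) set set.
     D = (\<Union>k. Dk k) \<and>
     (\<forall>k. partition_on UNIV (Dk k) \<and> (\<forall>Q\<in>Dk k. is_cube (2 powi (- k)) Q)) \<and>
     (\<forall>k. refines UNIV (Dk (k + 1)) (Dk k)))"

definition dyadic_parent :: "(real^'n) set set \<Rightarrow> (real^'n) set \<Rightarrow> (real^'n) set" where
  "dyadic_parent D Q = (THE R. R \<in> D \<and> Q \<subset> R \<and> (\<forall>S\<in>D. Q \<subset> S \<longrightarrow> R \<subseteq> S))"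


subsection \<open>Weights\<close>

definition locally_integrable ::
  "(real^'n \<Rightarrow> 'k::{banach,second_countable_topology}) \<Rightarrow> bool" where
  "locally_integrable f \<longleftrightarrow> (\<forall>K. compact K \<longrightarrow> set_integrable lebesgue K f)"

definition average ::
  "(real^'n) set \<Rightarrow> (real^'n \<Rightarrow> 'k::{banach,second_countable_topology}) \<Rightarrow> 'k" where
  "average Q f = (LINT x:Q|lebesgue. f x) /\<^sub>R measure lebesgue Q"

definition nn_average :: "(real^'n) set \<Rightarrow> (real^'n \<Rightarrow> ennreal) \<Rightarrow> ennreal" where
  "nn_average Q f = (\<integral>\<^sup>+x\<in>Q. f x \<partial>lebesgue) / emeasure lebesgue Q"

definition weight :: "(real^'n \<Rightarrow> real) \<Rightarrow> bool" where
  "weight w \<longleftrightarrow> locally_integrable w \<and> (\<forall>x. w x > 0)"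

definition wmass :: "(real^'n \<Rightarrow> real) \<Rightarrow> (real^'n) set \<Rightarrow> ennreal" where
  "wmass w E = (\<integral>\<^sup>+x\<in>E. ennreal (w x) \<partial>lebesgue)"

definition Ap_char :: "(real^'n) set set \<Rightarrow> real \<Rightarrow> (real^'n \<Rightarrow> real) \<Rightarrow> ennreal" where
  "Ap_char D p w = (SUP Q\<in>D. nn_average Q (\<lambda>x. ennreal (w x)) *
     ennpowr (nn_average Q (\<lambda>x. ennreal (w x powr (- conj_exp p / p)))) (p / conj_exp p))"

definition Ainf_char :: "(real^'n) set set \<Rightarrow> (real^'n \<Rightarrow> real) \<Rightarrow> ennreal" where
  "Ainf_char D w = (SUP Q\<in>D.
     (\<integral>\<^sup>+x\<in>Q. (SUP R\<in>{R\<in>D. x \<in> R \<and> R \<subseteq> Q}. wmass w R / emeasure lebesgue R) \<partial>lebesgue) / wmass w Q)"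

definition Ap_weight :: "(real^'n) set set \<Rightarrow> real \<Rightarrow> (real^'n \<Rightarrow> real) \<Rightarrow> bool" where
  "Ap_weight D p w \<longleftrightarrow> weight w \<and> Ap_char D p w < \<infinity>"

text \<open>The argument \<open>g\<close> stands for the modulus of the function whose norm is taken.\<close>

definition wLp_norm :: "real \<Rightarrow> (real^'n \<Rightarrow> real) \<Rightarrow> (real^'n \<Rightarrow> ennreal) \<Rightarrow> ennreal" where
  "wLp_norm p w g = ennpowr (\<integral>\<^sup>+x. ennpowr (g x) p * ennreal (w x) \<partial>lebesgue) (1 / p)"


subsection \<open>Oscillation\<close>

definition oscillation ::
  "(real^'n \<Rightarrow> 'k::{banach,second_countable_topology}) \<Rightarrow> (real^'n) set \<Rightarrow> ennreal" where
  "oscillation b Q = (\<integral>\<^sup>+x\<in>Q. ennreal (norm (b x - average Q b)) \<partial>lebesgue)"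

definition bmo_norm ::
  "(real^'n) set set \<Rightarrow> real \<Rightarrow> (real^'n \<Rightarrow> real) \<Rightarrow>
   (real^'n \<Rightarrow> 'k::{banach,second_countable_topology}) \<Rightarrow> ennreal" where
  "bmo_norm D \<alpha> \<nu> b =
     (SUP Q\<in>D. oscillation b Q / ennpowr (wmass \<nu> Q) (1 + \<alpha> / real CARD('n)))"

definition sharp_maximal ::
  "(real^'n) set set \<Rightarrow> (real^'n \<Rightarrow> real) \<Rightarrow>
   (real^'n \<Rightarrow> 'k::{banach,second_countable_topology}) \<Rightarrow> real^'n \<Rightarrow> ennreal" where
  "sharp_maximal D \<nu> b x = (SUP Q\<in>D. indicator Q x / wmass \<nu> Q * oscillation b Q)"


subsection \<open>Paraproducts\<close>

definition mart_diff ::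
  "(real^'n) set set \<Rightarrow> (real^'n) set \<Rightarrow>
   (real^'n \<Rightarrow> 'k::{banach,second_countable_topology}) \<Rightarrow> real^'n \<Rightarrow> 'k" where
  "mart_diff D Q b x =
     (\<Sum>R | R \<in> D \<and> dyadic_parent D R = Q. indicator R x *\<^sub>R average R b)
     - indicator Q x *\<^sub>R average Q b"

definition Linf_c :: "(real^'n \<Rightarrow> 'k::real_normed_vector) set" where
  "Linf_c = {f \<in> borel_measurable lebesgue.
     bounded (range f) \<and> compact (closure {x. f x \<noteq> 0})}"

text \<open>Unconditional convergence in \<open>L\<^sup>1(K)\<close> to \<open>g\<close>, i.e. convergence along the net of
  finite partial sums.\<close>

definition has_uncond_L1_sum ::
  "('i \<Rightarrow> real^'n \<Rightarrow> 'k::{banach,second_countable_topology}) \<Rightarrow> 'i set \<Rightarrow>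
   (real^'n) set \<Rightarrow> (real^'n \<Rightarrow> 'k) \<Rightarrow> bool" where
  "has_uncond_L1_sum u I K g \<longleftrightarrow> set_integrable lebesgue K g \<and>
     ((\<lambda>F. \<integral>\<^sup>+x\<in>K. ennreal (norm ((\<Sum>i\<in>F. u i x) - g x)) \<partial>lebesgue) \<longlongrightarrow> 0)
       (finite_subsets_at_top I)"

definition para_term ::
  "(real^'n) set set \<Rightarrow> (real^'n \<Rightarrow> 'k) \<Rightarrow> (real^'n \<Rightarrow> 'k) \<Rightarrow>
   (real^'n) set \<Rightarrow> real^'n \<Rightarrow> 'k::{real_normed_field,banach,second_countable_topology}" where
  "para_term D b f Q x = mart_diff D Q b x * average Q f"

definition para_well_defined ::
  "(real^'n) set set \<Rightarrow>
   (real^'n \<Rightarrow> 'k::{real_normed_field,banach,second_countable_topology}) \<Rightarrow> bool" where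
  "para_well_defined D b \<longleftrightarrow>
     (\<forall>f\<in>Linf_c. \<forall>K. compact K \<longrightarrow> (\<exists>g. has_uncond_L1_sum (para_term D b f) D K g))"

text \<open>The function \<open>g\<close> is a representative of the paraproduct with symbol \<open>b\<close> applied to \<open>f\<close>;
  it is determined almost everywhere.\<close>

definition is_paraproduct ::
  "(real^'n) set set \<Rightarrow>
   (real^'n \<Rightarrow> 'k::{real_normed_field,banach,second_countable_topology}) \<Rightarrow>
   (real^'n \<Rightarrow> 'k) \<Rightarrow> (real^'n \<Rightarrow> 'k) \<Rightarrow> bool" where
  "is_paraproduct D b f g \<longleftrightarrow>
     (\<forall>K. compact K \<longrightarrow> has_uncond_L1_sum (para_term D b f) D K g)"

text \<open>The infimum is over finite \<open>N\<close>, and the infimum of the empty set is \<open>\<infinity>\<close>.\<close>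

definition para_norm ::
  "(real^'n) set set \<Rightarrow> real \<Rightarrow> (real^'n \<Rightarrow> real) \<Rightarrow> real \<Rightarrow> (real^'n \<Rightarrow> real) \<Rightarrow>
   (real^'n \<Rightarrow> 'k::{real_normed_field,banach,second_countable_topology}) \<Rightarrow> ennreal" where
  "para_norm D p \<mu> q \<kappa> b =
     (if para_well_defined D b then
        Inf {N. N < \<infinity> \<and> (\<forall>f\<in>Linf_c. \<exists>g. is_paraproduct D b f g \<and>
               wLp_norm q \<kappa> (\<lambda>x. ennreal (norm (g x)))
                 \<le> N * wLp_norm p \<mu> (\<lambda>x. ennreal (norm (f x))))}
      else \<infinity>)"

end

(*
  Upper bound.  By duality one estimates sums of |<f>_Q| |D_Q b|_2 |D_Q g|_2.  Stop at the maximal subcubes of a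
  cube S on which the mean of |f|, of |b - <b>_S| or of |g| grows by a large factor.  On the tree of cubes between
  S and its stopping children, orthogonality of the martingale differences and Cauchy-Schwarz bound the sum by
  <|f|>_S osc_S(b) <|g|>_S |S|, and the stopping cubes form a sparse family.  Hoelder's inequality for the weights
  then leaves Carleson embeddings for mu and for the dual weight of lambda, whose constants come from the A_p
  conditions and Doob's inequality, and, if p > q, one for nu governed by its A_infinity characteristic.

  Lower bound.  On S, the paraproduct of the indicator of S is b up to a constant, which bounds the oscillation of
  b on S by mu(S)^(1/p) sigma(S)^(1/q'), a quantity comparable to a power of nu(S).  If p > q, these single cube
  estimates are combined with random signs over the principal cubes of the sharp maximal function, which form a
  sparse family because nu is an A_infinity weight.
*)
theory Submission
  imports Defs
begin

section \<open>Dyadic lattices\<close>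

text \<open>The paraproduct is a limit, so all quantitative estimates concern finite sums of cubes,
  with constants blind to the number of terms. That the limit exists is part of the upper bound:
  \<open>para_norm\<close> is infinite unless the sum converges unconditionally in L^1 on compact
  sets, and the L^1 norms of the terms inside a fixed cube need not be summable. A weighted
  Cauchy-Schwarz inequality supplies the Cauchy property instead. Dual weights restore symmetry.
  With \<sigma> dual to the weight lambda (called \<kappa> in the code), \<nu>^s is \<mu>^(1/p)
  \<sigma>^(1/q') for s = 1/p + 1/q' = 1 + \<alpha>/d. Hoelder exponents with sum s \<ge> 1 suffice
  if p \<le> q; otherwise 1/r is exactly the missing 1 - s, and the sharp function fills the gap.
  The power 1/(p-1) of the characteristic of \<mu> is 1/p from the A_p inequality on a cube plus
  1/(p(p-1)) from passing from a cube to its disjoint part; for \<kappa> the same count gives 1/q +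
  1/q' = 1. A lattice need not have a cube around a given compact set, so roots of trees are always
  maximal cubes of a finite family.\<close>

lemma is_cube_facts:
  fixes Q :: "(real^'n) set"
  assumes "is_cube l Q"
  shows is_cube_lmeasurable: "Q \<in> lmeasurable"
    and is_cube_measure: "measure lebesgue Q = l ^ CARD('n)"
    and is_cube_bounded: "bounded Q"
    and is_cube_interior: "interior Q \<noteq> {}"
proof -
  obtain a where l: "l > 0" and Q: "box a (\<chi> i. a $ i + l) \<subseteq> Q" "Q \<subseteq> cbox a (\<chi> i. a $ i + l)"
    using assms unfolding is_cube_def by blast
  let ?b = "\<chi> i. a $ i + l"
  \<comment> \<open>The faces that \<open>is_cube\<close> leaves undecided lie in the boundary, a
    null set, so measurability and volume are those of the closed box.\<close>
  have "negligible (cbox a ?b - box a ?b)"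
    using negligible_frontier_interval by blast
  then have N: "negligible ((cbox a ?b - Q) \<union> (Q - cbox a ?b))"
    by (rule negligible_subset) (use Q in auto)
  have ne: "cbox a ?b \<noteq> {}"
    using l by (auto simp: interval_ne_empty_cart)
  show "Q \<in> lmeasurable"
    using N by (rule lmeasurable_negligible_symdiff[rotated]) simp
  have "measure lebesgue Q = measure lebesgue (cbox a ?b)"
    by (rule measure_negligible_symdiff) (use N in auto)
  then show "measure lebesgue Q = l ^ CARD('n)"
    using ne by (simp add: content_cbox_cart)
  show "bounded Q"
    using Q(2) bounded_cbox bounded_subset by blast
  have "box a ?b \<noteq> {}"
    using l by (auto simp: interval_ne_empty_cart)
  moreover have "box a ?b \<subseteq> interior Q"
    using Q(1) open_box by (rule interior_maximal)
  ultimately show "interior Q \<noteq> {}" by auto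
qed

text \<open>\<open>dyadic_lattice\<close> only asserts that generations exist; a fixed witness
  \<open>Dk\<close> gives each cube a level, on which the inductions run.\<close>

locale dyadic =
  fixes D :: "(real^'n) set set" and Dk :: "int \<Rightarrow> (real^'n) set set"
  assumes D_eq: "D = (\<Union>k. Dk k)"
    and part: "\<And>k. partition_on UNIV (Dk k)"
    and cube: "\<And>k Q. Q \<in> Dk k \<Longrightarrow> is_cube (2 powi (- k)) Q"
    and refine: "\<And>k. refines UNIV (Dk (k + 1)) (Dk k)"
begin

definition vol :: "int \<Rightarrow> real" where
  "vol k = (2 powi (- k)) ^ CARD('n)"

lemma vol_pos [simp]: "vol k > 0"
  by (simp add: vol_def)

lemma vol_Suc: "vol k = 2 ^ CARD('n) * vol (k + 1)"
proof -
  have "(2::real) powi (-k) = 2 * 2 powi (- (k+1))"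
    using power_int_add[of "2::real" 1 "-(k+1)"] by simp
  then show ?thesis by (simp add: vol_def power_mult_distrib)
qed

lemma vol_strict_mono: "k < l \<Longrightarrow> vol l < vol k"
  unfolding vol_def by (intro power_strict_mono power_int_strict_increasing) auto

lemma vol_inj: "vol k = vol l \<longleftrightarrow> k = l"
  by (metis vol_strict_mono less_irrefl linorder_neqE)

lemma Dk_D: "Q \<in> Dk k \<Longrightarrow> Q \<in> D"
  using D_eq by blast

lemma DE: "Q \<in> D \<Longrightarrow> (\<And>k. Q \<in> Dk k \<Longrightarrow> P) \<Longrightarrow> P"
  using D_eq by blast

lemma measure_Dk: "Q \<in> Dk k \<Longrightarrow> measure lebesgue Q = vol k"
  using is_cube_measure[OF cube] by (simp add: vol_def)

lemma D_lmeasurable: "Q \<in> D \<Longrightarrow> Q \<in> lmeasurable"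
  using is_cube_lmeasurable[OF cube] by (metis DE)

lemma D_sets [measurable]: "Q \<in> D \<Longrightarrow> Q \<in> sets lebesgue"
  using D_lmeasurable by blast

lemma D_bounded: "Q \<in> D \<Longrightarrow> bounded Q"
  using is_cube_bounded[OF cube] by (metis DE)

lemma D_interior: "Q \<in> D \<Longrightarrow> interior Q \<noteq> {}"
  using is_cube_interior[OF cube] by (metis DE)

lemma D_nonempty: "Q \<in> D \<Longrightarrow> Q \<noteq> {}"
  using D_interior by fastforce

lemma D_measure_pos: "Q \<in> D \<Longrightarrow> measure lebesgue Q > 0"
  by (metis DE measure_Dk vol_pos)

lemma D_emeasure: "Q \<in> D \<Longrightarrow> emeasure lebesgue Q = ennreal (measure lebesgue Q)"
  using D_lmeasurable by (simp add: emeasure_eq_measure2)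

lemma Dk_eq: "Q \<in> Dk k \<Longrightarrow> R \<in> Dk k \<Longrightarrow> Q \<inter> R \<noteq> {} \<Longrightarrow> Q = R"
  using part[of k] by (meson disjointD partition_onD2)

lemma Dk_cover: "\<exists>Q\<in>Dk k. x \<in> Q"
  using partition_onD1[OF part[of k]] by blast

lemma Dk_up: "Q \<in> Dk (k + int n) \<Longrightarrow> \<exists>R\<in>Dk k. Q \<subseteq> R"
proof (induction n arbitrary: Q)
  case 0 then show ?case by auto
next
  case (Suc n)
  then have "Q \<in> Dk (k + int n + 1)" by (simp add: algebra_simps)
  then obtain P where "P \<in> Dk (k + int n)" "Q \<subseteq> P"
    using refine[of "k + int n"] unfolding refines_def by blast
  with Suc.IH show ?case by (meson subset_trans)
qed

lemma Dk_nested: "Q \<in> Dk k \<Longrightarrow> R \<in> Dk l \<Longrightarrow> Q \<inter> R \<noteq> {} \<Longrightarrow> l \<le> k \<Longrightarrow> Q \<subseteq> R"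
proof -
  assume a: "Q \<in> Dk k" "R \<in> Dk l" "Q \<inter> R \<noteq> {}" "l \<le> k"
  have "k = l + int (nat (k - l))" using a(4) by simp
  with a(1) obtain P where "P \<in> Dk l" "Q \<subseteq> P" using Dk_up by metis
  with a Dk_eq show ?thesis by blast
qed

lemma D_nested: "Q \<in> D \<Longrightarrow> R \<in> D \<Longrightarrow> Q \<inter> R \<noteq> {} \<Longrightarrow> Q \<subseteq> R \<or> R \<subseteq> Q"
  by (metis DE Dk_nested inf_commute linear)

lemma D_level_mono: "Q \<in> Dk k \<Longrightarrow> R \<in> Dk l \<Longrightarrow> Q \<subseteq> R \<Longrightarrow> l \<le> k"
proof (rule ccontr)
  assume a: "Q \<in> Dk k" "R \<in> Dk l" "Q \<subseteq> R" "\<not> l \<le> k"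
  then have "measure lebesgue Q \<le> measure lebesgue R"
    by (intro measure_mono_fmeasurable D_sets D_lmeasurable) (auto intro: Dk_D)
  with a vol_strict_mono[of k l] show False by (simp add: measure_Dk)
qed

text \<open>The level can be read off the volume, which strictly decreases from one generation to
  the next.\<close>

lemma D_level_unique: "Q \<in> Dk k \<Longrightarrow> Q \<in> Dk l \<Longrightarrow> k = l"
  by (metis measure_Dk vol_inj)

lemma D_level_strict: "Q \<in> Dk k \<Longrightarrow> R \<in> Dk l \<Longrightarrow> Q \<subset> R \<Longrightarrow> l < k"
proof -
  assume a: "Q \<in> Dk k" "R \<in> Dk l" "Q \<subset> R"
  then have "l \<le> k" using D_level_mono by blast
  moreover have "l \<noteq> k"
    using a Dk_eq[of Q k R] D_nonempty[OF Dk_D[OF a(1)]] by blast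
  ultimately show ?thesis by simp
qed

text \<open>\<open>dyadic_parent\<close> is a definite description over the whole lattice. A
  competitor \<open>S\<close> strictly above \<open>Q\<close> has level at most \<open>k\<close> and
  meets \<open>R\<close>, so it contains \<open>R\<close>.\<close>

lemma dyadic_parent_unique:
  assumes Q: "Q \<in> Dk (k + 1)" and R: "R \<in> Dk k" and "Q \<subseteq> R"
  shows "dyadic_parent D Q = R"
proof -
  have QR: "Q \<subset> R"
    using assms D_level_unique[of Q "k+1" k] by auto
  have "R \<subseteq> S" if "S \<in> D" "Q \<subset> S" for S
  proof -
    obtain l where S: "S \<in> Dk l" using \<open>S \<in> D\<close> DE by blast
    have "l < k + 1" using D_level_strict[OF Q S that(2)] .
    moreover have "R \<inter> S \<noteq> {}" using D_nonempty[OF Dk_D[OF Q]] assms(3) that(2) by blast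
    ultimately show ?thesis using Dk_nested[OF R S] by simp
  qed
  note m = this
  show ?thesis unfolding dyadic_parent_def
  proof (rule the_equality)
    show "R \<in> D \<and> Q \<subset> R \<and> (\<forall>S\<in>D. Q \<subset> S \<longrightarrow> R \<subseteq> S)"
      using R QR m Dk_D by blast
    fix R' assume "R' \<in> D \<and> Q \<subset> R' \<and> (\<forall>S\<in>D. Q \<subset> S \<longrightarrow> R' \<subseteq> S)"
    then show "R' = R" using R QR m Dk_D by blast
  qed
qed

definition children :: "(real^'n) set \<Rightarrow> (real^'n) set set" where
  "children Q = {R \<in> D. dyadic_parent D R = Q}"

text \<open>Replaces the parent relation in \<open>mart_diff\<close> by generations; finiteness,
  disjointness and the volume ratio of children follow from this form.\<close>

lemma children_Dk:
  assumes Q: "Q \<in> Dk k"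
  shows "children Q = {R \<in> Dk (k + 1). R \<subseteq> Q}"
proof safe
  fix R x assume "R \<in> children Q"
  then have R: "R \<in> D" "dyadic_parent D R = Q" by (auto simp: children_def)
  then obtain l where l: "R \<in> Dk l" by (metis DE)
  then obtain P where P: "P \<in> Dk (l - 1)" "R \<subseteq> P"
    using Dk_up[of R "l - 1" 1] by auto
  then have "Q = P" using dyadic_parent_unique[of R "l-1" P] l R by simp
  then have "l = k + 1" using D_level_unique[of Q k "l - 1"] P Q by auto
  then show "R \<in> Dk (k+1)" "x \<in> R \<Longrightarrow> x \<in> Q" using l P \<open>Q = P\<close> by auto
next
  fix R assume "R \<in> Dk (k+1)" "R \<subseteq> Q"
  then show "R \<in> children Q"
    using Q dyadic_parent_unique Dk_D by (auto simp: children_def)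
qed

lemma Union_children: "Q \<in> D \<Longrightarrow> \<Union>(children Q) = Q"
proof -
  assume "Q \<in> D"
  then obtain k where k: "Q \<in> Dk k" by (metis DE)
  show ?thesis
  proof
    show "\<Union>(children Q) \<subseteq> Q" using children_Dk[OF k] by auto
    show "Q \<subseteq> \<Union>(children Q)"
    proof
      fix x assume x: "x \<in> Q"
      obtain R where R: "R \<in> Dk (k+1)" "x \<in> R" using Dk_cover by blast
      then have "R \<subseteq> Q" using Dk_nested[OF R(1) k] x by auto
      with R k show "x \<in> \<Union>(children Q)" by (auto simp: children_Dk)
    qed
  qed
qed

lemma children_D: "R \<in> children Q \<Longrightarrow> R \<in> D"
  by (auto simp: children_def)

lemma children_subset: "Q \<in> D \<Longrightarrow> R \<in> children Q \<Longrightarrow> R \<subseteq> Q"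
  using Union_children by blast

lemma children_disjoint: "Q \<in> D \<Longrightarrow> disjoint (children Q)"
proof (rule disjointI)
  fix R S assume "Q \<in> D" and RS: "R \<in> children Q" "S \<in> children Q" "R \<noteq> S"
  then obtain k where "Q \<in> Dk k" by (metis DE)
  with RS show "R \<inter> S = {}" using Dk_eq by (auto simp: children_Dk)
qed

lemma children_measure:
  assumes "Q \<in> D" "R \<in> children Q"
  shows "measure lebesgue Q = 2 ^ CARD('n) * measure lebesgue R"
proof -
  obtain k where k: "Q \<in> Dk k" using assms by (metis DE)
  with assms have "R \<in> Dk (k+1)" by (simp add: children_Dk)
  with k show ?thesis by (simp add: measure_Dk vol_Suc[of k])
qed

lemma children_psubset: "Q \<in> D \<Longrightarrow> R \<in> children Q \<Longrightarrow> R \<subset> Q"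
proof -
  assume a: "Q \<in> D" "R \<in> children Q"
  have "measure lebesgue R < measure lebesgue Q"
    using children_measure[OF a] D_measure_pos[OF children_D[OF a(2)]]
    by (simp add: less_le_not_le[symmetric] mult_less_cancel_right2)
  then show ?thesis using children_subset[OF a] by blast
qed

text \<open>Volume count: the cubes are disjoint and all have volume \<open>vol k\<close>, while
  their union has finite measure.\<close>

lemma finite_disjoint_Dk:
  assumes "F \<subseteq> Dk k" "bounded (\<Union>F)"
  shows "finite F"
proof -
  obtain B where B: "\<Union>F \<subseteq> B" "B \<in> lmeasurable"
    using assms(2) by (metis bounded_subset_cbox_symmetric lmeasurable_cbox)
  have "card G \<le> measure lebesgue B / vol k" if G: "finite G" "G \<subseteq> F" for G
  proof -
    have "measure lebesgue (\<Union>G) = (\<Sum>Q\<in>G. measure lebesgue Q)"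
    proof (rule measure_Union')
      show "finite G" by fact
      show "\<And>A. A \<in> G \<Longrightarrow> A \<in> lmeasurable" using G assms D_lmeasurable Dk_D by blast
      show "pairwise disjnt G"
        using G assms Dk_eq unfolding pairwise_def disjnt_def by blast
    qed
    also have "\<dots> = card G * vol k"
      using G assms measure_Dk by (subst sum.cong[OF refl, of _ _ "\<lambda>_. vol k"]) auto
    finally have "card G * vol k = measure lebesgue (\<Union>G)" by simp
    also have "\<dots> \<le> measure lebesgue B"
    proof (rule measure_mono_fmeasurable[OF _ _ B(2)])
      show "\<Union>G \<subseteq> B" using G B by blast
      show "\<Union>G \<in> sets lebesgue"
        using G assms D_sets Dk_D by (intro sets.finite_Union) auto
    qed
    finally show ?thesis by (simp add: pos_le_divide_eq)
  qed
  then have "\<forall>G. finite G \<and> G \<subseteq> F \<longrightarrow> card G \<le> nat \<lfloor>measure lebesgue B / vol k\<rfloor>"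
    by (auto simp: le_nat_floor)
  then show ?thesis
    by (metis finite_if_finite_subsets_card_bdd)
qed

lemma finite_children: "Q \<in> D \<Longrightarrow> finite (children Q)"
proof -
  assume Q: "Q \<in> D"
  then obtain k where k: "Q \<in> Dk k" by (metis DE)
  show ?thesis
  proof (rule finite_disjoint_Dk)
    show "children Q \<subseteq> Dk (k+1)" using k by (auto simp: children_Dk)
    show "bounded (\<Union>(children Q))" using Union_children D_bounded Q by simp
  qed
qed

lemma dist_Dk_le:
  assumes Q: "Q \<in> Dk k" and xy: "x \<in> Q" "y \<in> Q"
  shows "dist x y \<le> 2 powi (-k) * CARD('n)"
proof -
  obtain a where a: "Q \<subseteq> cbox a (\<chi> i. a $ i + 2 powi (-k))"
    using cube[OF Q] unfolding is_cube_def by blast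
  have "\<bar>(x - y) $ i\<bar> \<le> 2 powi (-k)" for i
  proof -
    have "a $ i \<le> x $ i \<and> x $ i \<le> a $ i + 2 powi (-k)" "a $ i \<le> y $ i \<and> y $ i \<le> a $ i + 2 powi (-k)"
      using a xy unfolding mem_box_cart subset_iff by (metis vec_lambda_beta)+
    then show ?thesis by (simp add: abs_le_iff)
  qed
  then have "(\<Sum>i\<in>UNIV. \<bar>(x - y) $ i\<bar>) \<le> CARD('n) * 2 powi (-k)"
    by (intro sum_bounded_above) auto
  with norm_le_l1_cart[of "x - y"] show ?thesis by (simp add: mult.commute dist_norm)
qed

lemma finite_Dk_meets:
  assumes "bounded K"
  shows "finite {Q \<in> Dk k. Q \<inter> K \<noteq> {}}"
proof (rule finite_disjoint_Dk)
  obtain r where r: "K \<subseteq> cball 0 r" using assms unfolding bounded_iff by (metis mem_cball_0 subsetI)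
  have "Q \<subseteq> cball 0 (r + 2 powi (-k) * CARD('n))" if "Q \<in> Dk k" "Q \<inter> K \<noteq> {}" for Q
  proof -
    from that(2) obtain y where y: "y \<in> Q" "y \<in> K" by blast
    have "norm x \<le> r + 2 powi (-k) * CARD('n)" if "x \<in> Q" for x
    proof -
      have "dist x y \<le> 2 powi (-k) * CARD('n)"
        by (rule dist_Dk_le[OF \<open>Q \<in> Dk k\<close> that y(1)])
      moreover have "norm y \<le> r" using y r by auto
      ultimately show ?thesis
        using norm_triangle_ineq2[of x y] by (simp add: dist_norm)
    qed
    then show ?thesis by auto
  qed
  then show "bounded (\<Union>{Q \<in> Dk k. Q \<inter> K \<noteq> {}})"
    by (intro bounded_subset[OF bounded_cball]) blast
qed auto

lemma countable_D: "countable D"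
proof -
  have "countable (Dk k)" for k
    using countable_disjoint_nonempty_interior_subsets[of "Dk k"] D_interior Dk_D
      partition_onD2[OF part[of k]] by (metis disjoint_def pairwise_def disjnt_def)
  then show ?thesis using D_eq by auto
qed

text \<open>There are finitely many levels between those of \<open>R\<close> and \<open>Q\<close>,
  and each contributes at most one cube above \<open>Q\<close>. Every choice of a smallest or
  largest stopping cube rests on this.\<close>

lemma finite_chain:
  assumes "Q \<in> D" "R \<in> D"
  shows "finite {P \<in> D. Q \<subseteq> P \<and> P \<subseteq> R}"
proof -
  obtain k l where k: "Q \<in> Dk k" and l: "R \<in> Dk l" using assms by (metis DE)
  have "{P \<in> D. Q \<subseteq> P \<and> P \<subseteq> R} \<subseteq> (\<Union>j\<in>{l..k}. {P \<in> Dk j. Q \<subseteq> P})"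
  proof safe
    fix P assume P: "P \<in> D" "Q \<subseteq> P" "P \<subseteq> R"
    then obtain j where "P \<in> Dk j" by (metis DE)
    then show "P \<in> (\<Union>j\<in>{l..k}. {P \<in> Dk j. Q \<subseteq> P})"
      using P D_level_mono k l by auto
  qed
  moreover have "finite {P \<in> Dk j. Q \<subseteq> P}" for j
  proof -
    have "{P \<in> Dk j. Q \<subseteq> P} \<subseteq> {P}" if "P \<in> Dk j" "Q \<subseteq> P" for P
      using that Dk_eq D_nonempty[OF assms(1)] by blast
    then show ?thesis by (metis (no_types, lifting) Collect_empty_eq finite.emptyI finite.insertI finite_subset)
  qed
  ultimately show ?thesis by (meson finite_UN_I finite_atLeastAtMost_int finite_subset)
qed

end

section \<open>Integrals over cubes\<close>

lemma locally_integrable_set_integrable: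
  assumes "locally_integrable h" "E \<in> sets lebesgue" "bounded E"
  shows "set_integrable lebesgue E h"
proof -
  have "compact (closure E)" using assms(3) by simp
  then have "set_integrable lebesgue (closure E) h"
    using assms(1) by (auto simp: locally_integrable_def)
  then show ?thesis
    by (rule set_integrable_subset) (use assms closure_subset in auto)
qed

text \<open>Measurability is no clause of \<open>locally_integrable\<close>; it comes from the
  truncations to balls, which are integrable and eventually equal to \<open>h\<close> at every
  point.\<close>

lemma locally_integrable_measurable [measurable_dest]:
  fixes h :: "real^'n \<Rightarrow> 'k::{banach,second_countable_topology}"
  assumes "locally_integrable h"
  shows "h \<in> borel_measurable lebesgue"
proof (rule borel_measurable_LIMSEQ_metric)
  show "(\<lambda>x. indicator (cball 0 (real n)) x *\<^sub>R h x) \<in> borel_measurable lebesgue" for n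
    using assms compact_cball[of 0 "real n"] unfolding locally_integrable_def set_integrable_def
    by (auto intro: borel_measurable_integrable)
  show "(\<lambda>n. indicator (cball 0 (real n)) x *\<^sub>R h x) \<longlonglongrightarrow> h x" for x
  proof (rule tendsto_eventually)
    obtain m :: nat where m: "norm x \<le> m" using real_arch_simple by blast
    show "\<forall>\<^sub>F n in sequentially. indicator (cball 0 (real n)) x *\<^sub>R h x = h x"
      using eventually_ge_at_top[of m]
    proof eventually_elim
      case (elim n)
      then have "norm x \<le> n" using m by (meson of_nat_mono order_trans)
      then show ?case by simp
    qed
  qed
qed

lemma locally_integrableI_bounded:
  assumes "h \<in> borel_measurable lebesgue" "locally_integrable w" "\<And>x. norm (h x) \<le> C * norm (w x)"
  shows "locally_integrable h"
  unfolding locally_integrable_def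
proof (intro allI impI)
  fix K :: "(real^'a) set" assume "compact K"
  then have K: "K \<in> sets lebesgue" by (simp add: lmeasurable_compact fmeasurableD)
  have "set_integrable lebesgue K w"
    using assms(2) \<open>compact K\<close> by (auto simp: locally_integrable_def)
  then have "integrable lebesgue (\<lambda>x. C * norm (indicator K x *\<^sub>R w x))"
    unfolding set_integrable_def by (intro integrable_mult_right integrable_norm)
  then show "set_integrable lebesgue K h"
    unfolding set_integrable_def
    by (rule Bochner_Integration.integrable_bound)
       (use K assms(1,3) in \<open>auto intro!: AE_I2 order_trans[OF assms(3)] simp: indicator_def\<close>)
qed

lemma locally_integrable_const: "locally_integrable (\<lambda>x. c :: 'k::{banach,second_countable_topology})"
  unfolding locally_integrable_def set_integrable_def
proof (intro allI impI integrable_scaleR_left integrable_real_indicator)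
  fix K :: "(real^'a) set" assume "compact K"
  then have "K \<in> lmeasurable" by (rule lmeasurable_compact)
  then show "K \<in> sets lebesgue" "emeasure lebesgue K < \<infinity>" by (auto simp: fmeasurable_def)
qed

lemma locally_integrable_diff:
  "locally_integrable f \<Longrightarrow> locally_integrable g \<Longrightarrow> locally_integrable (\<lambda>x. f x - g x)"
  unfolding locally_integrable_def by (auto intro: set_integral_diff)

lemma locally_integrable_add:
  "locally_integrable f \<Longrightarrow> locally_integrable g \<Longrightarrow> locally_integrable (\<lambda>x. f x + g x)"
  unfolding locally_integrable_def by (auto intro: set_integral_add)

lemma locally_integrable_norm:
  "locally_integrable f \<Longrightarrow> locally_integrable (\<lambda>x. norm (f x))"
  unfolding locally_integrable_def by (auto intro: set_integrable_norm)

lemma set_integral_nonneg':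
  fixes f :: "_ \<Rightarrow> real"
  shows "(\<And>x. x \<in> E \<Longrightarrow> 0 \<le> f x) \<Longrightarrow> 0 \<le> (LINT x:E|M. f x)"
  unfolding set_lebesgue_integral_def
  by (intro integral_nonneg_AE AE_I2) (auto simp: indicator_def)

lemma nn_integral_set_integral:
  fixes f :: "_ \<Rightarrow> real"
  assumes "set_integrable M E f" "\<And>x. x \<in> E \<Longrightarrow> 0 \<le> f x"
  shows "(\<integral>\<^sup>+x\<in>E. ennreal (f x) \<partial>M) = ennreal (LINT x:E|M. f x)"
proof -
  have "(\<integral>\<^sup>+x\<in>E. ennreal (f x) \<partial>M) = (\<integral>\<^sup>+x. ennreal (indicator E x *\<^sub>R f x) \<partial>M)"
    by (intro nn_integral_cong) (auto simp: indicator_def)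
  also have "\<dots> = ennreal (LINT x:E|M. f x)"
    unfolding set_lebesgue_integral_def
    by (rule nn_integral_eq_integral) (use assms in \<open>auto simp: set_integrable_def indicator_def\<close>)
  finally show ?thesis .
qed

lemma set_integral_mono_set:
  fixes f :: "_ \<Rightarrow> real"
  assumes "set_integrable M B f" "A \<in> sets M" "A \<subseteq> B" "\<And>x. x \<in> B \<Longrightarrow> 0 \<le> f x"
  shows "(LINT x:A|M. f x) \<le> (LINT x:B|M. f x)"
  unfolding set_lebesgue_integral_def
  by (rule integral_mono)
     (use assms set_integrable_subset[OF assms(1-3)] in \<open>auto simp: set_integrable_def indicator_def\<close>)

lemma set_integral_const_fmeasurable:
  fixes c :: "'k::{banach,second_countable_topology}"
  assumes "E \<in> fmeasurable M"
  shows "(LINT x:E|M. c) = measure M E *\<^sub>R c"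
  using assms by (simp add: set_lebesgue_integral_def fmeasurable_def)

context dyadic
begin

lemma D_subset_sets: "G \<subseteq> D \<Longrightarrow> \<Union>G \<in> sets lebesgue"
  using countable_subset[OF _ countable_D] by (intro sets.countable_Union) auto

lemma set_integrable_D:
  "locally_integrable h \<Longrightarrow> Q \<in> D \<Longrightarrow> set_integrable lebesgue Q h"
  by (simp add: locally_integrable_set_integrable D_bounded)

text \<open>The family may be infinite, so the inequality is summed through countable additivity of
  the measures with densities \<open>w\<close> and \<open>h\<close>. It serves the weak type bound
  (constant \<open>w\<close>) and the mass of \<nu> on stopping cubes
  (\<open>sharp_stop_measure\<close>).\<close>

lemma disjoint_Union_integral_le:
  fixes w h :: "real^'n \<Rightarrow> real"
  assumes w: "locally_integrable w" "\<And>x. w x \<ge> 0" and h: "locally_integrable h" "\<And>x. h x \<ge> 0"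
    and S: "S \<in> D" and G: "G \<subseteq> D" "disjoint G" "\<And>Q. Q \<in> G \<Longrightarrow> Q \<subseteq> S"
    and le: "\<And>Q. Q \<in> G \<Longrightarrow> (LINT x:Q|lebesgue. w x) \<le> (LINT x:Q|lebesgue. h x)"
  shows "(LINT x:\<Union>G|lebesgue. w x) \<le> (LINT x:S|lebesgue. h x)"
proof -
  have [measurable]: "w \<in> borel_measurable lebesgue" "h \<in> borel_measurable lebesgue"
    using w h by (auto intro: locally_integrable_measurable)
  have cG: "countable G" using countable_subset[OF G(1) countable_D] .
  have US: "\<Union>G \<subseteq> S" using G(3) by auto
  have UD: "\<Union>G \<in> sets lebesgue" using D_subset_sets[OF G(1)] .
  have bU: "bounded (\<Union>G)" using US D_bounded[OF S] bounded_subset by blast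
  have eq: "(\<integral>\<^sup>+x\<in>\<Union>G. ennreal (f x) \<partial>lebesgue) = (\<integral>\<^sup>+Q. (\<integral>\<^sup>+x\<in>Q. ennreal (f x) \<partial>lebesgue) \<partial>count_space G)"
    if [measurable]: "f \<in> borel_measurable lebesgue" for f :: "real^'n \<Rightarrow> real"
  proof -
    have *: "emeasure (density lebesgue (\<lambda>x. ennreal (f x))) A = (\<integral>\<^sup>+x\<in>A. ennreal (f x) \<partial>lebesgue)"
      if "A \<in> sets lebesgue" for A
      using that by (subst emeasure_density) auto
    have "emeasure (density lebesgue (\<lambda>x. ennreal (f x))) (\<Union>Q\<in>G. Q)
       = (\<integral>\<^sup>+Q. emeasure (density lebesgue (\<lambda>x. ennreal (f x))) Q \<partial>count_space G)"
      by (rule emeasure_UN_countable)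
         (use G cG in \<open>auto simp: disjoint_family_on_def disjoint_def\<close>)
    also have "\<dots> = (\<integral>\<^sup>+Q. (\<integral>\<^sup>+x\<in>Q. ennreal (f x) \<partial>lebesgue) \<partial>count_space G)"
      by (rule nn_integral_cong) (use G(1) in \<open>auto intro!: *\<close>)
    finally show ?thesis using *[OF UD] by simp
  qed
  have "ennreal (LINT x:\<Union>G|lebesgue. w x) = (\<integral>\<^sup>+x\<in>\<Union>G. ennreal (w x) \<partial>lebesgue)"
    using w UD bU by (subst nn_integral_set_integral) (auto intro: locally_integrable_set_integrable)
  also have "\<dots> = (\<integral>\<^sup>+Q. (\<integral>\<^sup>+x\<in>Q. ennreal (w x) \<partial>lebesgue) \<partial>count_space G)"
    by (rule eq) simp
  also have "\<dots> \<le> (\<integral>\<^sup>+Q. (\<integral>\<^sup>+x\<in>Q. ennreal (h x) \<partial>lebesgue) \<partial>count_space G)"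
  proof (rule nn_integral_mono)
    fix Q assume "Q \<in> space (count_space G)"
    then show "(\<integral>\<^sup>+x\<in>Q. ennreal (w x) \<partial>lebesgue) \<le> (\<integral>\<^sup>+x\<in>Q. ennreal (h x) \<partial>lebesgue)"
      using w h le[of Q] G(1) by (subst (1 2) nn_integral_set_integral) (auto intro: set_integrable_D ennreal_leI)
  qed
  also have "\<dots> = (\<integral>\<^sup>+x\<in>\<Union>G. ennreal (h x) \<partial>lebesgue)"
    by (rule eq[symmetric]) simp
  also have "\<dots> \<le> (\<integral>\<^sup>+x\<in>S. ennreal (h x) \<partial>lebesgue)"
    using US by (intro nn_integral_mono) (auto simp: indicator_def)
  also have "\<dots> = ennreal (LINT x:S|lebesgue. h x)"
    using h S by (subst nn_integral_set_integral) (auto intro: set_integrable_D)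
  finally show ?thesis
    using set_integral_nonneg'[of S h lebesgue] h(2) by (simp add: ennreal_le_iff)
qed

subsection \<open>Stopping families\<close>

definition stops :: "((real^'n) set \<Rightarrow> (real^'n) set \<Rightarrow> bool) \<Rightarrow> (real^'n) set \<Rightarrow> (real^'n) set set" where
  "stops stp S = {Q \<in> D. Q \<subset> S \<and> stp S Q \<and> \<not> (\<exists>P\<in>D. Q \<subset> P \<and> P \<subset> S \<and> stp S P)}"

primrec stop_gen :: "((real^'n) set \<Rightarrow> (real^'n) set \<Rightarrow> bool) \<Rightarrow> (real^'n) set set \<Rightarrow> nat \<Rightarrow> (real^'n) set set" where
  "stop_gen stp T 0 = T"
| "stop_gen stp T (Suc n) = \<Union> (stops stp ` stop_gen stp T n)"

definition stop_family :: "((real^'n) set \<Rightarrow> (real^'n) set \<Rightarrow> bool) \<Rightarrow> (real^'n) set set \<Rightarrow> (real^'n) set set" where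
  "stop_family stp T = (\<Union>n. stop_gen stp T n)"

text \<open>The remainders, pairwise disjoint over a stopping family, will be the large subsets
  required by \<open>sparse\<close>.\<close>

definition core :: "((real^'n) set \<Rightarrow> (real^'n) set \<Rightarrow> bool) \<Rightarrow> (real^'n) set \<Rightarrow> (real^'n) set" where
  "core stp S = S - \<Union>(stops stp S)"

text \<open>The block of cubes whose averages are controlled by those of \<open>S\<close>. It is
  convex under inclusion, as the energy estimates require.\<close>

definition stop_tree :: "((real^'n) set \<Rightarrow> (real^'n) set \<Rightarrow> bool) \<Rightarrow> (real^'n) set \<Rightarrow> (real^'n) set set" where
  "stop_tree stp S = {Q \<in> D. Q \<subseteq> S \<and> (\<forall>R\<in>stops stp S. \<not> Q \<subseteq> R)}"

lemma stops_D: "stops stp S \<subseteq> D" and stops_psubset: "Q \<in> stops stp S \<Longrightarrow> Q \<subset> S"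
  by (auto simp: stops_def)

lemma stops_disjoint: "disjoint (stops stp S)"
proof (rule disjointI, rule ccontr)
  fix P Q assume a: "P \<in> stops stp S" "Q \<in> stops stp S" "P \<noteq> Q" "P \<inter> Q \<noteq> {}"
  then have "P \<subset> Q \<or> Q \<subset> P" using D_nested[of P Q] by (auto simp: stops_def)
  with a show False unfolding stops_def by blast
qed

lemma stop_gen_D: "T \<subseteq> D \<Longrightarrow> stop_gen stp T n \<subseteq> D"
  by (induction n) (auto simp: stops_def)

lemma stop_family_D: "T \<subseteq> D \<Longrightarrow> stop_family stp T \<subseteq> D"
  using stop_gen_D unfolding stop_family_def by blast

lemma stop_gen_disjoint:
  assumes "disjoint T"
  shows "disjoint (stop_gen stp T n)"
proof (induction n)
  case 0 then show ?case using assms by simp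
next
  case (Suc n)
  show ?case
  proof (rule disjointI)
    fix P Q assume PQ: "P \<in> stop_gen stp T (Suc n)" "Q \<in> stop_gen stp T (Suc n)" "P \<noteq> Q"
    then obtain A B where AB: "A \<in> stop_gen stp T n" "B \<in> stop_gen stp T n" "P \<in> stops stp A" "Q \<in> stops stp B"
      by auto
    show "P \<inter> Q = {}"
    proof (cases "A = B")
      case True
      then show ?thesis using AB PQ disjointD[OF stops_disjoint] by blast
    next
      case False
      then have "A \<inter> B = {}" using disjointD[OF Suc.IH] AB by blast
      then show ?thesis using stops_psubset AB by blast
    qed
  qed
qed

lemma stop_gen_ancestor:
  "Q \<in> stop_gen stp T (m + k) \<Longrightarrow> \<exists>P\<in>stop_gen stp T m. Q \<subseteq> P"
proof (induction k arbitrary: Q)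
  case 0 then show ?case by auto
next
  case (Suc k)
  then obtain A where A: "A \<in> stop_gen stp T (m + k)" "Q \<in> stops stp A" by auto
  from Suc.IH[OF A(1)] obtain P where "P \<in> stop_gen stp T m" "A \<subseteq> P" by blast
  then show ?case using stops_psubset[OF A(2)] by blast
qed

text \<open>The ancestor of \<open>S'\<close> in generation \<open>m + 1\<close> is a stopping child
  of some cube of generation \<open>m\<close> that meets \<open>S\<close>; disjointness within a
  generation identifies this cube with \<open>S\<close>.\<close>

lemma stop_gen_nested:
  assumes T: "T \<subseteq> D" "disjoint T" and "S \<in> stop_gen stp T m" "S' \<in> stop_gen stp T n" "m < n" "S \<inter> S' \<noteq> {}"
  shows "\<exists>R\<in>stops stp S. S' \<subseteq> R"
proof -
  obtain k where "n = Suc m + k" using \<open>m < n\<close> less_iff_Suc_add by auto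
  then obtain R where R: "R \<in> stop_gen stp T (Suc m)" "S' \<subseteq> R"
    using stop_gen_ancestor[of S' stp T "Suc m" k] assms(4) by auto
  then obtain P where P: "P \<in> stop_gen stp T m" "R \<in> stops stp P" by auto
  then have "P \<inter> S \<noteq> {}" using stops_psubset[OF P(2)] R(2) assms(6) by auto
  then have "P = S" using disjointD[OF stop_gen_disjoint[OF T(2)]] P assms by blast
  then show ?thesis using P R by blast
qed

text \<open>Cubes of one generation are disjoint; a cube of a later generation that meets
  \<open>S\<close> lies in a stopping child, hence outside \<open>core stp S\<close>.\<close>

lemma core_disjoint:
  assumes T: "T \<subseteq> D" "disjoint T"
  shows "disjoint_family_on (core stp) (stop_family stp T)"
  unfolding disjoint_family_on_def
proof (intro ballI impI)
  fix S S' assume SS: "S \<in> stop_family stp T" "S' \<in> stop_family stp T" "S \<noteq> S'"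
  then obtain m n where mn: "S \<in> stop_gen stp T m" "S' \<in> stop_gen stp T n" by (auto simp: stop_family_def)
  have *: "core stp A \<inter> core stp B = {}"
    if "A \<in> stop_gen stp T i" "B \<in> stop_gen stp T j" "i < j" for A B i j
  proof (cases "A \<inter> B = {}")
    case False
    then show ?thesis using stop_gen_nested[OF T that False] by (auto simp: core_def)
  qed (auto simp: core_def)
  show "core stp S \<inter> core stp S' = {}"
  proof (cases "m = n")
    case True
    then have "S \<inter> S' = {}" using disjointD[OF stop_gen_disjoint[OF T(2)]] mn SS by blast
    then show ?thesis by (auto simp: core_def)
  qed (use * mn in \<open>metis inf_commute linorder_neqE_nat\<close>)
qed

lemma core_sets [measurable]: "S \<in> D \<Longrightarrow> core stp S \<in> sets lebesgue"
  unfolding core_def by (intro sets.Diff D_subset_sets stops_D) auto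

lemma core_subset: "core stp S \<subseteq> S"
  by (auto simp: core_def)

text \<open>Take a minimal stopping cube \<open>S\<close> above \<open>Q\<close> inside
  \<open>P\<close>: a stopping child of \<open>S\<close> containing \<open>Q\<close> would be a
  smaller candidate.\<close>

lemma ex_stop_tree:
  assumes T: "T \<subseteq> D" and Q: "Q \<in> D" "Q \<subseteq> P" "P \<in> T"
  shows "\<exists>S\<in>stop_family stp T. Q \<in> stop_tree stp S"
proof -
  let ?A = "{S \<in> stop_family stp T. Q \<subseteq> S \<and> S \<subseteq> P}"
  have "finite ?A"
    by (rule finite_subset[OF _ finite_chain[of Q P]]) (use stop_family_D[OF T] Q T in auto)
  moreover have "P \<in> ?A"
    using Q stop_gen.simps(1)[of stp T] unfolding stop_family_def by blast
  ultimately obtain S where S: "S \<in> ?A" "\<And>S'. S' \<in> ?A \<Longrightarrow> S' \<subseteq> S \<Longrightarrow> S' = S"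
    using finite_has_minimal[of ?A] by (metis (no_types, lifting) empty_iff)
  have "\<not> Q \<subseteq> R" if R: "R \<in> stops stp S" for R
  proof
    assume "Q \<subseteq> R"
    obtain n where "S \<in> stop_gen stp T n" using S by (auto simp: stop_family_def)
    then have "R \<in> stop_gen stp T (Suc n)" using R by auto
    then have "R \<in> stop_family stp T" unfolding stop_family_def by blast
    then have "R \<in> ?A" using \<open>Q \<subseteq> R\<close> stops_psubset[OF R] S(1) by auto
    then show False using S(2) stops_psubset[OF R] by blast
  qed
  then show ?thesis using S Q unfolding stop_tree_def by blast
qed

text \<open>A cube \<open>P\<close> that meets the stopping condition lies in a maximal one, which
  is a stopping child of \<open>S\<close> and would swallow \<open>Q\<close>.\<close>

lemma stop_tree_not_stop:
  assumes S: "S \<in> D" and "Q \<in> stop_tree stp S" "P \<in> D" "Q \<subseteq> P" "P \<subset> S"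
  shows "\<not> stp S P"
proof
  assume "stp S P"
  let ?A = "{R \<in> D. P \<subseteq> R \<and> R \<subset> S \<and> stp S R}"
  have "finite ?A"
    by (rule finite_subset[OF _ finite_chain[OF assms(3) S]]) auto
  moreover have "P \<in> ?A" using assms \<open>stp S P\<close> by auto
  ultimately obtain R where R: "R \<in> ?A" "\<And>R'. R' \<in> ?A \<Longrightarrow> R \<subseteq> R' \<Longrightarrow> R' = R"
    using finite_has_maximal[of ?A] by (metis (no_types, lifting) empty_iff)
  then have "R \<in> stops stp S" unfolding stops_def by blast
  moreover have "Q \<subseteq> R" using R assms by auto
  ultimately show False using assms(2) by (auto simp: stop_tree_def)
qed

lemma stop_tree_upward:
  assumes "Q \<in> stop_tree stp S" "P \<in> D" "Q \<subseteq> P" "P \<subseteq> S"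
  shows "P \<in> stop_tree stp S"
  using assms unfolding stop_tree_def by blast

lemma core_measure:
  assumes "S \<in> D" "measure lebesgue (\<Union>(stops stp S)) \<le> measure lebesgue S / 2"
  shows "measure lebesgue S \<le> 2 * measure lebesgue (core stp S)"
proof -
  have U: "\<Union>(stops stp S) \<in> sets lebesgue" "\<Union>(stops stp S) \<subseteq> S"
    using D_subset_sets[OF stops_D] stops_psubset by blast+
  then have "measure lebesgue (core stp S) = measure lebesgue S - measure lebesgue (\<Union>(stops stp S))"
    unfolding core_def using D_lmeasurable[OF assms(1)]
    by (intro measurable_measure_Diff) auto
  then show ?thesis using assms by simp
qed

text \<open>A lattice has no largest cubes, so roots of stopping trees and covers of level sets are
  maximal members of a finite family.\<close>

lemma maximal_cubes:
  assumes "finite F" "F \<subseteq> D"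
  obtains T where "T \<subseteq> F" "disjoint T" "\<And>Q. Q \<in> F \<Longrightarrow> \<exists>P\<in>T. Q \<subseteq> P"
proof -
  define T where "T = {P \<in> F. \<forall>R\<in>F. P \<subseteq> R \<longrightarrow> R = P}"
  have "T \<subseteq> F" by (auto simp: T_def)
  moreover have "disjoint T"
  proof (rule disjointI, rule ccontr)
    fix P Q assume "P \<in> T" "Q \<in> T" "P \<noteq> Q" "P \<inter> Q \<noteq> {}"
    then show False using D_nested[of P Q] assms(2) unfolding T_def by blast
  qed
  moreover have "\<exists>P\<in>T. Q \<subseteq> P" if "Q \<in> F" for Q
  proof -
    obtain P where "P \<in> {P\<in>F. Q \<subseteq> P}" "\<And>R. R \<in> {P\<in>F. Q \<subseteq> P} \<Longrightarrow> P \<subseteq> R \<Longrightarrow> R = P"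
      using finite_has_maximal[of "{P\<in>F. Q \<subseteq> P}"] assms(1) \<open>Q \<in> F\<close>
      by (metis (no_types, lifting) empty_iff finite_subset mem_Collect_eq order_refl subsetI)
    then show ?thesis unfolding T_def by blast
  qed
  ultimately show thesis using that by blast
qed

end

section \<open>Sparse domination\<close>

lemma sum_UN_le:
  fixes h :: "'a \<Rightarrow> real"
  assumes "finite I" "\<And>i. i \<in> I \<Longrightarrow> finite (A i)" "\<And>x. 0 \<le> h x"
  shows "sum h (\<Union>i\<in>I. A i) \<le> (\<Sum>i\<in>I. sum h (A i))"
  using assms
proof (induction I rule: finite_induct)
  case (insert i I)
  then have "sum h (A i \<union> (\<Union>i\<in>I. A i)) \<le> sum h (A i) + sum h (\<Union>i\<in>I. A i)"
    by (subst sum.union_inter[symmetric]) (auto intro: sum_nonneg)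
  with insert show ?case by auto
qed simp

context dyadic
begin

section \<open>Averages, mean oscillation and the energy of martingale differences\<close>

abbreviation "mea \<equiv> measure lebesgue"

definition avgn :: "(real^'n) set \<Rightarrow> (real^'n \<Rightarrow> complex) \<Rightarrow> real" where
  "avgn Q h = average Q (\<lambda>x. norm (h x))"

text \<open>Normalised by volume, unlike \<open>oscillation\<close>; hence the products
  \<open>mea Q * osc Q b\<close> throughout.\<close>

definition osc :: "(real^'n) set \<Rightarrow> (real^'n \<Rightarrow> complex) \<Rightarrow> real" where
  "osc Q b = avgn Q (\<lambda>x. b x - average Q b)"

text \<open>The squared L^2 norm of the martingale difference of \<open>h\<close> on
  \<open>Q\<close>. As a finite sum over children it makes sense for every locally integrable
  \<open>h\<close>.\<close>

definition energy :: "(real^'n) set \<Rightarrow> (real^'n \<Rightarrow> complex) \<Rightarrow> real" where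
  "energy Q h = (\<Sum>R\<in>children Q. mea R * (norm (average R h - average Q h))\<^sup>2)"

lemma avgn_integral: "Q \<in> D \<Longrightarrow> (LINT x:Q|lebesgue. norm (h x)) = mea Q * avgn Q h"
  using D_measure_pos[of Q] by (simp add: avgn_def average_def)

lemma average_integral: "Q \<in> D \<Longrightarrow> (LINT x:Q|lebesgue. h x) = mea Q *\<^sub>R average Q h"
  using D_measure_pos[of Q] by (simp add: average_def)

lemma avgn_nonneg [simp]: "avgn Q h \<ge> 0"
  unfolding avgn_def average_def by (simp add: set_integral_nonneg')

lemma osc_nonneg [simp]: "osc Q b \<ge> 0"
  by (simp add: osc_def)

lemma energy_nonneg [simp]: "energy Q b \<ge> 0"
  unfolding energy_def by (intro sum_nonneg) auto

lemma norm_average_le: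
  assumes "locally_integrable h" "Q \<in> D"
  shows "norm (average Q h) \<le> avgn Q h"
proof -
  have "norm (LINT x:Q|lebesgue. h x) \<le> (LINT x:Q|lebesgue. norm (h x))"
    unfolding set_lebesgue_integral_def
    by (rule order_trans[OF integral_norm_bound]) simp
  then show ?thesis by (simp add: avgn_def average_def divide_right_mono divide_inverse mult_left_mono)
qed

lemma integral_children:
  fixes h :: "real^'n \<Rightarrow> 'k::{banach,second_countable_topology}"
  assumes "locally_integrable h" "Q \<in> D"
  shows "(LINT x:Q|lebesgue. h x) = (\<Sum>R\<in>children Q. LINT x:R|lebesgue. h x)"
proof -
  have "(LINT x:(\<Union>R\<in>children Q. R)|lebesgue. h x) = (\<Sum>R\<in>children Q. LINT x:R|lebesgue. h x)"
    using assms children_disjoint[of Q] 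
    by (intro set_integral_finite_Union)
       (auto simp: finite_children disjoint_family_on_def disjoint_def children_D set_integrable_D)
  then show ?thesis using Union_children[OF assms(2)] by simp
qed

lemma measure_children:
  assumes "Q \<in> D"
  shows "mea Q = (\<Sum>R\<in>children Q. mea R)"
proof -
  have "(LINT x:Q|lebesgue. 1::real) = (\<Sum>R\<in>children Q. LINT x:R|lebesgue. 1)"
    using assms locally_integrable_const by (rule integral_children[rotated])
  then show ?thesis
    using assms by (simp add: set_integral_const_fmeasurable D_lmeasurable children_D)
qed

lemma average_children:
  assumes "locally_integrable h" "Q \<in> D"
  shows "mea Q *\<^sub>R average Q h = (\<Sum>R\<in>children Q. mea R *\<^sub>R average R h)"
  using integral_children[OF assms] assms(2) by (simp add: average_integral children_D)

text \<open>Pythagoras on one generation: in the expanded square the cross term collapses, because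
  the volume-weighted mean of the children's averages is the average over \<open>Q\<close>.\<close>

lemma energy_eq:
  assumes "locally_integrable h" "Q \<in> D"
  shows "energy Q h + mea Q * (norm (average Q h))\<^sup>2 = (\<Sum>R\<in>children Q. mea R * (norm (average R h))\<^sup>2)"
proof -
  let ?a = "average Q h"
  have "energy Q h = (\<Sum>R\<in>children Q. mea R * (norm (average R h))\<^sup>2 - 2 * ((mea R *\<^sub>R average R h) \<bullet> ?a) + mea R * (norm ?a)\<^sup>2)"
    unfolding energy_def
    by (intro sum.cong refl) (simp add: power2_norm_eq_inner inner_diff inner_commute algebra_simps)
  also have "\<dots> = (\<Sum>R\<in>children Q. mea R * (norm (average R h))\<^sup>2)
      - 2 * ((\<Sum>R\<in>children Q. mea R *\<^sub>R average R h) \<bullet> ?a) + (\<Sum>R\<in>children Q. mea R) * (norm ?a)\<^sup>2"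
    by (simp add: sum.distrib sum_subtractf inner_sum_left sum_distrib_left sum_distrib_right)
  also have "\<dots> = (\<Sum>R\<in>children Q. mea R * (norm (average R h))\<^sup>2) - mea Q * (norm ?a)\<^sup>2"
    unfolding average_children[OF assms, symmetric] measure_children[OF assms(2), symmetric]
    by (simp add: power2_norm_eq_inner)
  finally show ?thesis by simp
qed

lemma integral_mono_D:
  assumes "locally_integrable h" "Q \<in> D" "R \<in> D" "R \<subseteq> Q"
  shows "mea R * avgn R h \<le> mea Q * avgn Q h"
  unfolding avgn_integral[OF assms(2), symmetric] avgn_integral[OF assms(3), symmetric]
  by (rule set_integral_mono_set) (use assms locally_integrable_norm set_integrable_D in auto)

lemma avgn_child:
  assumes "locally_integrable h" "Q \<in> D" "R \<in> children Q"
  shows "avgn R h \<le> 2 ^ CARD('n) * avgn Q h"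
proof -
  have "mea R * avgn R h \<le> mea R * (2 ^ CARD('n) * avgn Q h)"
    using integral_mono_D[OF assms(1,2) children_D[OF assms(3)] children_subset[OF assms(2,3)]]
      children_measure[OF assms(2,3)] by (simp add: mult_ac)
  then show ?thesis using D_measure_pos[OF children_D[OF assms(3)]] by simp
qed

text \<open>The induction exploits that \<open>energy Q h\<close> is the increment of \<open>mea Q * (norm (average Q h))\<^sup>2\<close>
  on passing from \<open>Q\<close> to its children; the children that leave \<open>A\<close> cost at most the factor \<open>2\<^sup>d\<close>.\<close>

lemma energy_sum_level:
  assumes h: "locally_integrable h" and A: "A \<subseteq> D" "\<And>Q. Q \<in> A \<Longrightarrow> avgn Q h \<le> T"
    and up: "\<And>P Q R. P \<in> A \<Longrightarrow> R \<in> A \<Longrightarrow> Q \<in> D \<Longrightarrow> P \<subseteq> Q \<Longrightarrow> Q \<subseteq> R \<Longrightarrow> Q \<in> A"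
  shows "Q \<in> A \<Longrightarrow> Q \<in> Dk k \<Longrightarrow> finite G \<Longrightarrow> G \<subseteq> A \<Longrightarrow>
    (\<And>P. P \<in> G \<Longrightarrow> P \<subseteq> Q \<and> (\<exists>j<k + int m. P \<in> Dk j)) \<Longrightarrow>
    (\<Sum>P\<in>G. energy P h) + mea Q * (norm (average Q h))\<^sup>2 \<le> 2 ^ CARD('n) * T * (mea Q * avgn Q h)"
proof (induction m arbitrary: Q k G)
  case 0
  have QD: "Q \<in> D" using 0 A by auto
  \<comment> \<open>A cube of \<open>G\<close> would lie in \<open>Q\<close> and have level below
    \<open>k\<close>; for \<open>m = 0\<close> even \<open>Q\<close> itself is excluded.\<close>
  have G: "G = {}"
  proof (rule ccontr)
    assume "G \<noteq> {}"
    then obtain P j where "P \<subseteq> Q" "P \<in> Dk j" "j < k" using 0(5) by force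
    then show False using D_level_mono[OF _ 0(2)] by force
  qed
  have "(norm (average Q h))\<^sup>2 \<le> T * avgn Q h"
    unfolding power2_eq_square using norm_average_le[OF h QD] A(2)[OF 0(1)]
    by (intro mult_mono) (auto intro: order_trans[OF avgn_nonneg])
  also have "\<dots> \<le> 2 ^ CARD('n) * (T * avgn Q h)"
  proof -
    have "0 \<le> T * avgn Q h"
      using A(2)[OF 0(1)] avgn_nonneg[of Q h] by (intro mult_nonneg_nonneg) linarith+
    then show ?thesis using mult_right_mono[of 1 "2 ^ CARD('n)" "T * avgn Q h"] by simp
  qed
  finally show ?case using G D_measure_pos[OF QD] by (simp add: mult_ac)
next
  case (Suc m)
  have QD: "Q \<in> D" using Suc A by auto
  have T0: "T \<ge> 0" using A(2)[OF Suc.prems(1)] avgn_nonneg[of Q h] by linarith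
  let ?G = "\<lambda>R. {P\<in>G. P \<subseteq> R}"
  \<comment> \<open>A cube of \<open>G\<close> other than \<open>Q\<close> has level at least
    \<open>k + 1\<close>, so it lies inside the child that it meets.\<close>
  have sub: "G - {Q} \<subseteq> (\<Union>R\<in>children Q. ?G R)"
  proof
    fix P assume P: "P \<in> G - {Q}"
    then obtain j where j: "P \<in> Dk j" "P \<subset> Q" using Suc.prems(5) by blast
    then have jk: "k + 1 \<le> j" using D_level_strict[OF j(1) Suc.prems(2)] by simp
    obtain x where x: "x \<in> P" using D_nonempty[OF Dk_D[OF j(1)]] by blast
    then have "x \<in> \<Union>(children Q)" using Union_children[OF QD] j by blast
    then obtain R where R: "R \<in> children Q" "x \<in> R" by auto
    then have "P \<subseteq> R" using Dk_nested[OF j(1) _ _ jk] x children_Dk[OF Suc.prems(2)] by auto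
    then show "P \<in> (\<Union>R\<in>children Q. ?G R)" using R P by auto
  qed
  have "(\<Sum>P\<in>G. energy P h) \<le> (\<Sum>P\<in>insert Q (\<Union>R\<in>children Q. ?G R). energy P h)"
    using sub Suc.prems(3) finite_children[OF QD] by (intro sum_mono2) auto
  also have "\<dots> \<le> energy Q h + (\<Sum>P\<in>(\<Union>R\<in>children Q. ?G R). energy P h)"
    using Suc.prems(3) finite_children[OF QD] by (simp add: sum.insert_if)
  also have "(\<Sum>P\<in>(\<Union>R\<in>children Q. ?G R). energy P h) \<le> (\<Sum>R\<in>children Q. \<Sum>P\<in>?G R. energy P h)"
    using finite_children[OF QD] Suc.prems(3) by (intro sum_UN_le) auto
  finally have 1: "(\<Sum>P\<in>G. energy P h) \<le> energy Q h + (\<Sum>R\<in>children Q. \<Sum>P\<in>?G R. energy P h)"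
    by simp
  have 2: "(\<Sum>P\<in>?G R. energy P h) + mea R * (norm (average R h))\<^sup>2 \<le> 2 ^ CARD('n) * T * (mea R * avgn R h)"
    if R: "R \<in> children Q" for R
  proof (cases "R \<in> A")
    case True
    have "\<And>P. P \<in> ?G R \<Longrightarrow> P \<subseteq> R \<and> (\<exists>j<k + 1 + int m. P \<in> Dk j)"
      using Suc.prems(5) by (fastforce simp: algebra_simps)
    then show ?thesis
      using R Suc.prems True children_Dk[OF Suc.prems(2)] by (intro Suc.IH[of R "k+1"]) auto
  next
    case False
    \<comment> \<open>A cube of \<open>G\<close> below \<open>R\<close> would put \<open>R\<close>
      between two members of \<open>A\<close>, hence into \<open>A\<close>; only the term with the
      average over \<open>R\<close> remains.\<close>
    then have G0: "?G R = {}"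
      using up Suc.prems(1,4) children_D[OF R] children_subset[OF QD R] by blast
    have R0: "0 \<le> avgn R h" by simp
    have "(norm (average R h))\<^sup>2 \<le> (2 ^ CARD('n) * T) * avgn R h"
      unfolding power2_eq_square
    proof (intro mult_mono)
      show "norm (average R h) \<le> avgn R h" by (rule norm_average_le[OF h children_D[OF R]])
      then show "norm (average R h) \<le> 2 ^ CARD('n) * T"
        using avgn_child[OF h QD R] A(2)[OF Suc.prems(1)]
        by (meson mult_left_mono order_trans zero_le_numeral zero_le_power)
    qed (use T0 in auto)
    then have "mea R * (norm (average R h))\<^sup>2 \<le> mea R * ((2 ^ CARD('n) * T) * avgn R h)"
      by (intro mult_left_mono) auto
    then show ?thesis unfolding G0 by (simp add: mult_ac)
  qed
  have "(\<Sum>P\<in>G. energy P h) + mea Q * (norm (average Q h))\<^sup>2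
     \<le> (energy Q h + mea Q * (norm (average Q h))\<^sup>2) + (\<Sum>R\<in>children Q. \<Sum>P\<in>?G R. energy P h)"
    using 1 by simp
  also have "\<dots> = (\<Sum>R\<in>children Q. (\<Sum>P\<in>?G R. energy P h) + mea R * (norm (average R h))\<^sup>2)"
    unfolding energy_eq[OF h QD] by (simp add: sum.distrib)
  also have "\<dots> \<le> (\<Sum>R\<in>children Q. 2 ^ CARD('n) * T * (mea R * avgn R h))"
    by (intro sum_mono 2)
  also have "\<dots> = 2 ^ CARD('n) * T * (mea Q * avgn Q h)"
    using integral_children[OF locally_integrable_norm[OF h] QD] QD
    by (simp add: avgn_integral children_D sum_distrib_left)
  finally show ?case .
qed


text \<open>A discrete form of the bound of a squared L^2 norm by sup norm times L^1 norm, with the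
  averages over \<open>A\<close> in the role of the sup norm. A finite \<open>G\<close> has bounded
  depth, so the level-wise statement applies.\<close>

lemma energy_sum_le:
  assumes h: "locally_integrable h" and A: "A \<subseteq> D" "\<And>Q. Q \<in> A \<Longrightarrow> avgn Q h \<le> T"
    and up: "\<And>P Q R. P \<in> A \<Longrightarrow> R \<in> A \<Longrightarrow> Q \<in> D \<Longrightarrow> P \<subseteq> Q \<Longrightarrow> Q \<subseteq> R \<Longrightarrow> Q \<in> A"
    and S: "S \<in> A" and G: "finite G" "G \<subseteq> A" "\<And>P. P \<in> G \<Longrightarrow> P \<subseteq> S"
  shows "(\<Sum>P\<in>G. energy P h) \<le> 2 ^ CARD('n) * T * (mea S * avgn S h)"
proof -
  obtain k where k: "S \<in> Dk k" using S A(1) D_eq by blast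
  have "\<forall>P\<in>G. \<exists>j. P \<in> Dk j" using G(2) A(1) D_eq by blast
  then obtain l where l: "\<And>P. P \<in> G \<Longrightarrow> P \<in> Dk (l P)" by metis
  define m where "m = nat (Max (insert k (l ` G)) - k + 1)"
  have m: "l P < k + int m" if "P \<in> G" for P
  proof -
    have "l P \<le> Max (insert k (l ` G))" "k \<le> Max (insert k (l ` G))"
      using G(1) that by (auto intro!: Max_ge)
    then show ?thesis by (simp add: m_def)
  qed
  have "(\<Sum>P\<in>G. energy P h) + mea S * (norm (average S h))\<^sup>2 \<le> 2 ^ CARD('n) * T * (mea S * avgn S h)"
  proof (rule energy_sum_level[OF h A _ S k G(1,2), where m = m])
    show "\<And>P Q R. P \<in> A \<Longrightarrow> R \<in> A \<Longrightarrow> Q \<in> D \<Longrightarrow> P \<subseteq> Q \<Longrightarrow> Q \<subseteq> R \<Longrightarrow> Q \<in> A"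
      by (rule up)
    show "P \<subseteq> S \<and> (\<exists>j<k + int m. P \<in> Dk j)" if "P \<in> G" for P
      using G(3)[OF that] l[OF that] m[OF that] by blast
  qed
  moreover have "0 \<le> mea S * (norm (average S h))\<^sup>2" by simp
  ultimately show ?thesis by linarith
qed

text \<open>Martingale differences do not see constants; this lets \<open>b\<close> be replaced by
  \<open>b - average S b\<close>, which brings in \<open>osc\<close>.\<close>

lemma energy_diff_const:
  assumes "locally_integrable h" "Q \<in> D"
  shows "energy Q (\<lambda>x. h x - c) = energy Q h"
proof -
  have av: "average R (\<lambda>x. h x - c) = average R h - c" if "R \<in> D" for R
    using that D_measure_pos[OF that] set_integrable_D[OF assms(1) that]
      set_integrable_D[OF locally_integrable_const[of c] that] D_lmeasurable[OF that]
    by (simp add: average_def set_integral_diff set_integral_const_fmeasurable scaleR_diff_right)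
  show ?thesis unfolding energy_def using assms
    by (intro sum.cong) (auto simp: av children_D)
qed

section \<open>Sparse families from stopping on large averages\<close>

definition sparse :: "(real^'n) set set \<Rightarrow> bool" where
  "sparse F \<longleftrightarrow> F \<subseteq> D \<and> (\<exists>E. disjoint_family_on E F \<and>
     (\<forall>S\<in>F. E S \<in> sets lebesgue \<and> E S \<subseteq> S \<and> mea S \<le> 2 * mea (E S)))"

lemma sparse_subset: "sparse F \<Longrightarrow> G \<subseteq> F \<Longrightarrow> sparse G"
  unfolding sparse_def by (meson disjoint_family_on_mono subset_iff)

lemma sparse_stop_family:
  assumes T: "T \<subseteq> D" "disjoint T"
    and le: "\<And>S. S \<in> D \<Longrightarrow> mea (\<Union>(stops stp S)) \<le> mea S / 2"
  shows "sparse (stop_family stp T)"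
  unfolding sparse_def
  using stop_family_D[OF T(1)] core_disjoint[OF T] core_measure[OF _ le]
  by (intro conjI exI[of _ "core stp"]) (use core_subset in \<open>auto simp: subset_iff\<close>)

text \<open>The weak (1,1) bound of the dyadic maximal function, localised to \<open>S\<close>.
  Three conditions at threshold 8 will cost at most 3/8 of \<open>S\<close>, below the 1/2 that
  \<open>sparse\<close> allows.\<close>

lemma weak_type:
  assumes h: "locally_integrable h" and S: "S \<in> D" and G: "G \<subseteq> D" "disjoint G"
    "\<And>Q. Q \<in> G \<Longrightarrow> Q \<subseteq> S" "\<And>Q. Q \<in> G \<Longrightarrow> avgn Q h > 8 * avgn S h"
  shows "mea (\<Union>G) \<le> mea S / 8"
proof (cases "avgn S h = 0")
  \<comment> \<open>The average cannot be cancelled here, but the integral of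
    \<open>norm (h x)\<close> over any subcube vanishes too, so no cube passes the strict
    inequality.\<close>
  case True
  have "G = {}"
  proof (rule ccontr)
    assume "G \<noteq> {}"
    then obtain Q where Q: "Q \<in> G" by auto
    then have "mea Q * avgn Q h \<le> 0"
      using integral_mono_D[OF h S, of Q] G True by auto
    moreover have "mea Q * avgn Q h > 0"
      using G(1) Q G(4)[OF Q] True D_measure_pos[of Q] by auto
    ultimately show False by linarith
  qed
  then show ?thesis by simp
next
  case False
  let ?c = "8 * avgn S h"
  have UG: "\<Union>G \<in> lmeasurable"
  proof (rule bounded_set_imp_lmeasurable)
    show "bounded (\<Union>G)" using D_bounded[OF S] by (rule bounded_subset) (use G(3) in blast)
  qed (rule D_subset_sets[OF G(1)])
  have "(LINT x:\<Union>G|lebesgue. ?c) \<le> (LINT x:S|lebesgue. norm (h x))"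
  proof (rule disjoint_Union_integral_le)
    fix Q assume Q: "Q \<in> G"
    then have "(LINT x:Q|lebesgue. ?c) = mea Q * ?c"
      using G(1) by (subst set_integral_const_fmeasurable) (auto intro: D_lmeasurable)
    also have "\<dots> \<le> mea Q * avgn Q h" using G(4)[OF Q] by (intro mult_left_mono) auto
    finally show "(LINT x:Q|lebesgue. ?c) \<le> (LINT x:Q|lebesgue. norm (h x))"
      using Q G(1) by (subst avgn_integral) auto
  qed (use h S G locally_integrable_const locally_integrable_norm in auto)
  then have "mea (\<Union>G) * ?c \<le> mea S * avgn S h"
    using UG by (simp add: set_integral_const_fmeasurable avgn_integral[OF S])
  then have "8 * mea (\<Union>G) * avgn S h \<le> mea S * avgn S h" by (simp add: mult_ac)
  moreover have "0 < avgn S h" using False avgn_nonneg[of S h] by linarith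
  ultimately have "8 * mea (\<Union>G) \<le> mea S" by (simp only: mult_le_cancel_right_pos)
  then show ?thesis by simp
qed

text \<open>The function \<open>b\<close> is centred at its average over the root \<open>S\<close>,
  not over \<open>Q\<close>, because the energies of a whole tree are compared with one fixed
  function.\<close>

definition stop_avg ::
  "(real^'n \<Rightarrow> complex) \<Rightarrow> (real^'n \<Rightarrow> complex) \<Rightarrow> (real^'n \<Rightarrow> complex) \<Rightarrow> (real^'n) set \<Rightarrow> (real^'n) set \<Rightarrow> bool" where
  "stop_avg f b g S Q \<longleftrightarrow> avgn Q f > 8 * avgn S f \<or> avgn Q g > 8 * avgn S g \<or>
     avgn Q (\<lambda>x. b x - average S b) > 8 * osc S b"

lemma stop_avg_measure:
  assumes fbg: "locally_integrable f" "locally_integrable b" "locally_integrable g" and S: "S \<in> D"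
  shows "mea (\<Union>(stops (stop_avg f b g) S)) \<le> mea S / 2"
proof -
  let ?G = "\<lambda>h. {Q \<in> stops (stop_avg f b g) S. avgn Q h > 8 * avgn S h}"
  let ?b = "\<lambda>x. b x - average S b"
  have le: "mea (\<Union>(?G h)) \<le> mea S / 8" if "locally_integrable h" for h
    using pairwise_subset[OF stops_disjoint, of "?G h" "stop_avg f b g" S] stops_D stops_psubset
    by (intro weak_type[OF that S]) blast+
  have m: "\<Union>(?G h) \<in> lmeasurable" for h
  proof (rule bounded_set_imp_lmeasurable)
    show "bounded (\<Union>(?G h))" using D_bounded[OF S] by (rule bounded_subset) (use stops_psubset in blast)
  qed (rule D_subset_sets, use stops_D in blast)
  have "\<Union>(stops (stop_avg f b g) S) \<subseteq> \<Union>(?G f) \<union> (\<Union>(?G g) \<union> \<Union>(?G ?b))"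
    by (auto simp: stops_def stop_avg_def osc_def)
  then have "mea (\<Union>(stops (stop_avg f b g) S)) \<le> mea (\<Union>(?G f) \<union> (\<Union>(?G g) \<union> \<Union>(?G ?b)))"
    by (intro measure_mono_fmeasurable fmeasurable.Un m D_subset_sets stops_D)
  also have "\<dots> \<le> mea (\<Union>(?G f)) + (mea (\<Union>(?G g)) + mea (\<Union>(?G ?b)))"
    by (intro order_trans[OF measure_Un_le] add_mono order_refl m fmeasurableD sets.Un)
  also have "\<dots> \<le> mea S / 8 + (mea S / 8 + mea S / 8)"
    using fbg by (intro add_mono le locally_integrable_diff locally_integrable_const)
  finally show ?thesis using D_measure_pos[OF S] by simp
qed

lemma sparse_stop_avg:
  assumes "locally_integrable f" "locally_integrable b" "locally_integrable g" "T \<subseteq> D" "disjoint T"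
  shows "sparse (stop_family (stop_avg f b g) T)"
  using assms by (intro sparse_stop_family stop_avg_measure)

lemma stop_tree_avgn:
  assumes S: "S \<in> D" and Q: "Q \<in> stop_tree (stop_avg f b g) S"
  shows "avgn Q f \<le> 8 * avgn S f" "avgn Q g \<le> 8 * avgn S g"
    "avgn Q (\<lambda>x. b x - average S b) \<le> 8 * osc S b"
proof -
  \<comment> \<open>Stopping concerns proper subcubes only; at \<open>S\<close> itself the bounds
    hold because 8 is at least 1.\<close>
  have "Q = S \<or> \<not> stop_avg f b g S Q"
    using stop_tree_not_stop[OF S Q _ order_refl] Q by (auto simp: stop_tree_def)
  then show "avgn Q f \<le> 8 * avgn S f" "avgn Q g \<le> 8 * avgn S g"
    "avgn Q (\<lambda>x. b x - average S b) \<le> 8 * osc S b"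
    by (auto simp: stop_avg_def osc_def)
qed

text \<open>The tree is convex, so \<open>energy_sum_le\<close> applies with the thresholds
  \<open>8 * avgn S g\<close> and \<open>8 * osc S b\<close>, the latter for \<open>b\<close>
  centred at its average over \<open>S\<close>.\<close>

lemma stop_tree_energy:
  assumes li: "locally_integrable b" "locally_integrable g" and S: "S \<in> D"
    and G: "finite G" "G \<subseteq> stop_tree (stop_avg f b g) S"
  shows "(\<Sum>P\<in>G. energy P g) \<le> 2 ^ CARD('n) * 8 * (avgn S g)\<^sup>2 * mea S"
    and "(\<Sum>P\<in>G. energy P b) \<le> 2 ^ CARD('n) * 8 * (osc S b)\<^sup>2 * mea S"
proof -
  have tD: "stop_tree (stop_avg f b g) S \<subseteq> D" "\<And>P. P \<in> stop_tree (stop_avg f b g) S \<Longrightarrow> P \<subseteq> S"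
    by (auto simp: stop_tree_def)
  have St: "S \<in> stop_tree (stop_avg f b g) S"
    using S stops_psubset by (auto simp: stop_tree_def)
  have up: "Q \<in> stop_tree (stop_avg f b g) S"
    if "P \<in> stop_tree (stop_avg f b g) S" "R \<in> stop_tree (stop_avg f b g) S" "Q \<in> D" "P \<subseteq> Q" "Q \<subseteq> R" for P Q R
    by (rule stop_tree_upward[OF that(1,3,4)]) (use that tD in blast)
  have "(\<Sum>P\<in>G. energy P g) \<le> 2 ^ CARD('n) * (8 * avgn S g) * (mea S * avgn S g)"
    by (rule energy_sum_le[OF li(2) tD(1) stop_tree_avgn(2)[OF S] up St G]) (use G(2) tD in auto)
  then show "(\<Sum>P\<in>G. energy P g) \<le> 2 ^ CARD('n) * 8 * (avgn S g)\<^sup>2 * mea S"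
    by (simp add: power2_eq_square mult_ac)
  let ?b = "\<lambda>x. b x - average S b"
  have "(\<Sum>P\<in>G. energy P ?b) \<le> 2 ^ CARD('n) * (8 * osc S b) * (mea S * avgn S ?b)"
    by (rule energy_sum_le[OF _ tD(1) stop_tree_avgn(3)[OF S] up St G])
       (use G(2) tD in \<open>auto intro!: locally_integrable_diff li locally_integrable_const\<close>)
  then show "(\<Sum>P\<in>G. energy P b) \<le> 2 ^ CARD('n) * 8 * (osc S b)\<^sup>2 * mea S"
    using G(2) tD(1) energy_diff_const[OF li(1)] unfolding osc_def[symmetric]
    by (simp add: power2_eq_square mult_ac subset_iff)
qed

lemma sum_sqrt_mult_le:
  fixes x y :: "'i \<Rightarrow> real"
  assumes "\<And>i. i \<in> I \<Longrightarrow> 0 \<le> x i" "\<And>i. i \<in> I \<Longrightarrow> 0 \<le> y i"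
  shows "(\<Sum>i\<in>I. sqrt (x i) * sqrt (y i)) \<le> sqrt (\<Sum>i\<in>I. x i) * sqrt (\<Sum>i\<in>I. y i)"
proof -
  have "(\<Sum>i\<in>I. sqrt (x i) * sqrt (y i))\<^sup>2 \<le> (\<Sum>i\<in>I. (sqrt (x i))\<^sup>2) * (\<Sum>i\<in>I. (sqrt (y i))\<^sup>2)"
    by (rule Cauchy_Schwarz_ineq_sum)
  also have "\<dots> = (\<Sum>i\<in>I. x i) * (\<Sum>i\<in>I. y i)"
    using assms by simp
  finally show ?thesis
    unfolding real_sqrt_mult[symmetric] by (rule real_le_rsqrt)
qed

text \<open>The Cauchy-Schwarz majorant of the modulus of \<open>average Q f\<close> times the
  integral of \<open>mart_diff D Q b * g\<close>; see \<open>mart_diff_mult_le\<close>.\<close>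

definition pairing :: "(real^'n \<Rightarrow> complex) \<Rightarrow> (real^'n \<Rightarrow> complex) \<Rightarrow> (real^'n \<Rightarrow> complex) \<Rightarrow> (real^'n) set \<Rightarrow> real" where
  "pairing f b g Q = norm (average Q f) * (sqrt (energy Q b) * sqrt (energy Q g))"

text \<open>Cauchy-Schwarz over the tree with \<open>stop_tree_energy\<close> for both factors. The
  constant is 8 from the averages of \<open>f\<close> times \<open>2 ^ CARD('n) * 8\<close> from the
  geometric mean of the two energy bounds.\<close>

lemma stop_tree_pairing:
  assumes li: "locally_integrable f" "locally_integrable b" "locally_integrable g" and S: "S \<in> D"
    and G: "finite G" "G \<subseteq> stop_tree (stop_avg f b g) S"
  shows "(\<Sum>Q\<in>G. pairing f b g Q) \<le> 64 * 2 ^ CARD('n) * (avgn S f * osc S b * avgn S g * mea S)"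
proof -
  have GD: "G \<subseteq> D" using G by (auto simp: stop_tree_def)
  let ?c = "2 ^ CARD('n) * 8 :: real"
  have "(\<Sum>Q\<in>G. pairing f b g Q) \<le> (\<Sum>Q\<in>G. 8 * avgn S f * (sqrt (energy Q b) * sqrt (energy Q g)))"
    unfolding pairing_def
  proof (intro sum_mono mult_right_mono)
    fix Q assume "Q \<in> G"
    then show "norm (average Q f) \<le> 8 * avgn S f"
      using norm_average_le[OF li(1), of Q] stop_tree_avgn(1)[OF S, of Q] G(2) GD by fastforce
  qed auto
  also have "\<dots> = 8 * avgn S f * (\<Sum>Q\<in>G. sqrt (energy Q b) * sqrt (energy Q g))"
    by (simp add: sum_distrib_left)
  also have "\<dots> \<le> 8 * avgn S f * (sqrt (\<Sum>Q\<in>G. energy Q b) * sqrt (\<Sum>Q\<in>G. energy Q g))"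
    by (intro mult_left_mono sum_sqrt_mult_le) auto
  also have "\<dots> \<le> 8 * avgn S f * (sqrt (?c * (osc S b)\<^sup>2 * mea S) * sqrt (?c * (avgn S g)\<^sup>2 * mea S))"
    using stop_tree_energy[OF li(2,3) S G] by (intro mult_left_mono mult_mono real_sqrt_le_mono) (auto intro: sum_nonneg)
  also have "\<dots> = 8 * avgn S f * (?c * (osc S b * avgn S g * mea S))"
  proof -
    have "sqrt (?c * (osc S b)\<^sup>2 * mea S) * sqrt (?c * (avgn S g)\<^sup>2 * mea S) = sqrt ((?c * (osc S b * avgn S g * mea S))\<^sup>2)"
      unfolding real_sqrt_mult[symmetric] by (intro arg_cong[of _ _ sqrt]) (simp add: power2_eq_square mult_ac)
    also have "\<dots> = ?c * (osc S b * avgn S g * mea S)"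
      by (intro real_sqrt_abs2[THEN trans] real_sqrt_unique) auto
    finally show ?thesis by simp
  qed
  finally show ?thesis by (simp add: mult_ac)
qed

text \<open>Each cube of \<open>F\<close> is charged to one stopping cube whose tree contains it.
  Only the finitely many charged cubes are kept, so the right side is a finite sum over a subfamily
  of a sparse family.\<close>

theorem sparse_domination:
  assumes li: "locally_integrable f" "locally_integrable b" "locally_integrable g"
    and F: "finite F" "F \<subseteq> D"
  obtains SS where "finite SS" "sparse SS"
    "(\<Sum>Q\<in>F. pairing f b g Q) \<le> 64 * 2 ^ CARD('n) * (\<Sum>S\<in>SS. avgn S f * osc S b * avgn S g * mea S)"
proof -
  obtain T where T: "T \<subseteq> F" "disjoint T" "\<And>Q. Q \<in> F \<Longrightarrow> \<exists>P\<in>T. Q \<subseteq> P"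
    using maximal_cubes[OF F] by blast
  have TD: "T \<subseteq> D" using T F by blast
  let ?st = "stop_avg f b g"
  have "\<forall>Q\<in>F. \<exists>S\<in>stop_family ?st T. Q \<in> stop_tree ?st S"
    using T(3) F(2) ex_stop_tree[OF TD] by blast
  then obtain s where s: "\<And>Q. Q \<in> F \<Longrightarrow> s Q \<in> stop_family ?st T" "\<And>Q. Q \<in> F \<Longrightarrow> Q \<in> stop_tree ?st (s Q)"
    by metis
  show thesis
  proof
    show "finite (s ` F)" using F by simp
    show "sparse (s ` F)"
      by (rule sparse_subset[OF sparse_stop_avg[OF li TD T(2)]]) (use s in auto)
    have "(\<Sum>Q\<in>F. pairing f b g Q) = (\<Sum>S\<in>s ` F. \<Sum>Q\<in>{Q\<in>F. s Q = S}. pairing f b g Q)"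
      using F(1) by (subst sum.image_gen[OF F(1), of _ s]) simp
    also have "\<dots> \<le> (\<Sum>S\<in>s ` F. 64 * 2 ^ CARD('n) * (avgn S f * osc S b * avgn S g * mea S))"
    proof (rule sum_mono)
      fix S assume "S \<in> s ` F"
      then have "S \<in> D" using s stop_family_D[OF TD] by blast
      then show "(\<Sum>Q\<in>{Q\<in>F. s Q = S}. pairing f b g Q) \<le> 64 * 2 ^ CARD('n) * (avgn S f * osc S b * avgn S g * mea S)"
        by (rule stop_tree_pairing[OF li]) (use F s in auto)
    qed
    finally show "(\<Sum>Q\<in>F. pairing f b g Q) \<le> 64 * 2 ^ CARD('n) * (\<Sum>S\<in>s ` F. avgn S f * osc S b * avgn S g * mea S)"
      by (simp add: sum_distrib_left)
  qed
qed

end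

section \<open>Powers in the extended nonnegative reals and Hoelder's inequality\<close>

lemma ennpowr_ennreal [simp]: "0 \<le> x \<Longrightarrow> ennpowr (ennreal x) a = ennreal (x powr a)"
  by (simp add: ennpowr_def)

lemma ennpowr_top [simp]: "ennpowr \<infinity> a = \<infinity>" "ennpowr top a = top"
  by (simp_all add: ennpowr_def)

lemma ennpowr_0 [simp]: "ennpowr 0 a = 0"
  by (simp add: ennpowr_def)

lemma ennpowr_1 [simp]: "ennpowr x 1 = x"
  by (cases x) (auto simp: ennpowr_def)

lemma ennpowr_less_top [simp]: "ennpowr x a < top \<longleftrightarrow> x < top"
  by (auto simp: ennpowr_def less_top[symmetric])

lemma ennpowr_mono: "x \<le> y \<Longrightarrow> 0 \<le> a \<Longrightarrow> ennpowr x a \<le> ennpowr y a"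
  by (cases x; cases y) (auto simp: top_unique intro: powr_mono2)

text \<open>For \<open>a > 0\<close> the power fixes 0 and infinity, so both sides follow the
  convention that 0 times infinity is 0.\<close>

lemma ennpowr_mult: "0 < a \<Longrightarrow> ennpowr (x * y) a = ennpowr x a * ennpowr y a"
proof (cases x; cases y)
  fix r s assume "0 < a" "x = ennreal r" "0 \<le> r" "y = ennreal s" "0 \<le> s"
  then show ?thesis by (simp add: ennreal_mult[symmetric] powr_mult)
next
  fix r assume *: "0 < a" "x = ennreal r" "0 \<le> r" "y = top"
  then show ?thesis by (cases "r = 0") (auto simp: ennreal_mult_top)
next
  fix s assume *: "0 < a" "x = top" "y = ennreal s" "0 \<le> s"
  then show ?thesis by (cases "s = 0") (auto simp: ennreal_top_mult)
qed (auto simp: ennreal_top_mult)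

lemma ennpowr_ennpowr [simp]: "ennpowr (ennpowr x a) b = ennpowr x (a * b)"
  by (cases x) (auto simp: powr_powr)

lemma ennpowr_eq_0_iff [simp]: "ennpowr x a = 0 \<longleftrightarrow> x = 0"
  by (cases x) auto

text \<open>Division by a power of \<open>Y\<close>. Finiteness of \<open>Y\<close> is essential,
  since infinity satisfies the last premise whenever \<open>X\<close> is not 0; each use therefore
  relies on an a priori bound.\<close>

lemma ennpowr_absorb:
  assumes "Y < \<infinity>" "0 < a" "a < 1" "Y \<le> X * ennpowr Y (1 - a)"
  shows "Y \<le> ennpowr X (1 / a)"
proof (cases "Y = 0")
  case False
  obtain y where y: "Y = ennreal y" "y > 0"
    using assms(1) False by (cases Y) (auto simp: less_le)
  show ?thesis
  proof (cases X)
    case (real x)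
    have "y \<le> x * y powr (1 - a)"
      using assms(4) real y by (simp add: ennreal_mult[symmetric])
    then have "y * y powr (a - 1) \<le> x * y powr (1 - a) * y powr (a - 1)"
      by (intro mult_right_mono) auto
    moreover have "y * y powr (a - 1) = y powr a"
      using y(2) by (simp add: powr_mult_base)
    moreover have "x * y powr (1 - a) * y powr (a - 1) = x"
      using y(2) by (simp add: mult.assoc powr_add[symmetric])
    ultimately have "y powr a \<le> x" by simp
    then have "(y powr a) powr (1 / a) \<le> x powr (1 / a)"
      using assms(2) by (intro powr_mono2) auto
    then show ?thesis using y real assms(2) by (simp add: powr_powr ennreal_leI)
  qed simp
qed simp

lemma Young_powr:
  fixes x y :: real
  assumes "0 < a" "0 < b" "a + b = 1" "0 \<le> x" "0 \<le> y"
  shows "x powr a * y powr b \<le> a * x + b * y"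
  using Youngs_inequality_0[of a b x y] assms by (cases "x = 0 \<or> y = 0") auto

text \<open>Pointwise Young inequality after normalising both integrals to 1. The exponents sit
  inside, so that integrals of p-th powers enter without roots.\<close>

lemma nn_integral_Holder:
  fixes F G :: "'a \<Rightarrow> real"
  assumes [measurable]: "F \<in> borel_measurable M" "G \<in> borel_measurable M"
    and nn: "\<And>x. 0 \<le> F x" "\<And>x. 0 \<le> G x" and ab: "0 < a" "0 < b" "a + b = 1"
  shows "(\<integral>\<^sup>+x. ennreal (F x powr a * G x powr b) \<partial>M)
    \<le> ennpowr (\<integral>\<^sup>+x. ennreal (F x) \<partial>M) a * ennpowr (\<integral>\<^sup>+x. ennreal (G x) \<partial>M) b"
proof -
  let ?I = "\<integral>\<^sup>+x. ennreal (F x) \<partial>M" and ?J = "\<integral>\<^sup>+x. ennreal (G x) \<partial>M"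
  consider "?I = 0 \<or> ?J = 0" | "?I \<noteq> 0" "?J \<noteq> 0" "?I = top \<or> ?J = top"
    | "?I \<noteq> 0" "?J \<noteq> 0" "?I \<noteq> top" "?J \<noteq> top" by blast
  then show ?thesis
  proof cases
    \<comment> \<open>A vanishing integral makes the right side 0 even if the other one is infinite,
      so the left side has to vanish: \<open>F\<close> or \<open>G\<close> is 0 almost
      everywhere.\<close>
    case 1
    then have "AE x in M. F x = 0 \<or> G x = 0"
      using nn by (auto simp: nn_integral_0_iff_AE ennreal_eq_0_iff intro: antisym elim: eventually_mono)
    then have "(\<integral>\<^sup>+x. ennreal (F x powr a * G x powr b) \<partial>M) = (\<integral>\<^sup>+x. 0 \<partial>M)"
      by (intro nn_integral_cong_AE) (auto elim: eventually_mono)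
    then show ?thesis by simp
  next
    case 2
    then have "ennpowr ?I a * ennpowr ?J b = top"
      by (auto simp: ennreal_mult_top ennreal_top_mult ennreal_mult_eq_top_iff)
    then show ?thesis by simp
  next
    case 3
    then obtain i j where ij: "?I = ennreal i" "i > 0" "?J = ennreal j" "j > 0"
      by (metis ennreal_cases ennreal_0 less_le)
    have le: "F x powr a * G x powr b \<le> i powr a * j powr b * (a / i) * F x + i powr a * j powr b * (b / j) * G x" for x
    proof -
      have "F x powr a * G x powr b = i powr a * j powr b * ((F x / i) powr a * (G x / j) powr b)"
        using ij nn by (simp add: powr_divide)
      also have "\<dots> \<le> i powr a * j powr b * (a * (F x / i) + b * (G x / j))"
        using ij nn ab by (intro mult_left_mono Young_powr) auto
      finally show ?thesis by (simp add: algebra_simps)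
    qed
    let ?c = "i powr a * j powr b"
    have "(\<integral>\<^sup>+x. ennreal (F x powr a * G x powr b) \<partial>M)
       \<le> (\<integral>\<^sup>+x. ennreal (?c * (a / i)) * ennreal (F x) + ennreal (?c * (b / j)) * ennreal (G x) \<partial>M)"
      using le ij ab nn by (intro nn_integral_mono) (simp add: ennreal_mult[symmetric] ennreal_plus[symmetric] ennreal_leI del: ennreal_plus)
    also have "\<dots> = ennreal (?c * (a / i)) * ?I + ennreal (?c * (b / j)) * ?J"
      by (simp add: nn_integral_add nn_integral_cmult)
    also have "\<dots> = ennreal (?c * (a / i) * i + ?c * (b / j) * j)"
      using ij ab by (simp add: ennreal_mult[symmetric] ennreal_plus[symmetric] del: ennreal_plus)
    also have "?c * (a / i) * i + ?c * (b / j) * j = ?c"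
    proof -
      have "?c * (a / i) * i + ?c * (b / j) * j = ?c * (a + b)"
        using ij by (simp add: distrib_left)
      then show ?thesis using ab by simp
    qed
    also have "ennreal ?c = ennpowr ?I a * ennpowr ?J b"
      using ij by (simp add: ennreal_mult)
    finally show ?thesis .
  qed
qed

lemma sum_Holder:
  fixes x y :: "'i \<Rightarrow> real"
  assumes "finite I" and nn: "\<And>i. 0 \<le> x i" "\<And>i. 0 \<le> y i" and ab: "0 < a" "0 < b" "a + b = 1"
  shows "(\<Sum>i\<in>I. x i powr a * y i powr b) \<le> (\<Sum>i\<in>I. x i) powr a * (\<Sum>i\<in>I. y i) powr b"
proof -
  have "ennreal (\<Sum>i\<in>I. x i powr a * y i powr b) \<le> ennpowr (ennreal (\<Sum>i\<in>I. x i)) a * ennpowr (ennreal (\<Sum>i\<in>I. y i)) b"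
    using nn_integral_Holder[of x "count_space I" y a b] assms
    by (simp add: nn_integral_count_space_finite)
  then show ?thesis using nn by (simp add: ennreal_mult[symmetric] sum_nonneg)
qed

text \<open>Hoelder twice; the inner exponents \<open>b / (b + c)\<close> and
  \<open>c / (b + c)\<close> add up to 1.\<close>

lemma sum_Holder3:
  fixes x y z :: "'i \<Rightarrow> real"
  assumes "finite I" and nn: "\<And>i. 0 \<le> x i" "\<And>i. 0 \<le> y i" "\<And>i. 0 \<le> z i"
    and abc: "0 < a" "0 < b" "0 < c" "a + b + c = 1"
  shows "(\<Sum>i\<in>I. x i powr a * y i powr b * z i powr c)
    \<le> (\<Sum>i\<in>I. x i) powr a * (\<Sum>i\<in>I. y i) powr b * (\<Sum>i\<in>I. z i) powr c"
proof -
  let ?d = "b + c"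
  let ?w = "\<lambda>i. y i powr (b / ?d) * z i powr (c / ?d)"
  have "(\<Sum>i\<in>I. x i powr a * y i powr b * z i powr c) = (\<Sum>i\<in>I. x i powr a * ?w i powr ?d)"
    using abc by (intro sum.cong refl) (simp add: powr_mult powr_powr)
  also have "\<dots> \<le> (\<Sum>i\<in>I. x i) powr a * (\<Sum>i\<in>I. ?w i) powr ?d"
    using assms by (intro sum_Holder) auto
  also have "\<dots> \<le> (\<Sum>i\<in>I. x i) powr a * ((\<Sum>i\<in>I. y i) powr (b / ?d) * (\<Sum>i\<in>I. z i) powr (c / ?d)) powr ?d"
    using assms by (intro mult_left_mono powr_mono2 sum_Holder sum_nonneg) (auto simp: add_divide_distrib[symmetric])
  also have "\<dots> = (\<Sum>i\<in>I. x i) powr a * (\<Sum>i\<in>I. y i) powr b * (\<Sum>i\<in>I. z i) powr c"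
    using abc by (simp add: powr_mult powr_powr)
  finally show ?thesis .
qed

lemma sum_powr_le_powr_sum:
  fixes x :: "'i \<Rightarrow> real"
  assumes "finite I" "\<And>i. 0 \<le> x i" "1 \<le> s"
  shows "(\<Sum>i\<in>I. x i powr s) \<le> (\<Sum>i\<in>I. x i) powr s"
proof -
  let ?X = "\<Sum>i\<in>I. x i"
  have X: "0 \<le> ?X" using assms by (simp add: sum_nonneg)
  have "(\<Sum>i\<in>I. x i powr s) = (\<Sum>i\<in>I. x i * x i powr (s - 1))"
    using assms(2) by (intro sum.cong refl) (simp add: powr_mult_base)
  also have "\<dots> \<le> (\<Sum>i\<in>I. x i * ?X powr (s - 1))"
    using assms by (intro sum_mono mult_left_mono powr_mono2 member_le_sum) auto
  also have "\<dots> = ?X powr s"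
    using X by (simp add: sum_distrib_right[symmetric] powr_mult_base)
  finally show ?thesis .
qed

text \<open>Made for \<open>p \<le> q\<close>, where the exponents add up to at least 1. Divided by
  their sum they form an exact Hoelder pair, and the surplus power is absorbed by the embedding of
  l^1 into l^s.\<close>

lemma sum_Holder_superadditive:
  fixes x y :: "'i \<Rightarrow> real"
  assumes "finite I" and nn: "\<And>i. 0 \<le> x i" "\<And>i. 0 \<le> y i" and ab: "0 < a" "0 < b" "1 \<le> a + b"
  shows "(\<Sum>i\<in>I. x i powr a * y i powr b) \<le> (\<Sum>i\<in>I. x i) powr a * (\<Sum>i\<in>I. y i) powr b"
proof -
  let ?s = "a + b"
  let ?w = "\<lambda>i. x i powr (a / ?s) * y i powr (b / ?s)"
  have "(\<Sum>i\<in>I. x i powr a * y i powr b) = (\<Sum>i\<in>I. ?w i powr ?s)"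
    using ab by (intro sum.cong refl) (simp add: powr_mult powr_powr)
  also have "\<dots> \<le> (\<Sum>i\<in>I. ?w i) powr ?s"
    using assms by (intro sum_powr_le_powr_sum) auto
  also have "\<dots> \<le> ((\<Sum>i\<in>I. x i) powr (a / ?s) * (\<Sum>i\<in>I. y i) powr (b / ?s)) powr ?s"
    using assms by (intro powr_mono2 sum_Holder sum_nonneg) (auto simp: add_divide_distrib[symmetric])
  also have "\<dots> = (\<Sum>i\<in>I. x i) powr a * (\<Sum>i\<in>I. y i) powr b"
    using ab by (simp add: powr_mult powr_powr)
  finally show ?thesis .
qed

section \<open>Maximal functions\<close>

lemma powr_layer_cake:
  fixes u :: real
  assumes "0 \<le> u" "0 < a"
  shows "(\<integral>\<^sup>+t. ennreal (a * t powr (a - 1)) * indicator {t. 0 < t \<and> t < u} t \<partial>lborel) = ennreal (u powr a)"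
proof -
  have "((\<lambda>t. t powr (a - 1)) has_integral u powr a / a) {0..u}"
    using has_integral_powr_from_0[of "a - 1" u] assms by simp
  then have "((\<lambda>t. a * t powr (a - 1)) has_integral u powr a) {0..u}"
    using has_integral_mult_right[of "\<lambda>t. t powr (a - 1)" "u powr a / a" "{0..u}" a] assms by simp
  then have "((\<lambda>t. if t \<in> {0<..<u} then a * t powr (a - 1) else 0) has_integral u powr a) UNIV"
    by (simp only: has_integral_restrict_UNIV has_integral_Icc_iff_Ioo)
  then have "(\<integral>\<^sup>+t. ennreal (if t \<in> {0<..<u} then a * t powr (a - 1) else 0) \<partial>lborel) = ennreal (u powr a)"
    using assms by (intro nn_integral_has_integral_lborel) auto
  moreover have "(\<integral>\<^sup>+t. ennreal (if t \<in> {0<..<u} then a * t powr (a - 1) else 0) \<partial>lborel)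
    = (\<integral>\<^sup>+t. ennreal (a * t powr (a - 1)) * indicator {t. 0 < t \<and> t < u} t \<partial>lborel)"
    by (intro nn_integral_cong) (auto simp: indicator_def)
  ultimately show ?thesis by simp
qed

text \<open>The weak inequality is integrated against \<open>p * t powr (p - 2)\<close>: layer cake
  turns its two sides into moments of \<open>F\<close> of order \<open>p\<close> and
  \<open>p - 1\<close>, whence \<open>p / (p - 1)\<close>. That \<open>h\<close> is integrated over
  the level set only is what lets \<open>F\<close> reappear on the right.\<close>

lemma Doob_layer_cake:
  fixes v h F :: "'a \<Rightarrow> real"
  assumes "sigma_finite_measure M"
    and [measurable]: "v \<in> borel_measurable M" "h \<in> borel_measurable M" "F \<in> borel_measurable M"
    and nn: "\<And>x. 0 \<le> v x" "\<And>x. 0 \<le> h x" "\<And>x. 0 \<le> F x" and p: "1 < p"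
    and weak: "\<And>t. 0 < t \<Longrightarrow> ennreal t * (\<integral>\<^sup>+x. ennreal (v x) * indicator {x. t < F x} x \<partial>M)
       \<le> (\<integral>\<^sup>+x. ennreal (h x * v x) * indicator {x. t < F x} x \<partial>M)"
  shows "(\<integral>\<^sup>+x. ennreal (F x powr p * v x) \<partial>M)
    \<le> ennreal (p / (p - 1)) * (\<integral>\<^sup>+x. ennreal (h x * F x powr (p - 1) * v x) \<partial>M)"
proof -
  interpret M: sigma_finite_measure M by fact
  interpret P: pair_sigma_finite M lborel ..
  have layer: "(\<integral>\<^sup>+x. ennreal (F x powr a * k x) \<partial>M)
    = (\<integral>\<^sup>+t. ennreal (a * t powr (a - 1)) * indicator {0<..} t * (\<integral>\<^sup>+x. ennreal (k x) * indicator {x. t < F x} x \<partial>M) \<partial>lborel)"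
    if [measurable]: "k \<in> borel_measurable M" and k: "\<And>x. 0 \<le> k x" and "0 < a" for k :: "'a \<Rightarrow> real" and a
  proof -
    have "(\<integral>\<^sup>+x. ennreal (F x powr a * k x) \<partial>M)
      = (\<integral>\<^sup>+x. (\<integral>\<^sup>+t. ennreal (a * t powr (a - 1)) * indicator {t. 0 < t \<and> t < F x} t * ennreal (k x) \<partial>lborel) \<partial>M)"
      using k nn \<open>0 < a\<close> by (intro nn_integral_cong) (subst nn_integral_multc, simp, subst powr_layer_cake, auto simp: ennreal_mult)
    also have "\<dots> = (\<integral>\<^sup>+t. (\<integral>\<^sup>+x. ennreal (a * t powr (a - 1)) * indicator {t. 0 < t \<and> t < F x} t * ennreal (k x) \<partial>M) \<partial>lborel)"
      by (subst P.Fubini') (auto simp: split_def)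
    also have "\<dots> = (\<integral>\<^sup>+t. (\<integral>\<^sup>+x. ennreal (a * t powr (a - 1)) * indicator {0<..} t * (ennreal (k x) * indicator {x. t < F x} x) \<partial>M) \<partial>lborel)"
      by (intro nn_integral_cong) (auto simp: indicator_def)
    also have "\<dots> = (\<integral>\<^sup>+t. ennreal (a * t powr (a - 1)) * indicator {0<..} t * (\<integral>\<^sup>+x. ennreal (k x) * indicator {x. t < F x} x \<partial>M) \<partial>lborel)"
      by (intro nn_integral_cong nn_integral_cmult) measurable
    finally show ?thesis .
  qed
  have "(\<integral>\<^sup>+x. ennreal (F x powr p * v x) \<partial>M)
    = (\<integral>\<^sup>+t. ennreal (p * t powr (p - 1)) * indicator {0<..} t * (\<integral>\<^sup>+x. ennreal (v x) * indicator {x. t < F x} x \<partial>M) \<partial>lborel)"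
    using p nn by (intro layer) auto
  also have "\<dots> \<le> (\<integral>\<^sup>+t. ennreal (p / (p - 1)) * (ennreal ((p - 1) * t powr (p - 1 - 1)) * indicator {0<..} t *
       (\<integral>\<^sup>+x. ennreal (h x * v x) * indicator {x. t < F x} x \<partial>M)) \<partial>lborel)"
  proof (intro nn_integral_mono)
    fix t :: real
    show "ennreal (p * t powr (p - 1)) * indicator {0<..} t * (\<integral>\<^sup>+x. ennreal (v x) * indicator {x. t < F x} x \<partial>M)
       \<le> ennreal (p / (p - 1)) * (ennreal ((p - 1) * t powr (p - 1 - 1)) * indicator {0<..} t *
       (\<integral>\<^sup>+x. ennreal (h x * v x) * indicator {x. t < F x} x \<partial>M))"
    proof (cases "0 < t")
      case True
      have "t powr (p - 1) = t powr (p - 1 - 1) * t"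
        using True powr_mult_base[of t "p - 1 - 1"] by (simp add: mult.commute)
      then have "ennreal (p * t powr (p - 1)) = ennreal (p / (p - 1)) * ennreal ((p - 1) * t powr (p - 1 - 1)) * ennreal t"
        using p True by (simp add: ennreal_mult[symmetric])
      then show ?thesis using True weak[OF True] by (simp add: mult.assoc mult_left_mono)
    qed simp
  qed
  also have "\<dots> = ennreal (p / (p - 1)) * (\<integral>\<^sup>+t. ennreal ((p - 1) * t powr (p - 1 - 1)) * indicator {0<..} t *
       (\<integral>\<^sup>+x. ennreal (h x * v x) * indicator {x. t < F x} x \<partial>M) \<partial>lborel)"
    by (rule nn_integral_cmult) measurable
  also have "\<dots> = ennreal (p / (p - 1)) * (\<integral>\<^sup>+x. ennreal (F x powr (p - 1) * (h x * v x)) \<partial>M)"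
    using p nn by (subst layer) auto
  finally show ?thesis by (simp add: mult_ac)
qed

lemma sigma_finite_lebesgue: "sigma_finite_measure (lebesgue :: 'a::euclidean_space measure)"
proof (unfold_locales, intro exI conjI ballI)
  let ?A = "range (\<lambda>n. cball 0 (real n)) :: 'a set set"
  show "countable ?A" by simp
  show "?A \<subseteq> sets lebesgue" by auto
  show "\<Union>?A = space lebesgue"
    using real_arch_simple by fastforce
  fix a assume "a \<in> ?A"
  then have "a \<in> lmeasurable" by auto
  then show "emeasure lebesgue a \<noteq> \<infinity>" using fmeasurableD2 by (metis infinity_ennreal_def)
qed

section \<open>Doob's inequality and the Carleson embedding relative to a weight\<close>

context dyadic
begin

abbreviation wt :: "(real^'n \<Rightarrow> real) \<Rightarrow> (real^'n) set \<Rightarrow> real" where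
  "wt w E \<equiv> (LINT x:E|lebesgue. w x)"

lemma wt_mono:
  assumes "locally_integrable w" "\<And>x. 0 \<le> w x" "E \<in> sets lebesgue" "F \<in> sets lebesgue" "bounded F" "E \<subseteq> F"
  shows "wt w E \<le> wt w F"
  using assms by (intro set_integral_mono_set locally_integrable_set_integrable) auto

lemma wt_nonneg: "(\<And>x. 0 \<le> w x) \<Longrightarrow> 0 \<le> wt w E"
  by (rule set_integral_nonneg') simp

lemma nn_integral_wt:
  assumes "locally_integrable w" "\<And>x. 0 \<le> w x" "E \<in> sets lebesgue" "bounded E"
  shows "(\<integral>\<^sup>+x. ennreal (w x) * indicator E x \<partial>lebesgue) = ennreal (wt w E)"
  using assms by (intro nn_integral_set_integral locally_integrable_set_integrable) auto

lemma wt_pos: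
  assumes w: "locally_integrable w" "\<And>x. 0 < w x" and E: "E \<in> sets lebesgue" "bounded E" "0 < mea E"
  shows "0 < wt w E"
proof (rule ccontr)
  have nn: "\<And>x. 0 \<le> w x" using w(2) less_imp_le by blast
  assume "\<not> 0 < wt w E"
  then have "wt w E = 0" using wt_nonneg[of w E] nn by force
  then have "(\<integral>\<^sup>+x\<in>E. ennreal (w x) \<partial>lebesgue) = 0"
    using nn_integral_wt[OF w(1) nn E(1,2)] by simp
  then have "E \<in> null_sets lebesgue"
    using w locally_integrable_measurable[OF w(1)] E(1) by (intro null_if_pos_func_has_zero_nn_int) auto
  then show False using E(3) by (simp add: measure_eq_0_null_sets)
qed

lemma wt_pos_D: "locally_integrable w \<Longrightarrow> (\<And>x. 0 < w x) \<Longrightarrow> Q \<in> D \<Longrightarrow> 0 < wt w Q"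
  by (intro wt_pos) (auto simp: D_bounded D_measure_pos)

lemma wt_Holder:
  assumes u: "locally_integrable u" "\<And>x. 0 \<le> u x" and v: "locally_integrable v" "\<And>x. 0 \<le> v x"
    and w: "locally_integrable w" "\<And>x. 0 \<le> w x"
    and E: "E \<in> sets lebesgue" "bounded E" and a: "0 < a" "a < 1"
    and eq: "\<And>x. w x = u x powr a * v x powr (1 - a)"
  shows "wt w E \<le> wt u E powr a * wt v E powr (1 - a)"
proof -
  have [measurable]: "u \<in> borel_measurable lebesgue" "v \<in> borel_measurable lebesgue" "w \<in> borel_measurable lebesgue"
    using u v w by (auto intro: locally_integrable_measurable)
  note [measurable] = E(1)
  have "ennreal (wt w E) = (\<integral>\<^sup>+x. ennreal ((u x * indicator E x) powr a * (v x * indicator E x) powr (1 - a)) \<partial>lebesgue)"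
    unfolding nn_integral_wt[OF w E, symmetric]
    by (intro nn_integral_cong) (auto simp: indicator_def eq)
  also have "\<dots> \<le> ennpowr (\<integral>\<^sup>+x. ennreal (u x * indicator E x) \<partial>lebesgue) a * ennpowr (\<integral>\<^sup>+x. ennreal (v x * indicator E x) \<partial>lebesgue) (1 - a)"
    using u v a by (intro nn_integral_Holder) auto
  also have "(\<lambda>x. ennreal (u x * indicator E x)) = (\<lambda>x. ennreal (u x) * indicator E x)"
    by (auto simp: indicator_def)
  also have "(\<lambda>x. ennreal (v x * indicator E x)) = (\<lambda>x. ennreal (v x) * indicator E x)"
    by (auto simp: indicator_def)
  finally show ?thesis
    unfolding nn_integral_wt[OF u E] nn_integral_wt[OF v E]
    using u v by (simp add: wt_nonneg ennreal_mult[symmetric])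
qed

text \<open>The maximal function of \<open>v\<close>-weighted averages is bounded on L^p(v) with a
  constant independent of \<open>v\<close>. As the sets \<open>E S\<close> are disjoint, the sum on
  the left is at most the integral of its p-th power.\<close>

lemma Doob_dyadic:
  assumes v: "locally_integrable v" "\<And>x. 0 < v x" and h: "locally_integrable (\<lambda>x. h x * v x)" "\<And>x. 0 \<le> h x"
    and hm [measurable]: "h \<in> borel_measurable lebesgue"
    and F: "finite F" "F \<subseteq> D" and p: "1 < p"
    and E: "disjoint_family_on E F" "\<And>S. S \<in> F \<Longrightarrow> E S \<in> sets lebesgue" "\<And>S. S \<in> F \<Longrightarrow> E S \<subseteq> S"
  shows "ennreal (\<Sum>S\<in>F. (wt (\<lambda>x. h x * v x) S / wt v S) powr p * wt v (E S))
    \<le> ennreal ((p / (p - 1)) powr p) * (\<integral>\<^sup>+x. ennreal (h x powr p * v x) \<partial>lebesgue)"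
proof -
  note [measurable] = locally_integrable_measurable[OF v(1)]
  have v0: "\<And>x. 0 \<le> v x" using v(2) less_imp_le by blast
  define A where "A S = wt (\<lambda>x. h x * v x) S / wt v S" for S
  have A0: "0 \<le> A S" for S using h v0 by (auto simp: A_def intro!: divide_nonneg_nonneg wt_nonneg)
  \<comment> \<open>Only the finitely many cubes of \<open>F\<close> enter, so \<open>M\<close>
    takes finitely many values; the inserted 0 is the value off \<open>\<Union>F\<close>.\<close>
  define M where "M x = Max (insert 0 (A ` {S\<in>F. x \<in> S}))" for x
  have M_gr: "t < M x \<longleftrightarrow> (\<exists>S\<in>F. x \<in> S \<and> t < A S)" if "0 \<le> t" for t x
    unfolding M_def using F(1) that by (subst Max_gr_iff) auto
  have M0: "0 \<le> M x" for x unfolding M_def using F(1) by (intro Max_ge) auto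
  have M_set: "{x. t < M x} = \<Union>{S\<in>F. t < A S}" if "0 \<le> t" for t
    using M_gr[OF that] by auto
  have Mm [measurable]: "M \<in> borel_measurable lebesgue"
  proof (subst borel_measurable_iff_greater, intro allI)
    fix t
    show "{w \<in> space lebesgue. t < M w} \<in> sets lebesgue"
    proof (cases "0 \<le> t")
      case True
      then show ?thesis using M_set[OF True] D_subset_sets[of "{S\<in>F. t < A S}"] F by auto
    next
      case False
      then have "t < M w" for w using M0[of w] by linarith
      then have "{w \<in> space lebesgue. t < M w} = UNIV" by auto
      then show ?thesis by simp
    qed
  qed
  have weak: "ennreal t * (\<integral>\<^sup>+x. ennreal (v x) * indicator {x. t < M x} x \<partial>lebesgue)
       \<le> (\<integral>\<^sup>+x. ennreal (h x * v x) * indicator {x. t < M x} x \<partial>lebesgue)" if t: "0 < t" for t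
  proof -
    \<comment> \<open>The level set is the disjoint union of the maximal cubes with average above
      \<open>t\<close>; on each of them the weak inequality is the definition of
      \<open>A\<close>.\<close>
    obtain T where T: "T \<subseteq> {S\<in>F. t < A S}" "disjoint T" "\<And>Q. Q \<in> {S\<in>F. t < A S} \<Longrightarrow> \<exists>P\<in>T. Q \<subseteq> P"
      by (rule maximal_cubes[of "{S\<in>F. t < A S}"]) (use F in auto)
    have TD: "T \<subseteq> D" "finite T" using T(1) F by (auto intro: finite_subset)
    have UT: "{x. t < M x} = \<Union>T"
      unfolding M_set[OF less_imp_le[OF t]] using T(1,3) by blast
    have sum: "(\<integral>\<^sup>+x. ennreal (k x) * indicator (\<Union>T) x \<partial>lebesgue) = (\<Sum>S\<in>T. ennreal (wt k S))"
      if k: "locally_integrable k" "\<And>x. 0 \<le> k x" for k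
    proof -
      note [measurable] = locally_integrable_measurable[OF k(1)]
      have "ennreal (k x) * indicator (\<Union>T) x = (\<Sum>S\<in>T. ennreal (k x) * indicator S x)" for x
      proof -
        have "indicator (\<Union>S\<in>T. S) x = (\<Sum>S\<in>T. indicator S x :: ennreal)"
          by (rule indicator_UN_disjoint) (use TD T(2) in \<open>auto simp: disjoint_family_on_def disjoint_def\<close>)
        then show ?thesis by (simp add: sum_distrib_left)
      qed
      then have "(\<integral>\<^sup>+x. ennreal (k x) * indicator (\<Union>T) x \<partial>lebesgue) = (\<integral>\<^sup>+x. (\<Sum>S\<in>T. ennreal (k x) * indicator S x) \<partial>lebesgue)"
        by (simp only:)
      also have "\<dots> = (\<Sum>S\<in>T. \<integral>\<^sup>+x. ennreal (k x) * indicator S x \<partial>lebesgue)"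
        using TD by (intro nn_integral_sum) auto
      finally have "(\<integral>\<^sup>+x. ennreal (k x) * indicator (\<Union>T) x \<partial>lebesgue) = (\<Sum>S\<in>T. \<integral>\<^sup>+x. ennreal (k x) * indicator S x \<partial>lebesgue)" .
      also have "\<dots> = (\<Sum>S\<in>T. ennreal (wt k S))"
        using TD k by (intro sum.cong nn_integral_wt) (auto simp: D_bounded)
      finally show ?thesis .
    qed
    have "ennreal t * (\<Sum>S\<in>T. ennreal (wt v S)) = (\<Sum>S\<in>T. ennreal (t * wt v S))"
      unfolding sum_distrib_left using t by (intro sum.cong refl) (simp add: ennreal_mult wt_nonneg v0)
    also have "\<dots> \<le> (\<Sum>S\<in>T. ennreal (wt (\<lambda>x. h x * v x) S))"
    proof (intro sum_mono ennreal_leI)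
      fix S assume "S \<in> T"
      then have "t < A S" "S \<in> D" using T(1) F by auto
      then show "t * wt v S \<le> wt (\<lambda>x. h x * v x) S"
        using wt_pos_D[OF v] by (simp add: A_def pos_less_divide_eq less_imp_le)
    qed
    finally show ?thesis using sum[OF v(1) v0] sum[OF h(1)] h(2) v0 unfolding UT by simp
  qed
  let ?Y = "\<integral>\<^sup>+x. ennreal (M x powr p * v x) \<partial>lebesgue" and ?H = "\<integral>\<^sup>+x. ennreal (h x powr p * v x) \<partial>lebesgue"
  have "?Y \<le> ennreal (p / (p - 1)) * (\<integral>\<^sup>+x. ennreal (h x * M x powr (p - 1) * v x) \<partial>lebesgue)"
    by (rule Doob_layer_cake[OF sigma_finite_lebesgue]) (use v0 h(2) M0 p weak in auto)
  also have "(\<integral>\<^sup>+x. ennreal (h x * M x powr (p - 1) * v x) \<partial>lebesgue)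
     = (\<integral>\<^sup>+x. ennreal ((h x powr p * v x) powr (1 / p) * (M x powr p * v x) powr (1 - 1 / p)) \<partial>lebesgue)"
  proof (intro nn_integral_cong arg_cong[of _ _ ennreal])
    fix x
    have "v x powr (1 / p) * v x powr (1 - 1 / p) = v x"
      using v(2)[of x] by (simp add: powr_add[symmetric])
    moreover have "p * (1 - 1 / p) = p - 1" using p by (simp add: field_simps)
    ultimately show "h x * M x powr (p - 1) * v x = (h x powr p * v x) powr (1 / p) * (M x powr p * v x) powr (1 - 1 / p)"
      using p h(2)[of x] M0[of x] v0[of x] by (simp add: powr_mult powr_powr mult_ac)
  qed
  also have "\<dots> \<le> ennpowr ?H (1 / p) * ennpowr ?Y (1 - 1 / p)"
    using p h(2) v0 by (intro nn_integral_Holder) auto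
  finally have Y: "?Y \<le> ennreal (p / (p - 1)) * ennpowr ?H (1 / p) * ennpowr ?Y (1 - 1 / p)"
    by (simp add: mult_left_mono mult.assoc)
  \<comment> \<open>Required for the absorption: \<open>M\<close> is bounded and vanishes outside
    the bounded set \<open>\<Union>F\<close>, on which \<open>v\<close> is integrable.\<close>
  have fin: "?Y < \<infinity>"
  proof -
    define m where "m = Max (insert 0 (A ` F))"
    have mA: "A S \<le> m" if "S \<in> F" for S unfolding m_def using F(1) that by (intro Max_ge) auto
    have bU: "bounded (\<Union>F)" using F D_bounded by (intro bounded_Union) auto
    have "?Y \<le> (\<integral>\<^sup>+x. ennreal (m powr p) * (ennreal (v x) * indicator (\<Union>F) x) \<partial>lebesgue)"
    proof (intro nn_integral_mono)
      fix x
      show "ennreal (M x powr p * v x) \<le> ennreal (m powr p) * (ennreal (v x) * indicator (\<Union>F) x)"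
      proof (cases "x \<in> \<Union>F")
        case True
        have "M x \<le> m" unfolding M_def m_def using F(1) by (intro Max_mono) auto
        then have "M x powr p \<le> m powr p" using p M0[of x] by (intro powr_mono2) auto
        then show ?thesis using True v0[of x] by (simp add: ennreal_mult[symmetric] mult_right_mono ennreal_leI)
      next
        case False
        then have "{S\<in>F. x \<in> S} = {}" by auto
        then have "M x = 0" by (simp only: M_def image_empty Max_singleton)
        then show ?thesis by simp
      qed
    qed
    also have "\<dots> = ennreal (m powr p) * ennreal (wt v (\<Union>F))"
      using D_subset_sets[OF F(2)] by (simp add: nn_integral_cmult nn_integral_wt[OF v(1) v0 _ bU])
    also have "\<dots> < \<infinity>" by (simp add: ennreal_mult[symmetric] wt_nonneg v0)
    finally show ?thesis .
  qed
  have "?Y \<le> ennpowr (ennreal (p / (p - 1)) * ennpowr ?H (1 / p)) (1 / (1 / p))"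
    by (rule ennpowr_absorb[OF fin _ _ Y]) (use p in auto)
  also have "\<dots> = ennreal ((p / (p - 1)) powr p) * ?H"
    using p by (simp add: ennpowr_mult)
  finally have main: "?Y \<le> ennreal ((p / (p - 1)) powr p) * ?H" .
  have bE: "bounded (E S)" if "S \<in> F" for S
    using E(3)[OF that] D_bounded F(2) that bounded_subset by blast
  have "ennreal (\<Sum>S\<in>F. A S powr p * wt v (E S)) = (\<Sum>S\<in>F. ennreal (A S powr p) * (\<integral>\<^sup>+x. ennreal (v x) * indicator (E S) x \<partial>lebesgue))"
    using bE E(2) by (simp add: nn_integral_wt[OF v(1) v0] sum_ennreal[symmetric] wt_nonneg v0 ennreal_mult del: sum_ennreal)
  also have "\<dots> = (\<integral>\<^sup>+x. (\<Sum>S\<in>F. ennreal (A S powr p) * (ennreal (v x) * indicator (E S) x)) \<partial>lebesgue)"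
    using E(2) by (simp add: nn_integral_sum nn_integral_cmult)
  also have "\<dots> \<le> ?Y"
  proof (intro nn_integral_mono)
    fix x
    show "(\<Sum>S\<in>F. ennreal (A S powr p) * (ennreal (v x) * indicator (E S) x)) \<le> ennreal (M x powr p * v x)"
    proof (cases "\<exists>S\<in>F. x \<in> E S")
      case True
      then obtain S where S: "S \<in> F" "x \<in> E S" by auto
      have "(\<Sum>S\<in>F. ennreal (A S powr p) * (ennreal (v x) * indicator (E S) x)) = (\<Sum>S\<in>{S}. ennreal (A S powr p) * (ennreal (v x) * indicator (E S) x))"
        using S E(1) F(1) by (intro sum.mono_neutral_right) (auto simp: disjoint_family_on_def indicator_def split: if_splits)
      also have "\<dots> = ennreal (A S powr p * v x)" using S v0 by (simp add: ennreal_mult)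
      also have "\<dots> \<le> ennreal (M x powr p * v x)"
      proof (intro ennreal_leI mult_right_mono powr_mono2)
        show "A S \<le> M x" unfolding M_def using F(1) S E(3) by (intro Max_ge) auto
      qed (use A0 p v0 in auto)
      finally show ?thesis .
    next
      case False
      then have "(\<Sum>S\<in>F. ennreal (A S powr p) * (ennreal (v x) * indicator (E S) x)) = 0" by (intro sum.neutral) auto
      then show ?thesis by (simp only: zero_le)
    qed
  qed
  finally show ?thesis using main unfolding A_def by simp
qed

text \<open>Layer cake in the coefficient \<open>c\<close>: the cubes with \<open>c Q > t\<close>
  lie in the maximal ones among them, where the packing condition bounds the sum of \<open>a\<close>
  by \<open>A\<close> times the mass of \<open>w\<close>. Integration in \<open>t\<close> and Fubini
  bring in \<open>\<Phi>\<close>.\<close>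

lemma Carleson_embedding:
  assumes w: "locally_integrable w" "\<And>x. 0 \<le> w x" and F: "finite F" "F \<subseteq> D"
    and c: "\<And>Q. 0 \<le> c Q"
    and A: "\<And>Q. Q \<in> F \<Longrightarrow> (\<Sum>P\<in>{P\<in>F. P \<subseteq> Q}. a P) \<le> A * wmass w Q"
    and Phi: "\<And>Q x. Q \<in> F \<Longrightarrow> x \<in> Q \<Longrightarrow> ennreal (c Q) \<le> \<Phi> x"
  shows "(\<Sum>Q\<in>F. ennreal (c Q) * a Q) \<le> A * (\<integral>\<^sup>+x. \<Phi> x * ennreal (w x) \<partial>lebesgue)"
proof -
  note [measurable] = locally_integrable_measurable[OF w(1)]
  interpret M: sigma_finite_measure "lebesgue :: (real^'n) measure" by (rule sigma_finite_lebesgue)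
  interpret P: pair_sigma_finite "lebesgue :: (real^'n) measure" "lborel :: real measure" ..
  let ?U = "\<lambda>t. \<Union>{Q\<in>F. t < c Q}"
  have fF: "F \<subseteq> sets lebesgue" using F(2) by auto
  have level: "(\<Sum>Q\<in>F. a Q * indicator {0..<c Q} t) \<le> A * (\<integral>\<^sup>+x. ennreal (w x) * indicator {0..} t * indicator (?U t) x \<partial>lebesgue)" for t :: real
  proof (cases "0 \<le> t")
    case True
    obtain T where T: "T \<subseteq> {Q\<in>F. t < c Q}" "disjoint T" "\<And>Q. Q \<in> {Q\<in>F. t < c Q} \<Longrightarrow> \<exists>P\<in>T. Q \<subseteq> P"
      by (rule maximal_cubes[of "{Q\<in>F. t < c Q}"]) (use F in auto)
    have TD: "T \<subseteq> D" "finite T" "T \<subseteq> F" using T(1) F by (auto intro: finite_subset)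
    have "(\<Sum>Q\<in>F. a Q * indicator {0..<c Q} t) = (\<Sum>Q\<in>{Q\<in>F. t < c Q}. a Q)"
      using F(1) True by (intro sum.mono_neutral_cong_right) (auto simp: indicator_def)
    also have "\<dots> \<le> (\<Sum>Q\<in>(\<Union>P\<in>T. {Q\<in>F. Q \<subseteq> P}). a Q)"
      using F(1) TD T(3) by (intro sum_mono2) auto
    also have "\<dots> = (\<Sum>P\<in>T. \<Sum>Q\<in>{Q\<in>F. Q \<subseteq> P}. a Q)"
    proof (rule sum.UNION_disjoint)
      show "\<forall>P\<in>T. \<forall>R\<in>T. P \<noteq> R \<longrightarrow> {Q\<in>F. Q \<subseteq> P} \<inter> {Q\<in>F. Q \<subseteq> R} = {}"
      proof (intro ballI impI)
        fix P R assume "P \<in> T" "R \<in> T" "P \<noteq> R"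
        then have "P \<inter> R = {}" using disjointD[OF T(2)] by blast
        then show "{Q\<in>F. Q \<subseteq> P} \<inter> {Q\<in>F. Q \<subseteq> R} = {}" using D_nonempty F(2) by blast
      qed
    qed (use F TD in auto)
    also have "\<dots> \<le> (\<Sum>P\<in>T. A * wmass w P)"
      using TD by (intro sum_mono A) auto
    also have "\<dots> = A * (\<integral>\<^sup>+x. (\<Sum>P\<in>T. ennreal (w x) * indicator P x) \<partial>lebesgue)"
      unfolding wmass_def using TD by (subst nn_integral_sum) (auto simp: sum_distrib_left)
    also have "(\<lambda>x. \<Sum>P\<in>T. ennreal (w x) * indicator P x) = (\<lambda>x. ennreal (w x) * indicator {0..} t * indicator (?U t) x)"
    proof
      fix x
      have "indicator (\<Union>S\<in>T. S) x = (\<Sum>S\<in>T. indicator S x :: ennreal)"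
        by (rule indicator_UN_disjoint) (use TD T(2) in \<open>auto simp: disjoint_family_on_def disjoint_def\<close>)
      moreover have "\<Union>T = ?U t" using T by blast
      ultimately show "(\<Sum>P\<in>T. ennreal (w x) * indicator P x) = ennreal (w x) * indicator {0..} t * indicator (?U t) x"
        using True by (simp add: sum_distrib_left[symmetric])
    qed
    finally show ?thesis .
  qed simp
  have "(\<Sum>Q\<in>F. ennreal (c Q) * a Q) = (\<Sum>Q\<in>F. \<integral>\<^sup>+t. a Q * indicator {0..<c Q} t \<partial>lborel)"
    using c by (intro sum.cong refl) (simp add: nn_integral_cmult mult.commute)
  also have "\<dots> = (\<integral>\<^sup>+t. (\<Sum>Q\<in>F. a Q * indicator {0..<c Q} t) \<partial>lborel)"
    by (subst nn_integral_sum) auto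
  also have "\<dots> \<le> (\<integral>\<^sup>+t. A * (\<integral>\<^sup>+x. ennreal (w x) * indicator {0..} t * indicator (?U t) x \<partial>lebesgue) \<partial>lborel)"
    by (intro nn_integral_mono level)
  also have "(\<lambda>t x. ennreal (w x) * indicator {0..} t * indicator (?U t) x)
      = (\<lambda>t x. ennreal (w x) * indicator {0..} t * indicator {x. \<exists>Q\<in>F. x \<in> Q \<and> t < c Q} x)"
    by (intro ext) (auto simp: indicator_def)
  also have "(\<integral>\<^sup>+t. A * (\<integral>\<^sup>+x. ennreal (w x) * indicator {0..} t * indicator {x. \<exists>Q\<in>F. x \<in> Q \<and> t < c Q} x \<partial>lebesgue) \<partial>lborel)
    = A * (\<integral>\<^sup>+t. (\<integral>\<^sup>+x. ennreal (w x) * indicator {0..} t * indicator {x. \<exists>Q\<in>F. x \<in> Q \<and> t < c Q} x \<partial>lebesgue) \<partial>lborel)"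
    using F fF by (intro nn_integral_cmult) (measurable, auto)
  also have "(\<integral>\<^sup>+t. (\<integral>\<^sup>+x. ennreal (w x) * indicator {0..} t * indicator {x. \<exists>Q\<in>F. x \<in> Q \<and> t < c Q} x \<partial>lebesgue) \<partial>lborel)
     = (\<integral>\<^sup>+x. (\<integral>\<^sup>+t. ennreal (w x) * indicator {0..} t * indicator {x. \<exists>Q\<in>F. x \<in> Q \<and> t < c Q} x \<partial>lborel) \<partial>lebesgue)"
    using F fF by (intro P.Fubini') (measurable, auto)
  also have "\<dots> \<le> (\<integral>\<^sup>+x. \<Phi> x * ennreal (w x) \<partial>lebesgue)"
  proof (intro nn_integral_mono)
    fix x
    show "(\<integral>\<^sup>+t. ennreal (w x) * indicator {0..} t * indicator {x. \<exists>Q\<in>F. x \<in> Q \<and> t < c Q} x \<partial>lborel) \<le> \<Phi> x * ennreal (w x)"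
    proof (cases "\<Phi> x")
      case (real y)
      have "(\<integral>\<^sup>+t. ennreal (w x) * indicator {0..} t * indicator {x. \<exists>Q\<in>F. x \<in> Q \<and> t < c Q} x \<partial>lborel)
        \<le> (\<integral>\<^sup>+t. ennreal (w x) * indicator {0..y} t \<partial>lborel)"
      proof (intro nn_integral_mono)
        fix t
        have "t \<le> y" if "Q \<in> F" "x \<in> Q" "t < c Q" for Q
          using Phi[OF that(1,2)] real that(3) by simp
        then show "ennreal (w x) * indicator {0..} t * indicator {x. \<exists>Q\<in>F. x \<in> Q \<and> t < c Q} x \<le> ennreal (w x) * indicator {0..y} t"
          by (auto simp: indicator_def)
      qed
      also have "\<dots> = \<Phi> x * ennreal (w x)"
        using real by (simp add: nn_integral_cmult mult.commute)
      finally show ?thesis .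
    next
      case top
      show ?thesis
        using top by (cases "w x = 0") (use w(2)[of x] in \<open>auto simp: ennreal_top_mult\<close>)
    qed
  qed
  finally show ?thesis by (simp add: mult_left_mono)
qed

end

section \<open>Weighted estimates for sparse families\<close>

text \<open>The p-th power of the weighted norm; roots are taken only after the absorption
  arguments.\<close>

definition Lp_int :: "real \<Rightarrow> (real^'n \<Rightarrow> real) \<Rightarrow> (real^'n \<Rightarrow> 'k::real_normed_vector) \<Rightarrow> ennreal" where
  "Lp_int p w f = (\<integral>\<^sup>+x. ennreal (norm (f x) powr p * w x) \<partial>lebesgue)"

lemma wLp_norm_eq:
  "wLp_norm p w (\<lambda>x. ennreal (norm (f x))) = ennpowr (Lp_int p w f) (1 / p)"
  by (simp add: wLp_norm_def Lp_int_def ennreal_mult')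

context dyadic
begin

text \<open>For \<open>w \<in> A\<^sub>p\<close> this is used with \<open>u = w\<close>, \<open>v\<close> the dual weight and \<open>B\<close> the power \<open>1 / p\<close> of the
  \<open>A\<^sub>p\<close> characteristic: the condition is then symmetric in \<open>(p, u)\<close> and \<open>(p', v)\<close>.\<close>

definition Apair :: "real \<Rightarrow> (real^'n \<Rightarrow> real) \<Rightarrow> (real^'n \<Rightarrow> real) \<Rightarrow> real \<Rightarrow> bool" where
  "Apair p u v B \<longleftrightarrow> 1 < p \<and> locally_integrable u \<and> locally_integrable v \<and> (\<forall>x. 0 < u x) \<and> (\<forall>x. 0 < v x) \<and>
     (\<forall>x. u x powr (1 / p) * v x powr (1 - 1 / p) = 1) \<and> 0 < B \<and>
     (\<forall>Q\<in>D. wt u Q powr (1 / p) * wt v Q powr (1 - 1 / p) \<le> B * mea Q)"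

lemma ApairD:
  assumes "Apair p u v B"
  shows "1 < p" "locally_integrable u" "locally_integrable v" "\<And>x. 0 < u x" "\<And>x. 0 < v x"
    "\<And>x. 0 \<le> u x" "\<And>x. 0 \<le> v x"
    "\<And>x. u x powr (1 / p) * v x powr (1 - 1 / p) = 1" "0 < B"
    "\<And>Q. Q \<in> D \<Longrightarrow> wt u Q powr (1 / p) * wt v Q powr (1 - 1 / p) \<le> B * mea Q"
  using assms by (auto simp: Apair_def less_imp_le)

lemma Apair_swap: "Apair p u v B \<Longrightarrow> Apair (p / (p - 1)) v u B"
proof -
  assume a: "Apair p u v B"
  then have p: "1 < p" by (rule ApairD)
  have "1 / (p / (p - 1)) = 1 - 1 / p" "1 - 1 / (p / (p - 1)) = 1 / p" "1 < p / (p - 1)"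
    using p by (auto simp: field_simps)
  then show ?thesis using ApairD[OF a] unfolding Apair_def by (simp add: mult.commute)
qed

text \<open>Hoelder for the factorisation of 1 into powers of \<open>u\<close> and \<open>v\<close>:
  a converse to the defining inequality of \<open>Apair\<close>, valid on all bounded measurable
  sets.\<close>

lemma Apair_mea_le:
  assumes "Apair p u v B" and E: "E \<in> sets lebesgue" "bounded E"
  shows "mea E \<le> wt u E powr (1 / p) * wt v E powr (1 - 1 / p)"
proof -
  note a = ApairD[OF assms(1)]
  have "E \<in> lmeasurable" using E by (intro bounded_set_imp_lmeasurable)
  then have "mea E = wt (\<lambda>x. 1) E" by (simp add: set_integral_const_fmeasurable)
  also have "\<dots> \<le> wt u E powr (1 / p) * wt v E powr (1 - 1 / p)"
    by (rule wt_Holder) (use a E in \<open>auto intro: locally_integrable_const\<close>)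
  finally show ?thesis .
qed

text \<open>The A_p inequality on \<open>S\<close>, Hoelder on \<open>E\<close> and monotonicity of
  the \<open>u\<close>-mass let that mass cancel. What remains compares the powers
  \<open>1 - 1 / p\<close> of the two \<open>v\<close>-masses.\<close>

lemma Apair_sparse_mass:
  assumes A: "Apair p u v B" and S: "S \<in> D" and E: "E \<in> sets lebesgue" "E \<subseteq> S" "mea S \<le> 2 * mea E"
  shows "wt v S \<le> (2 * B) powr (p / (p - 1)) * wt v E"
proof -
  note a = ApairD[OF A]
  have bE: "bounded E" using D_bounded[OF S] E(2) bounded_subset by blast
  let ?a = "1 / p" and ?b = "1 - 1 / p"
  have b: "0 < ?b" using a(1) by simp
  have uS: "0 < wt u S" by (rule wt_pos_D) (use a S in auto)
  have "wt u S powr ?a * wt v S powr ?b \<le> B * mea S" by (rule a(10)[OF S])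
  also have "\<dots> \<le> B * (2 * (wt u E powr ?a * wt v E powr ?b))"
    using Apair_mea_le[OF A E(1) bE] E(3) a(9) by (intro mult_left_mono) auto
  also have "\<dots> \<le> B * (2 * (wt u S powr ?a * wt v E powr ?b))"
    using a E bE S by (intro mult_left_mono mult_right_mono powr_mono2 wt_mono wt_nonneg) (auto simp: D_bounded)
  finally have "wt u S powr ?a * wt v S powr ?b \<le> wt u S powr ?a * (2 * B * wt v E powr ?b)"
    by (simp add: mult_ac)
  then have "wt v S powr ?b \<le> 2 * B * wt v E powr ?b" using uS by simp
  then have "(wt v S powr ?b) powr (1 / ?b) \<le> (2 * B * wt v E powr ?b) powr (1 / ?b)"
    using b by (intro powr_mono2) auto
  moreover have inv: "(x powr ?b) powr (1 / ?b) = x" if "0 \<le> x" for x :: real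
  proof -
    have "?b * (1 / ?b) = 1" using b by (metis less_irrefl nonzero_mult_div_cancel_left times_divide_eq_right mult.right_neutral)
    then show ?thesis using that by (simp only: powr_powr powr_one)
  qed
  ultimately have "wt v S \<le> (2 * B) powr (1 / ?b) * wt v E"
    using a(7) by (simp only: powr_mult inv wt_nonneg)
  moreover have "1 / ?b = p / (p - 1)" using a(1) by (simp add: field_simps)
  ultimately show ?thesis by simp
qed

text \<open>Relative to the dual weight \<open>v\<close>, averages of \<open>norm (f x)\<close>
  become weighted averages of \<open>h\<close>. The A_p inequality gives \<open>B powr p\<close>,
  \<open>Apair_sparse_mass\<close> moves the mass of \<open>v\<close> to the disjoint sets, and
  Doob's inequality for \<open>v\<close> finishes.\<close>

lemma sparse_embedding:
  assumes A: "Apair p u v B" and f: "locally_integrable f" and F: "finite F" "sparse F"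
  shows "ennreal (\<Sum>S\<in>F. avgn S f powr p * wt u S)
    \<le> ennreal (B powr p * (2 * B) powr (p / (p - 1)) * (p / (p - 1)) powr p) * Lp_int p u f"
proof -
  note a = ApairD[OF A]
  obtain E where E: "disjoint_family_on E F" "\<And>S. S \<in> F \<Longrightarrow> E S \<in> sets lebesgue"
      "\<And>S. S \<in> F \<Longrightarrow> E S \<subseteq> S" "\<And>S. S \<in> F \<Longrightarrow> mea S \<le> 2 * mea (E S)" and FD: "F \<subseteq> D"
    using F(2) unfolding sparse_def by blast
  define h where "h x = norm (f x) / v x" for x
  have hv: "(\<lambda>x. h x * v x) = (\<lambda>x. norm (f x))"
    using a(5) by (auto simp: h_def less_imp_neq[symmetric])
  have [measurable]: "f \<in> borel_measurable lebesgue" "v \<in> borel_measurable lebesgue"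
    using f a by (auto intro: locally_integrable_measurable)
  have hm: "h \<in> borel_measurable lebesgue" unfolding h_def by measurable
  let ?K = "(2 * B) powr (p / (p - 1))"
  have 1: "avgn S f powr p * wt u S \<le> B powr p * ?K * ((wt (\<lambda>x. h x * v x) S / wt v S) powr p * wt v (E S))"
    if S: "S \<in> F" for S
  proof -
    have SD: "S \<in> D" using S FD by auto
    have vS: "0 < wt v S" and uS: "0 < wt u S" and mS: "0 < mea S"
      using a SD wt_pos_D D_measure_pos by auto
    have "wt u S * wt v S powr (p - 1) = (wt u S powr (1 / p) * wt v S powr (1 - 1 / p)) powr p"
    proof -
      have "(1 - 1 / p) * p = p - 1" using a(1) by (simp add: field_simps)
      then show ?thesis using a(1) uS vS by (simp add: powr_mult powr_powr)
    qed
    also have "\<dots> \<le> (B * mea S) powr p"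
      using a(1) by (intro powr_mono2 a(10)[OF SD]) auto
    finally have "wt u S * wt v S powr (p - 1) \<le> B powr p * mea S powr p"
      using a(9) by (simp add: powr_mult)
    then have "(avgn S f * mea S) powr p * (wt u S * wt v S powr (p - 1)) \<le> (avgn S f * mea S) powr p * (B powr p * mea S powr p)"
      by (intro mult_left_mono) auto
    then have "avgn S f powr p * wt u S * (mea S powr p * wt v S powr (p - 1))
       \<le> B powr p * ((avgn S f * mea S) powr p) * mea S powr p"
      by (simp add: powr_mult mult_ac)
    then have "avgn S f powr p * wt u S * wt v S powr (p - 1) \<le> B powr p * ((avgn S f * mea S) powr p)"
      using mS by (simp add: mult_ac)
    then have "avgn S f powr p * wt u S \<le> B powr p * ((avgn S f * mea S) powr p) / wt v S powr (p - 1)"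
      using vS by (simp add: pos_le_divide_eq)
    also have "\<dots> = B powr p * ((mea S * avgn S f / wt v S) powr p * wt v S)"
      using vS by (simp add: powr_divide powr_diff mult_ac)
    also have "mea S * avgn S f = wt (\<lambda>x. h x * v x) S"
      unfolding hv avgn_integral[OF SD] ..
    also have "B powr p * ((wt (\<lambda>x. h x * v x) S / wt v S) powr p * wt v S)
       \<le> B powr p * ((wt (\<lambda>x. h x * v x) S / wt v S) powr p * (?K * wt v (E S)))"
      using Apair_sparse_mass[OF A SD E(2-4)[OF S]] by (intro mult_left_mono) auto
    finally show ?thesis by (simp add: mult_ac)
  qed
  have "ennreal (\<Sum>S\<in>F. avgn S f powr p * wt u S)
    \<le> ennreal (B powr p * ?K * (\<Sum>S\<in>F. (wt (\<lambda>x. h x * v x) S / wt v S) powr p * wt v (E S)))"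
    unfolding sum_distrib_left by (intro ennreal_leI sum_mono 1)
  also have "\<dots> \<le> ennreal (B powr p * ?K) * (ennreal ((p / (p - 1)) powr p) * (\<integral>\<^sup>+x. ennreal (h x powr p * v x) \<partial>lebesgue))"
  proof -
    have "ennreal (\<Sum>S\<in>F. (wt (\<lambda>x. h x * v x) S / wt v S) powr p * wt v (E S))
      \<le> ennreal ((p / (p - 1)) powr p) * (\<integral>\<^sup>+x. ennreal (h x powr p * v x) \<partial>lebesgue)"
    proof (rule Doob_dyadic[OF a(3,5) _ _ hm F(1) FD a(1) E(1-3)])
      show "locally_integrable (\<lambda>x. h x * v x)" unfolding hv by (rule locally_integrable_norm[OF f])
      show "\<And>x. 0 \<le> h x" unfolding h_def using a(7) by simp
    qed
    then show ?thesis
      using a(7) by (subst ennreal_mult) (auto intro!: mult_left_mono sum_nonneg mult_nonneg_nonneg wt_nonneg)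
  qed
  also have "(\<integral>\<^sup>+x. ennreal (h x powr p * v x) \<partial>lebesgue) = Lp_int p u f"
    unfolding Lp_int_def
  proof (intro nn_integral_cong arg_cong[of _ _ ennreal])
    fix x
    have uv: "0 < u x" "0 < v x" by (rule a)+
    \<comment> \<open>Duality says that \<open>u x\<close> is \<open>v x powr (1 - p)\<close>, which
      makes the L^p(v) norm of \<open>h\<close> the L^p(u) norm of \<open>f\<close>.\<close>
    have "u x * v x powr (p - 1) = (u x powr (1 / p) * v x powr (1 - 1 / p)) powr p"
    proof -
      have "(1 - 1 / p) * p = p - 1" using a(1) by (simp add: field_simps)
      then show ?thesis using a(1) uv by (simp add: powr_mult powr_powr)
    qed
    then have "u x * v x powr (p - 1) = 1" unfolding a(8) by simp
    then have "u x * (v x powr p / v x) = 1" using uv by (simp add: powr_diff)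
    then have "u x = v x / v x powr p" using uv by (simp add: field_simps)
    then show "h x powr p * v x = norm (f x) powr p * u x"
      unfolding h_def using uv by (simp add: powr_divide)
  qed
  finally show ?thesis using a(9) by (simp add: ennreal_mult mult.assoc)
qed

text \<open>The characteristic is at least 1 by Hoelder on any one cube; this makes the constant of
  \<open>Apair\<close> positive and later excludes a product of zero and infinity.\<close>

lemma Ap_weight_Apair:
  assumes w: "Ap_weight D p w" and p: "1 < p"
  shows "Apair p w (\<lambda>x. w x powr (- 1 / (p - 1))) (enn2real (Ap_char D p w) powr (1 / p))"
    and "1 \<le> Ap_char D p w"
proof -
  let ?v = "\<lambda>x. w x powr (- 1 / (p - 1))"
  let ?a = "enn2real (Ap_char D p w)"
  have wt: "locally_integrable w" "\<And>x. 0 < w x" "Ap_char D p w < \<infinity>"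
    using w by (auto simp: Ap_weight_def weight_def)
  have w0: "\<And>x. 0 \<le> w x" using wt(2) less_imp_le by blast
  note [measurable] = locally_integrable_measurable[OF wt(1)]
  have ex: "- conj_exp p / p = - 1 / (p - 1)" "p / conj_exp p = p - 1"
    using p by (auto simp: conj_exp_def field_simps)
  have v0: "\<And>x. 0 < ?v x" using wt(2) by (simp add: less_imp_neq[symmetric])
  have av: "nn_average Q (\<lambda>x. ennreal (w x)) = ennreal (wt w Q / mea Q)" if "Q \<in> D" for Q
    unfolding nn_average_def D_emeasure[OF that] using that D_measure_pos[OF that] wt w0
    by (simp add: nn_integral_wt D_bounded divide_ennreal wt_nonneg)
  have le: "ennreal (wt w Q / mea Q) * ennpowr (nn_average Q (\<lambda>x. ennreal (?v x))) (p - 1) \<le> Ap_char D p w"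
    if "Q \<in> D" for Q
    unfolding Ap_char_def ex av[OF that, symmetric] by (rule SUP_upper[OF that])
  \<comment> \<open>Integrability of the dual weight has to be derived: an infinite average,
    multiplied by the positive average of \<open>w\<close>, would make the characteristic
    infinite.\<close>
  have fin: "(\<integral>\<^sup>+x. ennreal (?v x) * indicator Q x \<partial>lebesgue) < \<infinity>" if Q: "Q \<in> D" for Q
  proof (rule ccontr)
    assume "\<not> ?thesis"
    then have "(\<integral>\<^sup>+x. ennreal (?v x) * indicator Q x \<partial>lebesgue) = top" by (metis infinity_ennreal_def less_top)
    then have "nn_average Q (\<lambda>x. ennreal (?v x)) = top"
      unfolding nn_average_def D_emeasure[OF Q] by (simp add: ennreal_top_divide)
    moreover have "ennreal (wt w Q / mea Q) \<noteq> 0"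
      using wt_pos_D[OF wt(1,2) Q] D_measure_pos[OF Q] by (simp add: ennreal_eq_0_iff not_le)
    then have "ennreal (wt w Q / mea Q) * top = top" by (simp only: ennreal_mult_top if_False)
    ultimately have "Ap_char D p w = top" using le[OF Q] by (simp only: ennpowr_top top_unique)
    then show False using wt(3) by simp
  qed
  have lv: "locally_integrable ?v"
    unfolding locally_integrable_def
  proof (intro allI impI)
    fix K :: "(real^'n) set" assume K: "compact K"
    let ?T = "{Q \<in> Dk 0. Q \<inter> K \<noteq> {}}"
    have fT: "finite ?T" by (rule finite_Dk_meets) (use K compact_imp_bounded in auto)
    have KT: "K \<subseteq> (\<Union>Q\<in>?T. Q)" 
    proof
      fix x assume "x \<in> K"
      moreover obtain Q where "Q \<in> Dk 0" "x \<in> Q" using Dk_cover by blast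
      ultimately show "x \<in> (\<Union>Q\<in>?T. Q)" by auto
    qed
    have "set_integrable lebesgue (\<Union>Q\<in>?T. Q) ?v"
    proof (rule set_integrable_UN[OF fT])
      fix Q assume "Q \<in> ?T"
      then have Q: "Q \<in> D" using Dk_D by auto
      show "Q \<in> sets lebesgue" using Q by simp
      show "set_integrable lebesgue Q ?v" unfolding set_integrable_def
      proof (rule integrableI_bounded)
        show "(\<lambda>x. indicator Q x *\<^sub>R ?v x) \<in> borel_measurable lebesgue" using Q by measurable
        have "(\<integral>\<^sup>+x. ennreal (norm (indicator Q x *\<^sub>R ?v x)) \<partial>lebesgue) = (\<integral>\<^sup>+x. ennreal (?v x) * indicator Q x \<partial>lebesgue)"
          by (intro nn_integral_cong) (auto simp: indicator_def)
        then show "(\<integral>\<^sup>+x. ennreal (norm (indicator Q x *\<^sub>R ?v x)) \<partial>lebesgue) < \<infinity>" using fin[OF Q] by simp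
      qed
    qed
    then show "set_integrable lebesgue K ?v"
      by (rule set_integrable_subset) (use K KT in \<open>auto simp: lmeasurable_compact fmeasurableD\<close>)
  qed
  have "?a \<ge> 0" by simp
  have one: "w x powr (1 / p) * ?v x powr (1 - 1 / p) = 1" for x
  proof -
    have "- 1 / (p - 1) * (1 - 1 / p) = - (1 / p)" using p by (simp add: field_simps)
    then show ?thesis using wt(2)[of x] by (simp add: powr_powr powr_add[symmetric])
  qed
  have main: "wt w Q powr (1 / p) * wt ?v Q powr (1 - 1 / p) \<le> ?a powr (1 / p) * mea Q" if Q: "Q \<in> D" for Q
  proof -
    have pos: "0 < wt w Q" "0 < wt ?v Q" "0 < mea Q"
      using wt_pos_D[OF wt(1,2) Q] wt_pos_D[OF lv v0 Q] D_measure_pos[OF Q] by auto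
    have "nn_average Q (\<lambda>x. ennreal (?v x)) = ennreal (wt ?v Q / mea Q)"
      unfolding nn_average_def D_emeasure[OF Q] using Q pos(3) nn_integral_wt[OF lv less_imp_le[OF v0]]
      by (simp add: D_bounded divide_ennreal wt_nonneg)
    then have "ennreal (wt w Q / mea Q * (wt ?v Q / mea Q) powr (p - 1)) \<le> Ap_char D p w"
      using le[OF Q] pos by (subst ennreal_mult) (auto simp: less_imp_le)
    also have "Ap_char D p w = ennreal ?a" using wt(3) by simp
    finally have "wt w Q / mea Q * (wt ?v Q / mea Q) powr (p - 1) \<le> ?a" by simp
    then have "(wt w Q / mea Q * (wt ?v Q / mea Q) powr (p - 1)) powr (1 / p) \<le> ?a powr (1 / p)"
      using p pos by (intro powr_mono2) auto
    also have "(wt w Q / mea Q * (wt ?v Q / mea Q) powr (p - 1)) powr (1 / p)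
      = (wt w Q / mea Q) powr (1 / p) * (wt ?v Q / mea Q) powr ((p - 1) * (1 / p))"
      by (simp only: powr_mult powr_powr)
    also have "(p - 1) * (1 / p) = 1 - 1 / p" using p by (simp add: field_simps)
    also have "(wt w Q / mea Q) powr (1 / p) * (wt ?v Q / mea Q) powr (1 - 1 / p)
      = wt w Q powr (1 / p) * wt ?v Q powr (1 - 1 / p) / (mea Q powr (1 / p) * mea Q powr (1 - 1 / p))"
      using pos by (simp add: powr_divide)
    also have "mea Q powr (1 / p) * mea Q powr (1 - 1 / p) = mea Q"
      using pos by (simp add: powr_add[symmetric])
    finally show ?thesis using pos by (simp add: pos_divide_le_eq)
  qed
  obtain Q where Q: "Q \<in> D" using Dk_cover Dk_D by blast
  have pos: "0 < mea Q" using D_measure_pos[OF Q] .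
  have "wt (\<lambda>x. 1) Q \<le> wt w Q powr (1 / p) * wt ?v Q powr (1 - 1 / p)"
    by (rule wt_Holder) (use wt w0 lv v0 one p Q in \<open>auto intro: locally_integrable_const simp: D_bounded less_imp_le\<close>)
  also have "\<dots> \<le> ?a powr (1 / p) * mea Q" by (rule main[OF Q])
  finally have "mea Q \<le> ?a powr (1 / p) * mea Q"
    using D_lmeasurable[OF Q] by (simp add: set_integral_const_fmeasurable)
  then have B1: "1 \<le> ?a powr (1 / p)" using pos by simp
  then show "Apair p w ?v (?a powr (1 / p))"
    unfolding Apair_def using p wt(1,2) lv v0 one main by auto
  have "1 powr p \<le> (?a powr (1 / p)) powr p" using B1 p by (intro powr_mono2) auto
  then have "1 \<le> ?a" using p by (simp add: powr_powr)
  then have "ennreal 1 \<le> ennreal ?a" by (rule ennreal_leI)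
  then show "1 \<le> Ap_char D p w" using wt(3) by (metis ennreal_1 ennreal_enn2real infinity_ennreal_def)
qed

end

text \<open>\<open>\<kappa>\<close> is the weight lambda of the theorem; \<open>\<omega>\<close> and
  \<open>\<sigma>\<close> are the dual weights of \<open>\<mu>\<close> and \<open>\<kappa>\<close>.
  \<open>Bm\<close> and \<open>Bk\<close> will be the roots of order \<open>p\<close> and
  \<open>q\<close> of the two characteristics, and \<open>s\<close> equals 1 + \<alpha>/d.\<close>

locale bloom = dyadic D Dk for D :: "(real^'n) set set" and Dk +
  fixes p q s :: real and \<mu> \<omega> \<kappa> \<sigma> \<nu> :: "real^'n \<Rightarrow> real" and Bm Bk :: real
  assumes Am: "Apair p \<mu> \<omega> Bm" and Ak: "Apair q \<kappa> \<sigma> Bk"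
    and nu_pos: "\<And>x. 0 < \<nu> x"
    and s_eq: "s = 1 / p + (1 - 1 / q)"
    and nu_eq: "\<And>x. \<nu> x powr s = \<mu> x powr (1 / p) * \<kappa> x powr (- 1 / q)"
begin

lemmas mu_pair = ApairD[OF Am] and kappa_pair = ApairD[OF Ak]

lemma p1: "1 < p" and q1: "1 < q"
  using mu_pair(1) kappa_pair(1) by auto

lemma s_pos: "0 < s"
proof -
  have "0 < 1 / p" "0 < 1 - 1 / q" using p1 q1 by auto
  then show ?thesis unfolding s_eq by linarith
qed

lemma nu_s: "\<nu> x powr s = \<mu> x powr (1 / p) * \<sigma> x powr (1 - 1 / q)"
proof -
  have "\<kappa> x powr (1 / q) * (\<sigma> x powr (1 - 1 / q)) = 1" by (rule kappa_pair(8))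
  then have "\<sigma> x powr (1 - 1 / q) = \<kappa> x powr (- 1 / q)"
    using kappa_pair(4)[of x] by (simp add: powr_minus_divide field_simps)
  then show ?thesis by (simp add: nu_eq)
qed

text \<open>The exponent for which \<open>\<nu>\<close> is the geometric mean of
  \<open>\<mu>\<close> and \<open>\<sigma>\<close> with weights \<open>\<theta>\<close> and
  \<open>1 - \<theta>\<close>.\<close>

definition "\<theta> = 1 / (p * s)"

lemma theta: "0 < \<theta>" "\<theta> < 1" "\<theta> * s = 1 / p" "(1 - \<theta>) * s = 1 - 1 / q"
proof -
  show 1: "0 < \<theta>" using p1 s_pos by (simp add: \<theta>_def)
  show 2: "\<theta> * s = 1 / p" using s_pos by (simp add: \<theta>_def)
  then show 3: "(1 - \<theta>) * s = 1 - 1 / q" by (simp add: left_diff_distrib s_eq)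
  have "0 < (1 - \<theta>) * s" unfolding 3 using q1 by simp
  then show "\<theta> < 1" using s_pos by (simp add: zero_less_mult_iff)
qed

lemma nu_theta: "\<nu> x = \<mu> x powr \<theta> * \<sigma> x powr (1 - \<theta>)"
proof -
  have "\<nu> x = (\<nu> x powr s) powr (1 / s)" using nu_pos[of x] s_pos by (simp add: powr_powr)
  also have "\<dots> = \<mu> x powr (1 / p / s) * \<sigma> x powr ((1 - 1 / q) / s)"
    unfolding nu_s by (simp add: powr_mult powr_powr)
  finally show ?thesis using theta(3,4)[symmetric] s_pos by simp
qed

text \<open>By Young's inequality the geometric mean is at most the sum of its two weights.\<close>

lemma nu_li: "locally_integrable \<nu>"
proof (rule locally_integrableI_bounded)
  have [measurable]: "\<mu> \<in> borel_measurable lebesgue" "\<sigma> \<in> borel_measurable lebesgue"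
    using mu_pair kappa_pair by (auto intro: locally_integrable_measurable)
  have "\<nu> = (\<lambda>x. \<mu> x powr \<theta> * \<sigma> x powr (1 - \<theta>))" using nu_theta by auto
  then show "\<nu> \<in> borel_measurable lebesgue" by simp
  show "locally_integrable (\<lambda>x. \<mu> x + \<sigma> x)" using mu_pair kappa_pair by (auto intro: locally_integrable_add)
  fix x
  have "\<nu> x \<le> \<theta> * \<mu> x + (1 - \<theta>) * \<sigma> x"
    unfolding nu_theta using theta mu_pair(6) kappa_pair(7) by (intro Young_powr) auto
  also have "\<dots> \<le> 1 * \<mu> x + 1 * \<sigma> x"
    using theta mu_pair(6)[of x] kappa_pair(7)[of x] by (intro add_mono mult_right_mono) auto
  finally show "norm (\<nu> x) \<le> 1 * norm (\<mu> x + \<sigma> x)"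
    using nu_pos[of x] mu_pair(6)[of x] kappa_pair(7)[of x] by simp
qed

lemma nu_nonneg: "0 \<le> \<nu> x"
  using nu_pos[of x] by simp

text \<open>Hoelder for the geometric mean. On cubes \<open>wt_reverse\<close> gives the opposite
  inequality up to the A_p constants.\<close>

lemma wt_nu_s:
  assumes "E \<in> sets lebesgue" "bounded E"
  shows "wt \<nu> E powr s \<le> wt \<mu> E powr (1 / p) * wt \<sigma> E powr (1 - 1 / q)"
proof -
  have "wt \<nu> E \<le> wt \<mu> E powr \<theta> * wt \<sigma> E powr (1 - \<theta>)"
    by (rule wt_Holder[OF mu_pair(2,6) kappa_pair(3,7) nu_li nu_nonneg assms theta(1,2) nu_theta])
  then have "wt \<nu> E powr s \<le> (wt \<mu> E powr \<theta> * wt \<sigma> E powr (1 - \<theta>)) powr s"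
    using s_pos nu_nonneg by (intro powr_mono2 wt_nonneg) auto
  also have "\<dots> = wt \<mu> E powr (1 / p) * wt \<sigma> E powr (1 - 1 / q)"
    by (simp add: powr_mult powr_powr theta)
  finally show ?thesis .
qed

lemma wmass_nu: "Q \<in> D \<Longrightarrow> wmass \<nu> Q = ennreal (wt \<nu> Q)"
  unfolding wmass_def by (rule nn_integral_wt) (auto intro: nu_li nu_nonneg simp: D_bounded)

lemma wt_nu_pos: "Q \<in> D \<Longrightarrow> 0 < wt \<nu> Q"
  by (rule wt_pos_D[OF nu_li nu_pos])

text \<open>The interface between the size of \<open>b\<close> and the rest of the upper bound: both
  cases, \<open>p \<le> q\<close> and \<open>p > q\<close>, enter through it alone.\<close>

definition form_bound :: "real \<Rightarrow> (real^'n \<Rightarrow> complex) \<Rightarrow> bool" where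
  "form_bound N b \<longleftrightarrow> 0 \<le> N \<and> (\<forall>f g F. locally_integrable f \<longrightarrow> locally_integrable g \<longrightarrow> finite F \<longrightarrow> sparse F \<longrightarrow>
     (\<Sum>S\<in>F. avgn S f * osc S b * avgn S g * mea S)
       \<le> N * ((\<Sum>S\<in>F. avgn S f powr p * wt \<mu> S) powr (1 / p)
           * (\<Sum>S\<in>F. avgn S g powr (q / (q - 1)) * wt \<sigma> S) powr (1 - 1 / q)))"

definition "q' = q / (q - 1)"

lemma q': "1 / q' = 1 - 1 / q" "1 < q'" "q' * (1 - 1 / q) = 1"
  using q1 by (auto simp: q'_def field_simps)

lemma weight_product_split:
  assumes "S \<in> D"
  shows "avgn S f * avgn S g * wt \<nu> S powr s
    \<le> (avgn S f powr p * wt \<mu> S) powr (1 / p) * (avgn S g powr q' * wt \<sigma> S) powr (1 - 1 / q)"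
proof -
  have "avgn S f * avgn S g * wt \<nu> S powr s \<le> avgn S f * avgn S g * (wt \<mu> S powr (1 / p) * wt \<sigma> S powr (1 - 1 / q))"
    using assms by (intro mult_left_mono wt_nu_s) (auto simp: D_bounded)
  also have "\<dots> = (avgn S f powr p * wt \<mu> S) powr (1 / p) * (avgn S g powr q' * wt \<sigma> S) powr (1 - 1 / q)"
    using p1 by (simp add: powr_mult powr_powr q')
  finally show ?thesis .
qed

text \<open>Here \<open>s \<ge> 1\<close>, so the two sums obey the superadditive form of Hoelder's
  inequality and \<open>b\<close> contributes only a supremum.\<close>

lemma form_bound_bmo:
  assumes "p \<le> q" "0 \<le> N" and N: "\<And>Q. Q \<in> D \<Longrightarrow> mea Q * osc Q b \<le> N * wt \<nu> Q powr s"
  shows "form_bound N b"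
  unfolding form_bound_def q'_def[symmetric]
proof (intro conjI allI impI)
  fix f g :: "real^'n \<Rightarrow> complex" and F assume f: "locally_integrable f" and g: "locally_integrable g" and F: "finite F" "sparse F"
  have FD: "F \<subseteq> D" using F by (simp add: sparse_def)
  have s1: "1 \<le> 1 / p + (1 - 1 / q)" using assms(1) p1 by (simp add: frac_le)
  have "(\<Sum>S\<in>F. avgn S f * osc S b * avgn S g * mea S) = (\<Sum>S\<in>F. avgn S f * avgn S g * (mea S * osc S b))"
    by (simp add: mult_ac)
  also have "\<dots> \<le> (\<Sum>S\<in>F. avgn S f * avgn S g * (N * wt \<nu> S powr s))"
    using FD by (intro sum_mono mult_left_mono N) auto
  also have "\<dots> = N * (\<Sum>S\<in>F. avgn S f * avgn S g * wt \<nu> S powr s)"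
    by (simp add: sum_distrib_left mult_ac)
  also have "\<dots> \<le> N * (\<Sum>S\<in>F. (avgn S f powr p * wt \<mu> S) powr (1 / p) * (avgn S g powr q' * wt \<sigma> S) powr (1 - 1 / q))"
    using FD assms(2) by (intro sum_mono mult_left_mono weight_product_split) auto
  also have "\<dots> \<le> N * ((\<Sum>S\<in>F. avgn S f powr p * wt \<mu> S) powr (1 / p) * (\<Sum>S\<in>F. avgn S g powr q' * wt \<sigma> S) powr (1 - 1 / q))"
    using F assms(2) p1 q1 s1 mu_pair(6) kappa_pair(7)
    by (intro mult_left_mono sum_Holder_superadditive) (auto intro!: mult_nonneg_nonneg wt_nonneg)
  finally show "(\<Sum>S\<in>F. avgn S f * osc S b * avgn S g * mea S) \<le> N * ((\<Sum>S\<in>F. avgn S f powr p * wt \<mu> S) powr (1 / p) * (\<Sum>S\<in>F. avgn S g powr q' * wt \<sigma> S) powr (1 - 1 / q))" .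
qed (fact assms(2))

text \<open>The quotient whose supremum over the cubes around a point is
  \<open>sharp_maximal\<close>; as a real function of the cube it can be summed over sparse
  families.\<close>

definition sharp :: "(real^'n \<Rightarrow> complex) \<Rightarrow> (real^'n) set \<Rightarrow> real" where
  "sharp b Q = mea Q * osc Q b / wt \<nu> Q"

lemma sharp_nonneg: "0 \<le> sharp b Q"
  using nu_nonneg by (auto simp: sharp_def intro!: divide_nonneg_nonneg wt_nonneg)

text \<open>Here \<open>1 / r\<close>, \<open>1 / p\<close> and \<open>1 - 1 / q\<close> form an
  exact Hoelder triple. Writing the mass of \<open>\<nu>\<close> as the product of its powers
  \<open>1 / r\<close> and \<open>s\<close> splits each term into the three factors.\<close>

lemma form_bound_sharp:
  assumes r: "1 / r = 1 / q - 1 / p" "0 < r" and "0 \<le> N"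
    and N: "\<And>F. finite F \<Longrightarrow> sparse F \<Longrightarrow> (\<Sum>S\<in>F. sharp b S powr r * wt \<nu> S) powr (1 / r) \<le> N"
  shows "form_bound N b"
  unfolding form_bound_def q'_def[symmetric]
proof (intro conjI allI impI)
  fix f g :: "real^'n \<Rightarrow> complex" and F assume f: "locally_integrable f" and g: "locally_integrable g" and F: "finite F" "sparse F"
  have FD: "F \<subseteq> D" using F by (simp add: sparse_def)
  have s1: "1 / r + 1 / p + (1 - 1 / q) = 1" using r by simp
  have sr: "1 / r + s = 1" using s1 by (simp add: s_eq)
  have "(\<Sum>S\<in>F. avgn S f * osc S b * avgn S g * mea S)
     = (\<Sum>S\<in>F. (sharp b S powr r * wt \<nu> S) powr (1 / r) * (avgn S f * avgn S g * wt \<nu> S powr s))"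
  proof (intro sum.cong refl)
    fix S assume "S \<in> F"
    then have n: "0 < wt \<nu> S" using FD wt_nu_pos by auto
    have "(sharp b S powr r * wt \<nu> S) powr (1 / r) * (avgn S f * avgn S g * wt \<nu> S powr s)
       = sharp b S * (wt \<nu> S powr (1 / r) * wt \<nu> S powr s) * (avgn S f * avgn S g)"
    proof -
      have "(sharp b S powr r) powr (1 / r) = sharp b S"
        unfolding powr_powr using r(2) sharp_nonneg by simp
      then show ?thesis by (simp only: powr_mult mult_ac)
    qed
    also have "wt \<nu> S powr (1 / r) * wt \<nu> S powr s = wt \<nu> S"
      unfolding powr_add[symmetric] sr using n by simp
    also have "sharp b S * wt \<nu> S = mea S * osc S b" using n by (simp add: sharp_def)
    finally show "avgn S f * osc S b * avgn S g * mea S = (sharp b S powr r * wt \<nu> S) powr (1 / r) * (avgn S f * avgn S g * wt \<nu> S powr s)"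
      by (simp only: mult_ac)
  qed
  also have "\<dots> \<le> (\<Sum>S\<in>F. (sharp b S powr r * wt \<nu> S) powr (1 / r) * ((avgn S f powr p * wt \<mu> S) powr (1 / p) * (avgn S g powr q' * wt \<sigma> S) powr (1 - 1 / q)))"
    using FD by (intro sum_mono mult_left_mono weight_product_split) auto
  also have "\<dots> = (\<Sum>S\<in>F. (sharp b S powr r * wt \<nu> S) powr (1 / r) * (avgn S f powr p * wt \<mu> S) powr (1 / p) * (avgn S g powr q' * wt \<sigma> S) powr (1 - 1 / q))"
    by (simp add: mult_ac)
  also have "\<dots> \<le> (\<Sum>S\<in>F. sharp b S powr r * wt \<nu> S) powr (1 / r) * (\<Sum>S\<in>F. avgn S f powr p * wt \<mu> S) powr (1 / p) * (\<Sum>S\<in>F. avgn S g powr q' * wt \<sigma> S) powr (1 - 1 / q)"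
    using F r p1 q1 s1 mu_pair(6) kappa_pair(7) nu_nonneg
    by (intro sum_Holder3) (auto intro!: mult_nonneg_nonneg wt_nonneg)
  also have "\<dots> \<le> N * (\<Sum>S\<in>F. avgn S f powr p * wt \<mu> S) powr (1 / p) * (\<Sum>S\<in>F. avgn S g powr q' * wt \<sigma> S) powr (1 - 1 / q)"
    by (intro mult_right_mono N F) auto
  finally show "(\<Sum>S\<in>F. avgn S f * osc S b * avgn S g * mea S) \<le> N * ((\<Sum>S\<in>F. avgn S f powr p * wt \<mu> S) powr (1 / p) * (\<Sum>S\<in>F. avgn S g powr q' * wt \<sigma> S) powr (1 - 1 / q))"
    by (simp add: mult.assoc)
qed (fact assms(3))

lemma oscillation_eq: "locally_integrable b \<Longrightarrow> Q \<in> D \<Longrightarrow> oscillation b Q = ennreal (mea Q * osc Q b)"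
  unfolding oscillation_def osc_def avgn_integral[symmetric]
  by (rule nn_integral_set_integral)
     (auto intro!: set_integrable_D locally_integrable_norm locally_integrable_diff locally_integrable_const)

lemma sharp_maximal_ge:
  "locally_integrable b \<Longrightarrow> Q \<in> D \<Longrightarrow> x \<in> Q \<Longrightarrow> ennreal (sharp b Q) \<le> sharp_maximal D \<nu> b x"
proof -
  assume b: "locally_integrable b" and Q: "Q \<in> D" "x \<in> Q"
  have "indicator Q x / wmass \<nu> Q * oscillation b Q \<le> sharp_maximal D \<nu> b x"
    unfolding sharp_maximal_def by (rule SUP_upper[OF Q(1)])
  moreover have "indicator Q x / wmass \<nu> Q * oscillation b Q = ennreal (sharp b Q)"
  proof -
    have "1 / ennreal (wt \<nu> Q) = ennreal (1 / wt \<nu> Q)"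
      using wt_nu_pos[OF Q(1)] by (metis divide_ennreal ennreal_1 zero_le_one)
    then show ?thesis
      using Q wt_nu_pos[OF Q(1)] by (simp add: oscillation_eq[OF b] wmass_nu sharp_def ennreal_mult[symmetric] less_imp_le)
  qed
  ultimately show ?thesis by simp
qed

text \<open>On \<open>E P\<close> the density \<open>wt \<nu> P / mea P\<close> is at most the
  localised maximal function, and \<open>E P\<close> is at least half of \<open>P\<close>. The sets
  being disjoint, the masses add up to at most twice the integral in
  \<open>Ainf_char\<close>.\<close>

lemma Ainf_Carleson:
  assumes F: "finite F" "sparse F" and Q: "Q \<in> D"
  shows "(\<Sum>P\<in>{P\<in>F. P \<subseteq> Q}. ennreal (wt \<nu> P)) \<le> 2 * Ainf_char D \<nu> * wmass \<nu> Q"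
proof -
  obtain E where E: "disjoint_family_on E F" "\<And>S. S \<in> F \<Longrightarrow> E S \<in> sets lebesgue"
      "\<And>S. S \<in> F \<Longrightarrow> E S \<subseteq> S" "\<And>S. S \<in> F \<Longrightarrow> mea S \<le> 2 * mea (E S)" and FD: "F \<subseteq> D"
    using F(2) unfolding sparse_def by blast
  let ?M = "\<lambda>x. SUP R\<in>{R\<in>D. x \<in> R \<and> R \<subseteq> Q}. wmass \<nu> R / emeasure lebesgue R"
  let ?G = "{P\<in>F. P \<subseteq> Q}"
  have 1: "ennreal (wt \<nu> P) \<le> 2 * (\<integral>\<^sup>+x. ennreal (wt \<nu> P / mea P) * indicator (E P) x \<partial>lebesgue)" if P: "P \<in> F" for P
  proof -
    have pos: "0 < mea P" "0 < wt \<nu> P" using P FD D_measure_pos wt_nu_pos by auto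
    have "E P \<in> lmeasurable"
    proof (rule bounded_set_imp_lmeasurable)
      show "bounded (E P)" using D_bounded E(3)[OF P] P FD by (meson bounded_subset subsetD)
    qed (rule E(2)[OF P])
    then have "(\<integral>\<^sup>+x. ennreal (wt \<nu> P / mea P) * indicator (E P) x \<partial>lebesgue) = ennreal (wt \<nu> P / mea P * mea (E P))"
    proof -
      have "(\<integral>\<^sup>+x. ennreal (wt \<nu> P / mea P) * indicator (E P) x \<partial>lebesgue) = ennreal (wt \<nu> P / mea P) * ennreal (mea (E P))"
        using \<open>E P \<in> lmeasurable\<close> E(2)[OF P] by (simp add: nn_integral_cmult emeasure_eq_measure2)
      then show ?thesis using pos by (subst ennreal_mult) (auto simp: less_imp_le)
    qed
    moreover have "ennreal (wt \<nu> P) \<le> ennreal (2 * (wt \<nu> P / mea P * mea (E P)))"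
      using E(4)[OF P] pos by (intro ennreal_leI) (simp add: field_simps)
    moreover have "ennreal (2 * (wt \<nu> P / mea P * mea (E P))) = 2 * ennreal (wt \<nu> P / mea P * mea (E P))"
      by (subst ennreal_mult') auto
    ultimately show ?thesis by simp
  qed
  have "(\<Sum>P\<in>?G. ennreal (wt \<nu> P)) \<le> (\<Sum>P\<in>?G. 2 * (\<integral>\<^sup>+x. ennreal (wt \<nu> P / mea P) * indicator (E P) x \<partial>lebesgue))"
    by (intro sum_mono 1) auto
  also have "\<dots> = 2 * (\<integral>\<^sup>+x. (\<Sum>P\<in>?G. ennreal (wt \<nu> P / mea P) * indicator (E P) x) \<partial>lebesgue)"
    using E(2) by (subst nn_integral_sum) (auto simp: sum_distrib_left)
  also have "\<dots> \<le> 2 * (\<integral>\<^sup>+x\<in>Q. ?M x \<partial>lebesgue)"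
  proof (intro mult_left_mono nn_integral_mono)
    fix x
    show "(\<Sum>P\<in>?G. ennreal (wt \<nu> P / mea P) * indicator (E P) x) \<le> ?M x * indicator Q x"
    proof (cases "\<exists>P\<in>?G. x \<in> E P")
      case True
      then obtain P where P: "P \<in> ?G" "x \<in> E P" by auto
      have "(\<Sum>P\<in>?G. ennreal (wt \<nu> P / mea P) * indicator (E P) x) = (\<Sum>P\<in>{P}. ennreal (wt \<nu> P / mea P) * indicator (E P) x)"
        using P E(1) F(1) by (intro sum.mono_neutral_right) (auto simp: disjoint_family_on_def indicator_def split: if_splits)
      also have "\<dots> = wmass \<nu> P / emeasure lebesgue P"
      proof -
        have PD: "P \<in> D" using P FD by auto
        show ?thesis unfolding wmass_nu[OF PD] D_emeasure[OF PD]
          using P(2) D_measure_pos[OF PD] wt_nu_pos[OF PD] by (simp add: divide_ennreal)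
      qed
      also have "\<dots> \<le> ?M x" using P FD E(3)[of P] by (intro SUP_upper) auto
      also have "\<dots> = ?M x * indicator Q x" using P E(3)[of P] by auto
      finally show ?thesis .
    next
      case False
      then have "(\<Sum>P\<in>?G. ennreal (wt \<nu> P / mea P) * indicator (E P) x) = 0" by (intro sum.neutral) auto
      then show ?thesis by (simp only: zero_le)
    qed
  qed simp
  \<comment> \<open>The mass of \<open>\<nu>\<close> on \<open>Q\<close> is positive and finite, so
    it may be divided out and multiplied back in \<open>ennreal\<close>.\<close>
  also have "(\<integral>\<^sup>+x\<in>Q. ?M x \<partial>lebesgue) = (\<integral>\<^sup>+x\<in>Q. ?M x \<partial>lebesgue) / wmass \<nu> Q * wmass \<nu> Q"
    using wt_nu_pos[OF Q] by (simp add: wmass_nu[OF Q] ennreal_divide_times ennreal_times_divide[symmetric] divide_ennreal)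
  also have "2 * \<dots> \<le> 2 * (Ainf_char D \<nu> * wmass \<nu> Q)"
    unfolding Ainf_char_def by (intro mult_left_mono mult_right_mono SUP_upper Q) auto
  finally show ?thesis by (simp add: mult.assoc)
qed

text \<open>Carleson embedding with the r-th power of \<open>sharp_maximal\<close> as majorant;
  \<open>1 \<le> r\<close> replaces \<open>2 powr (1 / r)\<close> by 2.\<close>

lemma sharp_sum_le:
  assumes F: "finite F" "sparse F" and b: "locally_integrable b" and r: "1 \<le> r"
  shows "ennreal ((\<Sum>S\<in>F. sharp b S powr r * wt \<nu> S) powr (1 / r))
    \<le> 2 * (ennpowr (Ainf_char D \<nu>) (1 / r) * wLp_norm r \<nu> (sharp_maximal D \<nu> b))"
proof -
  have FD: "F \<subseteq> D" using F by (simp add: sparse_def)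
  let ?I = "\<integral>\<^sup>+x. ennpowr (sharp_maximal D \<nu> b x) r * ennreal (\<nu> x) \<partial>lebesgue"
  have "ennreal (\<Sum>S\<in>F. sharp b S powr r * wt \<nu> S) = (\<Sum>S\<in>F. ennreal (sharp b S powr r) * ennreal (wt \<nu> S))"
    using nu_nonneg by (simp add: sum_ennreal[symmetric] wt_nonneg ennreal_mult del: sum_ennreal)
  also have "\<dots> \<le> 2 * Ainf_char D \<nu> * ?I"
  proof (rule Carleson_embedding[OF nu_li nu_nonneg F(1) FD])
    fix Q x assume Q: "Q \<in> F" "x \<in> Q"
    then have "ennpowr (ennreal (sharp b Q)) r \<le> ennpowr (sharp_maximal D \<nu> b x) r"
      using FD r by (intro ennpowr_mono sharp_maximal_ge[OF b]) auto
    then show "ennreal (sharp b Q powr r) \<le> ennpowr (sharp_maximal D \<nu> b x) r"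
      by (simp add: sharp_nonneg)
  qed (use Ainf_Carleson[OF F] FD in auto)
  finally have "ennpowr (ennreal (\<Sum>S\<in>F. sharp b S powr r * wt \<nu> S)) (1 / r) \<le> ennpowr (2 * Ainf_char D \<nu> * ?I) (1 / r)"
    using r by (intro ennpowr_mono) auto
  also have "\<dots> = ennpowr 2 (1 / r) * (ennpowr (Ainf_char D \<nu>) (1 / r) * ennpowr ?I (1 / r))"
    using r by (simp add: ennpowr_mult mult.assoc)
  also have "\<dots> \<le> 2 * (ennpowr (Ainf_char D \<nu>) (1 / r) * ennpowr ?I (1 / r))"
  proof (intro mult_right_mono)
    have "ennpowr 2 (1 / r) = ennreal (2 powr (1 / r))" using ennpowr_ennreal[of 2 "1 / r"] by simp
    also have "\<dots> \<le> ennreal (2 powr 1)" using r by (intro ennreal_leI powr_mono) auto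
    finally show "ennpowr 2 (1 / r) \<le> 2" by simp
  qed simp
  finally show ?thesis
    using nu_nonneg by (simp add: wLp_norm_def sum_nonneg wt_nonneg)
qed

text \<open>Roots of the constants of \<open>sparse_embedding\<close>: of order \<open>p\<close> for
  the pair of \<open>\<mu>\<close>, and of order \<open>q'\<close> for the swapped pair of
  \<open>\<kappa>\<close>, where the conjugate of \<open>q'\<close> is again
  \<open>q\<close>.\<close>

definition "Kf = Bm * (2 * Bm) powr (1 / (p - 1)) * (p / (p - 1))"
definition "Kg = Bk * (2 * Bk) powr (q - 1) * q"

lemma Kf_nonneg: "0 \<le> Kf" and Kg_nonneg: "0 \<le> Kg"
  using mu_pair(9) kappa_pair(9) p1 q1 by (auto simp: Kf_def Kg_def)

lemma form_estimate:
  assumes b: "form_bound N b" and f: "locally_integrable f" and g: "locally_integrable g" and F: "finite F" "sparse F"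
  shows "ennreal (\<Sum>S\<in>F. avgn S f * osc S b * avgn S g * mea S)
    \<le> ennreal (N * Kf * Kg) * (ennpowr (Lp_int p \<mu> f) (1 / p) * ennpowr (Lp_int q' \<sigma> g) (1 / q'))"
proof -
  let ?X = "\<Sum>S\<in>F. avgn S f powr p * wt \<mu> S" and ?Y = "\<Sum>S\<in>F. avgn S g powr q' * wt \<sigma> S"
  have XY: "0 \<le> ?X" "0 \<le> ?Y" using mu_pair(6) kappa_pair(7) by (auto intro!: sum_nonneg mult_nonneg_nonneg wt_nonneg)
  have N: "0 \<le> N" using b by (simp add: form_bound_def)
  have "ennreal ?X \<le> ennreal (Kf powr p) * Lp_int p \<mu> f"
  proof -
    have "Kf powr p = Bm powr p * (2 * Bm) powr (p / (p - 1)) * (p / (p - 1)) powr p"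
      using mu_pair(9) p1 by (simp add: Kf_def powr_mult powr_powr powr_divide)
    then show ?thesis using sparse_embedding[OF Am f F] by simp
  qed
  then have "ennpowr (ennreal ?X) (1 / p) \<le> ennpowr (ennreal (Kf powr p) * Lp_int p \<mu> f) (1 / p)"
    using p1 by (intro ennpowr_mono) auto
  then have X: "ennreal (?X powr (1 / p)) \<le> ennreal Kf * ennpowr (Lp_int p \<mu> f) (1 / p)"
    using p1 XY Kf_nonneg by (simp add: ennpowr_mult powr_powr)
  have q'': "q' / (q' - 1) = q" using q1 by (simp add: q'_def field_simps)
  have "ennreal ?Y \<le> ennreal (Kg powr q') * Lp_int q' \<sigma> g"
  proof -
    have "(q - 1) * q' = q" using q1 by (simp add: q'_def)
    then have "Kg powr q' = Bk powr q' * (2 * Bk) powr (q' / (q' - 1)) * (q' / (q' - 1)) powr q'"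
      using kappa_pair(9) q1 unfolding q'' by (simp add: Kg_def powr_mult powr_powr)
    then show ?thesis using sparse_embedding[OF Apair_swap[OF Ak] g F] unfolding q'_def[symmetric] by simp
  qed
  then have "ennpowr (ennreal ?Y) (1 / q') \<le> ennpowr (ennreal (Kg powr q') * Lp_int q' \<sigma> g) (1 / q')"
    using q'(2) by (intro ennpowr_mono) auto
  then have Y: "ennreal (?Y powr (1 / q')) \<le> ennreal Kg * ennpowr (Lp_int q' \<sigma> g) (1 / q')"
    using q'(2) XY Kg_nonneg by (simp add: ennpowr_mult powr_powr)
  have "ennreal (\<Sum>S\<in>F. avgn S f * osc S b * avgn S g * mea S) \<le> ennreal (N * (?X powr (1 / p) * ?Y powr (1 / q')))"
    using b f g F unfolding form_bound_def q'_def[symmetric] q'(1) by (intro ennreal_leI) blast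
  also have "\<dots> = ennreal N * (ennreal (?X powr (1 / p)) * ennreal (?Y powr (1 / q')))"
    using N by (simp add: ennreal_mult)
  also have "\<dots> \<le> ennreal N * ((ennreal Kf * ennpowr (Lp_int p \<mu> f) (1 / p)) * (ennreal Kg * ennpowr (Lp_int q' \<sigma> g) (1 / q')))"
    by (intro mult_left_mono mult_mono X Y) auto
  finally show ?thesis
    using N Kf_nonneg Kg_nonneg by (simp add: ennreal_mult mult_ac)
qed

theorem pairing_estimate:
  assumes b: "form_bound N b" and li: "locally_integrable f" "locally_integrable b" "locally_integrable g"
    and F: "finite F" "F \<subseteq> D"
  shows "ennreal (\<Sum>Q\<in>F. pairing f b g Q)
    \<le> ennreal (64 * 2 ^ CARD('n) * (N * Kf * Kg)) * (ennpowr (Lp_int p \<mu> f) (1 / p) * ennpowr (Lp_int q' \<sigma> g) (1 / q'))"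
proof -
  obtain SS where S: "finite SS" "sparse SS"
    "(\<Sum>Q\<in>F. pairing f b g Q) \<le> 64 * 2 ^ CARD('n) * (\<Sum>S\<in>SS. avgn S f * osc S b * avgn S g * mea S)"
    using sparse_domination[OF li F] by blast
  have N: "0 \<le> N" using b by (simp add: form_bound_def)
  have "ennreal (\<Sum>Q\<in>F. pairing f b g Q) \<le> ennreal (64 * 2 ^ CARD('n)) * ennreal (\<Sum>S\<in>SS. avgn S f * osc S b * avgn S g * mea S)"
    using S(3) by (subst ennreal_mult[symmetric]) (auto intro!: ennreal_leI sum_nonneg)
  also have "\<dots> \<le> ennreal (64 * 2 ^ CARD('n)) * (ennreal (N * Kf * Kg) * (ennpowr (Lp_int p \<mu> f) (1 / p) * ennpowr (Lp_int q' \<sigma> g) (1 / q')))"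
    by (intro mult_left_mono form_estimate[OF b li(1,3) S(1,2)]) auto
  finally show ?thesis using N Kf_nonneg Kg_nonneg by (simp add: ennreal_mult mult.assoc)
qed

end

section \<open>Unconditional convergence\<close>

lemma nn_set_integral_cong_on:
  "(\<And>x. x \<in> K \<Longrightarrow> f x = g x) \<Longrightarrow> (\<integral>\<^sup>+x\<in>K. f x \<partial>M) = (\<integral>\<^sup>+x\<in>K. g x \<partial>M)"
  by (intro nn_integral_cong) (auto simp: indicator_def)

lemma ennreal_tendsto_0I:
  fixes f :: "'a \<Rightarrow> ennreal"
  assumes "\<And>e::real. 0 < e \<Longrightarrow> \<forall>\<^sub>F x in F. f x \<le> ennreal e"
  shows "(f \<longlongrightarrow> 0) F"
proof (rule order_tendstoI)
  fix a :: ennreal assume "0 < a"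
  then obtain e where e: "0 < e" "ennreal e < a"
  proof (cases a)
    case (real r)
    then show ?thesis using \<open>0 < a\<close> that[of "r / 2"] by (auto simp: ennreal_less_iff)
  next
    case top
    then show ?thesis using that[of 1] by simp
  qed
  show "\<forall>\<^sub>F x in F. f x < a"
    using assms[OF e(1)] by eventually_elim (use e(2) in auto)
qed simp

text \<open>A finite set whose sum is within \<open>e\<close> of the supremum leaves less than
  \<open>e\<close> for any finite set disjoint from it.\<close>

lemma bounded_finite_sums_small_tail:
  fixes c :: "'i \<Rightarrow> real"
  assumes c: "\<And>i. i \<in> I \<Longrightarrow> 0 \<le> c i" and B: "\<And>F. finite F \<Longrightarrow> F \<subseteq> I \<Longrightarrow> sum c F \<le> B" and e: "0 < e"
  shows "\<exists>G. finite G \<and> G \<subseteq> I \<and> (\<forall>H. finite H \<longrightarrow> H \<subseteq> I \<longrightarrow> H \<inter> G = {} \<longrightarrow> sum c H < e)"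
proof -
  let ?X = "{sum c F | F. finite F \<and> F \<subseteq> I}"
  have bdd: "bdd_above ?X" using B by (auto intro!: bdd_aboveI[of _ B])
  have "?X \<noteq> {}" by (auto intro: exI[of _ "{}"])
  then obtain x where "x \<in> ?X" "Sup ?X - e < x"
    using less_cSup_iff[OF _ bdd, of "Sup ?X - e"] e by auto
  then obtain G where G: "finite G" "G \<subseteq> I" "Sup ?X - e < sum c G" by auto
  have "sum c H < e" if H: "finite H" "H \<subseteq> I" "H \<inter> G = {}" for H
  proof -
    have "sum c H + sum c G = sum c (H \<union> G)" using H G by (simp add: sum.union_disjoint)
    also have "\<dots> \<le> Sup ?X" by (rule cSup_upper[OF _ bdd]) (use H G in blast)
    finally show ?thesis using G by linarith
  qed
  then show ?thesis using G by blast
qed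

lemma nn_set_integral_norm_triangle:
  fixes f g :: "_ \<Rightarrow> 'k::{banach,second_countable_topology}"
  assumes "f \<in> borel_measurable M" "g \<in> borel_measurable M" "K \<in> sets M"
  shows "(\<integral>\<^sup>+x\<in>K. ennreal (norm (f x + g x)) \<partial>M)
    \<le> (\<integral>\<^sup>+x\<in>K. ennreal (norm (f x)) \<partial>M) + (\<integral>\<^sup>+x\<in>K. ennreal (norm (g x)) \<partial>M)"
proof -
  have "(\<integral>\<^sup>+x\<in>K. ennreal (norm (f x + g x)) \<partial>M) \<le> (\<integral>\<^sup>+x\<in>K. (ennreal (norm (f x)) + ennreal (norm (g x))) \<partial>M)"
    by (intro nn_integral_mono mult_right_mono)
       (auto simp: ennreal_plus[symmetric] norm_triangle_ineq simp del: ennreal_plus)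
  also have "\<dots> = (\<integral>\<^sup>+x\<in>K. ennreal (norm (f x)) \<partial>M) + (\<integral>\<^sup>+x\<in>K. ennreal (norm (g x)) \<partial>M)"
    using assms by (subst nn_integral_add[symmetric]) (auto simp: distrib_right)
  finally show ?thesis .
qed

text \<open>Completeness of L^1 along the net of finite sets. The sets \<open>G n\<close> for
  tolerance 2^(-n) are accumulated into an increasing sequence \<open>A n\<close>, whose partial
  sums converge; every finite set containing \<open>A N\<close> is then within twice 2^(-N) of the
  limit.\<close>

lemma has_uncond_L1_sum_Cauchy:
  fixes u :: "'i \<Rightarrow> real^'n \<Rightarrow> 'k::{banach,second_countable_topology}"
  assumes K: "K \<in> sets lebesgue" and um: "\<And>i. i \<in> I \<Longrightarrow> u i \<in> borel_measurable lebesgue"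
    and ui: "\<And>i. i \<in> I \<Longrightarrow> set_integrable lebesgue K (u i)"
    and C: "\<And>e::real. 0 < e \<Longrightarrow> \<exists>G. finite G \<and> G \<subseteq> I \<and>
       (\<forall>H. finite H \<longrightarrow> H \<subseteq> I \<longrightarrow> H \<inter> G = {} \<longrightarrow> (\<integral>\<^sup>+x\<in>K. ennreal (norm (\<Sum>i\<in>H. u i x)) \<partial>lebesgue) \<le> ennreal e)"
  shows "\<exists>g. has_uncond_L1_sum u I K g"
proof -
  note [measurable] = K
  let ?e = "\<lambda>n::nat. (1/2::real)^n"
  have "\<forall>n. \<exists>G. finite G \<and> G \<subseteq> I \<and>
       (\<forall>H. finite H \<longrightarrow> H \<subseteq> I \<longrightarrow> H \<inter> G = {} \<longrightarrow> (\<integral>\<^sup>+x\<in>K. ennreal (norm (\<Sum>i\<in>H. u i x)) \<partial>lebesgue) \<le> ennreal (?e n))"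
    using C by simp
  from choice[OF this] obtain G where G': "\<forall>n. finite (G n) \<and> G n \<subseteq> I \<and>
       (\<forall>H. finite H \<longrightarrow> H \<subseteq> I \<longrightarrow> H \<inter> G n = {} \<longrightarrow> (\<integral>\<^sup>+x\<in>K. ennreal (norm (\<Sum>i\<in>H. u i x)) \<partial>lebesgue) \<le> ennreal (?e n))"
    by (rule exE)
  then have G: "\<And>n. finite (G n)" "\<And>n. G n \<subseteq> I"
    "\<And>n H. finite H \<Longrightarrow> H \<subseteq> I \<Longrightarrow> H \<inter> G n = {} \<Longrightarrow> (\<integral>\<^sup>+x\<in>K. ennreal (norm (\<Sum>i\<in>H. u i x)) \<partial>lebesgue) \<le> ennreal (?e n)"
    by simp_all
  define A where "A n = (\<Union>m\<le>n. G m)" for n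
  have A: "finite (A n)" "A n \<subseteq> I" "G n \<subseteq> A n" for n using G by (auto simp: A_def)
  have Amono: "A n \<subseteq> A m" if "n \<le> m" for n m
    unfolding A_def using that by (intro UN_mono) auto
  have sm: "(\<lambda>x. \<Sum>i\<in>F. u i x) \<in> borel_measurable lebesgue" if "F \<subseteq> I" for F
    using that um by (intro borel_measurable_sum) auto
  have sint: "set_integrable lebesgue K (\<lambda>x. \<Sum>i\<in>F. u i x)" if "F \<subseteq> I" for F
    unfolding set_integrable_def scaleR_sum_right using that ui
    by (intro Bochner_Integration.integrable_sum) (auto simp: set_integrable_def)
  have small: "(\<integral>\<^sup>+x\<in>K. ennreal (norm ((\<Sum>i\<in>F. u i x) - (\<Sum>i\<in>A n. u i x))) \<partial>lebesgue) \<le> ennreal (?e n)"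
    if F: "finite F" "A n \<subseteq> F" "F \<subseteq> I" for F n
  proof -
    have "(\<Sum>i\<in>F. u i x) - (\<Sum>i\<in>A n. u i x) = (\<Sum>i\<in>F - A n. u i x)" for x
      using F A by (simp add: sum_diff)
    moreover have "(F - A n) \<inter> G n = {}" using A(3)[of n] by blast
    ultimately show ?thesis using G(3)[of "F - A n" n] F by auto
  qed
  define s where "s n x = indicator K x *\<^sub>R (\<Sum>i\<in>A n. u i x)" for n x
  have s_int: "integrable lebesgue (s n)" for n
    using sint[OF A(2)] by (simp add: s_def[abs_def] set_integrable_def)
  have s_small: "(\<integral>\<^sup>+x. ennreal (norm (s m x - s n x)) \<partial>lebesgue) \<le> ennreal (?e n)" if "n \<le> m" for n m
  proof -
    have "(\<integral>\<^sup>+x. ennreal (norm (s m x - s n x)) \<partial>lebesgue) = (\<integral>\<^sup>+x\<in>K. ennreal (norm ((\<Sum>i\<in>A m. u i x) - (\<Sum>i\<in>A n. u i x))) \<partial>lebesgue)"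
      by (intro nn_integral_cong) (auto simp: s_def indicator_def)
    also have "\<dots> \<le> ennreal (?e n)" by (intro small A Amono that)
    finally show ?thesis .
  qed
  have "\<exists>N. \<forall>i\<ge>N. \<forall>j\<ge>N. (LINT x|lebesgue. norm (s i x - s j x)) < e" if e: "e > 0" for e :: real
  proof -
    obtain N where N: "?e N < e / 2" using real_arch_pow_inv[of "e/2" "1/2"] e by auto
    have "(LINT x|lebesgue. norm (s i x - s N x)) \<le> ?e N" if "N \<le> i" for i
    proof -
      have "ennreal (LINT x|lebesgue. norm (s i x - s N x)) = (\<integral>\<^sup>+x. ennreal (norm (s i x - s N x)) \<partial>lebesgue)"
        using s_int by (intro nn_integral_eq_integral[symmetric]) auto
      also have "\<dots> \<le> ennreal (?e N)" by (rule s_small[OF that])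
      finally show ?thesis by (simp add: ennreal_le_iff)
    qed
    note sN = this
    have "(LINT x|lebesgue. norm (s i x - s j x)) < e" if "N \<le> i" "N \<le> j" for i j
    proof -
      have "(LINT x|lebesgue. norm (s i x - s j x)) \<le> (LINT x|lebesgue. norm (s i x - s N x) + norm (s j x - s N x))"
      proof (intro integral_mono)
        show "norm (s i x - s j x) \<le> norm (s i x - s N x) + norm (s j x - s N x)" for x
          using norm_triangle_ineq4[of "s i x - s N x" "s j x - s N x"] by simp
      qed (use s_int in auto)
      also have "\<dots> = (LINT x|lebesgue. norm (s i x - s N x)) + (LINT x|lebesgue. norm (s j x - s N x))"
        using s_int by (intro Bochner_Integration.integral_add) auto
      also have "\<dots> < e" using sN[OF that(1)] sN[OF that(2)] N by linarith
      finally show ?thesis .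
    qed
    then show ?thesis by blast
  qed
  then obtain r where r: "strict_mono r" "AE x in lebesgue. Cauchy (\<lambda>i. s (r i) x)"
    using cauchy_L1_AE_cauchy_subseq[of lebesgue s] s_int by blast
  define g where "g x = lim (\<lambda>i. s (r i) x)" for x
  have gm [measurable]: "g \<in> borel_measurable lebesgue"
    unfolding g_def using s_int by (intro borel_measurable_lim_metric) auto
  have conv: "AE x in lebesgue. (\<lambda>i. s (r i) x) \<longlonglongrightarrow> g x"
    using r(2) by eventually_elim (auto simp: g_def Cauchy_convergent_iff convergent_LIMSEQ_iff)
  \<comment> \<open>Fatou along the almost everywhere convergent subsequence turns the Cauchy bound
    into a bound of the distance to the limit.\<close>
  have s_g: "(\<integral>\<^sup>+x. ennreal (norm (s n x - g x)) \<partial>lebesgue) \<le> ennreal (?e n)" for n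
  proof -
    have "(\<integral>\<^sup>+x. ennreal (norm (s n x - g x)) \<partial>lebesgue) = (\<integral>\<^sup>+x. liminf (\<lambda>i. ennreal (norm (s (r i) x - s n x))) \<partial>lebesgue)"
    proof (rule nn_integral_cong_AE, use conv in eventually_elim)
      fix x assume "(\<lambda>i. s (r i) x) \<longlonglongrightarrow> g x"
      then have "(\<lambda>i. ennreal (norm (s (r i) x - s n x))) \<longlonglongrightarrow> ennreal (norm (g x - s n x))"
        by (intro tendsto_ennrealI tendsto_norm tendsto_diff tendsto_const)
      then show "ennreal (norm (s n x - g x)) = liminf (\<lambda>i. ennreal (norm (s (r i) x - s n x)))"
        unfolding norm_minus_commute[of "s n x" "g x"] by (rule lim_imp_Liminf[symmetric, rotated]) simp
    qed
    also have "\<dots> \<le> liminf (\<lambda>i. \<integral>\<^sup>+x. ennreal (norm (s (r i) x - s n x)) \<partial>lebesgue)"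
      using s_int by (intro nn_integral_liminf) auto
    also have "\<dots> \<le> ennreal (?e n)"
    proof (rule Liminf_le)
      show "\<forall>\<^sub>F i in sequentially. (\<integral>\<^sup>+x. ennreal (norm (s (r i) x - s n x)) \<partial>lebesgue) \<le> ennreal (?e n)"
        using eventually_ge_at_top[of n]
        by eventually_elim (use s_small seq_suble[OF r(1)] order_trans in blast)
    qed simp
    finally show ?thesis .
  qed
  have "integrable lebesgue (\<lambda>x. s 0 x - g x)"
    using s_int s_g[of 0] by (intro integrableI_bounded) (auto intro: le_less_trans)
  then have "integrable lebesgue (\<lambda>x. s 0 x - (s 0 x - g x))"
    using s_int by (rule Bochner_Integration.integrable_diff[rotated])
  then have g_int: "integrable lebesgue g" by simp
  have "has_uncond_L1_sum u I K g"
    unfolding has_uncond_L1_sum_def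
  proof (intro conjI ennreal_tendsto_0I)
    show "set_integrable lebesgue K g"
      unfolding set_integrable_def using g_int by (intro integrable_mult_indicator K)
    fix e :: real assume e: "0 < e"
    obtain N where N: "?e N < e / 2" using real_arch_pow_inv[of "e/2" "1/2"] e by auto
    show "\<forall>\<^sub>F F in finite_subsets_at_top I. (\<integral>\<^sup>+x\<in>K. ennreal (norm ((\<Sum>i\<in>F. u i x) - g x)) \<partial>lebesgue) \<le> ennreal e"
      unfolding eventually_finite_subsets_at_top
    proof (intro exI[of _ "A N"] conjI allI impI A)
      fix F assume F: "finite F \<and> A N \<subseteq> F \<and> F \<subseteq> I"
      have "(\<integral>\<^sup>+x\<in>K. ennreal (norm ((\<Sum>i\<in>F. u i x) - g x)) \<partial>lebesgue)
        = (\<integral>\<^sup>+x\<in>K. ennreal (norm (((\<Sum>i\<in>F. u i x) - (\<Sum>i\<in>A N. u i x)) + ((\<Sum>i\<in>A N. u i x) - g x))) \<partial>lebesgue)"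
        by simp
      also have "\<dots> \<le> (\<integral>\<^sup>+x\<in>K. ennreal (norm ((\<Sum>i\<in>F. u i x) - (\<Sum>i\<in>A N. u i x))) \<partial>lebesgue)
          + (\<integral>\<^sup>+x\<in>K. ennreal (norm ((\<Sum>i\<in>A N. u i x) - g x)) \<partial>lebesgue)"
        using F A by (intro nn_set_integral_norm_triangle borel_measurable_diff sm gm K) auto
      also have "\<dots> \<le> ennreal (?e N) + ennreal (?e N)"
      proof (rule add_mono)
        have "(\<integral>\<^sup>+x\<in>K. ennreal (norm ((\<Sum>i\<in>A N. u i x) - g x)) \<partial>lebesgue) \<le> (\<integral>\<^sup>+x. ennreal (norm (s N x - g x)) \<partial>lebesgue)"
          by (intro nn_integral_mono) (auto simp: s_def indicator_def)
        then show "(\<integral>\<^sup>+x\<in>K. ennreal (norm ((\<Sum>i\<in>A N. u i x) - g x)) \<partial>lebesgue) \<le> ennreal (?e N)"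
          using s_g[of N] by (rule order_trans)
      qed (use small F in auto)
      also have "\<dots> \<le> ennreal e"
        using N by (simp add: ennreal_plus[symmetric] ennreal_leI del: ennreal_plus)
      finally show "(\<integral>\<^sup>+x\<in>K. ennreal (norm ((\<Sum>i\<in>F. u i x) - g x)) \<partial>lebesgue) \<le> ennreal e" .
    qed
  qed
  then show ?thesis by (intro exI)
qed

lemma has_uncond_L1_sum_cong:
  assumes "has_uncond_L1_sum u I K g" "\<And>x. x \<in> K \<Longrightarrow> g x = h x"
  shows "has_uncond_L1_sum u I K h"
proof -
  have "set_integrable lebesgue K h"
    using assms unfolding has_uncond_L1_sum_def by (subst set_integrable_cong[OF refl refl, of K h g]) auto
  moreover have "(\<integral>\<^sup>+x\<in>K. ennreal (norm ((\<Sum>i\<in>F. u i x) - h x)) \<partial>lebesgue) = (\<integral>\<^sup>+x\<in>K. ennreal (norm ((\<Sum>i\<in>F. u i x) - g x)) \<partial>lebesgue)" for F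
    using assms(2) by (intro nn_set_integral_cong_on) simp
  ultimately show ?thesis using assms(1) unfolding has_uncond_L1_sum_def by simp
qed

text \<open>The error on \<open>K\<close> is at most the sum of the errors on the finitely many
  covering sets.\<close>

lemma has_uncond_L1_sum_subset_Union:
  fixes u :: "'i \<Rightarrow> real^'n \<Rightarrow> 'k::{banach,second_countable_topology}"
  assumes T: "finite T" "T \<subseteq> sets lebesgue" and K: "K \<in> sets lebesgue" "K \<subseteq> \<Union>T"
    and u: "\<And>Q. Q \<in> T \<Longrightarrow> has_uncond_L1_sum u I Q g"
    and m: "\<And>i. i \<in> I \<Longrightarrow> u i \<in> borel_measurable lebesgue" "g \<in> borel_measurable lebesgue"
  shows "has_uncond_L1_sum u I K g"
  unfolding has_uncond_L1_sum_def
proof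
  have "set_integrable lebesgue (\<Union>Q\<in>T. Q) g"
    using T u by (intro set_integrable_UN) (auto simp: has_uncond_L1_sum_def)
  then show "set_integrable lebesgue K g" by (rule set_integrable_subset) (use K in auto)
  let ?f = "\<lambda>F Q. \<integral>\<^sup>+x\<in>Q. ennreal (norm ((\<Sum>i\<in>F. u i x) - g x)) \<partial>lebesgue"
  have lim: "((\<lambda>F. \<Sum>Q\<in>T. ?f F Q) \<longlongrightarrow> (\<Sum>Q\<in>T. 0)) (finite_subsets_at_top I)"
    using u by (intro tendsto_sum) (auto simp: has_uncond_L1_sum_def)
  have le: "?f F K \<le> (\<Sum>Q\<in>T. ?f F Q)" if F: "F \<subseteq> I" for F
  proof -
    have [measurable]: "(\<lambda>x. \<Sum>i\<in>F. u i x) \<in> borel_measurable lebesgue"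
      using F m by (intro borel_measurable_sum) auto
    note [measurable] = m(2)
    have "?f F K \<le> (\<integral>\<^sup>+x. (\<Sum>Q\<in>T. ennreal (norm ((\<Sum>i\<in>F. u i x) - g x)) * indicator Q x) \<partial>lebesgue)"
    proof (rule nn_integral_mono)
      fix x
      have "indicator K x \<le> (\<Sum>Q\<in>T. indicator Q x :: ennreal)"
      proof (cases "x \<in> K")
        case True
        then obtain Q where "Q \<in> T" "x \<in> Q" using K by auto
        then show ?thesis using T(1) member_le_sum[of Q T "\<lambda>Q. indicator Q x :: ennreal"] True by auto
      qed simp
      then show "ennreal (norm ((\<Sum>i\<in>F. u i x) - g x)) * indicator K x \<le> (\<Sum>Q\<in>T. ennreal (norm ((\<Sum>i\<in>F. u i x) - g x)) * indicator Q x)"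
        unfolding sum_distrib_left[symmetric] by (rule mult_left_mono) simp
    qed
    also have "\<dots> = (\<Sum>Q\<in>T. ?f F Q)"
      using T by (intro nn_integral_sum) auto
    finally show ?thesis .
  qed
  show "((\<lambda>F. ?f F K) \<longlongrightarrow> 0) (finite_subsets_at_top I)"
  proof (rule tendsto_sandwich[OF _ _ tendsto_const])
    show "\<forall>\<^sub>F F in finite_subsets_at_top I. ?f F K \<le> (\<Sum>Q\<in>T. ?f F Q)"
      by (rule eventually_finite_subsets_at_top_weakI) (rule le)
    show "((\<lambda>F. \<Sum>Q\<in>T. ?f F Q) \<longlongrightarrow> 0) (finite_subsets_at_top I)" using lim by simp
  qed simp
qed

section \<open>Partial sums of the paraproduct\<close>

lemma mult_cnj_sgn: "z * cnj (sgn z) = complex_of_real (norm z)"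
proof (cases "z = 0")
  case False
  have "z * cnj (sgn z) = (z * cnj z) /\<^sub>R norm z" by (simp add: sgn_div_norm)
  also have "z * cnj z = complex_of_real (norm z ^ 2)" by (rule complex_norm_square[symmetric])
  finally show ?thesis using False by (simp add: scaleR_conv_of_real power2_eq_square)
qed simp

lemma borel_measurable_cnj_sgn:
  fixes f :: "'a \<Rightarrow> complex"
  assumes "f \<in> borel_measurable M"
  shows "(\<lambda>x. cnj (sgn (f x))) \<in> borel_measurable M"
proof (intro borel_measurable_continuous_on[OF continuous_on_cnj])
  show "(\<lambda>x. sgn (f x)) \<in> borel_measurable M" unfolding sgn_div_norm
    by (intro borel_measurable_scaleR borel_measurable_inverse measurable_compose[OF assms borel_measurable_norm] assms)
qed (rule continuous_on_id)

context dyadic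
begin

lemma mart_diff_children:
  fixes b :: "real^'n \<Rightarrow> complex"
  assumes "Q \<in> D"
  shows "mart_diff D Q b x = (\<Sum>R\<in>children Q. indicator R x *\<^sub>R (average R b - average Q b))"
proof -
  have "indicator (\<Union>R\<in>children Q. R) x = (\<Sum>R\<in>children Q. indicator R x :: real)"
    using children_disjoint[OF assms] finite_children[OF assms]
    by (intro indicator_UN_disjoint) (auto simp: disjoint_family_on_def disjoint_def)
  then have "indicator Q x = (\<Sum>R\<in>children Q. indicator R x :: real)" by (simp add: Union_children[OF assms])
  then show ?thesis
    unfolding mart_diff_def children_def[symmetric]
    by (simp only: scaleR_diff_right sum_subtractf scaleR_sum_left)
qed

lemma mart_diff_in:
  fixes b :: "real^'n \<Rightarrow> complex"
  assumes "Q \<in> D" "R \<in> children Q" "x \<in> R"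
  shows "mart_diff D Q b x = average R b - average Q b"
proof -
  have "mart_diff D Q b x = (\<Sum>R\<in>{R}. indicator R x *\<^sub>R (average R b - average Q b))"
    unfolding mart_diff_children[OF assms(1)]
    using finite_children[OF assms(1)] assms children_disjoint[OF assms(1)]
    by (intro sum.mono_neutral_right) (auto simp: disjoint_def indicator_def split: if_splits)
  then show ?thesis using assms by simp
qed

lemma mart_diff_out:
  fixes b :: "real^'n \<Rightarrow> complex"
  assumes "Q \<in> D" "x \<notin> Q"
  shows "mart_diff D Q b x = 0"
  unfolding mart_diff_children[OF assms(1)]
  using assms children_subset[OF assms(1)] by (intro sum.neutral) (auto simp: indicator_def)

lemma mart_diff_measurable [measurable]:
  fixes b :: "real^'n \<Rightarrow> complex"
  assumes "Q \<in> D"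
  shows "mart_diff D Q b \<in> borel_measurable lebesgue"
proof -
  have "mart_diff D Q b = (\<lambda>x. \<Sum>R\<in>children Q. indicator R x *\<^sub>R (average R b - average Q b))"
    using mart_diff_children[OF assms] by auto
  also have "\<dots> \<in> borel_measurable lebesgue"
    using children_D by (intro borel_measurable_sum borel_measurable_scaleR borel_measurable_indicator) auto
  finally show ?thesis .
qed

lemma mart_diff_bounded:
  fixes b :: "real^'n \<Rightarrow> complex"
  assumes "Q \<in> D"
  shows "norm (mart_diff D Q b x) \<le> (\<Sum>R\<in>children Q. norm (average R b - average Q b))"
  unfolding mart_diff_children[OF assms]
  by (intro sum_norm_le) (auto simp: indicator_def)

lemma mart_diff_mult_integral:
  fixes b g :: "real^'n \<Rightarrow> complex"
  assumes g: "locally_integrable g" and Q: "Q \<in> D"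
  shows "integrable lebesgue (\<lambda>x. mart_diff D Q b x * g x)"
    and "(LINT x|lebesgue. mart_diff D Q b x * g x) = (\<Sum>R\<in>children Q. (average R b - average Q b) * (LINT x:R|lebesgue. g x))"
proof -
  have eq: "mart_diff D Q b x * g x = (\<Sum>R\<in>children Q. (average R b - average Q b) * (indicator R x *\<^sub>R g x))" for x
    unfolding mart_diff_children[OF Q] sum_distrib_right by (intro sum.cong) auto
  have int: "integrable lebesgue (\<lambda>x. indicator R x *\<^sub>R g x)" if "R \<in> children Q" for R
    using set_integrable_D[OF g children_D[OF that]] by (simp add: set_integrable_def)
  show "integrable lebesgue (\<lambda>x. mart_diff D Q b x * g x)"
    unfolding eq by (intro Bochner_Integration.integrable_sum integrable_mult_right int)
  show "(LINT x|lebesgue. mart_diff D Q b x * g x) = (\<Sum>R\<in>children Q. (average R b - average Q b) * (LINT x:R|lebesgue. g x))"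
    unfolding eq set_lebesgue_integral_def
    using int by (subst Bochner_Integration.integral_sum) (auto intro!: integrable_mult_right sum.cong simp del: mult_scaleR_right)
qed

text \<open>The martingale difference of \<open>b\<close> has mean zero, so the average of
  \<open>g\<close> over \<open>Q\<close> may be subtracted from its averages over the children;
  Cauchy-Schwarz over the children then produces the two energies.\<close>

lemma mart_diff_mult_le:
  fixes b g :: "real^'n \<Rightarrow> complex"
  assumes b: "locally_integrable b" and g: "locally_integrable g" and Q: "Q \<in> D"
  shows "norm (LINT x|lebesgue. mart_diff D Q b x * g x) \<le> sqrt (energy Q b) * sqrt (energy Q g)"
proof -
  let ?z = "\<lambda>R. average R b - average Q b" and ?w = "\<lambda>R. average R g - average Q g"
  have z0: "(\<Sum>R\<in>children Q. mea R *\<^sub>R ?z R) = 0"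
    using average_children[OF b Q] measure_children[OF Q]
    by (simp add: scaleR_diff_right sum_subtractf scaleR_left.sum[symmetric])
  have "(LINT x|lebesgue. mart_diff D Q b x * g x) = (\<Sum>R\<in>children Q. ?z R * (mea R *\<^sub>R average R g))"
    unfolding mart_diff_mult_integral(2)[OF g Q] by (intro sum.cong refl) (simp add: average_integral children_D)
  also have "\<dots> = (\<Sum>R\<in>children Q. mea R *\<^sub>R (?z R * ?w R)) + (\<Sum>R\<in>children Q. mea R *\<^sub>R ?z R) * average Q g"
    unfolding sum_distrib_right sum.distrib[symmetric] by (intro sum.cong refl) (simp add: algebra_simps)
  finally have "(LINT x|lebesgue. mart_diff D Q b x * g x) = (\<Sum>R\<in>children Q. mea R *\<^sub>R (?z R * ?w R))"
    using z0 by simp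
  then have "norm (LINT x|lebesgue. mart_diff D Q b x * g x) \<le> (\<Sum>R\<in>children Q. sqrt (mea R * (norm (?z R))\<^sup>2) * sqrt (mea R * (norm (?w R))\<^sup>2))"
  proof (simp only:, intro sum_norm_le)
    fix R
    have "sqrt (mea R * (norm (?z R))\<^sup>2) * sqrt (mea R * (norm (?w R))\<^sup>2) = sqrt ((mea R * (norm (?z R) * norm (?w R)))\<^sup>2)"
      unfolding real_sqrt_mult[symmetric] by (simp add: power2_eq_square mult_ac)
    also have "\<dots> = mea R * (norm (?z R) * norm (?w R))"
      by (simp only: real_sqrt_abs abs_mult abs_norm_cancel abs_of_nonneg[OF measure_nonneg])
    finally show "norm (mea R *\<^sub>R (?z R * ?w R)) \<le> sqrt (mea R * (norm (?z R))\<^sup>2) * sqrt (mea R * (norm (?w R))\<^sup>2)"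
      by (simp add: norm_mult)
  qed
  also have "\<dots> \<le> sqrt (energy Q b) * sqrt (energy Q g)"
    unfolding energy_def by (intro sum_sqrt_mult_le) auto
  finally show ?thesis .
qed

definition psum :: "(real^'n \<Rightarrow> complex) \<Rightarrow> (real^'n \<Rightarrow> complex) \<Rightarrow> (real^'n) set set \<Rightarrow> real^'n \<Rightarrow> complex" where
  "psum b f F x = (\<Sum>Q\<in>F. para_term D b f Q x)"

lemma para_term_measurable [measurable]:
  fixes b f :: "real^'n \<Rightarrow> complex"
  shows "Q \<in> D \<Longrightarrow> para_term D b f Q \<in> borel_measurable lebesgue"
  unfolding para_term_def by measurable

lemma para_term_set_integrable:
  fixes b f :: "real^'n \<Rightarrow> complex"
  assumes "Q \<in> D" "E \<in> sets lebesgue"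
  shows "set_integrable lebesgue E (para_term D b f Q)"
proof -
  have "integrable lebesgue (\<lambda>x. mart_diff D Q b x * average Q f)"
    using mart_diff_mult_integral(1)[OF locally_integrable_const assms(1)] .
  then show ?thesis unfolding para_term_def set_integrable_def by (intro integrable_mult_indicator assms(2))
qed

lemma psum_measurable: "F \<subseteq> D \<Longrightarrow> psum b f F \<in> borel_measurable lebesgue"
  unfolding psum_def by (intro borel_measurable_sum) auto

lemma psum_bounded: "\<exists>C\<ge>0. \<forall>x. norm (psum b f F x) \<le> C" if "F \<subseteq> D"
proof -
  let ?C = "\<Sum>Q\<in>F. (\<Sum>R\<in>children Q. norm (average R b - average Q b)) * norm (average Q f)"
  have "norm (psum b f F x) \<le> ?C" for x
    unfolding psum_def para_term_def
    by (intro sum_norm_le) (use that mart_diff_bounded in \<open>auto simp: norm_mult intro!: mult_right_mono\<close>)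
  moreover have "0 \<le> ?C" by (intro sum_nonneg mult_nonneg_nonneg) auto
  ultimately show ?thesis by blast
qed

lemma psum_out: "F \<subseteq> D \<Longrightarrow> x \<notin> \<Union>F \<Longrightarrow> psum b f F x = 0"
  unfolding psum_def para_term_def by (intro sum.neutral) (auto simp: mart_diff_out)

lemma psum_mult_integral:
  assumes b: "locally_integrable b" and g: "locally_integrable g" and F: "F \<subseteq> D"
  shows "norm (LINT x|lebesgue. psum b f F x * g x) \<le> (\<Sum>Q\<in>F. pairing f b g Q)"
proof -
  have eq: "psum b f F x * g x = (\<Sum>Q\<in>F. average Q f * (mart_diff D Q b x * g x))" for x
    unfolding psum_def para_term_def sum_distrib_right by (intro sum.cong) auto
  have "(LINT x|lebesgue. psum b f F x * g x) = (\<Sum>Q\<in>F. average Q f * (LINT x|lebesgue. mart_diff D Q b x * g x))"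
    unfolding eq using F mart_diff_mult_integral(1)[OF g]
    by (subst Bochner_Integration.integral_sum) (auto intro!: integrable_mult_right)
  also have "norm \<dots> \<le> (\<Sum>Q\<in>F. pairing f b g Q)"
    unfolding pairing_def
    by (intro sum_norm_le) (use F mart_diff_mult_le[OF b g] in \<open>auto simp: norm_mult intro!: mult_left_mono\<close>)
  finally show ?thesis .
qed

text \<open>Testing against the unimodular function that makes the partial sum nonnegative.\<close>

lemma psum_L1:
  assumes b: "locally_integrable b" and F: "F \<subseteq> D" and E: "E \<in> sets lebesgue" "bounded E"
  obtains g where "locally_integrable g" "\<And>x. norm (g x) \<le> indicator E x"
    "(\<integral>\<^sup>+x\<in>E. ennreal (norm (psum b f F x)) \<partial>lebesgue) \<le> ennreal (\<Sum>Q\<in>F. pairing f b g Q)"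
proof -
  define g where "g x = indicator E x *\<^sub>R cnj (sgn (psum b f F x))" for x
  note [measurable] = psum_measurable[OF F] E(1)
  have gm: "g \<in> borel_measurable lebesgue"
    unfolding g_def
    by (intro borel_measurable_scaleR borel_measurable_indicator E(1) borel_measurable_cnj_sgn psum_measurable[OF F])
  have g1: "norm (g x) \<le> indicator E x" for x by (auto simp: g_def indicator_def norm_sgn)
  have gl: "locally_integrable g"
    by (rule locally_integrableI_bounded[OF gm locally_integrable_const[of "1::real"], of 1])
       (use order_trans[OF g1 indicator_le_1] in simp)
  have eq: "psum b f F x * g x = complex_of_real (indicator E x * norm (psum b f F x))" for x
    using mult_cnj_sgn[of "psum b f F x"] by (simp add: g_def scaleR_conv_of_real)
  obtain C where C: "0 \<le> C" "\<And>x. norm (psum b f F x) \<le> C" using psum_bounded[OF F] by blast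
  have int: "set_integrable lebesgue E (\<lambda>x. norm (psum b f F x))"
  proof (rule locally_integrable_set_integrable[OF _ E])
    show "locally_integrable (\<lambda>x. norm (psum b f F x))"
      by (rule locally_integrableI_bounded[OF _ locally_integrable_const[of "1::real"], of _ C]) (use C in auto)
  qed
  have "(\<integral>\<^sup>+x\<in>E. ennreal (norm (psum b f F x)) \<partial>lebesgue) = ennreal (LINT x:E|lebesgue. norm (psum b f F x))"
    using int by (intro nn_integral_set_integral) auto
  also have "(LINT x:E|lebesgue. norm (psum b f F x)) = norm (LINT x|lebesgue. psum b f F x * g x)"
  proof -
    have "0 \<le> (LINT x|lebesgue. indicator E x * norm (psum b f F x))"
      by (intro integral_nonneg_AE) auto
    then show ?thesis
      unfolding eq set_lebesgue_integral_def
      by (simp only: integral_complex_of_real norm_of_real abs_of_nonneg real_scaleR_def)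
  qed
  also have "\<dots> \<le> (\<Sum>Q\<in>F. pairing f b g Q)" by (rule psum_mult_integral[OF b gl F])
  finally show thesis using that[OF gl g1] by (simp add: ennreal_leI)
qed

end

section \<open>The upper bound\<close>

lemma Linf_c_facts:
  fixes f :: "real^'n \<Rightarrow> 'k::{banach,second_countable_topology}"
  assumes "f \<in> Linf_c"
  shows Linf_c_li: "locally_integrable f"
    and Linf_c_Lp_int: "locally_integrable w \<Longrightarrow> (\<And>x. 0 \<le> w x) \<Longrightarrow> 0 \<le> p \<Longrightarrow> Lp_int p w f < \<infinity>"
proof -
  let ?S = "closure {x. f x \<noteq> 0}"
  have fm [measurable]: "f \<in> borel_measurable lebesgue" and S: "compact ?S"
    using assms by (auto simp: Linf_c_def)
  obtain C where C: "0 < C" "\<And>x. norm (f x) \<le> C"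
    using assms by (auto simp: Linf_c_def bounded_pos)
  show "locally_integrable f"
    by (rule locally_integrableI_bounded[OF fm locally_integrable_const[of "1::real"], of C]) (use C in auto)
  assume w: "locally_integrable w" "\<And>x. 0 \<le> w x"
  have sS: "?S \<in> sets lebesgue" using S by (simp add: lmeasurable_compact fmeasurableD)
  note [measurable] = locally_integrable_measurable[OF w(1)] sS
  show "Lp_int p w f < \<infinity>" if True: "0 \<le> p"
  proof -
    have "Lp_int p w f \<le> (\<integral>\<^sup>+x. ennreal (C powr p) * (ennreal (w x) * indicator ?S x) \<partial>lebesgue)"
      unfolding Lp_int_def
    proof (intro nn_integral_mono)
      fix x
      show "ennreal (norm (f x) powr p * w x) \<le> ennreal (C powr p) * (ennreal (w x) * indicator ?S x)"
      proof (cases "f x = 0")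
        case False
        then have "x \<in> ?S" using closure_subset[of "{x. f x \<noteq> 0}"] by auto
        then show ?thesis
          using C w(2)[of x] True by (auto simp: ennreal_mult[symmetric] intro!: ennreal_leI mult_right_mono powr_mono2)
      qed simp
    qed
    also have "\<dots> = ennreal (C powr p) * (\<integral>\<^sup>+x\<in>?S. ennreal (w x) \<partial>lebesgue)"
      using sS by (intro nn_integral_cmult) auto
    also have "(\<integral>\<^sup>+x\<in>?S. ennreal (w x) \<partial>lebesgue) = ennreal (LINT x:?S|lebesgue. w x)"
      using w S by (intro nn_integral_set_integral) (auto simp: locally_integrable_def)
    finally show ?thesis by (simp add: ennreal_mult_less_top le_less_trans)
  qed
qed

context bloom
begin

text \<open>Makes the dual function of \<open>psum_Lq\<close> have the same power integral with
  respect to \<open>\<sigma>\<close> as the partial sum has with respect to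
  \<open>\<kappa>\<close>.\<close>

lemma sigma_kappa: "\<kappa> x powr q' * \<sigma> x = \<kappa> x"
proof -
  have pos: "0 < \<kappa> x" "0 < \<sigma> x" by (rule kappa_pair)+
  have "(\<kappa> x powr (1 / q) * \<sigma> x powr (1 - 1 / q)) powr q' = 1" using kappa_pair(8)[of x] by simp
  then have "\<kappa> x powr (q' / q) * \<sigma> x = 1"
    using pos q'(3) by (simp add: powr_mult powr_powr mult.commute)
  then have "\<kappa> x * (\<kappa> x powr (q' / q) * \<sigma> x) = \<kappa> x" by simp
  moreover have "q' = 1 + q' / q" using q1 by (simp add: q'_def field_simps)
  then have "\<kappa> x powr q' = \<kappa> x * \<kappa> x powr (q' / q)"
    using pos by (metis powr_add powr_one less_imp_le)
  ultimately show ?thesis by (simp add: mult.assoc)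
qed

text \<open>The partial sum is tested against its dual function \<open>g\<close>. Their pairing and
  the q'-th power integral of \<open>g\<close> with respect to \<open>\<sigma>\<close> are both the
  quantity to be bounded, which is then absorbed.\<close>

lemma psum_Lq:
  assumes N: "form_bound N b" and b: "locally_integrable b" and f: "locally_integrable f" and F: "finite F" "F \<subseteq> D"
  shows "Lp_int q \<kappa> (psum b f F) \<le> ennpowr (ennreal (64 * 2 ^ CARD('n) * (N * Kf * Kg)) * ennpowr (Lp_int p \<mu> f) (1 / p)) q"
proof -
  let ?T = "psum b f F"
  obtain C where C: "0 \<le> C" "\<And>x. norm (?T x) \<le> C" using psum_bounded[OF F(2)] by blast
  have Tm: "?T \<in> borel_measurable lebesgue" by (rule psum_measurable[OF F(2)])
  have km: "\<kappa> \<in> borel_measurable lebesgue" using kappa_pair by (auto intro: locally_integrable_measurable)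
  define g where "g x = (norm (?T x) powr (q - 1) * \<kappa> x) *\<^sub>R cnj (sgn (?T x))" for x
  have nT: "(\<lambda>x. norm (?T x)) \<in> borel_measurable lebesgue"
    by (rule measurable_compose[OF Tm borel_measurable_norm])
  have gm: "g \<in> borel_measurable lebesgue"
    unfolding g_def
  proof (intro borel_measurable_scaleR borel_measurable_times km borel_measurable_cnj_sgn Tm)
    show "(\<lambda>x. norm (?T x) powr (q - 1)) \<in> borel_measurable lebesgue"
      using nT by measurable
  qed
  have ng: "norm (g x) = norm (?T x) powr (q - 1) * \<kappa> x" for x
    using kappa_pair(6)[of x] q1 by (cases "?T x = 0") (auto simp: g_def norm_sgn abs_mult)
  have gl: "locally_integrable g"
  proof (rule locally_integrableI_bounded[OF gm kappa_pair(2), of "C powr (q - 1)"])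
    show "norm (g x) \<le> C powr (q - 1) * norm (\<kappa> x)" for x
      unfolding ng using kappa_pair(6)[of x] q1 C by (auto intro!: mult_right_mono powr_mono2)
  qed
  have Tg: "?T x * g x = complex_of_real (norm (?T x) powr q * \<kappa> x)" for x
  proof -
    have "?T x * g x = (norm (?T x) powr (q - 1) * \<kappa> x) *\<^sub>R (?T x * cnj (sgn (?T x)))"
      by (simp add: g_def)
    also have "\<dots> = complex_of_real (norm (?T x) * norm (?T x) powr (q - 1) * \<kappa> x)"
      unfolding mult_cnj_sgn by (simp add: scaleR_conv_of_real)
    also have "norm (?T x) * norm (?T x) powr (q - 1) = norm (?T x) powr q"
      by (simp add: powr_mult_base)
    finally show ?thesis .
  qed
  let ?U = "\<Union>F"
  have U: "?U \<in> sets lebesgue" "bounded ?U"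
    using D_subset_sets[OF F(2)] F D_bounded by (auto intro!: bounded_Union)
  have Yeq: "Lp_int q \<kappa> ?T = ennreal (LINT x|lebesgue. norm (?T x) powr q * \<kappa> x)"
    and Ynn: "0 \<le> (LINT x|lebesgue. norm (?T x) powr q * \<kappa> x)"
  proof -
    \<comment> \<open>A priori finiteness for the absorption: the partial sum is bounded and
      supported in \<open>\<Union>F\<close>.\<close>
    have "integrable lebesgue (\<lambda>x. C powr q * (indicator ?U x *\<^sub>R \<kappa> x))"
      using locally_integrable_set_integrable[OF kappa_pair(2) U] by (auto simp: set_integrable_def)
    then have "integrable lebesgue (\<lambda>x. norm (?T x) powr q * \<kappa> x)"
    proof (rule Bochner_Integration.integrable_bound)
      show "(\<lambda>x. norm (?T x) powr q * \<kappa> x) \<in> borel_measurable lebesgue" using nT km by measurable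
      show "AE x in lebesgue. norm (norm (?T x) powr q * \<kappa> x) \<le> norm (C powr q * (indicator ?U x *\<^sub>R \<kappa> x))"
      proof (rule AE_I2)
        fix x
        show "norm (norm (?T x) powr q * \<kappa> x) \<le> norm (C powr q * (indicator ?U x *\<^sub>R \<kappa> x))"
        proof (cases "x \<in> ?U")
          case True
          then show ?thesis using kappa_pair(6)[of x] q1 C by (auto simp: abs_mult intro!: mult_right_mono powr_mono2)
        next
          case False
          then show ?thesis using psum_out[OF F(2)] q1 by simp
        qed
      qed
    qed
    then show "Lp_int q \<kappa> ?T = ennreal (LINT x|lebesgue. norm (?T x) powr q * \<kappa> x)"
      unfolding Lp_int_def using kappa_pair(6) by (intro nn_integral_eq_integral) auto
    show "0 \<le> (LINT x|lebesgue. norm (?T x) powr q * \<kappa> x)" using kappa_pair(6) by (intro integral_nonneg_AE) auto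
  qed
  have gY: "Lp_int q' \<sigma> g = Lp_int q \<kappa> ?T"
    unfolding Lp_int_def
  proof (intro nn_integral_cong arg_cong[of _ _ ennreal])
    fix x
    have "(q - 1) * q' = q" using q1 by (simp add: q'_def)
    then have "norm (g x) powr q' = norm (?T x) powr q * \<kappa> x powr q'"
      unfolding ng by (simp add: powr_mult powr_powr)
    then show "norm (g x) powr q' * \<sigma> x = norm (?T x) powr q * \<kappa> x"
      using sigma_kappa[of x] by (simp add: mult.assoc)
  qed
  have "Lp_int q \<kappa> ?T = ennreal (norm (LINT x|lebesgue. ?T x * g x))"
    unfolding Yeq Tg using Ynn by (simp only: integral_complex_of_real norm_of_real abs_of_nonneg)
  also have "\<dots> \<le> ennreal (\<Sum>Q\<in>F. pairing f b g Q)"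
    by (intro ennreal_leI psum_mult_integral b gl F)
  also have "\<dots> \<le> ennreal (64 * 2 ^ CARD('n) * (N * Kf * Kg)) * (ennpowr (Lp_int p \<mu> f) (1 / p) * ennpowr (Lp_int q' \<sigma> g) (1 / q'))"
    by (rule pairing_estimate[OF N f b gl F])
  also have "\<dots> = (ennreal (64 * 2 ^ CARD('n) * (N * Kf * Kg)) * ennpowr (Lp_int p \<mu> f) (1 / p)) * ennpowr (Lp_int q \<kappa> ?T) (1 - 1 / q)"
    unfolding gY q'(1) by (simp add: mult.assoc)
  finally have "Lp_int q \<kappa> ?T \<le> (ennreal (64 * 2 ^ CARD('n) * (N * Kf * Kg)) * ennpowr (Lp_int p \<mu> f) (1 / p)) * ennpowr (Lp_int q \<kappa> ?T) (1 - 1 / q)" .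
  moreover have "Lp_int q \<kappa> ?T < \<infinity>" unfolding Yeq by simp
  ultimately have "Lp_int q \<kappa> ?T \<le> ennpowr (ennreal (64 * 2 ^ CARD('n) * (N * Kf * Kg)) * ennpowr (Lp_int p \<mu> f) (1 / p)) (1 / (1 / q))"
    using q1 by (intro ennpowr_absorb[of _ "1 / q"]) auto
  then show ?thesis by simp
qed

lemma indicator_li: "Q \<in> D \<Longrightarrow> locally_integrable (indicator Q :: _ \<Rightarrow> complex)"
  by (rule locally_integrableI_bounded[OF _ locally_integrable_const[of "1::real"], of _ 1]) (auto simp: indicator_def)

lemma indicator_Lp:
  assumes "Q \<in> D" "locally_integrable w" "\<And>x. 0 \<le> w x"
  shows "Lp_int t w (indicator Q :: _ \<Rightarrow> complex) = ennreal (wt w Q)"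
proof -
  have "Lp_int t w (indicator Q :: _ \<Rightarrow> complex) = (\<integral>\<^sup>+x. ennreal (w x) * indicator Q x \<partial>lebesgue)"
    unfolding Lp_int_def by (intro nn_integral_cong) (auto simp: indicator_def)
  then show ?thesis using assms by (simp add: nn_integral_wt D_bounded)
qed

text \<open>Qualitative: testing on the indicator of \<open>Q0\<close> bounds all finite sums by one
  number. It may depend on \<open>f\<close>, \<open>b\<close> and \<open>Q0\<close>, as it serves
  convergence only and not the constant of the theorem.\<close>

lemma form_estimate_cube:
  assumes N: "form_bound N b" and f: "locally_integrable f" "Lp_int p \<mu> f < \<infinity>" and Q0: "Q0 \<in> D"
  shows "\<exists>T0. (\<forall>F. finite F \<longrightarrow> sparse F \<longrightarrow> (\<Sum>S\<in>F. avgn S f * osc S b * avgn S (indicator Q0) * mea S) \<le> T0) \<and>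
    (\<forall>F. finite F \<longrightarrow> F \<subseteq> D \<longrightarrow> locally_integrable b \<longrightarrow> (\<Sum>Q\<in>F. pairing f b (indicator Q0) Q) \<le> T0)"
proof -
  let ?A = "ennpowr (Lp_int p \<mu> f) (1 / p) * ennpowr (Lp_int q' \<sigma> (indicator Q0 :: _ \<Rightarrow> complex)) (1 / q')"
  have "Lp_int q' \<sigma> (indicator Q0 :: _ \<Rightarrow> complex) < \<infinity>"
    using indicator_Lp[OF Q0 kappa_pair(3,7)] by simp
  then have A: "?A < \<infinity>" using f(2) by (auto simp: ennreal_mult_less_top)
  define t where "t = enn2real (ennreal (64 * 2 ^ CARD('n) * (N * Kf * Kg)) * ?A) + enn2real (ennreal (N * Kf * Kg) * ?A)"
  have t1: "x \<le> t" if "ennreal x \<le> ennreal (N * Kf * Kg) * ?A" for x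
  proof -
    have "ennreal x \<le> ennreal (enn2real (ennreal (N * Kf * Kg) * ?A))"
      using that A by (simp add: ennreal_mult_less_top)
    then have "x \<le> enn2real (ennreal (N * Kf * Kg) * ?A)" by (simp add: ennreal_le_iff)
    then show ?thesis by (simp add: t_def add_increasing)
  qed
  have t2: "x \<le> t" if "ennreal x \<le> ennreal (64 * 2 ^ CARD('n) * (N * Kf * Kg)) * ?A" for x
  proof -
    have "ennreal x \<le> ennreal (enn2real (ennreal (64 * 2 ^ CARD('n) * (N * Kf * Kg)) * ?A))"
      using that A by (simp add: ennreal_mult_less_top)
    then have "x \<le> enn2real (ennreal (64 * 2 ^ CARD('n) * (N * Kf * Kg)) * ?A)" by (simp add: ennreal_le_iff)
    then show ?thesis by (simp add: t_def add_increasing2)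
  qed
  show ?thesis
  proof (intro exI[of _ t] conjI allI impI)
    fix F assume "finite F" "sparse F"
    then show "(\<Sum>S\<in>F. avgn S f * osc S b * avgn S (indicator Q0) * mea S) \<le> t"
      by (intro t1 form_estimate[OF N f(1) indicator_li[OF Q0]])
  next
    fix F assume "finite F" "F \<subseteq> D" "locally_integrable b"
    then show "(\<Sum>Q\<in>F. pairing f b (indicator Q0) Q) \<le> t"
      by (intro t2 pairing_estimate[OF N f(1) _ indicator_li[OF Q0]])
  qed
qed

text \<open>Weighting the Cauchy-Schwarz inequality by the sparse masses \<open>t\<close> turns the sum over all
  stopping trees into a single convergent series \<open>c\<close>, which controls all partial sums at once.\<close>

lemma below_small_tail:
  assumes N: "form_bound N b" and b: "locally_integrable b" and f: "locally_integrable f" "Lp_int p \<mu> f < \<infinity>" and Q0: "Q0 \<in> D"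
  shows "\<exists>c K B. 0 \<le> K \<and> (\<forall>Q\<in>{Q\<in>D. Q \<subseteq> Q0}. 0 \<le> c Q) \<and> (\<forall>F. finite F \<longrightarrow> F \<subseteq> {Q\<in>D. Q \<subseteq> Q0} \<longrightarrow> sum c F \<le> B) \<and>
    (\<forall>H. finite H \<longrightarrow> H \<subseteq> {Q\<in>D. Q \<subseteq> Q0} \<longrightarrow>
      (\<integral>\<^sup>+x\<in>Q0. ennreal (norm (psum b f H x)) \<partial>lebesgue) \<le> ennreal (sqrt (sum c H) * K))"
proof -
  let ?I = "{Q\<in>D. Q \<subseteq> Q0}"
  \<comment> \<open>A constant in the place of \<open>g\<close> never triggers its stopping
    condition, so the family depends on \<open>f\<close> and \<open>b\<close> alone and serves all
    test functions at once.\<close>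
  let ?g1 = "\<lambda>x. 1 :: complex"
  let ?st = "stop_avg f b ?g1"
  let ?SS = "stop_family ?st {Q0}"
  have T: "{Q0} \<subseteq> D" "disjoint {Q0}" using Q0 by auto
  have lg: "locally_integrable ?g1" by (rule locally_integrable_const)
  have sp: "sparse ?SS" by (rule sparse_stop_avg[OF f(1) b lg T])
  have SSD: "?SS \<subseteq> D" by (rule stop_family_D[OF T(1)])
  have "\<forall>Q\<in>?I. \<exists>S\<in>?SS. Q \<in> stop_tree ?st S"
  proof
    fix Q assume "Q \<in> ?I"
    then show "\<exists>S\<in>?SS. Q \<in> stop_tree ?st S" using ex_stop_tree[OF T(1), of Q Q0] by auto
  qed
  then have "\<forall>Q\<in>?I. \<exists>S. S \<in> ?SS \<and> Q \<in> stop_tree ?st S" by blast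
  from bchoice[OF this] obtain st where "\<forall>Q\<in>?I. st Q \<in> ?SS \<and> Q \<in> stop_tree ?st (st Q)"
    by (rule exE)
  then have st: "\<And>Q. Q \<in> ?I \<Longrightarrow> st Q \<in> ?SS" "\<And>Q. Q \<in> ?I \<Longrightarrow> Q \<in> stop_tree ?st (st Q)"
    by simp_all
  have stD: "st Q \<in> D" if "Q \<in> ?I" for Q using st(1)[OF that] SSD by auto
  have SSQ0: "S \<subseteq> Q0" if S: "S \<in> ?SS" for S
  proof -
    obtain n where "S \<in> stop_gen ?st {Q0} (0 + n)" using S by (auto simp: stop_family_def)
    then show ?thesis using stop_gen_ancestor[of S ?st "{Q0}" 0 n] by auto
  qed
  obtain T0 where T0: "\<And>F. finite F \<Longrightarrow> sparse F \<Longrightarrow> (\<Sum>S\<in>F. avgn S f * osc S b * avgn S (indicator Q0) * mea S) \<le> T0"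
    using form_estimate_cube[OF N f Q0] by auto
  \<comment> \<open>By \<open>av1\<close> below, these are the terms of the sparse form tested on
    the indicator of \<open>Q0\<close>, so their finite sums are at most \<open>T0\<close>.\<close>
  define t where "t S = avgn S f * osc S b * mea S" for S
  have t0: "0 \<le> t S" for S by (simp add: t_def)
  have av1: "avgn S (indicator Q0) = 1" if "S \<in> ?SS" for S
  proof -
    have SD: "S \<in> D" using that SSD by auto
    have "mea S * avgn S (indicator Q0) = (LINT x:S|lebesgue. 1)"
      unfolding avgn_integral[OF SD, symmetric]
      using SSQ0[OF that] by (intro set_lebesgue_integral_cong) (use SD in auto)
    also have "\<dots> = mea S" using D_lmeasurable[OF SD] by (simp add: set_integral_const_fmeasurable)
    finally show ?thesis using D_measure_pos[OF SD] by simp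
  qed
  have tsum: "(\<Sum>S\<in>F. t S) \<le> T0" if "finite F" "F \<subseteq> ?SS" for F
  proof -
    have "(\<Sum>S\<in>F. t S) = (\<Sum>S\<in>F. avgn S f * osc S b * avgn S (indicator Q0) * mea S)"
      using that av1 by (intro sum.cong) (auto simp: t_def)
    also have "\<dots> \<le> T0" using that sp by (intro T0) (auto intro: sparse_subset)
    finally show ?thesis .
  qed
  have T00: "0 \<le> T0" using tsum[of "{}"] by simp
  define a where "a Q = (norm (average Q f))\<^sup>2 * energy Q b" for Q
  have a0: "0 \<le> a Q" for Q by (simp add: a_def)
  \<comment> \<open>64 is the square of the factor 8 for \<open>f\<close>; another 8 and
    \<open>2 ^ CARD('n)\<close> come from the energy of \<open>b\<close>.\<close>
  let ?C1 = "512 * 2 ^ CARD('n) :: real"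
  have atree: "sum a G \<le> ?C1 * (avgn S f * osc S b)\<^sup>2 * mea S"
    if S: "S \<in> D" and G: "finite G" "G \<subseteq> stop_tree ?st S" for S G
  proof -
    have "sum a G \<le> (\<Sum>Q\<in>G. (8 * avgn S f)\<^sup>2 * energy Q b)"
      unfolding a_def
    proof (intro sum_mono mult_right_mono power_mono)
      fix Q assume "Q \<in> G"
      then have "Q \<in> D" "Q \<in> stop_tree ?st S" using G by (auto simp: stop_tree_def)
      then show "norm (average Q f) \<le> 8 * avgn S f"
        using norm_average_le[OF f(1), of Q] stop_tree_avgn(1)[OF S] by fastforce
    qed auto
    also have "\<dots> = (8 * avgn S f)\<^sup>2 * (\<Sum>Q\<in>G. energy Q b)" by (simp add: sum_distrib_left)
    also have "\<dots> \<le> (8 * avgn S f)\<^sup>2 * (2 ^ CARD('n) * 8 * (osc S b)\<^sup>2 * mea S)"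
      by (intro mult_left_mono stop_tree_energy(2)[OF b lg S G]) auto
    finally show ?thesis by (simp add: power_mult_distrib mult_ac)
  qed
  \<comment> \<open>Chosen so that \<open>a Q\<close> is \<open>c Q\<close> times
    \<open>t (st Q) / mea (st Q)\<close>. The first factor is summable; the second weights the
    energies of the test function so that each tree contributes at most a multiple of
    \<open>t S\<close>. If \<open>t (st Q)\<close> is 0, then so is \<open>a Q\<close>.\<close>
  define c where "c Q = (if t (st Q) = 0 then 0 else mea (st Q) * a Q / t (st Q))" for Q
  have c0: "0 \<le> c Q" for Q using t0 a0 by (simp add: c_def)
  have ac: "a Q = c Q * (t (st Q) / mea (st Q))" if Q: "Q \<in> ?I" for Q
  proof (cases "t (st Q) = 0")
    case True
    have "sum a {Q} \<le> ?C1 * (avgn (st Q) f * osc (st Q) b)\<^sup>2 * mea (st Q)"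
      by (rule atree[OF stD[OF Q]]) (use st(2)[OF Q] in auto)
    moreover have "avgn (st Q) f * osc (st Q) b = 0" using True D_measure_pos[OF stD[OF Q]] by (simp add: t_def)
    ultimately have "a Q \<le> 0" by simp
    then show ?thesis using a0[of Q] True by simp
  next
    case False
    then show ?thesis using D_measure_pos[OF stD[OF Q]] by (simp add: c_def)
  qed
  have group: "(\<Sum>Q\<in>H. h Q) = (\<Sum>S\<in>st ` H. \<Sum>Q\<in>{Q\<in>H. st Q = S}. h Q)" if "finite H" for H and h :: "(real^'n) set \<Rightarrow> real"
    by (rule sum.image_gen[OF that])
  have csum: "sum c H \<le> ?C1 * T0" if H: "finite H" "H \<subseteq> ?I" for H
  proof -
    have "sum c H = (\<Sum>S\<in>st ` H. \<Sum>Q\<in>{Q\<in>H. st Q = S}. c Q)" by (rule group[OF H(1)])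
    also have "\<dots> \<le> (\<Sum>S\<in>st ` H. ?C1 * t S)"
    proof (intro sum_mono)
      fix S assume "S \<in> st ` H"
      then have SD: "S \<in> D" using H stD by auto
      let ?G = "{Q\<in>H. st Q = S}"
      show "(\<Sum>Q\<in>?G. c Q) \<le> ?C1 * t S"
      proof (cases "t S = 0")
        case True
        then have "(\<Sum>Q\<in>?G. c Q) = 0" by (intro sum.neutral) (auto simp: c_def)
        then show ?thesis using True by simp
      next
        case False
        have "(\<Sum>Q\<in>?G. c Q) = mea S / t S * sum a ?G"
          unfolding sum_distrib_left using False by (intro sum.cong) (auto simp: c_def)
        also have "\<dots> \<le> mea S / t S * (?C1 * (avgn S f * osc S b)\<^sup>2 * mea S)"
        proof (intro mult_left_mono atree[OF SD])
          show "?G \<subseteq> stop_tree ?st S" using H(2) st(2) by auto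
        qed (use H(1) t0 in auto)
        also have "\<dots> = ?C1 * ((t S)\<^sup>2 / t S)" by (simp add: t_def power_mult_distrib power2_eq_square mult_ac)
        also have "(t S)\<^sup>2 / t S = t S" by (simp add: power2_eq_square)
        finally show ?thesis .
      qed
    qed
    also have "\<dots> = ?C1 * (\<Sum>S\<in>st ` H. t S)" by (simp add: sum_distrib_left)
    also have "\<dots> \<le> ?C1 * T0" using H st(1) by (intro mult_left_mono tsum) auto
    finally show ?thesis .
  qed
  have L1: "(\<integral>\<^sup>+x\<in>Q0. ennreal (norm (psum b f H x)) \<partial>lebesgue) \<le> ennreal (sqrt (sum c H) * sqrt (2 ^ CARD('n) * T0))"
    if H: "finite H" "H \<subseteq> ?I" for H
  proof -
    have HD: "H \<subseteq> D" using H by auto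
    obtain g where g: "locally_integrable g" "\<And>x. norm (g x) \<le> indicator Q0 x"
      "(\<integral>\<^sup>+x\<in>Q0. ennreal (norm (psum b f H x)) \<partial>lebesgue) \<le> ennreal (\<Sum>Q\<in>H. pairing f b g Q)"
      using psum_L1[OF b HD D_sets[OF Q0] D_bounded[OF Q0], of f] by blast
    have av: "avgn Q g \<le> 1" if "Q \<in> D" for Q
    proof -
      have "mea Q * avgn Q g \<le> (LINT x:Q|lebesgue. 1)"
        unfolding avgn_integral[OF that, symmetric]
        using g(1,2) that by (intro set_integral_mono set_integrable_D locally_integrable_norm locally_integrable_const)
          (auto intro: order_trans[OF g(2) indicator_le_1])
      then show ?thesis using D_measure_pos[OF that] D_lmeasurable[OF that]
        by (simp add: set_integral_const_fmeasurable)
    qed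
    \<comment> \<open>All averages of \<open>norm (g x)\<close> are at most 1, so
      \<open>energy_sum_le\<close> applies with the whole lattice as \<open>A\<close> and threshold
      1.\<close>
    have eg: "(\<Sum>Q\<in>G. energy Q g) \<le> 2 ^ CARD('n) * mea S" if S: "S \<in> D" and G: "finite G" "G \<subseteq> D" "\<And>Q. Q \<in> G \<Longrightarrow> Q \<subseteq> S" for S G
    proof -
      have "(\<Sum>Q\<in>G. energy Q g) \<le> 2 ^ CARD('n) * 1 * (mea S * avgn S g)"
        by (rule energy_sum_le[OF g(1) order_refl av]) (use S G in auto)
      also have "\<dots> \<le> 2 ^ CARD('n) * 1 * (mea S * 1)" by (intro mult_left_mono av S) auto
      finally show ?thesis by simp
    qed
    have "(\<Sum>Q\<in>H. pairing f b g Q) = (\<Sum>Q\<in>H. sqrt (c Q) * sqrt (t (st Q) / mea (st Q) * energy Q g))"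
    proof (intro sum.cong refl)
      fix Q assume "Q \<in> H"
      then have Q: "Q \<in> ?I" using H by auto
      have "pairing f b g Q = sqrt (a Q) * sqrt (energy Q g)"
        by (simp add: pairing_def a_def real_sqrt_mult)
      then show "pairing f b g Q = sqrt (c Q) * sqrt (t (st Q) / mea (st Q) * energy Q g)"
        unfolding ac[OF Q] by (simp only: real_sqrt_mult mult.assoc)
    qed
    also have "\<dots> \<le> sqrt (sum c H) * sqrt (\<Sum>Q\<in>H. t (st Q) / mea (st Q) * energy Q g)"
      using c0 t0 by (intro sum_sqrt_mult_le) auto
    also have "(\<Sum>Q\<in>H. t (st Q) / mea (st Q) * energy Q g) \<le> 2 ^ CARD('n) * T0"
    proof -
      have "(\<Sum>Q\<in>H. t (st Q) / mea (st Q) * energy Q g) = (\<Sum>S\<in>st ` H. \<Sum>Q\<in>{Q\<in>H. st Q = S}. t S / mea S * energy Q g)"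
        by (subst group[OF H(1)]) (intro sum.cong refl, auto)
      also have "\<dots> \<le> (\<Sum>S\<in>st ` H. t S / mea S * (2 ^ CARD('n) * mea S))"
      proof (intro sum_mono)
        fix S assume S: "S \<in> st ` H"
        then have SD: "S \<in> D" using H stD by auto
        have "(\<Sum>Q\<in>{Q\<in>H. st Q = S}. energy Q g) \<le> 2 ^ CARD('n) * mea S"
        proof (rule eg[OF SD])
          show "Q \<subseteq> S" if "Q \<in> {Q\<in>H. st Q = S}" for Q
            using that H st(2)[of Q] by (auto simp: stop_tree_def)
        qed (use H in auto)
        then show "(\<Sum>Q\<in>{Q\<in>H. st Q = S}. t S / mea S * energy Q g) \<le> t S / mea S * (2 ^ CARD('n) * mea S)"
          unfolding sum_distrib_left[symmetric] using t0 by (intro mult_left_mono) auto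
      qed
      also have "\<dots> = 2 ^ CARD('n) * (\<Sum>S\<in>st ` H. t S)"
        unfolding sum_distrib_left
      proof (intro sum.cong refl)
        fix S assume "S \<in> st ` H"
        then have "0 < mea S" using H stD D_measure_pos by auto
        then show "t S / mea S * (2 ^ CARD('n) * mea S) = 2 ^ CARD('n) * t S" by simp
      qed
      also have "\<dots> \<le> 2 ^ CARD('n) * T0" using H st(1) by (intro mult_left_mono tsum) auto
      finally show ?thesis .
    qed
    finally have "(\<Sum>Q\<in>H. pairing f b g Q) \<le> sqrt (sum c H) * sqrt (2 ^ CARD('n) * T0)"
      using c0 by (simp add: mult_left_mono sum_nonneg)
    then show ?thesis using g(3) by (meson ennreal_leI order_trans)
  qed
  show ?thesis
    by (rule exI[of _ c], rule exI[of _ "sqrt (2 ^ CARD('n) * T0)"], rule exI[of _ "?C1 * T0"])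
       (use c0 csum L1 T00 in auto)
qed

end

lemma is_paraproduct_li:
  "is_paraproduct D b f g \<Longrightarrow> locally_integrable g"
  by (auto simp: is_paraproduct_def has_uncond_L1_sum_def locally_integrable_def)

context dyadic
begin

text \<open>A cube strictly inside \<open>Q\<close> lies in a single child of
  \<open>Q\<close>.\<close>

lemma above_const:
  fixes b :: "real^'n \<Rightarrow> complex"
  assumes Q: "Q \<in> D" and Q0: "Q0 \<in> D" "Q0 \<subset> Q"
  obtains z where "\<And>x. x \<in> Q0 \<Longrightarrow> mart_diff D Q b x = z"
proof -
  obtain k l where k: "Q \<in> Dk k" and l: "Q0 \<in> Dk l" using Q Q0 by (metis DE)
  have kl: "k + 1 \<le> l" using D_level_strict[OF l k Q0(2)] by simp
  obtain x where x: "x \<in> Q0" using D_nonempty[OF Q0(1)] by blast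
  then have "x \<in> \<Union>(children Q)" using Union_children[OF Q] Q0 by blast
  then obtain R where R: "R \<in> children Q" "x \<in> R" by auto
  have "Q0 \<subseteq> R"
    using Dk_nested[OF l _ _ kl, of R] R x children_Dk[OF k] by auto
  then show thesis using that mart_diff_in[OF Q R(1)] by blast
qed

text \<open>The martingale difference of a larger cube is constant on \<open>Q0\<close>, so its L^1
  norm there is the modulus of its integral, which the pairing with the indicator dominates. Above
  \<open>Q0\<close> the series therefore converges absolutely.\<close>

lemma above_L1:
  assumes b: "locally_integrable b" and Q: "Q \<in> D" and Q0: "Q0 \<in> D" "Q0 \<subset> Q"
  shows "(\<integral>\<^sup>+x\<in>Q0. ennreal (norm (para_term D b f Q x)) \<partial>lebesgue) \<le> ennreal (pairing f b (indicator Q0) Q)"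
proof -
  obtain z where z: "\<And>x. x \<in> Q0 \<Longrightarrow> mart_diff D Q b x = z" using above_const[OF Q Q0] by blast
  have li: "locally_integrable (indicator Q0 :: _ \<Rightarrow> complex)"
    by (rule locally_integrableI_bounded[OF _ locally_integrable_const[of "1::real"], of _ 1])
       (use Q0 in \<open>auto simp: indicator_def\<close>)
  have "(LINT x|lebesgue. mart_diff D Q b x * indicator Q0 x) = (LINT x:Q0|lebesgue. z)"
    unfolding set_lebesgue_integral_def
    by (intro Bochner_Integration.integral_cong) (auto simp: z indicator_def)
  also have "\<dots> = mea Q0 *\<^sub>R z" using D_lmeasurable[OF Q0(1)] by (simp add: set_integral_const_fmeasurable)
  finally have "mea Q0 * norm z \<le> sqrt (energy Q b) * sqrt (energy Q (indicator Q0))"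
    using mart_diff_mult_le[OF b li Q] by simp
  then have le: "mea Q0 * norm (z * average Q f) \<le> pairing f b (indicator Q0) Q"
  proof -
    have "norm (average Q f) * (mea Q0 * norm z) \<le> norm (average Q f) * (sqrt (energy Q b) * sqrt (energy Q (indicator Q0)))"
      by (rule mult_left_mono) (fact, simp)
    then show ?thesis by (simp add: pairing_def norm_mult mult_ac)
  qed
  have "(\<integral>\<^sup>+x\<in>Q0. ennreal (norm (para_term D b f Q x)) \<partial>lebesgue) = (\<integral>\<^sup>+x\<in>Q0. ennreal (norm (z * average Q f)) \<partial>lebesgue)"
    by (intro nn_set_integral_cong_on) (simp add: para_term_def z)
  also have "\<dots> = ennreal (norm (z * average Q f)) * ennreal (mea Q0)"
    unfolding D_emeasure[OF Q0(1), symmetric] using D_sets[OF Q0(1)] by (rule nn_integral_cmult_indicator)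
  also have "\<dots> \<le> ennreal (pairing f b (indicator Q0) Q)"
    using le by (simp add: ennreal_mult[symmetric] ennreal_leI mult.commute)
  finally show ?thesis .
qed

end

section \<open>Existence and norm of the paraproduct\<close>

context bloom
begin

text \<open>Cubes disjoint from \<open>Q0\<close> vanish on it. Those inside are controlled by
  \<open>below_small_tail\<close>, those strictly above by \<open>above_L1\<close>; each kind has a
  finite set outside of which the error is at most \<open>e / 2\<close>.\<close>

lemma cube_Cauchy:
  assumes N: "form_bound N b" and b: "locally_integrable b" and f: "locally_integrable f" "Lp_int p \<mu> f < \<infinity>"
    and Q0: "Q0 \<in> D" and e: "0 < e"
  shows "\<exists>G. finite G \<and> G \<subseteq> D \<and> (\<forall>H. finite H \<longrightarrow> H \<subseteq> D \<longrightarrow> H \<inter> G = {} \<longrightarrow>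
     (\<integral>\<^sup>+x\<in>Q0. ennreal (norm (\<Sum>Q\<in>H. para_term D b f Q x)) \<partial>lebesgue) \<le> ennreal e)"
proof -
  let ?I1 = "{Q\<in>D. Q \<subseteq> Q0}" and ?I2 = "{Q\<in>D. Q0 \<subset> Q}"
  obtain c K B where c: "0 \<le> K" "\<And>Q. Q \<in> ?I1 \<Longrightarrow> 0 \<le> c Q" "\<And>F. finite F \<Longrightarrow> F \<subseteq> ?I1 \<Longrightarrow> sum c F \<le> B"
    "\<And>H. finite H \<Longrightarrow> H \<subseteq> ?I1 \<Longrightarrow> (\<integral>\<^sup>+x\<in>Q0. ennreal (norm (psum b f H x)) \<partial>lebesgue) \<le> ennreal (sqrt (sum c H) * K)"
  proof -
    obtain c K B where "0 \<le> K \<and> (\<forall>Q\<in>?I1. 0 \<le> c Q) \<and> (\<forall>F. finite F \<longrightarrow> F \<subseteq> ?I1 \<longrightarrow> sum c F \<le> B) \<and>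
      (\<forall>H. finite H \<longrightarrow> H \<subseteq> ?I1 \<longrightarrow> (\<integral>\<^sup>+x\<in>Q0. ennreal (norm (psum b f H x)) \<partial>lebesgue) \<le> ennreal (sqrt (sum c H) * K))"
      using below_small_tail[OF N b f Q0] by (elim exE)
    then show thesis by (intro that[of K c B]) simp_all
  qed
  \<comment> \<open>The error is \<open>sqrt (sum c H) * K\<close>, so the tail of \<open>c\<close>
    is made smaller than a square; \<open>K + 1\<close> guards against \<open>K = 0\<close>.\<close>
  obtain G1 where G1: "finite G1" "G1 \<subseteq> ?I1"
    "\<And>H. finite H \<Longrightarrow> H \<subseteq> ?I1 \<Longrightarrow> H \<inter> G1 = {} \<Longrightarrow> sum c H < (e / (2 * (K + 1)))\<^sup>2"
  proof -
    have "0 < (e / (2 * (K + 1)))\<^sup>2" using c(1) e by (intro zero_less_power) auto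
    then have "\<exists>G. finite G \<and> G \<subseteq> ?I1 \<and> (\<forall>H. finite H \<longrightarrow> H \<subseteq> ?I1 \<longrightarrow> H \<inter> G = {} \<longrightarrow> sum c H < (e / (2 * (K + 1)))\<^sup>2)"
      by (intro bounded_finite_sums_small_tail[of ?I1 c B] c)
    then obtain G where "finite G \<and> G \<subseteq> ?I1 \<and> (\<forall>H. finite H \<longrightarrow> H \<subseteq> ?I1 \<longrightarrow> H \<inter> G = {} \<longrightarrow> sum c H < (e / (2 * (K + 1)))\<^sup>2)"
      by (rule exE)
    then show thesis by (intro that[of G]) simp_all
  qed
  obtain T0 where T0: "\<And>F. finite F \<Longrightarrow> F \<subseteq> D \<Longrightarrow> locally_integrable b \<Longrightarrow> (\<Sum>Q\<in>F. pairing f b (indicator Q0) Q) \<le> T0"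
    using form_estimate_cube[OF N f Q0] by auto
  have pn: "0 \<le> pairing f b (indicator Q0) Q" for Q by (simp add: pairing_def)
  obtain G2 where G2: "finite G2" "G2 \<subseteq> ?I2"
    "\<And>H. finite H \<Longrightarrow> H \<subseteq> ?I2 \<Longrightarrow> H \<inter> G2 = {} \<Longrightarrow> sum (pairing f b (indicator Q0)) H < e / 2"
  proof -
    have "\<exists>G. finite G \<and> G \<subseteq> ?I2 \<and> (\<forall>H. finite H \<longrightarrow> H \<subseteq> ?I2 \<longrightarrow> H \<inter> G = {} \<longrightarrow> sum (pairing f b (indicator Q0)) H < e / 2)"
    proof (rule bounded_finite_sums_small_tail[of _ _ T0])
      show "sum (pairing f b (indicator Q0)) F \<le> T0" if "finite F" "F \<subseteq> ?I2" for F
        using that b by (intro T0) auto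
    qed (use pn e in auto)
    then obtain G where "finite G \<and> G \<subseteq> ?I2 \<and> (\<forall>H. finite H \<longrightarrow> H \<subseteq> ?I2 \<longrightarrow> H \<inter> G = {} \<longrightarrow> sum (pairing f b (indicator Q0)) H < e / 2)"
      by (rule exE)
    then show thesis by (intro that[of G]) simp_all
  qed
  show ?thesis
  proof (intro exI[of _ "G1 \<union> G2"] conjI allI impI)
    show "finite (G1 \<union> G2)" "G1 \<union> G2 \<subseteq> D" using G1 G2 by auto
    fix H assume H: "finite H" "H \<subseteq> D" "H \<inter> (G1 \<union> G2) = {}"
    let ?H1 = "{Q\<in>H. Q \<subseteq> Q0}" and ?H2 = "{Q\<in>H. Q0 \<subset> Q}"
    have eq: "(\<Sum>Q\<in>H. para_term D b f Q x) = psum b f ?H1 x + psum b f ?H2 x" if x: "x \<in> Q0" for x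
    proof -
      have "(\<Sum>Q\<in>H. para_term D b f Q x) = (\<Sum>Q\<in>?H1 \<union> ?H2. para_term D b f Q x)"
      proof (rule sum.mono_neutral_right[OF H(1)])
        show "\<forall>Q\<in>H - (?H1 \<union> ?H2). para_term D b f Q x = 0"
        proof
          fix Q assume Q: "Q \<in> H - (?H1 \<union> ?H2)"
          then have QD: "Q \<in> D" using H by auto
          have "x \<notin> Q" using D_nested[OF QD Q0] Q x by auto
          then show "para_term D b f Q x = 0" unfolding para_term_def by (simp add: mart_diff_out[OF QD])
        qed
      qed auto
      also have "\<dots> = psum b f ?H1 x + psum b f ?H2 x"
        unfolding psum_def using H(1) by (intro sum.union_disjoint) auto
      finally show ?thesis .
    qed
    have "(\<integral>\<^sup>+x\<in>Q0. ennreal (norm (\<Sum>Q\<in>H. para_term D b f Q x)) \<partial>lebesgue)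
      = (\<integral>\<^sup>+x\<in>Q0. ennreal (norm (psum b f ?H1 x + psum b f ?H2 x)) \<partial>lebesgue)"
      by (intro nn_set_integral_cong_on) (simp add: eq)
    also have "\<dots> \<le> (\<integral>\<^sup>+x\<in>Q0. ennreal (norm (psum b f ?H1 x)) \<partial>lebesgue) + (\<integral>\<^sup>+x\<in>Q0. ennreal (norm (psum b f ?H2 x)) \<partial>lebesgue)"
      using H Q0 by (intro nn_set_integral_norm_triangle psum_measurable) auto
    also have "\<dots> \<le> ennreal (e / 2) + ennreal (e / 2)"
    proof (intro add_mono)
      have "sum c ?H1 < (e / (2 * (K + 1)))\<^sup>2" using H by (intro G1(3)) auto
      then have "sqrt (sum c ?H1) \<le> e / (2 * (K + 1))"
        using e c(1) by (intro real_le_lsqrt) auto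
      then have "sqrt (sum c ?H1) * K \<le> e / (2 * (K + 1)) * K" using c(1) by (rule mult_right_mono)
      also have "\<dots> \<le> e / 2" using e c(1) by (simp add: field_simps)
      finally have "sqrt (sum c ?H1) * K \<le> e / 2" .
      moreover have "(\<integral>\<^sup>+x\<in>Q0. ennreal (norm (psum b f ?H1 x)) \<partial>lebesgue) \<le> ennreal (sqrt (sum c ?H1) * K)"
        using H by (intro c(4)) auto
      ultimately show "(\<integral>\<^sup>+x\<in>Q0. ennreal (norm (psum b f ?H1 x)) \<partial>lebesgue) \<le> ennreal (e / 2)"
        by (meson ennreal_leI order_trans)
    next
      have fm: "(\<lambda>x. ennreal (norm (para_term D b f Q x)) * indicator Q0 x) \<in> borel_measurable lebesgue" if "Q \<in> ?H2" for Q
        using that H Q0 by (intro borel_measurable_times_ennreal measurable_compose[OF _ measurable_ennreal]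
          measurable_compose[OF para_term_measurable borel_measurable_norm]) auto
      have "(\<integral>\<^sup>+x\<in>Q0. ennreal (norm (psum b f ?H2 x)) \<partial>lebesgue) \<le> (\<integral>\<^sup>+x. (\<Sum>Q\<in>?H2. ennreal (norm (para_term D b f Q x)) * indicator Q0 x) \<partial>lebesgue)"
        unfolding psum_def sum_distrib_right[symmetric]
        by (intro nn_integral_mono mult_right_mono) (auto simp: sum_ennreal intro: norm_sum ennreal_leI)
      also have "\<dots> = (\<Sum>Q\<in>?H2. \<integral>\<^sup>+x\<in>Q0. ennreal (norm (para_term D b f Q x)) \<partial>lebesgue)"
        by (intro nn_integral_sum fm)
      also have "\<dots> \<le> (\<Sum>Q\<in>?H2. ennreal (pairing f b (indicator Q0) Q))"
        using H Q0 by (intro sum_mono above_L1[OF b]) auto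
      also have "\<dots> = ennreal (sum (pairing f b (indicator Q0)) ?H2)" using pn by (simp add: sum_ennreal)
      also have "\<dots> \<le> ennreal (e / 2)" by (rule ennreal_leI, rule less_imp_le, rule G2(3)) (use H in auto)
      finally show "(\<integral>\<^sup>+x\<in>Q0. ennreal (norm (psum b f ?H2 x)) \<partial>lebesgue) \<le> ennreal (e / 2)" .
    qed
    also have "\<dots> = ennreal e" using e by (simp add: ennreal_plus[symmetric] del: ennreal_plus)
    finally show "(\<integral>\<^sup>+x\<in>Q0. ennreal (norm (\<Sum>Q\<in>H. para_term D b f Q x)) \<partial>lebesgue) \<le> ennreal e" .
  qed
qed

lemma ex_paraproduct:
  assumes N: "form_bound N b" and b: "locally_integrable b" and f: "locally_integrable f" "Lp_int p \<mu> f < \<infinity>"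
  shows "\<exists>g. is_paraproduct D b f g"
proof -
  have "\<exists>g. has_uncond_L1_sum (para_term D b f) D Q g" if "Q \<in> D" for Q
    using that para_term_measurable para_term_set_integrable cube_Cauchy[OF N b f that]
    by (intro has_uncond_L1_sum_Cauchy) auto
  then have "\<forall>Q\<in>D. \<exists>g. has_uncond_L1_sum (para_term D b f) D Q g" by blast
  from bchoice[OF this] obtain G where "\<forall>Q\<in>D. has_uncond_L1_sum (para_term D b f) D Q (G Q)"
    by (rule exE)
  then have G: "\<And>Q. Q \<in> D \<Longrightarrow> has_uncond_L1_sum (para_term D b f) D Q (G Q)" by simp
  \<comment> \<open>The limits on different cubes are unrelated representatives. Gluing along
    generation 0, a partition of the space, gives one function for all compact sets.\<close>
  define g where "g x = G (SOME Q. Q \<in> Dk 0 \<and> x \<in> Q) x" for x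
  have gQ: "g x = G Q x" if "Q \<in> Dk 0" "x \<in> Q" for Q x
  proof -
    have "(SOME Q. Q \<in> Dk 0 \<and> x \<in> Q) = Q"
    proof (rule some_equality)
      show "Q \<in> Dk 0 \<and> x \<in> Q" using that by simp
      show "R = Q" if R: "R \<in> Dk 0 \<and> x \<in> R" for R
        by (rule Dk_eq[of R 0 Q]) (use R \<open>Q \<in> Dk 0\<close> \<open>x \<in> Q\<close> in auto)
    qed
    then show ?thesis by (simp add: g_def)
  qed
  have g: "has_uncond_L1_sum (para_term D b f) D Q g" if "Q \<in> Dk 0" for Q
    by (rule has_uncond_L1_sum_cong[OF G[OF Dk_D[OF that]]]) (use gQ[OF that] in simp)
  have cov: "\<exists>T. finite T \<and> T \<subseteq> Dk 0 \<and> K \<subseteq> \<Union>T" if "bounded K" for K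
  proof (intro exI[of _ "{Q \<in> Dk 0. Q \<inter> K \<noteq> {}}"] conjI finite_Dk_meets[OF that] subsetI)
    fix x assume "x \<in> K"
    moreover obtain Q where "Q \<in> Dk 0" "x \<in> Q" using Dk_cover by blast
    ultimately show "x \<in> \<Union>{Q \<in> Dk 0. Q \<inter> K \<noteq> {}}" by auto
  qed auto
  have "locally_integrable g"
    unfolding locally_integrable_def
  proof (intro allI impI)
    fix K :: "(real^'n) set" assume K: "compact K"
    obtain T where T: "finite T" "T \<subseteq> Dk 0" "K \<subseteq> \<Union>T" using cov[OF compact_imp_bounded[OF K]] by auto
    have "set_integrable lebesgue (\<Union>Q\<in>T. Q) g"
      using T g Dk_D by (intro set_integrable_UN) (auto simp: has_uncond_L1_sum_def)
    then show "set_integrable lebesgue K g"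
      by (rule set_integrable_subset) (use K T in \<open>auto simp: lmeasurable_compact fmeasurableD\<close>)
  qed
  then have gm: "g \<in> borel_measurable lebesgue" by (rule locally_integrable_measurable)
  have "is_paraproduct D b f g"
    unfolding is_paraproduct_def
  proof (intro allI impI)
    fix K :: "(real^'n) set" assume K: "compact K"
    obtain T where T: "finite T" "T \<subseteq> Dk 0" "K \<subseteq> \<Union>T" using cov[OF compact_imp_bounded[OF K]] by auto
    show "has_uncond_L1_sum (para_term D b f) D K g"
    proof (rule has_uncond_L1_sum_subset_Union[OF T(1) _ _ T(3) g _ gm])
      show "T \<subseteq> sets lebesgue" using T Dk_D by auto
      show "K \<in> sets lebesgue" using K by (simp add: lmeasurable_compact fmeasurableD)
    qed (use T para_term_measurable in auto)
  qed
  then show ?thesis by (intro exI)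
qed

text \<open>Convergence in L^1 on a compact set yields an almost everywhere convergent sequence of
  partial sums, so a uniform bound passes to the limit by Fatou. A second use of Fatou exhausts the
  space by balls.\<close>

lemma paraproduct_Fatou:
  assumes g: "is_paraproduct D b f g" and w: "locally_integrable w" "\<And>x. 0 \<le> w x" and t: "0 < t"
    and B: "\<And>F. finite F \<Longrightarrow> F \<subseteq> D \<Longrightarrow> Lp_int t w (psum b f F) \<le> B"
  shows "Lp_int t w g \<le> B"
proof -
  have gl: "locally_integrable g" by (rule is_paraproduct_li[OF g])
  note [measurable] = locally_integrable_measurable[OF gl] locally_integrable_measurable[OF w(1)]
  have K: "(\<integral>\<^sup>+x\<in>K. ennreal (norm (g x) powr t * w x) \<partial>lebesgue) \<le> B" if K: "compact K" for K
  proof -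
    have Ks [measurable]: "K \<in> sets lebesgue" using K by (simp add: lmeasurable_compact fmeasurableD)
    have lim: "((\<lambda>F. \<integral>\<^sup>+x\<in>K. ennreal (norm (psum b f F x - g x)) \<partial>lebesgue) \<longlongrightarrow> 0) (finite_subsets_at_top D)"
      and gK: "set_integrable lebesgue K g"
      using g K by (auto simp: is_paraproduct_def has_uncond_L1_sum_def psum_def)
    have "\<forall>m::nat. \<exists>F. finite F \<and> F \<subseteq> D \<and> (\<integral>\<^sup>+x\<in>K. ennreal (norm (psum b f F x - g x)) \<partial>lebesgue) < ennreal (1 / Suc m)"
    proof
      fix m :: nat
      have "\<forall>\<^sub>F F in finite_subsets_at_top D. (\<integral>\<^sup>+x\<in>K. ennreal (norm (psum b f F x - g x)) \<partial>lebesgue) < ennreal (1 / Suc m)"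
        by (rule order_tendstoD(2)[OF lim]) simp
      then show "\<exists>F. finite F \<and> F \<subseteq> D \<and> (\<integral>\<^sup>+x\<in>K. ennreal (norm (psum b f F x - g x)) \<partial>lebesgue) < ennreal (1 / Suc m)"
        unfolding eventually_finite_subsets_at_top by blast
    qed
    from choice[OF this] obtain F where F: "\<And>m. finite (F m)" "\<And>m. F m \<subseteq> D"
      "\<And>m::nat. (\<integral>\<^sup>+x\<in>K. ennreal (norm (psum b f (F m) x - g x)) \<partial>lebesgue) < ennreal (1 / Suc m)"
      by blast
    note [measurable] = psum_measurable[OF F(2)]
    define u where "u m x = indicator K x *\<^sub>R (psum b f (F m) x - g x)" for m x
    have nu: "(\<integral>\<^sup>+x. ennreal (norm (u m x)) \<partial>lebesgue) < ennreal (1 / Suc m)" for m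
    proof -
      have "(\<integral>\<^sup>+x. ennreal (norm (u m x)) \<partial>lebesgue) = (\<integral>\<^sup>+x\<in>K. ennreal (norm (psum b f (F m) x - g x)) \<partial>lebesgue)"
        by (intro nn_integral_cong) (auto simp: u_def indicator_def)
      then show ?thesis using F(3) by simp
    qed
    have um: "u m \<in> borel_measurable lebesgue" for m
      unfolding u_def by (intro borel_measurable_scaleR borel_measurable_indicator Ks borel_measurable_diff
        psum_measurable F locally_integrable_measurable[OF gl])
    have ui: "integrable lebesgue (u m)" for m
      using um nu[of m] by (intro integrableI_bounded) (auto intro: less_trans)
    have uL: "(LINT x|lebesgue. norm (u m x)) \<le> 1 / Suc m" for m
    proof -
      have "ennreal (LINT x|lebesgue. norm (u m x)) = (\<integral>\<^sup>+x. ennreal (norm (u m x)) \<partial>lebesgue)"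
        using ui by (intro nn_integral_eq_integral[symmetric]) auto
      also have "\<dots> \<le> ennreal (1 / Suc m)" using nu by (rule less_imp_le)
      finally show ?thesis by (simp add: ennreal_le_iff)
    qed
    have "(\<lambda>m. LINT x|lebesgue. norm (u m x)) \<longlonglongrightarrow> 0"
    proof (rule tendsto_sandwich[OF _ _ tendsto_const])
      show "(\<lambda>m. 1 / real (Suc m)) \<longlonglongrightarrow> 0" using LIMSEQ_inverse_real_of_nat by (simp add: inverse_eq_divide)
      show "\<forall>\<^sub>F m in sequentially. (LINT x|lebesgue. norm (u m x)) \<le> 1 / real (Suc m)"
        using uL by (intro always_eventually allI) auto
    qed (auto intro: integral_nonneg_AE)
    then obtain r :: "nat \<Rightarrow> nat" where r: "AE x in lebesgue. (\<lambda>n. u (r n) x) \<longlonglongrightarrow> 0"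
      using tendsto_L1_AE_subseq[of lebesgue u, OF ui] by blast
    let ?h = "\<lambda>n x. ennreal (norm (psum b f (F (r n)) x) powr t * w x) * indicator K x"
    have hm: "?h n \<in> borel_measurable lebesgue" for n
    proof -
      have [measurable]: "(\<lambda>x. norm (psum b f (F (r n)) x)) \<in> borel_measurable lebesgue"
        by (rule measurable_compose[OF psum_measurable[OF F(2)] borel_measurable_norm])
      show ?thesis
        by (intro borel_measurable_times_ennreal borel_measurable_indicator Ks measurable_compose[OF _ measurable_ennreal]) measurable
    qed
    have "(\<integral>\<^sup>+x\<in>K. ennreal (norm (g x) powr t * w x) \<partial>lebesgue) = (\<integral>\<^sup>+x. liminf (\<lambda>n. ?h n x) \<partial>lebesgue)"
    proof (rule nn_integral_cong_AE, use r in eventually_elim)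
      fix x assume lim: "(\<lambda>n. u (r n) x) \<longlonglongrightarrow> 0"
      show "ennreal (norm (g x) powr t * w x) * indicator K x = liminf (\<lambda>n. ?h n x)"
      proof (cases "x \<in> K")
        case True
        have "(\<lambda>n. psum b f (F (r n)) x - g x) \<longlonglongrightarrow> 0" using lim True by (simp add: u_def)
        then have "(\<lambda>n. psum b f (F (r n)) x) \<longlonglongrightarrow> g x" by (simp add: LIM_zero_iff)
        then have "(\<lambda>n. ennreal (norm (psum b f (F (r n)) x) powr t * w x)) \<longlonglongrightarrow> ennreal (norm (g x) powr t * w x)"
          using t by (intro tendsto_ennrealI tendsto_mult tendsto_const tendsto_powr2 tendsto_norm) auto
        then show ?thesis using True by (simp add: lim_imp_Liminf)
      qed (simp add: Liminf_const)
    qed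
    also have "\<dots> \<le> liminf (\<lambda>n. \<integral>\<^sup>+x. ?h n x \<partial>lebesgue)"
      by (rule nn_integral_liminf[OF hm])
    also have "\<dots> \<le> B"
    proof (rule Liminf_le)
      show "\<forall>\<^sub>F n in sequentially. (\<integral>\<^sup>+x. ?h n x \<partial>lebesgue) \<le> B"
      proof (intro always_eventually allI)
        fix n
        have "(\<integral>\<^sup>+x. ?h n x \<partial>lebesgue) \<le> Lp_int t w (psum b f (F (r n)))"
          unfolding Lp_int_def by (intro nn_integral_mono) (auto simp: indicator_def)
        also have "\<dots> \<le> B" by (intro B F)
        finally show "(\<integral>\<^sup>+x. ?h n x \<partial>lebesgue) \<le> B" .
      qed
    qed simp
    finally show ?thesis .
  qed
  let ?k = "\<lambda>n::nat. \<lambda>x. ennreal (norm (g x) powr t * w x) * indicator (cball 0 (real n)) x"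
  have "Lp_int t w g = (\<integral>\<^sup>+x. liminf (\<lambda>n. ?k n x) \<partial>lebesgue)"
    unfolding Lp_int_def
  proof (intro nn_integral_cong)
    fix x
    have "(\<lambda>n. ?k n x) \<longlonglongrightarrow> ennreal (norm (g x) powr t * w x)"
    proof (rule tendsto_eventually)
      obtain m :: nat where m: "norm x \<le> m" using real_arch_simple by blast
      show "\<forall>\<^sub>F n in sequentially. ?k n x = ennreal (norm (g x) powr t * w x)"
        using eventually_ge_at_top[of m]
      proof eventually_elim
        case (elim n)
        then have "norm x \<le> n" using m by (meson of_nat_mono order_trans)
        then show ?case by simp
      qed
    qed
    then show "ennreal (norm (g x) powr t * w x) = liminf (\<lambda>n. ?k n x)"
      by (simp add: lim_imp_Liminf)
  qed
  also have "\<dots> \<le> liminf (\<lambda>n. \<integral>\<^sup>+x. ?k n x \<partial>lebesgue)"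
    by (intro nn_integral_liminf borel_measurable_times_ennreal borel_measurable_indicator
        measurable_compose[OF _ measurable_ennreal] fmeasurableD lmeasurable_cball) measurable
  also have "\<dots> \<le> B"
    by (rule Liminf_le) (auto intro!: always_eventually K)
  finally show ?thesis .
qed

theorem para_norm_upper:
  assumes N: "form_bound N b" and b: "locally_integrable b"
  shows "para_norm D p \<mu> q \<kappa> b \<le> ennreal (64 * 2 ^ CARD('n) * (N * Kf * Kg))"
proof -
  let ?K = "ennreal (64 * 2 ^ CARD('n) * (N * Kf * Kg))"
  have ex: "\<exists>g. is_paraproduct D b f g \<and> wLp_norm q \<kappa> (\<lambda>x. ennreal (norm (g x))) \<le> ?K * wLp_norm p \<mu> (\<lambda>x. ennreal (norm (f x)))"
    if f: "f \<in> Linf_c" for f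
  proof -
    have fl: "locally_integrable f" by (rule Linf_c_li[OF f])
    have ff: "Lp_int p \<mu> f < \<infinity>" using p1 by (intro Linf_c_Lp_int[OF f mu_pair(2,6)]) auto
    obtain g where g: "is_paraproduct D b f g" using ex_paraproduct[OF N b fl ff] by blast
    have "Lp_int q \<kappa> g \<le> ennpowr (?K * ennpowr (Lp_int p \<mu> f) (1 / p)) q"
      by (rule paraproduct_Fatou[OF g kappa_pair(2,6)]) (use q1 psum_Lq[OF N b fl] in auto)
    then have "ennpowr (Lp_int q \<kappa> g) (1 / q) \<le> ennpowr (ennpowr (?K * ennpowr (Lp_int p \<mu> f) (1 / p)) q) (1 / q)"
      using q1 by (intro ennpowr_mono) auto
    then have "ennpowr (Lp_int q \<kappa> g) (1 / q) \<le> ?K * ennpowr (Lp_int p \<mu> f) (1 / p)"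
      using q1 by simp
    then show ?thesis using g unfolding wLp_norm_eq by blast
  qed
  then have wd: "para_well_defined D b"
    unfolding para_well_defined_def is_paraproduct_def by blast
  have "?K < \<infinity>" by simp
  then show ?thesis unfolding para_norm_def using wd ex by (auto intro!: Inf_lower)
qed

end

section \<open>The lower bound\<close>

context dyadic
begin

text \<open>An open set is exhausted by the cubes of generation \<open>n\<close> that it contains; the
  differentiation theorem for boxes then applies.\<close>

lemma zero_averages_AE:
  fixes h :: "real^'n \<Rightarrow> complex"
  assumes h: "locally_integrable h" and Q: "Q \<in> D"
    and z: "\<And>R. R \<in> D \<Longrightarrow> R \<subseteq> Q \<Longrightarrow> (LINT x:R|lebesgue. h x) = 0"
  shows "AE x in lebesgue. x \<in> Q \<longrightarrow> h x = 0"
proof -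
  obtain k where k: "Q \<in> Dk k" using Q by (metis DE)
  have hQ: "set_integrable lebesgue Q h" by (rule set_integrable_D[OF h Q])
  have open0: "(LINT x:Q \<inter> U|lebesgue. h x) = 0" if U: "open U" for U
  proof -
    define F where "F n = {R \<in> Dk (k + int n). R \<subseteq> Q \<and> R \<subseteq> U}" for n
    define A where "A n = \<Union>(F n)" for n
    have fF: "finite (F n)" for n
      by (rule finite_subset[OF _ finite_Dk_meets[OF D_bounded[OF Q], of "k + int n"]])
         (use D_nonempty[OF Dk_D] in \<open>auto simp: F_def Int_absorb2\<close>)
    have FD: "F n \<subseteq> D" for n using Dk_D by (auto simp: F_def)
    have inc: "incseq A"
    proof (rule incseq_SucI)
      fix n
      show "A n \<subseteq> A (Suc n)"
      proof
        fix x assume "x \<in> A n"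
        then obtain R where R: "R \<in> Dk (k + int n)" "R \<subseteq> Q" "R \<subseteq> U" "x \<in> R" by (auto simp: A_def F_def)
        obtain R' where R': "R' \<in> Dk (k + int (Suc n))" "x \<in> R'" using Dk_cover by blast
        have "R' \<subseteq> R" using Dk_nested[OF R'(1) R(1)] R R' by auto
        then show "x \<in> A (Suc n)" using R R' by (auto simp: A_def F_def)
      qed
    qed
    have un: "(\<Union>n. A n) = Q \<inter> U"
    proof
      show "(\<Union>n. A n) \<subseteq> Q \<inter> U" by (auto simp: A_def F_def)
      show "Q \<inter> U \<subseteq> (\<Union>n. A n)"
      proof
        fix x assume x: "x \<in> Q \<inter> U"
        obtain e where e: "0 < e" "ball x e \<subseteq> U" using U x by (meson IntD2 open_contains_ball)
        obtain n :: nat where n: "(1/2::real) ^ n < e / (2 powi (-k) * CARD('n))"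
          using real_arch_pow_inv[of "e / (2 powi (-k) * CARD('n))" "1/2"] e by auto
        obtain R where R: "R \<in> Dk (k + int n)" "x \<in> R" using Dk_cover by blast
        have "R \<subseteq> Q" using Dk_nested[OF R(1) k] R x by auto
        moreover have "R \<subseteq> U"
        proof
          fix y assume "y \<in> R"
          have "dist x y \<le> 2 powi (-(k + int n)) * CARD('n)" by (rule dist_Dk_le[OF R(1,2) \<open>y \<in> R\<close>])
          also have "(2::real) powi (-(k + int n)) = 2 powi (-k) * (1/2) ^ n"
            by (simp add: power_int_diff power_one_over power_int_minus field_simps)
          also have "2 powi (-k) * (1/2) ^ n * CARD('n) < e"
            using n by (simp add: pos_less_divide_eq mult_ac)
          finally show "y \<in> U" using e by auto
        qed
        ultimately show "x \<in> (\<Union>n. A n)" using R by (auto simp: A_def F_def)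
      qed
    qed
    have A0: "(LINT x:A n|lebesgue. h x) = 0" for n
    proof -
      have "(LINT x:(\<Union>R\<in>F n. R)|lebesgue. h x) = (\<Sum>R\<in>F n. LINT x:R|lebesgue. h x)"
      proof (rule set_integral_finite_Union[OF fF])
        show "disjoint_family_on (\<lambda>R. R) (F n)"
          unfolding disjoint_family_on_def F_def using Dk_eq by blast
        fix R assume "R \<in> F n"
        then have "R \<in> D" using FD by auto
        then show "set_integrable lebesgue R h" "R \<in> sets lebesgue" using h by (auto intro: set_integrable_D)
      qed
      also have "\<dots> = 0" using FD z by (intro sum.neutral) (auto simp: F_def)
      finally show ?thesis by (simp add: A_def)
    qed
    have "(\<lambda>n. LINT x:A n|lebesgue. h x) \<longlonglongrightarrow> (LINT x:(\<Union>n. A n)|lebesgue. h x)"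
    proof (rule set_integral_cont_up)
      show "A n \<in> sets lebesgue" for n unfolding A_def by (rule D_subset_sets[OF FD])
      show "set_integrable lebesgue (\<Union>n. A n) h"
        unfolding un using U Q by (intro set_integrable_subset[OF hQ]) auto
    qed (rule inc)
    then show ?thesis unfolding un A0 by (simp add: LIMSEQ_const_iff)
  qed
  define f where "f x = indicator Q x *\<^sub>R h x" for x
  have fint: "integrable lebesgue f" using hQ by (simp add: f_def[abs_def] set_integrable_def)
  \<comment> \<open>The differentiation theorem speaks of closed boxes, \<open>open0\<close> of open
    sets; they differ by a null set.\<close>
  have box0: "integral (cbox u v) f = 0" for u v
  proof -
    have sf: "set_integrable lebesgue (cbox u v) f"
      unfolding set_integrable_def by (intro integrable_mult_indicator fint) auto
    have "integral (cbox u v) f = integral (box u v) f"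
    proof (rule integral_spike_set)
      show "negligible {x \<in> cbox u v - box u v. f x \<noteq> 0}"
        by (rule negligible_subset[OF negligible_frontier_interval[of u v]]) auto
      show "negligible {x \<in> box u v - cbox u v. f x \<noteq> 0}"
        by (rule negligible_subset[OF negligible_empty]) (use box_subset_cbox[of u v] in auto)
    qed
    also have "\<dots> = (LINT x:box u v|lebesgue. f x)"
      by (intro set_lebesgue_integral_eq_integral(2)[symmetric] set_integrable_subset[OF sf] box_subset_cbox) auto
    also have "\<dots> = (LINT x:Q \<inter> box u v|lebesgue. h x)"
      unfolding set_lebesgue_integral_def f_def
      by (intro Bochner_Integration.integral_cong) (auto simp: indicator_def)
    finally show ?thesis using open0[OF open_box] by simp
  qed
  have fi: "f integrable_on cbox a b" for a b
  proof -
    have "set_integrable lebesgue (cbox a b) f"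
      unfolding set_integrable_def by (intro integrable_mult_indicator fint) auto
    then show ?thesis by (rule set_lebesgue_integral_eq_integral(1))
  qed
  obtain N where N: "negligible N" "\<And>x e. \<lbrakk>x \<notin> N; 0 < e\<rbrakk> \<Longrightarrow> \<exists>d>0. \<forall>t. 0 < t \<and> t < d \<longrightarrow>
      norm (integral (cbox x (x + t *\<^sub>R One)) f /\<^sub>R t ^ DIM(real^'n) - f x) < e"
    using integrable_ccontinuous_explicit[of f, OF fi] by auto
  have "f x = 0" if x: "x \<notin> N" for x
  proof (rule ccontr)
    assume "f x \<noteq> 0"
    then obtain d where d: "d > 0" "\<And>t. 0 < t \<and> t < d \<Longrightarrow>
        norm (integral (cbox x (x + t *\<^sub>R One)) f /\<^sub>R t ^ DIM(real^'n) - f x) < norm (f x)"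
      using N(2)[OF x, of "norm (f x)"] by auto
    from d(2)[of "d/2"] d(1) show False unfolding box0 by simp
  qed
  moreover have "N \<in> null_sets lebesgue" using N(1) by (simp add: negligible_iff_null_sets)
  ultimately have "AE x in lebesgue. f x = 0" by (auto intro: AE_I')
  then show ?thesis by eventually_elim (auto simp: f_def)
qed

text \<open>Each step from a cube to its parent adds one summand, the martingale difference of the
  parent, which on the cube is the difference of the two averages.\<close>

lemma mart_diff_telescope:
  fixes b :: "real^'n \<Rightarrow> complex"
  shows "R \<in> Dk (k + int n) \<Longrightarrow> S \<in> Dk k \<Longrightarrow> R \<subseteq> S \<Longrightarrow> x \<in> R \<Longrightarrow>
    (\<Sum>Q\<in>{Q\<in>D. R \<subset> Q \<and> Q \<subseteq> S}. mart_diff D Q b x) = average R b - average S b"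
proof (induction n arbitrary: R)
  case 0
  then have "R = S" using Dk_eq[of R k S] by auto
  then have "{Q\<in>D. R \<subset> Q \<and> Q \<subseteq> S} = {}" by auto
  then have "(\<Sum>Q\<in>{Q\<in>D. R \<subset> Q \<and> Q \<subseteq> S}. mart_diff D Q b x) = 0" by (simp only: sum.empty)
  then show ?case using \<open>R = S\<close> by simp
next
  case (Suc n)
  have R: "R \<in> Dk ((k + int n) + 1)" using Suc.prems(1) by (simp add: algebra_simps)
  obtain P where P: "P \<in> Dk (k + int n)" "R \<subseteq> P" using Dk_up[of R "k + int n" 1] R by auto
  have PD: "P \<in> D" "S \<in> D" "R \<in> D" using P Suc.prems Dk_D by auto
  have PS: "P \<subseteq> S" using Dk_nested[OF P(1) Suc.prems(2)] P(2) Suc.prems by auto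
  have Rc: "R \<in> children P" using R P by (simp add: children_Dk[OF P(1)])
  have eq: "{Q\<in>D. R \<subset> Q \<and> Q \<subseteq> S} = insert P {Q\<in>D. P \<subset> Q \<and> Q \<subseteq> S}"
  proof (intro equalityI subsetI)
    fix Q assume Q: "Q \<in> {Q\<in>D. R \<subset> Q \<and> Q \<subseteq> S}"
    then obtain j where j: "Q \<in> Dk j" by (metis (no_types, lifting) DE mem_Collect_eq)
    then have "j < k + int n + 1" using D_level_strict[OF R j] Q by auto
    then have "P \<subseteq> Q" using Dk_nested[OF P(1) j] P(2) Q Suc.prems(4) by auto
    then show "Q \<in> insert P {Q\<in>D. P \<subset> Q \<and> Q \<subseteq> S}" using Q by auto
  qed (use PS PD P children_psubset[OF PD(1) Rc] in auto)
  have fin: "finite {Q\<in>D. P \<subset> Q \<and> Q \<subseteq> S}"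
    by (rule finite_subset[OF _ finite_chain[OF PD(1,2)]]) auto
  have "(\<Sum>Q\<in>{Q\<in>D. R \<subset> Q \<and> Q \<subseteq> S}. mart_diff D Q b x) = mart_diff D P b x + (\<Sum>Q\<in>{Q\<in>D. P \<subset> Q \<and> Q \<subseteq> S}. mart_diff D Q b x)"
    unfolding eq using fin by (subst sum.insert) auto
  also have "\<dots> = (average R b - average P b) + (average P b - average S b)"
    using Suc.IH[OF P(1) Suc.prems(2) PS] P(2) Suc.prems(4) mart_diff_in[OF PD(1) Rc Suc.prems(4)] by auto
  finally show ?case by simp
qed

lemma mart_diff_integral_0:
  fixes b :: "real^'n \<Rightarrow> complex"
  assumes b: "locally_integrable b" and Q: "Q \<in> D" "E \<in> sets lebesgue" "Q \<subseteq> E"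
  shows "(LINT x:E|lebesgue. mart_diff D Q b x) = 0"
proof -
  have "(LINT x:E|lebesgue. mart_diff D Q b x) = (LINT x|lebesgue. mart_diff D Q b x * 1)"
    unfolding set_lebesgue_integral_def
    by (intro Bochner_Integration.integral_cong) (use mart_diff_out[OF Q(1)] Q(3) in \<open>auto simp: indicator_def\<close>)
  also have "\<dots> = (\<Sum>R\<in>children Q. (average R b - average Q b) * (LINT x:R|lebesgue. 1))"
    by (rule mart_diff_mult_integral(2)[OF locally_integrable_const Q(1)])
  also have "\<dots> = (\<Sum>R\<in>children Q. mea R *\<^sub>R average R b) - (\<Sum>R\<in>children Q. mea R) *\<^sub>R average Q b"
    unfolding scaleR_sum_left sum_subtractf[symmetric]
    by (intro sum.cong refl) (simp add: set_integral_const_fmeasurable D_lmeasurable children_D algebra_simps scaleR_conv_of_real)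
  also have "\<dots> = 0" using average_children[OF b Q(1)] measure_children[OF Q(1)] by simp
  finally show ?thesis .
qed

lemma average_const:
  assumes "Q \<in> D" "\<And>x. x \<in> Q \<Longrightarrow> h x = c"
  shows "average Q h = c"
proof -
  have "(LINT x:Q|lebesgue. h x) = (LINT x:Q|lebesgue. c)"
    using assms by (intro set_lebesgue_integral_cong) auto
  also have "\<dots> = mea Q *\<^sub>R c" using D_lmeasurable[OF assms(1)] by (rule set_integral_const_fmeasurable)
  finally show ?thesis using D_measure_pos[OF assms(1)] by (simp add: average_def)
qed

lemma average_diff:
  assumes "set_integrable lebesgue Q f" "set_integrable lebesgue Q g"
  shows "average Q (\<lambda>x. f x - g x) = average Q f - average Q g"
  unfolding average_def using assms by (simp add: set_integral_diff scaleR_diff_right)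

lemma average_psum:
  assumes "F \<subseteq> D" "Q \<in> D"
  shows "average Q (psum b f F) = (\<Sum>P\<in>F. average Q (para_term D b f P))"
  unfolding average_def set_lebesgue_integral_def psum_def scaleR_sum_right
  using assms para_term_set_integrable[of _ Q b f]
  by (subst Bochner_Integration.integral_sum) (auto simp: set_integrable_def scaleR_sum_right)

text \<open>Term by term: cubes strictly above \<open>S\<close> have constant differences on
  \<open>S\<close>, cubes disjoint from \<open>S\<close> vanish there, and cubes in \<open>S\<close>
  not strictly containing \<open>R\<close> have mean zero over both \<open>R\<close> and
  \<open>S\<close>. For the remaining cubes the average of the indicator is 1, and their differences
  telescope.\<close>

lemma psum_indicator_average:
  fixes b :: "real^'n \<Rightarrow> complex"
  assumes b: "locally_integrable b" and S: "S \<in> D" and R: "R \<in> D" "R \<subseteq> S"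
    and F: "finite F" "F \<subseteq> D" "{Q\<in>D. R \<subset> Q \<and> Q \<subseteq> S} \<subseteq> F"
  shows "average R (psum b (indicator S) F) - average S (psum b (indicator S) F) = average R b - average S b"
proof -
  let ?C = "{Q\<in>D. R \<subset> Q \<and> Q \<subseteq> S}"
  obtain x where x: "x \<in> R" using D_nonempty[OF R(1)] by blast
  have av1: "average Q (indicator S :: _ \<Rightarrow> complex) = 1" if "Q \<in> D" "Q \<subseteq> S" for Q
    by (rule average_const) (use that in auto)
  let ?T = "\<lambda>Q. average R (para_term D b (indicator S) Q) - average S (para_term D b (indicator S) Q)"
  have avm: "average P (para_term D b f Q) = average P (mart_diff D Q b) * average Q f" for P Q f
    unfolding para_term_def average_def by simp
  have tm: "?T Q = (if Q \<in> ?C then mart_diff D Q b x else 0)" if Q: "Q \<in> D" for Q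
  proof -
    have "S \<subset> Q \<or> Q \<subseteq> S \<or> Q \<inter> S = {}" using D_nested[OF Q S] by auto
    then consider "S \<subset> Q" | "Q \<inter> S = {}" | "Q \<subseteq> S" by blast
    then show ?thesis
    proof cases
      case 1
      obtain z where z: "\<And>x. x \<in> S \<Longrightarrow> mart_diff D Q b x = z" using above_const[OF Q S 1] by blast
      have "average R (mart_diff D Q b) = z" "average S (mart_diff D Q b) = z"
        by (rule average_const; use z R S in auto)+
      then show ?thesis using 1 unfolding avm by auto
    next
      case 2
      have "average R (mart_diff D Q b) = 0" "average S (mart_diff D Q b) = 0"
        by (rule average_const; use 2 R S mart_diff_out[OF Q] in auto)+
      then show ?thesis using 2 D_nonempty[OF Q] unfolding avm by auto
    next
      case 3
      have s0: "average S (mart_diff D Q b) = 0"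
        using mart_diff_integral_0[OF b Q D_sets[OF S] 3] by (simp add: average_def)
      show ?thesis
      proof (cases "R \<subset> Q")
        case True
        obtain z where z: "\<And>x. x \<in> R \<Longrightarrow> mart_diff D Q b x = z" using above_const[OF Q R(1) True] by blast
        have "average R (mart_diff D Q b) = z" by (rule average_const[OF R(1) z])
        then show ?thesis using True 3 Q s0 z[OF x] unfolding avm av1[OF Q 3] by simp
      next
        case False
        have "average R (mart_diff D Q b) = 0"
        proof (cases "Q \<inter> R = {}")
          case True
          then show ?thesis by (intro average_const[OF R(1)] mart_diff_out[OF Q]) auto
        next
          case F: False
          then have "Q \<subseteq> R" using D_nested[OF Q R(1)] False by auto
          then show ?thesis using mart_diff_integral_0[OF b Q D_sets[OF R(1)]] by (simp add: average_def)
        qed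
        then show ?thesis using False s0 unfolding avm by simp
      qed
    qed
  qed
  have "average R (psum b (indicator S) F) - average S (psum b (indicator S) F) = (\<Sum>Q\<in>F. ?T Q)"
    using F S R by (simp add: average_psum sum_subtractf)
  also have "\<dots> = (\<Sum>Q\<in>F. if Q \<in> ?C then mart_diff D Q b x else 0)"
  proof (intro sum.cong refl)
    fix Q assume "Q \<in> F"
    then have "Q \<in> D" using F(2) by auto
    then show "?T Q = (if Q \<in> ?C then mart_diff D Q b x else 0)" by (rule tm)
  qed
  also have "\<dots> = (\<Sum>Q\<in>?C. mart_diff D Q b x)"
    using F by (intro sum.mono_neutral_cong_right) auto
  also have "\<dots> = average R b - average S b"
  proof -
    obtain k l where k: "S \<in> Dk k" and l: "R \<in> Dk l" using S R by (metis DE)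
    have "k \<le> l" using D_level_mono[OF l k R(2)] .
    then have "R \<in> Dk (k + int (nat (l - k)))" using l by simp
    then show ?thesis by (rule mart_diff_telescope[OF _ k R(2) x])
  qed
  finally show ?thesis .
qed

lemma average_norm_le:
  fixes h :: "real^'n \<Rightarrow> complex"
  assumes "set_integrable lebesgue Q h" "Q \<in> D" "(\<integral>\<^sup>+x\<in>Q. ennreal (norm (h x)) \<partial>lebesgue) \<le> ennreal e" "0 \<le> e"
  shows "norm (average Q h) \<le> e / mea Q"
proof -
  have "norm (LINT x:Q|lebesgue. h x) \<le> (LINT x:Q|lebesgue. norm (h x))"
    unfolding set_lebesgue_integral_def
    by (rule order_trans[OF integral_norm_bound]) simp
  also have "ennreal (LINT x:Q|lebesgue. norm (h x)) = (\<integral>\<^sup>+x\<in>Q. ennreal (norm (h x)) \<partial>lebesgue)"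
    using assms(1) by (intro nn_integral_set_integral[symmetric] set_integrable_norm) auto
  then have "(LINT x:Q|lebesgue. norm (h x)) \<le> e"
    using assms(3,4) by (metis ennreal_le_iff)
  finally show ?thesis
    using D_measure_pos[OF assms(2)] by (simp add: average_def divide_inverse mult.commute mult_right_mono)
qed

text \<open>Convergence along the net allows the approximating set to contain any prescribed finite
  set \<open>C\<close> of cubes.\<close>

lemma paraproduct_approx:
  assumes g: "is_paraproduct D b f g" and K: "bounded K" "K \<in> sets lebesgue" and e: "0 < e" and C: "finite C" "C \<subseteq> D"
  obtains F where "finite F" "F \<subseteq> D" "C \<subseteq> F" "(\<integral>\<^sup>+x\<in>K. ennreal (norm (psum b f F x - g x)) \<partial>lebesgue) \<le> ennreal e"
proof -
  have "compact (closure K)" using K by simp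
  then have "((\<lambda>F. \<integral>\<^sup>+x\<in>closure K. ennreal (norm (psum b f F x - g x)) \<partial>lebesgue) \<longlongrightarrow> 0) (finite_subsets_at_top D)"
    using g by (auto simp: is_paraproduct_def has_uncond_L1_sum_def psum_def)
  then have "\<forall>\<^sub>F F in finite_subsets_at_top D. (\<integral>\<^sup>+x\<in>closure K. ennreal (norm (psum b f F x - g x)) \<partial>lebesgue) < ennreal e"
    by (rule order_tendstoD(2)) (use e in simp)
  then obtain X where X: "finite X" "X \<subseteq> D" "\<And>Y. finite Y \<Longrightarrow> X \<subseteq> Y \<Longrightarrow> Y \<subseteq> D \<Longrightarrow> (\<integral>\<^sup>+x\<in>closure K. ennreal (norm (psum b f Y x - g x)) \<partial>lebesgue) < ennreal e"
    unfolding eventually_finite_subsets_at_top by auto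
  have "(\<integral>\<^sup>+x\<in>K. ennreal (norm (psum b f (X \<union> C) x - g x)) \<partial>lebesgue) \<le> (\<integral>\<^sup>+x\<in>closure K. ennreal (norm (psum b f (X \<union> C) x - g x)) \<partial>lebesgue)"
    by (intro nn_integral_mono) (use closure_subset[of K] in \<open>auto simp: indicator_def\<close>)
  also have "\<dots> \<le> ennreal e" using X C by (intro less_imp_le[OF X(3)]) auto
  finally show thesis using X C by (intro that[of "X \<union> C"]) auto
qed

lemma psum_li: "F \<subseteq> D \<Longrightarrow> locally_integrable (psum b f F)"
proof -
  assume F: "F \<subseteq> D"
  obtain C where C: "0 \<le> C" "\<And>x. norm (psum b f F x) \<le> C" using psum_bounded[OF F] by blast
  show ?thesis
    by (rule locally_integrableI_bounded[OF psum_measurable[OF F] locally_integrable_const[of "1::real"], where C = C]) (use C in auto)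
qed

text \<open>The averages of \<open>b\<close> and \<open>g\<close> over subcubes of \<open>S\<close>
  differ by one constant: this is exact for large partial sums and survives the L^1 limit. By
  \<open>zero_averages_AE\<close> the functions then differ by that constant almost everywhere on
  \<open>S\<close>.\<close>

lemma paraproduct_indicator:
  fixes b g :: "real^'n \<Rightarrow> complex"
  assumes b: "locally_integrable b" and g: "is_paraproduct D b (indicator S) g" and S: "S \<in> D"
  shows "AE x in lebesgue. x \<in> S \<longrightarrow> b x - average S b = g x - average S g"
proof -
  have gl: "locally_integrable g" by (rule is_paraproduct_li[OF g])
  have av: "average R g - average S g = average R b - average S b" if R: "R \<in> D" "R \<subseteq> S" for R
  proof -
    let ?C = "{Q\<in>D. R \<subset> Q \<and> Q \<subseteq> S}"
    have C: "finite ?C" "?C \<subseteq> D" by (rule finite_subset[OF _ finite_chain[OF R(1) S]]) auto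
    \<comment> \<open>The cubes between \<open>R\<close> and \<open>S\<close> are forced into the
      partial sum, so that \<open>psum_indicator_average\<close> applies; the error is
      \<open>e\<close> divided by the volumes of the two cubes.\<close>
    have small: "norm ((average R b - average S b) - (average R g - average S g)) \<le> e * (1 / mea R + 1 / mea S)" if e: "0 < e" for e
    proof -
      obtain F where F: "finite F" "F \<subseteq> D" "?C \<subseteq> F"
        "(\<integral>\<^sup>+x\<in>S. ennreal (norm (psum b (indicator S) F x - g x)) \<partial>lebesgue) \<le> ennreal e"
        using paraproduct_approx[OF g D_bounded[OF S] D_sets[OF S] e C] by blast
      let ?p = "psum b (indicator S) F"
      have dl: "locally_integrable (\<lambda>x. ?p x - g x)" by (intro locally_integrable_diff psum_li F gl)
      have FR: "(\<integral>\<^sup>+x\<in>R. ennreal (norm (?p x - g x)) \<partial>lebesgue) \<le> ennreal e"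
        by (rule order_trans[OF _ F(4)], intro nn_integral_mono) (use R in \<open>auto simp: indicator_def\<close>)
      have "norm (average R (\<lambda>x. ?p x - g x)) \<le> e / mea R" "norm (average S (\<lambda>x. ?p x - g x)) \<le> e / mea S"
        using dl R S e F FR by (auto intro!: average_norm_le set_integrable_D)
      moreover have "average R (\<lambda>x. ?p x - g x) = average R ?p - average R g" "average S (\<lambda>x. ?p x - g x) = average S ?p - average S g"
        using gl R S psum_li[OF F(2)] by (auto intro!: average_diff set_integrable_D)
      ultimately have le: "norm (average R ?p - average R g) \<le> e / mea R" "norm (average S ?p - average S g) \<le> e / mea S"
        by simp_all
      have pb: "average R ?p - average S ?p = average R b - average S b"
        by (rule psum_indicator_average[OF b S R F(1-3)])
      have "(average R b - average S b) - (average R g - average S g)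
          = (average R ?p - average R g) - (average S ?p - average S g)"
        unfolding pb[symmetric] by (simp add: algebra_simps)
      then have "norm ((average R b - average S b) - (average R g - average S g))
          \<le> norm (average R ?p - average R g) + norm (average S ?p - average S g)"
        using norm_triangle_ineq4[of "average R ?p - average R g" "average S ?p - average S g"] by (simp only:)
      also have "\<dots> \<le> e / mea R + e / mea S" using le by (rule add_mono)
      finally show ?thesis by (simp add: distrib_left)
    qed
    have c0: "0 < 1 / mea R + 1 / mea S" using D_measure_pos R S by (simp add: add_pos_pos)
    have "norm ((average R b - average S b) - (average R g - average S g)) \<le> 0"
    proof (rule field_le_epsilon)
      fix e :: real assume "0 < e"
      then show "norm ((average R b - average S b) - (average R g - average S g)) \<le> 0 + e"
        using small[of "e / (1 / mea R + 1 / mea S)"] c0 by simp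
    qed
    then show ?thesis by simp
  qed
  let ?h = "\<lambda>x. (b x - g x) - (average S b - average S g)"
  have "AE x in lebesgue. x \<in> S \<longrightarrow> ?h x = 0"
  proof (rule zero_averages_AE[OF _ S])
    show "locally_integrable ?h" by (intro locally_integrable_diff b gl locally_integrable_const)
    fix R assume R: "R \<in> D" "R \<subseteq> S"
    have "average R ?h = average R (\<lambda>x. b x - g x) - average R (\<lambda>x. average S b - average S g)"
      using R b gl by (intro average_diff set_integrable_D locally_integrable_diff locally_integrable_const)
    also have "\<dots> = (average R b - average R g) - (average S b - average S g)"
      using R b gl by (simp add: average_diff set_integrable_D average_const)
    also have "\<dots> = 0" using av[OF R] by (simp add: algebra_simps)
    finally show "(LINT x:R|lebesgue. ?h x) = 0" using average_integral[OF R(1), of ?h] by simp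
  qed
  then show ?thesis by eventually_elim (auto simp: algebra_simps)
qed

end

section \<open>The Bloom weight against the A_p weights; the estimate on one cube\<close>

context bloom
begin

lemma Holder_kappa_sigma:
  fixes g h :: "real^'n \<Rightarrow> complex"
  assumes [measurable]: "g \<in> borel_measurable lebesgue" "h \<in> borel_measurable lebesgue"
  shows "(\<integral>\<^sup>+x. ennreal (norm (g x) * norm (h x)) \<partial>lebesgue)
    \<le> ennpowr (Lp_int q \<kappa> g) (1 / q) * ennpowr (Lp_int q' \<sigma> h) (1 / q')"
proof -
  have [measurable]: "\<kappa> \<in> borel_measurable lebesgue" "\<sigma> \<in> borel_measurable lebesgue"
    using kappa_pair by (auto intro: locally_integrable_measurable)
  have q'0: "0 < q'" using q' by simp
  have "(\<integral>\<^sup>+x. ennreal (norm (g x) * norm (h x)) \<partial>lebesgue)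
    = (\<integral>\<^sup>+x. ennreal ((norm (g x) powr q * \<kappa> x) powr (1 / q) * (norm (h x) powr q' * \<sigma> x) powr (1 / q')) \<partial>lebesgue)"
  proof (intro nn_integral_cong arg_cong[of _ _ ennreal])
    fix x
    have "(norm (g x) powr q * \<kappa> x) powr (1 / q) * (norm (h x) powr q' * \<sigma> x) powr (1 / q')
      = norm (g x) * norm (h x) * (\<kappa> x powr (1 / q) * \<sigma> x powr (1 / q'))"
      using q1 q'0 by (simp add: powr_mult powr_powr)
    then show "norm (g x) * norm (h x) = (norm (g x) powr q * \<kappa> x) powr (1 / q) * (norm (h x) powr q' * \<sigma> x) powr (1 / q')"
      using kappa_pair(8)[of x] q'(1) by simp
  qed
  also have "\<dots> \<le> ennpowr (Lp_int q \<kappa> g) (1 / q) * ennpowr (Lp_int q' \<sigma> h) (1 / q')"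
    unfolding Lp_int_def using kappa_pair(6,7) q1 q' by (intro nn_integral_Holder) auto
  finally show ?thesis .
qed

text \<open>A substitute for the A_infinity property of \<open>\<nu>\<close>. Hoelder is applied to
  1 as a product of powers of \<open>\<nu>\<close> and of a weight \<open>w\<close> dual to it, and
  then to \<open>w\<close>, a geometric mean of \<open>\<omega>\<close> and
  \<open>\<kappa>\<close>.\<close>

lemma mea_le_nu:
  assumes E: "E \<in> sets lebesgue" "bounded E"
  shows "(mea E)\<^sup>2 \<le> wt \<nu> E powr s * (wt \<omega> E powr (1 - 1 / p) * wt \<kappa> E powr (1 / q))"
proof -
  \<comment> \<open>The exponent complementary to \<open>s\<close>: pointwise
    \<open>\<nu> x powr s * w x powr \<tau>\<close> is 1. Hoelder gives the powers
    \<open>s / 2\<close> and \<open>\<tau> / 2\<close>, hence the square of the volume.\<close>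
  define \<tau> where "\<tau> = 2 - s"
  have t: "\<tau> = (1 - 1 / p) + 1 / q" by (simp add: \<tau>_def s_eq)
  have p': "0 < 1 - 1 / p" "0 < 1 / q" using p1 q1 by auto
  have t0: "0 < \<tau>" using p' unfolding t by linarith
  have s2: "0 < s / 2" "s / 2 < 1" using s_pos t0 by (auto simp: \<tau>_def)
  define a where "a = (1 - 1 / p) / \<tau>"
  have a: "0 < a" "a < 1" "a * \<tau> = 1 - 1 / p" "(1 - a) * \<tau> = 1 / q"
  proof -
    show "0 < a" using p' t0 by (simp add: a_def)
    show 1: "a * \<tau> = 1 - 1 / p" using t0 by (simp add: a_def)
    show 2: "(1 - a) * \<tau> = 1 / q" using 1 by (simp add: left_diff_distrib t)
    have "0 < (1 - a) * \<tau>" unfolding 2 by (rule p')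
    then show "a < 1" using t0 by (simp add: zero_less_mult_iff)
  qed
  define w where "w x = \<omega> x powr a * \<kappa> x powr (1 - a)" for x
  have [measurable]: "\<omega> \<in> borel_measurable lebesgue" "\<kappa> \<in> borel_measurable lebesgue"
    using mu_pair kappa_pair by (auto intro: locally_integrable_measurable)
  have w0: "0 \<le> w x" for x by (simp add: w_def)
  have wl: "locally_integrable w"
  proof (rule locally_integrableI_bounded)
    show "w \<in> borel_measurable lebesgue" unfolding w_def by measurable
    show "locally_integrable (\<lambda>x. \<omega> x + \<kappa> x)" using mu_pair kappa_pair by (auto intro: locally_integrable_add)
    fix x
    have "w x \<le> a * \<omega> x + (1 - a) * \<kappa> x"
      unfolding w_def using a mu_pair(7) kappa_pair(6) by (intro Young_powr) auto
    also have "\<dots> \<le> 1 * \<omega> x + 1 * \<kappa> x"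
      using a mu_pair(7)[of x] kappa_pair(6)[of x] by (intro add_mono mult_right_mono) auto
    finally show "norm (w x) \<le> 1 * norm (\<omega> x + \<kappa> x)" using w0[of x] mu_pair(7)[of x] kappa_pair(6)[of x] by simp
  qed
  have wE: "wt w E powr \<tau> \<le> wt \<omega> E powr (1 - 1 / p) * wt \<kappa> E powr (1 / q)"
  proof -
    have "wt w E \<le> wt \<omega> E powr a * wt \<kappa> E powr (1 - a)"
      by (rule wt_Holder[OF mu_pair(3,7) kappa_pair(2,6) wl w0 E a(1,2)]) (rule w_def)
    then have "wt w E powr \<tau> \<le> (wt \<omega> E powr a * wt \<kappa> E powr (1 - a)) powr \<tau>"
      using t0 w0 by (intro powr_mono2 wt_nonneg) auto
    then show ?thesis by (simp add: powr_mult powr_powr a)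
  qed
  have one: "\<nu> x powr (s / 2) * w x powr (1 - s / 2) = 1" for x
  proof -
    have pos: "0 < \<mu> x" "0 < \<omega> x" "0 < \<kappa> x" "0 < \<nu> x" by (rule mu_pair kappa_pair nu_pos)+
    have "(\<nu> x powr (s / 2) * w x powr (1 - s / 2)) powr 2 = \<nu> x powr s * w x powr \<tau>"
    proof -
      have "(1 - s / 2) * 2 = \<tau>" by (simp add: \<tau>_def)
      then show ?thesis by (simp add: powr_mult powr_powr)
    qed
    also have "w x powr \<tau> = \<omega> x powr (1 - 1 / p) * \<kappa> x powr (1 / q)"
      unfolding w_def by (simp add: powr_mult powr_powr a)
    also have "\<nu> x powr s * (\<omega> x powr (1 - 1 / p) * \<kappa> x powr (1 / q))
      = (\<mu> x powr (1 / p) * \<omega> x powr (1 - 1 / p)) * (\<kappa> x powr (- 1 / q) * \<kappa> x powr (1 / q))"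
      unfolding nu_eq by simp
    also have "\<dots> = 1" using mu_pair(8)[of x] pos by (simp add: powr_add[symmetric])
    finally have "((\<nu> x powr (s / 2) * w x powr (1 - s / 2)) powr 2) powr (1 / 2) = 1" by simp
    then show ?thesis unfolding powr_powr by simp
  qed
  have "E \<in> lmeasurable" using E by (intro bounded_set_imp_lmeasurable)
  then have "mea E = wt (\<lambda>x. 1) E" by (simp add: set_integral_const_fmeasurable)
  also have "\<dots> \<le> wt \<nu> E powr (s / 2) * wt w E powr (1 - s / 2)"
    by (rule wt_Holder[OF nu_li nu_nonneg wl w0 locally_integrable_const _ E s2]) (use one in auto)
  finally have "(mea E)\<^sup>2 \<le> (wt \<nu> E powr (s / 2) * wt w E powr (1 - s / 2))\<^sup>2"
    by (intro power_mono) auto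
  also have "\<dots> = wt \<nu> E powr s * wt w E powr \<tau>"
  proof -
    have "s / 2 + s / 2 = s" "(1 - s / 2) + (1 - s / 2) = \<tau>" by (simp_all add: \<tau>_def)
    then have "wt \<nu> E powr (s / 2) * wt \<nu> E powr (s / 2) = wt \<nu> E powr s"
      "wt w E powr (1 - s / 2) * wt w E powr (1 - s / 2) = wt w E powr \<tau>"
      unfolding powr_add[symmetric] by simp_all
    moreover have "(x * y)\<^sup>2 = (x * x) * (y * y)" for x y :: real
      by (simp add: power2_eq_square mult_ac)
    ultimately show ?thesis by simp
  qed
  also have "\<dots> \<le> wt \<nu> E powr s * (wt \<omega> E powr (1 - 1 / p) * wt \<kappa> E powr (1 / q))"
    by (intro mult_left_mono wE) auto
  finally show ?thesis .
qed

lemma Ap_product: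
  assumes S: "S \<in> D"
  shows "wt \<mu> S powr (1 / p) * wt \<sigma> S powr (1 - 1 / q) * (wt \<omega> S powr (1 - 1 / p) * wt \<kappa> S powr (1 / q)) \<le> Bm * Bk * (mea S)\<^sup>2"
proof -
  have "(wt \<mu> S powr (1 / p) * wt \<omega> S powr (1 - 1 / p)) * (wt \<kappa> S powr (1 / q) * wt \<sigma> S powr (1 - 1 / q)) \<le> (Bm * mea S) * (Bk * mea S)"
    using mu_pair(9) by (intro mult_mono mu_pair(10)[OF S] kappa_pair(10)[OF S]) auto
  then show ?thesis by (simp add: power2_eq_square mult_ac)
qed

text \<open>After multiplication by the masses of \<open>\<omega>\<close> and
  \<open>\<kappa>\<close> both sides compare with the squared volume: the left through the two A_p
  conditions, the right through \<open>mea_le_nu\<close>.\<close>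

lemma wt_reverse:
  assumes S: "S \<in> D"
  shows "wt \<mu> S powr (1 / p) * wt \<sigma> S powr (1 - 1 / q) \<le> Bm * Bk * wt \<nu> S powr s"
proof -
  let ?o = "wt \<omega> S powr (1 - 1 / p) * wt \<kappa> S powr (1 / q)"
  have o: "0 < ?o" using wt_pos_D[OF mu_pair(3,5) S] wt_pos_D[OF kappa_pair(2,4) S] by simp
  have "wt \<mu> S powr (1 / p) * wt \<sigma> S powr (1 - 1 / q) * ?o \<le> Bm * Bk * (mea S)\<^sup>2" by (rule Ap_product[OF S])
  also have "\<dots> \<le> Bm * Bk * (wt \<nu> S powr s * ?o)"
    using mu_pair(9) kappa_pair(9) S by (intro mult_left_mono mea_le_nu) (auto simp: D_bounded)
  finally have "wt \<mu> S powr (1 / p) * wt \<sigma> S powr (1 - 1 / q) * ?o \<le> Bm * Bk * wt \<nu> S powr s * ?o"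
    by (simp add: mult_ac)
  then show ?thesis using o by (simp only: mult_le_cancel_right_pos)
qed

text \<open>The admissible numbers in the infimum of \<open>para_norm\<close>. Lower bounds are
  proved for each of them, which also covers the case that there is none.\<close>

definition para_bound :: "(real^'n \<Rightarrow> complex) \<Rightarrow> ennreal \<Rightarrow> bool" where
  "para_bound b N \<longleftrightarrow> N < \<infinity> \<and> (\<forall>f\<in>Linf_c. \<exists>g. is_paraproduct D b f g \<and>
     ennpowr (Lp_int q \<kappa> g) (1 / q) \<le> N * ennpowr (Lp_int p \<mu> f) (1 / p))"

lemma para_norm_geI:
  assumes "\<And>N. para_bound b N \<Longrightarrow> X \<le> N"
  shows "X \<le> para_norm D p \<mu> q \<kappa> b"
  unfolding para_norm_def using assms
  by (auto simp: para_bound_def wLp_norm_eq intro!: Inf_greatest)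

lemma indicator_Linf_c: "S \<in> D \<Longrightarrow> (indicator S :: _ \<Rightarrow> complex) \<in> Linf_c"
proof -
  assume S: "S \<in> D"
  have "{x. indicator S x \<noteq> (0::complex)} = S" by (auto simp: indicator_def)
  moreover have "bounded (range (indicator S :: _ \<Rightarrow> complex))"
    unfolding bounded_iff by (intro exI[of _ 1]) (auto simp: indicator_def)
  ultimately show ?thesis using S D_bounded[OF S] by (auto simp: Linf_c_def)
qed

text \<open>On \<open>S\<close> the function \<open>b\<close> is the paraproduct \<open>g\<close> of
  the indicator up to a constant, so its oscillation is at most twice the mean of
  \<open>norm (g x)\<close>. Hoelder brings in the masses of \<open>\<mu>\<close> and
  \<open>\<sigma>\<close>, which \<open>wt_reverse\<close> converts into that of
  \<open>\<nu>\<close>.\<close>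

lemma osc_le_para_bound:
  assumes b: "locally_integrable b" and N: "para_bound b N" and S: "S \<in> D"
  shows "ennreal (mea S * osc S b) \<le> ennreal (2 * Bm * Bk) * N * ennreal (wt \<nu> S powr s)"
proof -
  obtain g where g: "is_paraproduct D b (indicator S) g"
    "ennpowr (Lp_int q \<kappa> g) (1 / q) \<le> N * ennpowr (Lp_int p \<mu> (indicator S :: _ \<Rightarrow> complex)) (1 / p)"
    using N indicator_Linf_c[OF S] unfolding para_bound_def by blast
  have gl: "locally_integrable g" by (rule is_paraproduct_li[OF g(1)])
  have ae: "AE x in lebesgue. x \<in> S \<longrightarrow> b x - average S b = g x - average S g"
    by (rule paraproduct_indicator[OF b g(1) S])
  have "mea S * osc S b = (LINT x:S|lebesgue. norm (b x - average S b))"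
    unfolding osc_def by (rule avgn_integral[OF S, symmetric])
  also have "\<dots> = (LINT x:S|lebesgue. norm (g x - average S g))"
  proof (rule set_lebesgue_integral_cong_AE[OF D_sets[OF S]])
    show "AE x\<in>S in lebesgue. norm (b x - average S b) = norm (g x - average S g)"
      using ae by eventually_elim auto
  qed (use locally_integrable_measurable[OF b] locally_integrable_measurable[OF gl] in auto)
  also have "\<dots> \<le> (LINT x:S|lebesgue. norm (g x) + norm (average S g))"
    using S gl by (intro set_integral_mono set_integrable_D locally_integrable_norm locally_integrable_diff
      locally_integrable_add locally_integrable_const norm_triangle_ineq4)
  also have "\<dots> = (LINT x:S|lebesgue. norm (g x)) + mea S * norm (average S g)"
    using S gl D_lmeasurable[OF S]
    by (subst set_integral_add) (auto intro!: set_integrable_D locally_integrable_norm locally_integrable_const simp: set_integral_const_fmeasurable)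
  also have "\<dots> \<le> 2 * (mea S * avgn S g)"
    using norm_average_le[OF gl S] D_measure_pos[OF S] unfolding avgn_integral[OF S] by simp
  finally have 1: "mea S * osc S b \<le> 2 * (mea S * avgn S g)" .
  have "ennreal (mea S * avgn S g) = (\<integral>\<^sup>+x\<in>S. ennreal (norm (g x)) \<partial>lebesgue)"
    unfolding avgn_integral[OF S, symmetric] using gl S
    by (intro nn_integral_set_integral[symmetric] set_integrable_D locally_integrable_norm) auto
  also have "\<dots> = (\<integral>\<^sup>+x. ennreal (norm (g x) * norm (indicator S x :: complex)) \<partial>lebesgue)"
    by (intro nn_integral_cong) (auto simp: indicator_def)
  also have "\<dots> \<le> ennpowr (Lp_int q \<kappa> g) (1 / q) * ennpowr (Lp_int q' \<sigma> (indicator S :: _ \<Rightarrow> complex)) (1 / q')"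
    using locally_integrable_measurable[OF gl] locally_integrable_measurable[OF indicator_li[OF S]] by (rule Holder_kappa_sigma)
  also have "\<dots> \<le> N * ennpowr (Lp_int p \<mu> (indicator S :: _ \<Rightarrow> complex)) (1 / p) * ennpowr (Lp_int q' \<sigma> (indicator S :: _ \<Rightarrow> complex)) (1 / q')"
    by (intro mult_right_mono g) simp
  also have "\<dots> = N * ennreal (wt \<mu> S powr (1 / p) * wt \<sigma> S powr (1 - 1 / q))"
    using S mu_pair kappa_pair by (simp add: indicator_Lp wt_nonneg q' ennreal_mult mult.assoc)
  also have "\<dots> \<le> N * ennreal (Bm * Bk * wt \<nu> S powr s)"
    by (intro mult_left_mono ennreal_leI wt_reverse S) simp
  finally have 2: "ennreal (mea S * avgn S g) \<le> N * ennreal (Bm * Bk * wt \<nu> S powr s)" .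
  have "ennreal (mea S * osc S b) \<le> ennreal 2 * ennreal (mea S * avgn S g)"
    using 1 by (subst ennreal_mult[symmetric]) (auto intro!: ennreal_leI)
  also have "\<dots> \<le> ennreal 2 * (N * ennreal (Bm * Bk * wt \<nu> S powr s))" by (intro mult_left_mono 2) simp
  also have "\<dots> = ennreal (2 * Bm * Bk) * N * ennreal (wt \<nu> S powr s)"
    using mu_pair(9) kappa_pair(9) by (simp only: ennreal_mult mult_nonneg_nonneg less_imp_le powr_ge_zero zero_le_numeral mult_ac)
  finally show ?thesis .
qed

end

section \<open>Random signs, synthesis over sparse families, and test functions\<close>

text \<open>Averaging over one sign at a time kills the off-diagonal terms.\<close>

lemma random_signs:
  fixes a :: "'i \<Rightarrow> 'i \<Rightarrow> complex"
  assumes "finite I"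
    and "\<And>\<epsilon>. (\<And>i. \<epsilon> i = 1 \<or> \<epsilon> i = -1) \<Longrightarrow> norm (c + (\<Sum>i\<in>I. \<Sum>j\<in>I. \<epsilon> i * \<epsilon> j * a i j)) \<le> M"
  shows "norm (c + (\<Sum>i\<in>I. a i i)) \<le> M"
  using assms
proof (induction I arbitrary: c rule: finite_induct)
  case empty
  then show ?case using empty.prems[of "\<lambda>_. 1"] by simp
next
  case (insert k L)
  have "norm ((c + a k k) + (\<Sum>i\<in>L. a i i)) \<le> M"
  proof (rule insert.IH)
    fix \<epsilon> :: "'i \<Rightarrow> complex" assume e: "\<And>i. \<epsilon> i = 1 \<or> \<epsilon> i = -1"
    let ?S = "\<Sum>i\<in>L. \<Sum>j\<in>L. \<epsilon> i * \<epsilon> j * a i j"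
    let ?X = "(\<Sum>j\<in>L. \<epsilon> j * a k j) + (\<Sum>i\<in>L. \<epsilon> i * a i k)"
    have eq: "(\<Sum>i\<in>insert k L. \<Sum>j\<in>insert k L. (\<epsilon>(k := t)) i * (\<epsilon>(k := t)) j * a i j) = t * t * a k k + t * ?X + ?S" for t
    proof -
      have neq: "i \<noteq> k" if "i \<in> L" for i using that insert.hyps by auto
      have "(\<Sum>i\<in>insert k L. \<Sum>j\<in>insert k L. (\<epsilon>(k := t)) i * (\<epsilon>(k := t)) j * a i j)
        = (t * t * a k k + (\<Sum>j\<in>L. t * (\<epsilon>(k := t)) j * a k j))
          + (\<Sum>i\<in>L. (\<epsilon>(k := t)) i * t * a i k + (\<Sum>j\<in>L. (\<epsilon>(k := t)) i * (\<epsilon>(k := t)) j * a i j))"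
        using insert.hyps by simp
      also have "\<dots> = (t * t * a k k + (\<Sum>j\<in>L. t * (\<epsilon> j * a k j))) + ((\<Sum>i\<in>L. t * (\<epsilon> i * a i k)) + ?S)"
        unfolding sum.distrib by (intro arg_cong2[of _ _ _ _ "(+)"] sum.cong refl) (auto simp: neq)
      finally show ?thesis by (simp add: sum_distrib_left[symmetric] algebra_simps)
    qed
    have b: "norm (c + (t * t * a k k + t * ?X + ?S)) \<le> M" if "t = 1 \<or> t = -1" for t
      unfolding eq[symmetric] by (rule insert.prems) (use e that in auto)
    have "2 * ((c + a k k) + ?S) = (c + (1 * 1 * a k k + 1 * ?X + ?S)) + (c + ((-1) * (-1) * a k k + (-1) * ?X + ?S))"
      by (simp add: algebra_simps)
    then have "norm (2 * ((c + a k k) + ?S)) \<le> M + M"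
    proof (rule ssubst)
      show "norm ((c + (1 * 1 * a k k + 1 * ?X + ?S)) + (c + ((-1) * (-1) * a k k + (-1) * ?X + ?S))) \<le> M + M"
        by (rule norm_triangle_mono[OF b b]) auto
    qed
    then show "norm ((c + a k k) + ?S) \<le> M" unfolding norm_mult by simp
  qed
  then show ?case using insert.hyps by (simp add: add.assoc)
qed

context dyadic
begin

text \<open>Dual to the sparse embedding. The integral of \<open>\<Phi> y powr t * v y\<close> is a
  sum of integrals of \<open>h y * v y\<close> over cubes; Hoelder and Doob's inequality for
  \<open>h\<close> at the conjugate exponent bring back the same integral, which is
  absorbed.\<close>

lemma sparse_synthesis:
  assumes v: "locally_integrable v" "\<And>x. 0 < v x" and F: "finite F" "F \<subseteq> D"
    and E: "disjoint_family_on E F" "\<And>S. S \<in> F \<Longrightarrow> E S \<in> sets lebesgue" "\<And>S. S \<in> F \<Longrightarrow> E S \<subseteq> S"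
    and K: "0 \<le> K" "\<And>S. S \<in> F \<Longrightarrow> wt v S \<le> K * wt v (E S)"
    and x: "\<And>S. 0 \<le> x S" and t: "1 < t"
  shows "(\<integral>\<^sup>+y. ennreal ((\<Sum>S\<in>F. x S * indicator S y) powr t * v y) \<partial>lebesgue)
    \<le> ennreal ((K * t powr (t / (t - 1))) powr (t - 1) * (\<Sum>S\<in>F. x S powr t * wt v S))"
proof -
  have v0: "\<And>x. 0 \<le> v x" using v(2) less_imp_le by blast
  define \<Phi> where "\<Phi> y = (\<Sum>S\<in>F. x S * indicator S y)" for y
  define h where "h y = \<Phi> y powr (t - 1)" for y
  let ?t' = "t / (t - 1)"
  have t': "1 < ?t'" "1 / ?t' = 1 - 1 / t" "(t - 1) * ?t' = t" "?t' / (?t' - 1) = t" "?t' * (1 - 1 / t) = 1"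
    using t by (auto simp: field_simps)
  have Phi0: "0 \<le> \<Phi> y" for y using x by (auto simp: \<Phi>_def intro!: sum_nonneg)
  have Phim [measurable]: "\<Phi> \<in> borel_measurable lebesgue"
    unfolding \<Phi>_def using F by (intro borel_measurable_sum borel_measurable_times borel_measurable_indicator) auto
  have hm [measurable]: "h \<in> borel_measurable lebesgue" unfolding h_def by measurable
  have h0: "0 \<le> h y" for y by (simp add: h_def)
  note [measurable] = locally_integrable_measurable[OF v(1)]
  define C where "C = sum x F"
  have PhiC: "\<Phi> y \<le> C" for y
    unfolding \<Phi>_def C_def using x by (intro sum_mono) (auto simp: indicator_def)
  have hC: "h y \<le> C powr (t - 1)" for y
    unfolding h_def using PhiC Phi0 t by (intro powr_mono2) auto
  have hv: "locally_integrable (\<lambda>y. h y * v y)"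
  proof (rule locally_integrableI_bounded[OF _ v(1), of _ "C powr (t - 1)"])
    show "norm (h y * v y) \<le> C powr (t - 1) * norm (v y)" for y
      using hC[of y] h0[of y] v0[of y] by (simp add: abs_mult mult_right_mono)
  qed measurable
  let ?Y = "\<integral>\<^sup>+y. ennreal (\<Phi> y powr t * v y) \<partial>lebesgue"
  let ?X = "\<Sum>S\<in>F. x S powr t * wt v S"
  have X0: "0 \<le> ?X" using v0 by (intro sum_nonneg mult_nonneg_nonneg wt_nonneg) auto
  \<comment> \<open>This identity also shows that the integral is finite, as the absorption at the
    end requires.\<close>
  have Yeq: "?Y = ennreal (\<Sum>S\<in>F. x S * wt (\<lambda>y. h y * v y) S)"
  proof -
    have "?Y = (\<integral>\<^sup>+y. (\<Sum>S\<in>F. ennreal (x S) * (ennreal (h y * v y) * indicator S y)) \<partial>lebesgue)"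
    proof (intro nn_integral_cong)
      fix y
      have "\<Phi> y powr t * v y = \<Phi> y * h y * v y"
        using Phi0[of y] by (simp add: h_def powr_mult_base)
      also have "\<dots> = (\<Sum>S\<in>F. x S * (h y * v y * indicator S y))"
        unfolding \<Phi>_def sum_distrib_right by (intro sum.cong refl) (simp add: mult_ac)
      finally have "ennreal (\<Phi> y powr t * v y) = (\<Sum>S\<in>F. ennreal (x S * (h y * v y * indicator S y)))"
        using x h0 v0 by (simp add: sum_ennreal)
      also have "\<dots> = (\<Sum>S\<in>F. ennreal (x S) * (ennreal (h y * v y) * indicator S y))"
        using x h0 v0 by (intro sum.cong refl) (auto simp: indicator_def ennreal_mult)
      finally show "ennreal (\<Phi> y powr t * v y) = (\<Sum>S\<in>F. ennreal (x S) * (ennreal (h y * v y) * indicator S y))" .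
    qed
    also have "\<dots> = (\<Sum>S\<in>F. ennreal (x S) * (\<integral>\<^sup>+y. ennreal (h y * v y) * indicator S y \<partial>lebesgue))"
    proof (subst nn_integral_sum)
      show "(\<lambda>y. ennreal (x S) * (ennreal (h y * v y) * indicator S y)) \<in> borel_measurable lebesgue" if "S \<in> F" for S
      proof -
        have S: "S \<in> D" using that F by auto
        then show ?thesis by measurable
      qed
      show "(\<Sum>S\<in>F. \<integral>\<^sup>+y. ennreal (x S) * (ennreal (h y * v y) * indicator S y) \<partial>lebesgue) = (\<Sum>S\<in>F. ennreal (x S) * (\<integral>\<^sup>+y. ennreal (h y * v y) * indicator S y \<partial>lebesgue))"
        using F by (intro sum.cong refl nn_integral_cmult) (measurable, auto)
    qed
    also have "\<dots> = (\<Sum>S\<in>F. ennreal (x S * wt (\<lambda>y. h y * v y) S))"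
    proof (intro sum.cong refl)
      fix S assume "S \<in> F"
      then have S: "S \<in> D" using F by auto
      show "ennreal (x S) * (\<integral>\<^sup>+y. ennreal (h y * v y) * indicator S y \<partial>lebesgue) = ennreal (x S * wt (\<lambda>y. h y * v y) S)"
        using nn_integral_wt[OF hv _ D_sets[OF S] D_bounded[OF S]] h0 v0 x by (simp add: ennreal_mult wt_nonneg)
    qed
    also have "\<dots> = ennreal (\<Sum>S\<in>F. x S * wt (\<lambda>y. h y * v y) S)"
      using x h0 v0 by (intro sum_ennreal mult_nonneg_nonneg wt_nonneg) auto
    finally show ?thesis .
  qed
  define A where "A S = wt (\<lambda>y. h y * v y) S / wt v S" for S
  have A0: "0 \<le> A S" for S using h0 v0 by (auto simp: A_def intro!: divide_nonneg_nonneg wt_nonneg)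
  let ?W = "\<Sum>S\<in>F. A S powr ?t' * wt v S"
  have W0: "0 \<le> ?W" using v0 by (intro sum_nonneg mult_nonneg_nonneg wt_nonneg) auto
  have W: "ennreal ?W \<le> ennreal (K * t powr ?t') * ?Y"
  proof -
    have "?W \<le> (\<Sum>S\<in>F. A S powr ?t' * (K * wt v (E S)))"
      by (intro sum_mono mult_left_mono K) auto
    also have "\<dots> = K * (\<Sum>S\<in>F. A S powr ?t' * wt v (E S))" by (simp add: sum_distrib_left mult_ac)
    finally have "ennreal ?W \<le> ennreal K * ennreal (\<Sum>S\<in>F. A S powr ?t' * wt v (E S))"
      using K(1) v0 by (subst ennreal_mult[symmetric]) (auto intro!: ennreal_leI sum_nonneg mult_nonneg_nonneg wt_nonneg)
    also have "\<dots> \<le> ennreal K * (ennreal ((?t' / (?t' - 1)) powr ?t') * (\<integral>\<^sup>+y. ennreal (h y powr ?t' * v y) \<partial>lebesgue))"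
      unfolding A_def by (intro mult_left_mono Doob_dyadic[OF v hv h0 hm F t'(1) E]) auto
    also have "(\<integral>\<^sup>+y. ennreal (h y powr ?t' * v y) \<partial>lebesgue) = ?Y"
      unfolding h_def powr_powr t'(3) ..
    finally show ?thesis using K(1) unfolding t'(4) by (simp add: ennreal_mult mult.assoc)
  qed
  have "(\<Sum>S\<in>F. x S * wt (\<lambda>y. h y * v y) S) = (\<Sum>S\<in>F. (x S powr t * wt v S) powr (1 / t) * (A S powr ?t' * wt v S) powr (1 - 1 / t))"
  proof (intro sum.cong refl)
    fix S assume "S \<in> F"
    then have pos: "0 < wt v S" using F wt_pos_D[OF v] by auto
    have "(x S powr t * wt v S) powr (1 / t) * (A S powr ?t' * wt v S) powr (1 - 1 / t)
      = (x S powr t) powr (1 / t) * (A S powr ?t') powr (1 - 1 / t) * (wt v S powr (1 / t) * wt v S powr (1 - 1 / t))"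
      by (simp only: powr_mult mult_ac)
    also have "(x S powr t) powr (1 / t) = x S" unfolding powr_powr using t x by simp
    also have "(A S powr ?t') powr (1 - 1 / t) = A S" unfolding powr_powr t'(5) using A0 by simp
    also have "wt v S powr (1 / t) * wt v S powr (1 - 1 / t) = wt v S"
      unfolding powr_add[symmetric] using pos by simp
    finally show "x S * wt (\<lambda>y. h y * v y) S = (x S powr t * wt v S) powr (1 / t) * (A S powr ?t' * wt v S) powr (1 - 1 / t)"
      using pos by (simp add: A_def)
  qed
  also have "\<dots> \<le> ?X powr (1 / t) * ?W powr (1 - 1 / t)"
    using F(1) t v0 by (intro sum_Holder) (auto intro!: mult_nonneg_nonneg wt_nonneg)
  finally have "?Y \<le> ennreal (?X powr (1 / t) * ?W powr (1 - 1 / t))"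
    unfolding Yeq by (rule ennreal_leI)
  also have "\<dots> = ennreal (?X powr (1 / t)) * ennpowr (ennreal ?W) (1 - 1 / t)"
    using W0 by (simp add: ennreal_mult)
  also have "\<dots> \<le> ennreal (?X powr (1 / t)) * ennpowr (ennreal (K * t powr ?t') * ?Y) (1 - 1 / t)"
    using t by (intro mult_left_mono ennpowr_mono W) auto
  also have "\<dots> = ennreal (?X powr (1 / t) * (K * t powr ?t') powr (1 - 1 / t)) * ennpowr ?Y (1 - 1 / t)"
  proof -
    have a: "0 < 1 - 1 / t" "0 \<le> K * t powr ?t'" using t K(1) by auto
    show ?thesis unfolding ennpowr_mult[OF a(1)] ennpowr_ennreal[OF a(2)] by (simp add: ennreal_mult mult.assoc)
  qed
  finally have "?Y \<le> ennreal (?X powr (1 / t) * (K * t powr ?t') powr (1 - 1 / t)) * ennpowr ?Y (1 - 1 / t)" .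
  then have "?Y \<le> ennpowr (ennreal (?X powr (1 / t) * (K * t powr ?t') powr (1 - 1 / t))) (1 / (1 / t))"
    using t Yeq by (intro ennpowr_absorb) auto
  also have "\<dots> = ennreal ((?X powr (1 / t) * (K * t powr ?t') powr (1 - 1 / t)) powr t)" using t by simp
  also have "(?X powr (1 / t) * (K * t powr ?t') powr (1 - 1 / t)) powr t = (K * t powr ?t') powr (t - 1) * ?X"
  proof -
    have "(1 - 1 / t) * t = t - 1" using t by (simp add: left_diff_distrib)
    moreover have "1 / t * t = 1" using t by simp
    ultimately have "(X powr (1 / t) * w powr (1 - 1 / t)) powr t = w powr (t - 1) * X" if "0 \<le> X" for X w :: real
      using that by (simp only: powr_mult powr_powr powr_one mult.commute)
    then show ?thesis using X0 by blast
  qed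
  finally show ?thesis unfolding \<Phi>_def .
qed

text \<open>\<open>g\<close> is the conjugate sign of \<open>b - average S b\<close>, made mean zero
  on \<open>S\<close>. The paraproduct of the indicator is known on \<open>S\<close> only up to an
  additive constant, which the mean zero condition removes.\<close>

lemma test_function:
  fixes b :: "real^'n \<Rightarrow> complex"
  assumes b: "locally_integrable b" and S: "S \<in> D"
  shows "\<exists>g. g \<in> borel_measurable lebesgue \<and> (\<forall>y. norm (g y) \<le> 2 * indicator S y) \<and>
    (\<forall>P. is_paraproduct D b (indicator S) P \<longrightarrow> (LINT y|lebesgue. P y * g y) = complex_of_real (mea S * osc S b))"
proof -
  let ?c = "average S b"
  define u where "u y = cnj (sgn (b y - ?c))" for y
  define g where "g y = indicator S y *\<^sub>R (u y - average S u)" for y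
  have bl: "locally_integrable (\<lambda>y. b y - ?c)" by (intro locally_integrable_diff b locally_integrable_const)
  have bm: "(\<lambda>y. b y - ?c) \<in> borel_measurable lebesgue" by (rule locally_integrable_measurable[OF bl])
  have um: "u \<in> borel_measurable lebesgue"
    unfolding u_def by (rule borel_measurable_cnj_sgn[OF bm])
  have u1: "norm (u y) \<le> 1" for y by (simp add: u_def norm_sgn)
  have ul: "locally_integrable u"
    by (rule locally_integrableI_bounded[OF um locally_integrable_const[of "1::real"], of 1]) (use u1 in auto)
  have av1: "norm (average S u) \<le> 1"
  proof -
    have "mea S * avgn S u \<le> (LINT x:S|lebesgue. 1)"
      unfolding avgn_integral[OF S, symmetric]
      using ul S u1 by (intro set_integral_mono set_integrable_D locally_integrable_norm locally_integrable_const)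
    then have "avgn S u \<le> 1" using D_measure_pos[OF S] D_lmeasurable[OF S]
      by (simp add: set_integral_const_fmeasurable)
    then show ?thesis using norm_average_le[OF ul S] by linarith
  qed
  have gm: "g \<in> borel_measurable lebesgue"
    unfolding g_def by (intro borel_measurable_scaleR borel_measurable_indicator D_sets S borel_measurable_diff um borel_measurable_const)
  have g2: "norm (g y) \<le> 2 * indicator S y" for y
    using norm_triangle_ineq4[of "u y" "average S u"] u1[of y] av1 by (auto simp: g_def indicator_def)
  have gS: "(LINT y:S|lebesgue. g y) = 0"
  proof -
    have "(LINT y:S|lebesgue. g y) = (LINT y:S|lebesgue. u y - average S u)"
      using S by (intro set_lebesgue_integral_cong) (auto simp: g_def)
    also have "\<dots> = mea S *\<^sub>R average S (\<lambda>y. u y - average S u)" by (rule average_integral[OF S])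
    also have "average S (\<lambda>y. u y - average S u) = average S u - average S u"
      using S ul by (simp add: average_diff set_integrable_D locally_integrable_const average_const)
    finally show ?thesis by simp
  qed
  have nl: "locally_integrable (\<lambda>y. complex_of_real (norm (b y - ?c)))"
    by (rule locally_integrableI_bounded[OF _ bl, of _ 1])
       (use measurable_compose[OF bm borel_measurable_norm] in \<open>auto intro: borel_measurable_of_real\<close>)
  have main: "(LINT y:S|lebesgue. (b y - ?c) * g y) = complex_of_real (mea S * osc S b)"
    and int: "set_integrable lebesgue S (\<lambda>y. (b y - ?c) * g y)"
  proof -
    have eq: "(b y - ?c) * g y = complex_of_real (norm (b y - ?c)) - (b y - ?c) * average S u" if "y \<in> S" for y
      using that mult_cnj_sgn[of "b y - ?c"] by (simp add: g_def u_def right_diff_distrib)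
    have i1: "set_integrable lebesgue S (\<lambda>y. complex_of_real (norm (b y - ?c)))" using S nl by (intro set_integrable_D)
    have i2: "set_integrable lebesgue S (\<lambda>y. (b y - ?c) * average S u)"
      using set_integrable_D[OF bl S] by (rule set_integrable_mult_left)
    have "(LINT y:S|lebesgue. (b y - ?c) * g y) = (LINT y:S|lebesgue. complex_of_real (norm (b y - ?c)) - (b y - ?c) * average S u)"
      using S by (intro set_lebesgue_integral_cong) (auto simp: eq)
    also have "\<dots> = (LINT y:S|lebesgue. complex_of_real (norm (b y - ?c))) - (LINT y:S|lebesgue. (b y - ?c) * average S u)"
      by (rule set_integral_diff(2)[OF i1 i2])
    also have "(LINT y:S|lebesgue. (b y - ?c) * average S u) = (LINT y:S|lebesgue. b y - ?c) * average S u" by simp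
    also have "(LINT y:S|lebesgue. b y - ?c) = 0"
      using S b average_integral[OF S, of "\<lambda>y. b y - ?c"]
      by (simp add: average_diff set_integrable_D locally_integrable_const average_const)
    also have "(LINT y:S|lebesgue. complex_of_real (norm (b y - ?c))) = complex_of_real (mea S * osc S b)"
      unfolding osc_def avgn_integral[OF S, symmetric] by (rule set_integral_complex_of_real)
    finally show "(LINT y:S|lebesgue. (b y - ?c) * g y) = complex_of_real (mea S * osc S b)" by simp
    show "set_integrable lebesgue S (\<lambda>y. (b y - ?c) * g y)"
      using set_integral_diff(1)[OF i1 i2] by (subst set_integrable_cong[OF refl refl eq]) auto
  qed
  have "(LINT y|lebesgue. P y * g y) = complex_of_real (mea S * osc S b)" if P: "is_paraproduct D b (indicator S) P" for P
  proof -
    have pl: "locally_integrable P" by (rule is_paraproduct_li[OF P])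
    have ae: "AE x in lebesgue. x \<in> S \<longrightarrow> b x - ?c = P x - average S P"
      by (rule paraproduct_indicator[OF b P S])
    let ?d = "average S P"
    have gint: "set_integrable lebesgue S (\<lambda>y. ?d * g y)"
    proof -
      have "locally_integrable g"
        by (rule locally_integrableI_bounded[OF gm locally_integrable_const[of "1::real"], of 2])
           (use order_trans[OF g2] in \<open>auto simp: indicator_def\<close>)
      then show ?thesis using S by (intro set_integrable_mult_right set_integrable_D)
    qed
    have "(LINT y|lebesgue. P y * g y) = (LINT y:S|lebesgue. P y * g y)"
      unfolding set_lebesgue_integral_def by (intro Bochner_Integration.integral_cong) (auto simp: g_def indicator_def)
    also have "\<dots> = (LINT y:S|lebesgue. (b y - ?c) * g y + ?d * g y)"
    proof (rule set_lebesgue_integral_cong_AE[OF D_sets[OF S]])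
      show "AE y\<in>S in lebesgue. P y * g y = (b y - ?c) * g y + ?d * g y"
        using ae by eventually_elim (auto simp: left_diff_distrib)
    qed (use locally_integrable_measurable[OF pl] bm gm in \<open>auto intro!: borel_measurable_times borel_measurable_add\<close>)
    also have "\<dots> = (LINT y:S|lebesgue. (b y - ?c) * g y) + (LINT y:S|lebesgue. ?d * g y)"
      by (rule set_integral_add(2)[OF int gint])
    also have "(LINT y:S|lebesgue. ?d * g y) = 0" using gS by simp
    finally show ?thesis using main by simp
  qed
  then show ?thesis using gm g2 by blast
qed

text \<open>Representatives are determined almost everywhere only, so linearity is carried over from
  partial sums: the L^1 distance of the two sides on \<open>K\<close> is bounded by errors that tend
  to 0 along the net.\<close>

lemma paraproduct_linear:
  fixes b :: "real^'n \<Rightarrow> complex"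
  assumes I: "finite I" and P: "\<And>i. i \<in> I \<Longrightarrow> is_paraproduct D b (f i) (P i)" and f: "\<And>i. i \<in> I \<Longrightarrow> locally_integrable (f i)"
    and G: "is_paraproduct D b (\<lambda>x. \<Sum>i\<in>I. c i * f i x) G" and K: "compact K"
  shows "AE x in lebesgue. x \<in> K \<longrightarrow> G x = (\<Sum>i\<in>I. c i * P i x)"
proof -
  have Ks: "K \<in> sets lebesgue" using K by (simp add: lmeasurable_compact fmeasurableD)
  have Gm: "G \<in> borel_measurable lebesgue" by (rule locally_integrable_measurable[OF is_paraproduct_li[OF G]])
  have Pm: "P i \<in> borel_measurable lebesgue" if "i \<in> I" for i
    by (rule locally_integrable_measurable[OF is_paraproduct_li[OF P[OF that]]])
  let ?f = "\<lambda>x. \<Sum>i\<in>I. c i * f i x" and ?H = "\<lambda>x. \<Sum>i\<in>I. c i * P i x"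
  have Hm: "?H \<in> borel_measurable lebesgue" using Pm by (intro borel_measurable_sum borel_measurable_times) auto
  have av: "average Q ?f = (\<Sum>i\<in>I. c i * average Q (f i))" if "Q \<in> D" for Q
  proof -
    have "(LINT x:Q|lebesgue. ?f x) = (\<Sum>i\<in>I. LINT x:Q|lebesgue. c i * f i x)"
      unfolding set_lebesgue_integral_def scaleR_sum_right
    proof (intro Bochner_Integration.integral_sum)
      fix i assume "i \<in> I"
      then have "set_integrable lebesgue Q (\<lambda>x. c i * f i x)"
        by (intro set_integrable_mult_right set_integrable_D f that)
      then show "integrable lebesgue (\<lambda>x. indicator Q x *\<^sub>R (c i * f i x))" by (simp only: set_integrable_def)
    qed
    then show ?thesis by (simp add: average_def scaleR_sum_right)
  qed
  have lin: "psum b ?f F x = (\<Sum>i\<in>I. c i * psum b (f i) F x)" if "F \<subseteq> D" for F x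
  proof -
    have "psum b ?f F x = (\<Sum>Q\<in>F. \<Sum>i\<in>I. c i * (mart_diff D Q b x * average Q (f i)))"
      unfolding psum_def para_term_def using that av
      by (intro sum.cong refl) (auto simp: sum_distrib_left mult_ac subset_iff)
    also have "\<dots> = (\<Sum>i\<in>I. \<Sum>Q\<in>F. c i * (mart_diff D Q b x * average Q (f i)))" by (rule sum.swap)
    finally show ?thesis by (simp add: psum_def para_term_def sum_distrib_left)
  qed
  let ?n = "\<lambda>h. \<integral>\<^sup>+x\<in>K. ennreal (norm (h x)) \<partial>lebesgue"
  have lim: "((\<lambda>F. ?n (\<lambda>x. psum b ?f F x - G x) + (\<Sum>i\<in>I. ennreal (norm (c i)) * ?n (\<lambda>x. psum b (f i) F x - P i x)))
     \<longlongrightarrow> 0 + (\<Sum>i\<in>I. ennreal (norm (c i)) * 0)) (finite_subsets_at_top D)"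
    using P G K unfolding is_paraproduct_def has_uncond_L1_sum_def psum_def[symmetric]
    by (intro tendsto_add tendsto_sum ennreal_tendsto_cmult) auto
  have le: "?n (\<lambda>x. G x - ?H x) \<le> ?n (\<lambda>x. psum b ?f F x - G x) + (\<Sum>i\<in>I. ennreal (norm (c i)) * ?n (\<lambda>x. psum b (f i) F x - P i x))"
    if F: "F \<subseteq> D" for F
  proof -
    have pm: "psum b h F \<in> borel_measurable lebesgue" for h by (rule psum_measurable[OF F])
    have "?n (\<lambda>x. G x - ?H x) \<le> (\<integral>\<^sup>+x. ennreal (norm (psum b ?f F x - G x)) * indicator K x
        + (\<Sum>i\<in>I. ennreal (norm (c i)) * (ennreal (norm (psum b (f i) F x - P i x)) * indicator K x)) \<partial>lebesgue)"
    proof (rule nn_integral_mono)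
      fix x
      have "G x - ?H x = - (psum b ?f F x - G x) + (\<Sum>i\<in>I. c i * (psum b (f i) F x - P i x))"
        unfolding lin[OF F] by (simp add: right_diff_distrib sum_subtractf)
      then have "norm (G x - ?H x) \<le> norm (psum b ?f F x - G x) + norm (\<Sum>i\<in>I. c i * (psum b (f i) F x - P i x))"
        using norm_triangle_ineq[of "- (psum b ?f F x - G x)" "\<Sum>i\<in>I. c i * (psum b (f i) F x - P i x)"]
        by (simp only: norm_minus_cancel)
      also have "norm (\<Sum>i\<in>I. c i * (psum b (f i) F x - P i x)) \<le> (\<Sum>i\<in>I. norm (c i) * norm (psum b (f i) F x - P i x))"
        by (rule order_trans[OF norm_sum]) (simp add: norm_mult)
      finally have "norm (G x - ?H x) \<le> norm (psum b ?f F x - G x) + (\<Sum>i\<in>I. norm (c i) * norm (psum b (f i) F x - P i x))"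
        by simp
      then have "ennreal (norm (G x - ?H x)) \<le> ennreal (norm (psum b ?f F x - G x)) + (\<Sum>i\<in>I. ennreal (norm (c i)) * ennreal (norm (psum b (f i) F x - P i x)))"
        by (simp add: ennreal_mult[symmetric] sum_ennreal sum_nonneg ennreal_plus[symmetric] ennreal_leI del: ennreal_plus)
      then show "ennreal (norm (G x - ?H x)) * indicator K x \<le> ennreal (norm (psum b ?f F x - G x)) * indicator K x
        + (\<Sum>i\<in>I. ennreal (norm (c i)) * (ennreal (norm (psum b (f i) F x - P i x)) * indicator K x))"
        by (auto simp: indicator_def)
    qed
    also have "\<dots> = ?n (\<lambda>x. psum b ?f F x - G x) + (\<Sum>i\<in>I. ennreal (norm (c i)) * ?n (\<lambda>x. psum b (f i) F x - P i x))"
    proof -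
      have km: "(\<lambda>x. ennreal (norm (h x)) * indicator K x) \<in> borel_measurable lebesgue"
        if "h \<in> borel_measurable lebesgue" for h :: "real^'n \<Rightarrow> complex"
        by (intro borel_measurable_times_ennreal borel_measurable_indicator Ks measurable_compose[OF _ measurable_ennreal]
            measurable_compose[OF that borel_measurable_norm])
      show ?thesis
      proof (subst nn_integral_add)
        show "(\<lambda>x. ennreal (norm (psum b ?f F x - G x)) * indicator K x) \<in> borel_measurable lebesgue"
          using pm Gm by (intro km borel_measurable_diff)
        have tm: "(\<lambda>x. ennreal (norm (psum b (f i) F x - P i x)) * indicator K x) \<in> borel_measurable lebesgue" if "i \<in> I" for i
          using pm Pm[OF that] by (intro km borel_measurable_diff)
        then show "(\<lambda>x. \<Sum>i\<in>I. ennreal (norm (c i)) * (ennreal (norm (psum b (f i) F x - P i x)) * indicator K x)) \<in> borel_measurable lebesgue"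
          by (intro borel_measurable_sum) (rule borel_measurable_times_ennreal[OF borel_measurable_const tm])
        have "(\<integral>\<^sup>+x. (\<Sum>i\<in>I. ennreal (norm (c i)) * (ennreal (norm (psum b (f i) F x - P i x)) * indicator K x)) \<partial>lebesgue)
          = (\<Sum>i\<in>I. \<integral>\<^sup>+x. ennreal (norm (c i)) * (ennreal (norm (psum b (f i) F x - P i x)) * indicator K x) \<partial>lebesgue)"
          by (rule nn_integral_sum) (rule borel_measurable_times_ennreal[OF borel_measurable_const tm])
        also have "\<dots> = (\<Sum>i\<in>I. ennreal (norm (c i)) * ?n (\<lambda>x. psum b (f i) F x - P i x))"
          using tm by (intro sum.cong refl nn_integral_cmult)
        finally show "?n (\<lambda>x. psum b ?f F x - G x) + (\<integral>\<^sup>+x. (\<Sum>i\<in>I. ennreal (norm (c i)) * (ennreal (norm (psum b (f i) F x - P i x)) * indicator K x)) \<partial>lebesgue)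
          = ?n (\<lambda>x. psum b ?f F x - G x) + (\<Sum>i\<in>I. ennreal (norm (c i)) * ?n (\<lambda>x. psum b (f i) F x - P i x))" by simp
      qed
    qed
    finally show ?thesis .
  qed
  have "?n (\<lambda>x. G x - ?H x) \<le> 0"
    using tendsto_lowerbound[OF lim, of "?n (\<lambda>x. G x - ?H x)"] eventually_finite_subsets_at_top_weakI[of D] le
      finite_subsets_at_top_neq_bot[of D] by simp
  then have "AE x in lebesgue. ennreal (norm (G x - ?H x)) * indicator K x = 0"
    using Gm Hm Ks by (subst nn_integral_0_iff_AE[symmetric])
      (auto intro!: borel_measurable_times_ennreal borel_measurable_indicator measurable_compose[OF _ measurable_ennreal]
       measurable_compose[OF _ borel_measurable_norm] borel_measurable_diff)
  then show ?thesis by eventually_elim auto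
qed

text \<open>Allows one centre, the average over the root, on all subcubes of a stopping tree at the
  price of a factor 2.\<close>

lemma osc_le_twice:
  assumes b: "locally_integrable b" and Q: "Q \<in> D"
  shows "mea Q * osc Q b \<le> 2 * (LINT x:Q|lebesgue. norm (b x - c))"
proof -
  have bl: "locally_integrable (\<lambda>x. b x - c)" by (intro locally_integrable_diff b locally_integrable_const)
  have av: "average Q (\<lambda>x. b x - c) = average Q b - c"
    using b Q by (simp add: average_diff set_integrable_D locally_integrable_const average_const)
  have "mea Q * osc Q b = (LINT x:Q|lebesgue. norm (b x - average Q b))"
    unfolding osc_def by (rule avgn_integral[OF Q, symmetric])
  also have "\<dots> \<le> (LINT x:Q|lebesgue. norm (b x - c) + norm (average Q b - c))"
  proof (intro set_integral_mono)
    show "norm (b x - average Q b) \<le> norm (b x - c) + norm (average Q b - c)" for x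
      using norm_triangle_ineq4[of "b x - c" "average Q b - c"] by simp
  qed (use b bl Q in \<open>auto intro!: set_integrable_D locally_integrable_norm locally_integrable_add locally_integrable_diff locally_integrable_const\<close>)
  also have "\<dots> = (LINT x:Q|lebesgue. norm (b x - c)) + mea Q * norm (average Q b - c)"
    using Q bl D_lmeasurable[OF Q]
    by (subst set_integral_add) (auto intro!: set_integrable_D locally_integrable_norm locally_integrable_const simp: set_integral_const_fmeasurable)
  also have "mea Q * norm (average Q b - c) \<le> (LINT x:Q|lebesgue. norm (b x - c))"
    unfolding avgn_integral[OF Q] using norm_average_le[OF bl Q] D_measure_pos[OF Q] unfolding av by (intro mult_left_mono) auto
  finally show ?thesis by simp
qed

end

section \<open>Principal cubes of the sharp maximal function\<close>

context bloom
begin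

text \<open>Stopping at this factor leaves at most the fraction \<open>2 / Afac\<close> of the mass
  of \<open>\<nu>\<close>. The value makes the squared volume ratio at most 1/4, hence the volume
  ratio at most 1/2; the summand 1 ensures \<open>Afac \<ge> 1\<close>.\<close>

definition "Afac = 2 * (4 * Bm * Bk) powr (1 / s) + 1"

lemma Afac: "1 \<le> Afac" "(2 / Afac) powr s * (Bm * Bk) \<le> 1 / 4"
proof -
  let ?B = "4 * Bm * Bk"
  have B: "0 < ?B" using mu_pair(9) kappa_pair(9) by simp
  have p: "0 < ?B powr (1 / s)" using mu_pair(9) kappa_pair(9) by (simp add: less_imp_neq[symmetric])
  show A1: "1 \<le> Afac" using p by (simp add: Afac_def)
  have "2 / Afac \<le> 2 / (2 * ?B powr (1 / s))"
  proof (rule divide_left_mono)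
    show "2 * ?B powr (1 / s) \<le> Afac" by (simp add: Afac_def)
    have "0 < Afac" "0 < 2 * ?B powr (1 / s)" using A1 p by linarith+
    then show "0 < Afac * (2 * ?B powr (1 / s))" by (rule mult_pos_pos)
  qed simp
  then have "(2 / Afac) powr s \<le> (1 / ?B powr (1 / s)) powr s"
    using s_pos A1 by (intro powr_mono2) auto
  also have "\<dots> = 1 / ?B" using B s_pos by (simp add: powr_divide powr_powr)
  finally have "(2 / Afac) powr s * (Bm * Bk) \<le> 1 / ?B * (Bm * Bk)"
    using mu_pair(9) kappa_pair(9) by (intro mult_right_mono) auto
  also have "\<dots> = 1 / 4" using mu_pair(9) kappa_pair(9) by (simp add: less_imp_neq[symmetric])
  finally show "(2 / Afac) powr s * (Bm * Bk) \<le> 1 / 4" .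
qed

text \<open>Where \<open>sharp b\<close> jumps by a large factor little \<open>\<nu>\<close>-mass is left, hence little Lebesgue measure,
  so the principal cubes of \<open>sharp b\<close> form a sparse family.\<close>

lemma sharp_stop_measure:
  assumes b: "locally_integrable b" and S: "S \<in> D" and stp: "\<And>Q. stp S Q \<Longrightarrow> sharp b Q > Afac * sharp b S"
  shows "mea (\<Union>(stops stp S)) \<le> mea S / 2"
proof -
  let ?G = "stops stp S" and ?c = "average S b"
  let ?U = "\<Union>?G"
  have GD: "?G \<subseteq> D" by (rule stops_D)
  have GS: "Q \<subseteq> S" if "Q \<in> ?G" for Q using stops_psubset[OF that] by auto
  have US: "?U \<subseteq> S" using GS by auto
  have U: "?U \<in> sets lebesgue" "bounded ?U"
    using D_subset_sets[OF GD] bounded_subset[OF D_bounded[OF S] US] by auto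
  have bl: "locally_integrable (\<lambda>x. 2 * norm (b x - ?c))"
    by (rule locally_integrableI_bounded[OF _ locally_integrable_diff[OF b locally_integrable_const[of ?c]], of _ 2])
       (use locally_integrable_measurable[OF locally_integrable_norm[OF locally_integrable_diff[OF b locally_integrable_const[of ?c]]]] in auto)
  have int2: "(LINT x:Q|lebesgue. 2 * norm (b x - ?c)) = 2 * (LINT x:Q|lebesgue. norm (b x - ?c))" for Q by simp
  have oscS: "(LINT x:S|lebesgue. norm (b x - ?c)) = mea S * osc S b"
    unfolding osc_def by (rule avgn_integral[OF S])
  have "Q \<in> ?G \<Longrightarrow> Afac * sharp b S * wt \<nu> Q \<le> (LINT x:Q|lebesgue. 2 * norm (b x - ?c))
      \<and> 0 < (LINT x:Q|lebesgue. 2 * norm (b x - ?c))" for Q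
  proof -
    assume Q: "Q \<in> ?G"
    then have QD: "Q \<in> D" using GD by auto
    have n: "0 < wt \<nu> Q" by (rule wt_nu_pos[OF QD])
    have A0: "0 \<le> Afac * sharp b S" using Afac(1) sharp_nonneg by (intro mult_nonneg_nonneg) auto
    have j: "Afac * sharp b S < sharp b Q" using Q by (intro stp) (auto simp: stops_def)
    then have "Afac * sharp b S * wt \<nu> Q < mea Q * osc Q b"
      using n by (simp add: sharp_def pos_less_divide_eq)
    moreover have "0 \<le> Afac * sharp b S * wt \<nu> Q" using A0 n by simp
    ultimately show ?thesis
      unfolding int2 using osc_le_twice[OF b QD, of ?c] by linarith
  qed
  note Q1 = this
  \<comment> \<open>If \<open>sharp b S\<close> is 0, then \<open>b\<close> is constant almost
    everywhere on \<open>S\<close> and nothing stops. Otherwise the jump inequalities are summed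
    over the disjoint stopping cubes.\<close>
  have nuU: "wt \<nu> ?U \<le> 2 / Afac * wt \<nu> S"
  proof (cases "sharp b S = 0")
    case True
    then have "osc S b = 0" using wt_nu_pos[OF S] D_measure_pos[OF S] by (auto simp: sharp_def)
    have "?G = {}"
    proof (rule ccontr)
      assume "?G \<noteq> {}"
      then obtain Q where Q: "Q \<in> ?G" by auto
      then have QD: "Q \<in> D" using GD by auto
      have "(LINT x:Q|lebesgue. 2 * norm (b x - ?c)) \<le> (LINT x:S|lebesgue. 2 * norm (b x - ?c))"
        using GS[OF Q] QD S bl by (intro set_integral_mono_set set_integrable_D) auto
      also have "\<dots> = 0" unfolding int2 oscS \<open>osc S b = 0\<close> by simp
      finally show False using Q1[OF Q] by simp
    qed
    then show ?thesis using Afac(1) wt_nu_pos[OF S] by (simp add: set_lebesgue_integral_def)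
  next
    case False
    then have sp: "0 < Afac * sharp b S" using Afac(1) sharp_nonneg[of b S] by (intro mult_pos_pos) auto
    have "(LINT x:?U|lebesgue. (Afac * sharp b S) * \<nu> x) \<le> (LINT x:S|lebesgue. 2 * norm (b x - ?c))"
    proof (rule disjoint_Union_integral_le[OF _ _ bl _ S GD stops_disjoint GS])
      show "locally_integrable (\<lambda>x. (Afac * sharp b S) * \<nu> x)"
      proof (rule locally_integrableI_bounded[OF _ nu_li])
        show "norm ((Afac * sharp b S) * \<nu> x) \<le> (Afac * sharp b S) * norm (\<nu> x)" for x
          unfolding norm_mult[of "Afac * sharp b S"] real_norm_def[of "Afac * sharp b S"] abs_of_pos[OF sp] ..
      qed (use locally_integrable_measurable[OF nu_li] in simp)
      show "0 \<le> (Afac * sharp b S) * \<nu> x" for x by (rule mult_nonneg_nonneg[OF less_imp_le[OF sp] nu_nonneg])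
      show "(LINT x:Q|lebesgue. (Afac * sharp b S) * \<nu> x) \<le> (LINT x:Q|lebesgue. 2 * norm (b x - ?c))" if "Q \<in> ?G" for Q
        using Q1[OF that] by simp
    qed auto
    then have "(Afac * sharp b S) * wt \<nu> ?U \<le> 2 * (mea S * osc S b)" unfolding int2 oscS by simp
    also have "mea S * osc S b = sharp b S * wt \<nu> S" using wt_nu_pos[OF S] by (simp add: sharp_def)
    finally have "sharp b S * (Afac * wt \<nu> ?U) \<le> sharp b S * (2 * wt \<nu> S)" by (simp add: mult_ac)
    then have "Afac * wt \<nu> ?U \<le> 2 * wt \<nu> S"
      using False sharp_nonneg[of b S] by (simp add: mult_le_cancel_left)
    then show ?thesis using Afac(1) by (simp add: pos_le_divide_eq mult.commute)
  qed
  \<comment> \<open>The masses of \<open>\<omega>\<close> and \<open>\<kappa>\<close> only decrease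
    from \<open>S\<close> to the stopped set, so \<open>mea_le_nu\<close> turns a small mass of
    \<open>\<nu>\<close> into a small volume.\<close>
  let ?o = "\<lambda>E. wt \<omega> E powr (1 - 1 / p) * wt \<kappa> E powr (1 / q)"
  have oU: "?o ?U \<le> ?o S"
    using p1 q1 mu_pair kappa_pair U US S by (intro mult_mono powr_mono2 wt_mono wt_nonneg) (auto simp: D_bounded)
  have "(mea ?U)\<^sup>2 \<le> wt \<nu> ?U powr s * ?o ?U" by (rule mea_le_nu[OF U])
  also have "\<dots> \<le> (2 / Afac * wt \<nu> S) powr s * ?o S"
    using nuU s_pos nu_nonneg by (intro mult_mono powr_mono2 oU wt_nonneg mult_nonneg_nonneg) auto
  also have "\<dots> = (2 / Afac) powr s * (wt \<nu> S powr s * ?o S)" by (simp only: powr_mult mult.assoc)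
  also have "\<dots> \<le> (2 / Afac) powr s * (Bm * Bk * (mea S)\<^sup>2)"
  proof (intro mult_left_mono)
    have "wt \<nu> S powr s * ?o S \<le> wt \<mu> S powr (1 / p) * wt \<sigma> S powr (1 - 1 / q) * ?o S"
      using S by (intro mult_right_mono wt_nu_s) (auto simp: D_bounded)
    also have "\<dots> \<le> Bm * Bk * (mea S)\<^sup>2" by (rule Ap_product[OF S])
    finally show "wt \<nu> S powr s * ?o S \<le> Bm * Bk * (mea S)\<^sup>2" .
  qed simp
  also have "\<dots> = (2 / Afac) powr s * (Bm * Bk) * (mea S)\<^sup>2" by (simp add: mult.assoc)
  also have "\<dots> \<le> 1 / 4 * (mea S)\<^sup>2" by (intro mult_right_mono Afac) auto
  also have "\<dots> = (mea S / 2)\<^sup>2" by (simp add: power2_eq_square)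
  finally show ?thesis by (rule power2_le_imp_le) simp
qed

text \<open>Membership in the finite set \<open>QQ\<close> keeps the stopping family finite and
  inside \<open>QQ\<close>.\<close>

definition stop_sharp :: "(real^'n \<Rightarrow> complex) \<Rightarrow> (real^'n) set set \<Rightarrow> (real^'n) set \<Rightarrow> (real^'n) set \<Rightarrow> bool" where
  "stop_sharp b QQ S Q \<longleftrightarrow> Q \<in> QQ \<and> sharp b Q > Afac * sharp b S"

lemma principal_cubes:
  assumes b: "locally_integrable b" and QQ: "finite QQ" "QQ \<subseteq> D"
  obtains F where "F \<subseteq> QQ" "sparse F" "\<And>Q. Q \<in> QQ \<Longrightarrow> \<exists>S\<in>F. Q \<subseteq> S \<and> sharp b Q \<le> Afac * sharp b S"
proof -
  obtain T where T: "T \<subseteq> QQ" "disjoint T" "\<And>Q. Q \<in> QQ \<Longrightarrow> \<exists>P\<in>T. Q \<subseteq> P"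
    using maximal_cubes[OF QQ] by blast
  let ?st = "stop_sharp b QQ"
  have TD: "T \<subseteq> D" using T QQ by blast
  have gen: "stop_gen ?st T n \<subseteq> QQ" for n
    by (induction n) (use T in \<open>auto simp: stops_def stop_sharp_def\<close>)
  show thesis
  proof (rule that[of "stop_family ?st T"])
    show "stop_family ?st T \<subseteq> QQ" using gen by (auto simp: stop_family_def)
    show "sparse (stop_family ?st T)"
      by (intro sparse_stop_family TD T sharp_stop_measure[OF b]) (auto simp: stop_sharp_def)
    fix Q assume Q: "Q \<in> QQ"
    then obtain P where "P \<in> T" "Q \<subseteq> P" using T(3) by blast
    then obtain S where S: "S \<in> stop_family ?st T" "Q \<in> stop_tree ?st S"
      using ex_stop_tree[OF TD, of Q P ?st] Q QQ by blast
    have SD: "S \<in> D" using S stop_family_D[OF TD] by blast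
    have QS: "Q \<subseteq> S" using S(2) by (auto simp: stop_tree_def)
    have "sharp b Q \<le> Afac * sharp b S"
    proof (cases "Q = S")
      case True
      then show ?thesis using mult_right_mono[OF Afac(1) sharp_nonneg[of b S]] by simp
    next
      case False
      then have "\<not> ?st S Q" using stop_tree_not_stop[OF SD S(2), of Q] Q QS QQ by auto
      then show ?thesis using Q by (simp add: stop_sharp_def)
    qed
    then show "\<exists>S\<in>stop_family ?st T. Q \<subseteq> S \<and> sharp b Q \<le> Afac * sharp b S" using S QS by blast
  qed
qed

lemma sum_indicator_Linf_c:
  fixes a :: "(real^'n) set \<Rightarrow> complex"
  assumes F: "finite F" "F \<subseteq> D"
  shows "(\<lambda>x. \<Sum>S\<in>F. a S * indicator S x) \<in> Linf_c"
proof -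
  let ?f = "\<lambda>x. \<Sum>S\<in>F. a S * indicator S x"
  have "?f \<in> borel_measurable lebesgue"
    using F by (intro borel_measurable_sum borel_measurable_times borel_measurable_const borel_measurable_indicator D_sets) auto
  moreover have "norm (?f x) \<le> (\<Sum>S\<in>F. norm (a S))" for x
    by (intro sum_norm_le) (auto simp: indicator_def)
  then have "bounded (range ?f)" unfolding bounded_iff by auto
  moreover have "{x. ?f x \<noteq> 0} \<subseteq> \<Union>F"
  proof
    fix x assume "x \<in> {x. ?f x \<noteq> 0}"
    then have ne: "(\<Sum>S\<in>F. a S * indicator S x) \<noteq> 0" by simp
    show "x \<in> \<Union>F"
    proof (rule ccontr)
      assume "x \<notin> \<Union>F"
      then have "(\<Sum>S\<in>F. a S * indicator S x) = 0" by (intro sum.neutral) auto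
      then show False using ne by simp
    qed
  qed
  then have "bounded {x. ?f x \<noteq> 0}"
    by (rule bounded_subset[rotated]) (use F D_bounded in \<open>auto intro!: bounded_Union\<close>)
  ultimately show ?thesis by (simp add: Linf_c_def)
qed

text \<open>Constants of \<open>sparse_synthesis\<close> for \<open>\<mu>\<close> at
  \<open>p\<close> and \<open>\<sigma>\<close> at \<open>q'\<close>, with the mass ratios of
  \<open>Apair_sparse_mass\<close>. For \<open>\<mu>\<close> the swapped pair is used, hence the
  nested conjugate exponents.\<close>

definition "Km = ((2 * Bm) powr ((p / (p - 1)) / (p / (p - 1) - 1)) * p powr (p / (p - 1))) powr (p - 1)"
definition "Ks = ((2 * Bk) powr (q / (q - 1)) * q' powr (q' / (q' - 1))) powr (q' - 1)"

lemma synthesis_mu_sigma: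
  assumes F: "finite F" "sparse F" and x: "\<And>S. 0 \<le> x S"
  shows "(\<integral>\<^sup>+y. ennreal ((\<Sum>S\<in>F. x S * indicator S y) powr p * \<mu> y) \<partial>lebesgue)
      \<le> ennreal (Km * (\<Sum>S\<in>F. x S powr p * wt \<mu> S))"
    and "(\<integral>\<^sup>+y. ennreal ((\<Sum>S\<in>F. x S * indicator S y) powr q' * \<sigma> y) \<partial>lebesgue)
      \<le> ennreal (Ks * (\<Sum>S\<in>F. x S powr q' * wt \<sigma> S))"
proof -
  obtain E where E: "disjoint_family_on E F" "\<And>S. S \<in> F \<Longrightarrow> E S \<in> sets lebesgue"
      "\<And>S. S \<in> F \<Longrightarrow> E S \<subseteq> S" "\<And>S. S \<in> F \<Longrightarrow> mea S \<le> 2 * mea (E S)" and FD: "F \<subseteq> D"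
    using F(2) unfolding sparse_def by blast
  show "(\<integral>\<^sup>+y. ennreal ((\<Sum>S\<in>F. x S * indicator S y) powr p * \<mu> y) \<partial>lebesgue)
      \<le> ennreal (Km * (\<Sum>S\<in>F. x S powr p * wt \<mu> S))"
    unfolding Km_def
  proof (rule sparse_synthesis[OF mu_pair(2,4) F(1) FD E(1-3) _ _ x p1])
    show "wt \<mu> S \<le> (2 * Bm) powr ((p / (p - 1)) / (p / (p - 1) - 1)) * wt \<mu> (E S)" if "S \<in> F" for S
      by (rule Apair_sparse_mass[OF Apair_swap[OF Am]]) (use FD E that in auto)
  qed simp_all
  show "(\<integral>\<^sup>+y. ennreal ((\<Sum>S\<in>F. x S * indicator S y) powr q' * \<sigma> y) \<partial>lebesgue)
      \<le> ennreal (Ks * (\<Sum>S\<in>F. x S powr q' * wt \<sigma> S))"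
    unfolding Ks_def
  proof (rule sparse_synthesis[OF kappa_pair(3,5) F(1) FD E(1-3) _ _ x q'(2)])
    show "wt \<sigma> S \<le> (2 * Bk) powr (q / (q - 1)) * wt \<sigma> (E S)" if "S \<in> F" for S
      by (rule Apair_sparse_mass[OF Ak]) (use FD E that in auto)
  qed simp_all
qed

lemma Km_nonneg: "0 \<le> Km" and Ks_nonneg: "0 \<le> Ks"
  by (simp_all add: Km_def Ks_def)

text \<open>The double sum is the pairing of the paraproduct of a signed sum of indicators with a
  signed sum of test functions. Signs have modulus 1, so \<open>synthesis_mu_sigma\<close> bounds
  both norms uniformly in \<open>\<epsilon>\<close>.\<close>

lemma sign_bound:
  fixes \<epsilon> :: "(real^'n) set \<Rightarrow> complex"
  assumes b: "locally_integrable b" and N: "para_bound b (ennreal N)" "0 \<le> N" and F: "finite F" "sparse F"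
    and x: "\<And>S. 0 \<le> x S" and y: "\<And>S. 0 \<le> y S"
    and P: "\<And>S. S \<in> F \<Longrightarrow> is_paraproduct D b (indicator S) (P S)"
    and g: "\<And>S. S \<in> F \<Longrightarrow> g S \<in> borel_measurable lebesgue" "\<And>S z. S \<in> F \<Longrightarrow> norm (g S z) \<le> 2 * indicator S z"
    and e: "\<And>S. \<epsilon> S = 1 \<or> \<epsilon> S = -1"
  shows "norm (\<Sum>S\<in>F. \<Sum>T\<in>F. \<epsilon> S * \<epsilon> T * (complex_of_real (x S * y T) * (LINT z|lebesgue. P S z * g T z)))
    \<le> N * (Km * (\<Sum>S\<in>F. x S powr p * wt \<mu> S)) powr (1 / p) * (2 * (Ks * (\<Sum>S\<in>F. y S powr q' * wt \<sigma> S)) powr (1 / q'))"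
proof -
  have FD: "F \<subseteq> D" using F(2) by (simp add: sparse_def)
  let ?f = "\<lambda>z. \<Sum>S\<in>F. (\<epsilon> S * complex_of_real (x S)) * indicator S z"
  define h where "h z = (\<Sum>T\<in>F. (\<epsilon> T * complex_of_real (y T)) * g T z)" for z
  have ne: "norm (\<epsilon> S) = 1" for S using e[of S] by auto
  obtain G where G: "is_paraproduct D b ?f G" "ennpowr (Lp_int q \<kappa> G) (1 / q) \<le> ennreal N * ennpowr (Lp_int p \<mu> ?f) (1 / p)"
    using N(1) sum_indicator_Linf_c[OF F(1) FD, of "\<lambda>S. \<epsilon> S * complex_of_real (x S)"]
    unfolding para_bound_def by (elim conjE) (drule (1) bspec, auto)
  have Gl: "locally_integrable G" by (rule is_paraproduct_li[OF G(1)])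
  have Pl: "locally_integrable (P S)" if "S \<in> F" for S by (rule is_paraproduct_li[OF P[OF that]])
  have hm: "h \<in> borel_measurable lebesgue"
    unfolding h_def using g(1) by (intro borel_measurable_sum borel_measurable_times borel_measurable_const)
  have int: "integrable lebesgue (\<lambda>z. H z * g T z)" if H: "locally_integrable H" and T: "T \<in> F" for H :: "real^'n \<Rightarrow> complex" and T
  proof (rule Bochner_Integration.integrable_bound)
    have "T \<in> D" using T FD by auto
    then show "integrable lebesgue (\<lambda>z. 2 * norm (indicator T z *\<^sub>R H z))"
      using set_integrable_D[OF H] by (intro integrable_mult_right integrable_norm) (simp add: set_integrable_def)
    show "(\<lambda>z. H z * g T z) \<in> borel_measurable lebesgue"
      using locally_integrable_measurable[OF H] g(1)[OF T] by (rule borel_measurable_times)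
    show "AE z in lebesgue. norm (H z * g T z) \<le> norm (2 * norm (indicator T z *\<^sub>R H z))"
    proof (rule AE_I2)
      fix z
      show "norm (H z * g T z) \<le> norm (2 * norm (indicator T z *\<^sub>R H z))"
        using mult_left_mono[OF g(2)[OF T, of z] norm_ge_zero[of "H z"]]
        by (auto simp: norm_mult indicator_def mult_ac split: if_splits)
    qed
  qed
  have lin: "(LINT z|lebesgue. G z * g T z) = (\<Sum>S\<in>F. (\<epsilon> S * complex_of_real (x S)) * (LINT z|lebesgue. P S z * g T z))"
    if T: "T \<in> F" for T
  proof -
    have TD: "T \<in> D" using T FD by auto
    have "AE z in lebesgue. z \<in> closure T \<longrightarrow> G z = (\<Sum>S\<in>F. (\<epsilon> S * complex_of_real (x S)) * P S z)"
      by (rule paraproduct_linear[OF F(1) P _ G(1)]) (use FD indicator_li D_bounded[OF TD] in auto)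
    then have "AE z in lebesgue. G z * g T z = (\<Sum>S\<in>F. (\<epsilon> S * complex_of_real (x S)) * (P S z * g T z))"
    proof eventually_elim
      case (elim z)
      show ?case
      proof (cases "z \<in> T")
        case True
        then have "G z = (\<Sum>S\<in>F. (\<epsilon> S * complex_of_real (x S)) * P S z)" using elim closure_subset[of T] by auto
        then show ?thesis by (simp only: sum_distrib_right mult.assoc)
      next
        case False
        then have "g T z = 0" using g(2)[OF T, of z] by simp
        then show ?thesis by simp
      qed
    qed
    then have "(LINT z|lebesgue. G z * g T z) = (LINT z|lebesgue. (\<Sum>S\<in>F. (\<epsilon> S * complex_of_real (x S)) * (P S z * g T z)))"
      using int[OF Gl T] int[OF Pl T]
      by (intro integral_cong_AE) (auto intro!: borel_measurable_integrable Bochner_Integration.integrable_sum integrable_mult_right)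
    also have "\<dots> = (\<Sum>S\<in>F. (\<epsilon> S * complex_of_real (x S)) * (LINT z|lebesgue. P S z * g T z))"
      using int[OF Pl T] by (subst Bochner_Integration.integral_sum) (auto intro!: integrable_mult_right)
    finally show ?thesis .
  qed
  have Gh: "G z * h z = (\<Sum>T\<in>F. (\<epsilon> T * complex_of_real (y T)) * (G z * g T z))" for z
    unfolding h_def by (simp add: sum_distrib_left mult_ac)
  have "(LINT z|lebesgue. G z * h z) = (\<Sum>T\<in>F. (\<epsilon> T * complex_of_real (y T)) * (LINT z|lebesgue. G z * g T z))"
    unfolding Gh using int[OF Gl] by (subst Bochner_Integration.integral_sum) (auto intro!: integrable_mult_right)
  also have "\<dots> = (\<Sum>T\<in>F. \<Sum>S\<in>F. \<epsilon> S * \<epsilon> T * (complex_of_real (x S * y T) * (LINT z|lebesgue. P S z * g T z)))"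
    by (intro sum.cong refl) (simp add: lin sum_distrib_left mult_ac)
  also have "\<dots> = (\<Sum>S\<in>F. \<Sum>T\<in>F. \<epsilon> S * \<epsilon> T * (complex_of_real (x S * y T) * (LINT z|lebesgue. P S z * g T z)))"
    by (rule sum.swap)
  finally have eq: "(\<Sum>S\<in>F. \<Sum>T\<in>F. \<epsilon> S * \<epsilon> T * (complex_of_real (x S * y T) * (LINT z|lebesgue. P S z * g T z))) = (LINT z|lebesgue. G z * h z)" ..
  let ?X = "\<Sum>S\<in>F. x S powr p * wt \<mu> S" and ?Y = "\<Sum>S\<in>F. y S powr q' * wt \<sigma> S"
  have X0: "0 \<le> ?X" "0 \<le> ?Y" using mu_pair(6) kappa_pair(7) by (auto intro!: sum_nonneg mult_nonneg_nonneg wt_nonneg)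
  have fX: "Lp_int p \<mu> ?f \<le> ennreal (Km * ?X)"
  proof -
    have "norm (?f z) powr p * \<mu> z \<le> (\<Sum>S\<in>F. x S * indicator S z) powr p * \<mu> z" for z
      using p1 mu_pair(6) x ne by (intro mult_right_mono powr_mono2 sum_norm_le) (auto simp: norm_mult indicator_def)
    then have "Lp_int p \<mu> ?f \<le> (\<integral>\<^sup>+z. ennreal ((\<Sum>S\<in>F. x S * indicator S z) powr p * \<mu> z) \<partial>lebesgue)"
      unfolding Lp_int_def by (intro nn_integral_mono ennreal_leI)
    also have "\<dots> \<le> ennreal (Km * ?X)" by (rule synthesis_mu_sigma(1)[OF F x])
    finally show ?thesis .
  qed
  have hY: "Lp_int q' \<sigma> h \<le> ennreal (2 powr q' * (Ks * ?Y))"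
  proof -
    have le: "norm (h z) powr q' * \<sigma> z \<le> 2 powr q' * ((\<Sum>S\<in>F. y S * indicator S z) powr q' * \<sigma> z)" for z
    proof -
      have "norm (h z) \<le> (\<Sum>S\<in>F. 2 * (y S * indicator S z))"
        unfolding h_def
      proof (rule sum_norm_le)
        fix T assume T: "T \<in> F"
        show "norm ((\<epsilon> T * complex_of_real (y T)) * g T z) \<le> 2 * (y T * indicator T z)"
          using mult_left_mono[OF g(2)[OF T, of z] y[of T]] y[of T] ne[of T] by (simp add: norm_mult mult_ac)
      qed
      then have "norm (h z) powr q' \<le> (2 * (\<Sum>S\<in>F. y S * indicator S z)) powr q'"
        using q'(2) by (intro powr_mono2) (auto simp: sum_distrib_left)
      then show ?thesis using mult_right_mono[OF _ kappa_pair(7)[of z]] by (simp add: powr_mult mult.assoc[symmetric])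
    qed
    have "Lp_int q' \<sigma> h \<le> (\<integral>\<^sup>+z. ennreal (2 powr q') * ennreal ((\<Sum>S\<in>F. y S * indicator S z) powr q' * \<sigma> z) \<partial>lebesgue)"
      unfolding Lp_int_def using le kappa_pair(7) by (intro nn_integral_mono) (simp add: ennreal_mult[symmetric] ennreal_leI)
    also have "\<dots> = ennreal (2 powr q') * (\<integral>\<^sup>+z. ennreal ((\<Sum>S\<in>F. y S * indicator S z) powr q' * \<sigma> z) \<partial>lebesgue)"
    proof (rule nn_integral_cmult)
      have "(\<lambda>z. \<Sum>S\<in>F. y S * indicator S z) \<in> borel_measurable lebesgue"
        using FD by (intro borel_measurable_sum borel_measurable_times borel_measurable_const borel_measurable_indicator D_sets) auto
      then show "(\<lambda>z. ennreal ((\<Sum>S\<in>F. y S * indicator S z) powr q' * \<sigma> z)) \<in> borel_measurable lebesgue"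
        using locally_integrable_measurable[OF kappa_pair(3)] by measurable
    qed
    also have "\<dots> \<le> ennreal (2 powr q') * ennreal (Ks * ?Y)"
      by (intro mult_left_mono synthesis_mu_sigma(2)[OF F y]) simp
    finally show ?thesis using Ks_nonneg X0 by (simp add: ennreal_mult)
  qed
  have "ennreal (norm (LINT z|lebesgue. G z * h z)) \<le> (\<integral>\<^sup>+z. ennreal (norm (G z * h z)) \<partial>lebesgue)"
    by (rule integral_norm_bound_ennreal)
       (use int[OF Gl] in \<open>auto simp: Gh intro!: Bochner_Integration.integrable_sum integrable_mult_right\<close>)
  also have "\<dots> \<le> ennpowr (Lp_int q \<kappa> G) (1 / q) * ennpowr (Lp_int q' \<sigma> h) (1 / q')"
    unfolding norm_mult using locally_integrable_measurable[OF Gl] hm by (rule Holder_kappa_sigma)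
  also have "\<dots> \<le> (ennreal N * ennpowr (Lp_int p \<mu> ?f) (1 / p)) * ennpowr (Lp_int q' \<sigma> h) (1 / q')"
    by (intro mult_right_mono G) simp
  also have "\<dots> \<le> (ennreal N * ennpowr (ennreal (Km * ?X)) (1 / p)) * ennpowr (ennreal (2 powr q' * (Ks * ?Y))) (1 / q')"
    using p1 q'(2) by (intro mult_mono ennpowr_mono fX hY order_refl) auto
  also have "\<dots> = ennreal (N * (Km * ?X) powr (1 / p) * (2 * (Ks * ?Y) powr (1 / q')))"
  proof -
    have "(2 powr q' * (Ks * ?Y)) powr (1 / q') = (2 powr q') powr (1 / q') * (Ks * ?Y) powr (1 / q')" by (rule powr_mult)
    also have "(2 powr q') powr (1 / q') = 2" unfolding powr_powr using q'(2) by simp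
    finally have e2: "(2 powr q' * (Ks * ?Y)) powr (1 / q') = 2 * (Ks * ?Y) powr (1 / q')" .
    have nn: "0 \<le> Km * ?X" "0 \<le> 2 powr q' * (Ks * ?Y)" using X0 Km_nonneg Ks_nonneg by auto
    show ?thesis unfolding ennpowr_ennreal[OF nn(1)] ennpowr_ennreal[OF nn(2)] e2
      using N(2) by (simp only: ennreal_mult powr_ge_zero mult_nonneg_nonneg zero_le_numeral)
  qed
  finally show ?thesis
    unfolding eq using N(2) by (subst (asm) ennreal_le_iff) (auto intro!: mult_nonneg_nonneg)
qed

definition "Lc = Bm * Bk * (2 * Km powr (1 / p) * Ks powr (1 - 1 / q))"

text \<open>Random signs isolate the diagonal, where the test functions produce the oscillations.
  The coefficients are such that the sum \<open>?Z\<close> satisfies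
  \<open>?Z \<le> Lc * N * ?Z powr s\<close>; dividing leaves its power \<open>1 - s\<close>, which
  is \<open>1 / r\<close>.\<close>

lemma sharp_sum_lower:
  assumes r: "1 / r = 1 / q - 1 / p" "0 < r" and b: "locally_integrable b" and N: "para_bound b (ennreal N)" "0 \<le> N"
    and F: "finite F" "sparse F"
  shows "(\<Sum>S\<in>F. sharp b S powr r * wt \<nu> S) powr (1 / r) \<le> Lc * N"
proof -
  have FD: "F \<subseteq> D" using F(2) by (simp add: sparse_def)
  have sr: "1 / r + s = 1" using r by (simp add: s_eq)
  define z where "z S = sharp b S powr r * wt \<nu> S" for S
  have z0: "0 \<le> z S" for S using nu_nonneg by (auto simp: z_def intro!: mult_nonneg_nonneg wt_nonneg)
  \<comment> \<open>Extremal for Hoelder: \<open>x S powr p * wt \<mu> S\<close> and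
    \<open>y S powr q' * wt \<sigma> S\<close> are both \<open>z S\<close>.\<close>
  define x where "x S = (z S / wt \<mu> S) powr (1 / p)" for S
  define y where "y S = (z S / wt \<sigma> S) powr (1 - 1 / q)" for S
  have xy0: "0 \<le> x S" "0 \<le> y S" for S by (simp_all add: x_def y_def)
  let ?Z = "\<Sum>S\<in>F. z S"
  have Z0: "0 \<le> ?Z" using z0 by (intro sum_nonneg)
  have pos: "0 < wt \<mu> S" "0 < wt \<sigma> S" "0 < wt \<nu> S" if "S \<in> F" for S
    using that FD wt_pos_D[OF mu_pair(2,4)] wt_pos_D[OF kappa_pair(3,5)] wt_nu_pos by auto
  have xp: "x S powr p * wt \<mu> S = z S" if "S \<in> F" for S
  proof -
    have "x S powr p = z S / wt \<mu> S"
      unfolding x_def powr_powr using p1 z0[of S] pos[OF that] by simp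
    then show ?thesis using pos[OF that] by simp
  qed
  have yq: "y S powr q' * wt \<sigma> S = z S" if "S \<in> F" for S
  proof -
    have "(1 - 1 / q) * q' = 1" using q'(3) by (simp add: mult.commute)
    then have "y S powr q' = z S / wt \<sigma> S"
      unfolding y_def powr_powr using z0[of S] pos[OF that] by simp
    then show ?thesis using pos[OF that] by simp
  qed
  have "\<forall>S\<in>F. \<exists>P. is_paraproduct D b (indicator S) P"
  proof
    fix S assume "S \<in> F"
    then show "\<exists>P. is_paraproduct D b (indicator S) P"
      using N(1) indicator_Linf_c[of S] FD unfolding para_bound_def by blast
  qed
  from bchoice[OF this] obtain P where P: "\<forall>S\<in>F. is_paraproduct D b (indicator S) (P S)" by (rule exE)
  have "\<forall>S\<in>F. \<exists>g. g \<in> borel_measurable lebesgue \<and> (\<forall>y. norm (g y) \<le> 2 * indicator S y) \<and>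
    (\<forall>P. is_paraproduct D b (indicator S) P \<longrightarrow> (LINT y|lebesgue. P y * g y) = complex_of_real (mea S * osc S b))"
    using test_function[OF b] FD by blast
  from bchoice[OF this] obtain g where g: "\<forall>S\<in>F. g S \<in> borel_measurable lebesgue \<and> (\<forall>y. norm (g S y) \<le> 2 * indicator S y) \<and>
    (\<forall>P. is_paraproduct D b (indicator S) P \<longrightarrow> (LINT y|lebesgue. P y * g S y) = complex_of_real (mea S * osc S b))"
    by (rule exE)
  let ?a = "\<lambda>S T. complex_of_real (x S * y T) * (LINT z|lebesgue. P S z * g T z)"
  let ?M = "N * (Km * ?Z) powr (1 / p) * (2 * (Ks * ?Z) powr (1 / q'))"
  have signs: "norm (0 + (\<Sum>S\<in>F. ?a S S)) \<le> ?M"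
  proof (rule random_signs[OF F(1), where a = ?a and c = 0])
    fix \<epsilon> :: "(real^'n) set \<Rightarrow> complex" assume e: "\<And>i. \<epsilon> i = 1 \<or> \<epsilon> i = -1"
    have "norm (\<Sum>S\<in>F. \<Sum>T\<in>F. \<epsilon> S * \<epsilon> T * ?a S T)
      \<le> N * (Km * (\<Sum>S\<in>F. x S powr p * wt \<mu> S)) powr (1 / p) * (2 * (Ks * (\<Sum>S\<in>F. y S powr q' * wt \<sigma> S)) powr (1 / q'))"
      by (rule sign_bound[OF b N F xy0]) (use P g e in auto)
    then show "norm (0 + (\<Sum>S\<in>F. \<Sum>T\<in>F. \<epsilon> S * \<epsilon> T * ?a S T)) \<le> ?M"
      using xp yq by (simp cong: sum.cong)
  qed
  have as: "(\<Sum>S\<in>F. ?a S S) = complex_of_real (\<Sum>S\<in>F. x S * y S * (mea S * osc S b))"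
    unfolding of_real_sum using P g by (intro sum.cong refl) auto
  have "0 \<le> (\<Sum>S\<in>F. x S * y S * (mea S * osc S b))" using xy0 by (intro sum_nonneg mult_nonneg_nonneg) auto
  then have diag: "(\<Sum>S\<in>F. x S * y S * (mea S * osc S b)) \<le> ?M"
    using signs unfolding as by (simp only: add_0_left norm_of_real abs_of_nonneg)
  \<comment> \<open>\<open>wt_reverse\<close> exchanges the masses inside \<open>x S * y S\<close>
    for a power of that of \<open>\<nu>\<close>, and \<open>r * s + 1 = r\<close> collects the
    powers of \<open>sharp b S\<close>.\<close>
  have zle: "z S \<le> Bm * Bk * (x S * y S * (mea S * osc S b))" if S: "S \<in> F" for S
  proof -
    note n = pos[OF S]
    let ?w = "wt \<mu> S powr (1 / p) * wt \<sigma> S powr (1 - 1 / q)"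
    have w0: "0 < ?w" using n by simp
    have xyw: "x S * y S = z S powr s / ?w"
      unfolding x_def y_def s_eq using z0[of S] n by (simp add: powr_divide powr_add)
    have zs: "z S powr s = sharp b S powr (r * s) * wt \<nu> S powr s"
      by (simp add: z_def powr_mult powr_powr)
    have rs: "r * s + 1 = r"
    proof -
      have "r * (1 / r + s) = r" unfolding sr by simp
      then show ?thesis using r(2) by (simp add: distrib_left)
    qed
    have mo: "mea S * osc S b = sharp b S * wt \<nu> S" using n by (simp add: sharp_def)
    have "?w * z S = ?w * (sharp b S * sharp b S powr (r * s) * wt \<nu> S)"
      using sharp_nonneg[of b S] rs by (simp add: z_def powr_mult_base add.commute)
    also have "\<dots> \<le> (Bm * Bk * wt \<nu> S powr s) * (sharp b S * sharp b S powr (r * s) * wt \<nu> S)"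
      using wt_reverse[of S] S FD sharp_nonneg[of b S] n by (intro mult_right_mono) auto
    also have "\<dots> = Bm * Bk * (z S powr s * (mea S * osc S b))"
      unfolding zs mo by (simp add: mult_ac)
    also have "\<dots> = ?w * (Bm * Bk * (x S * y S * (mea S * osc S b)))"
    proof -
      have "a * (c * d) = w * (a * (c / w * d))" if "0 < w" for a c d w :: real
        using that by simp
      then show ?thesis unfolding xyw using w0 by blast
    qed
    finally show ?thesis using w0 by (simp only: mult_le_cancel_left_pos)
  qed
  have "?Z \<le> Bm * Bk * (\<Sum>S\<in>F. x S * y S * (mea S * osc S b))"
    unfolding sum_distrib_left by (intro sum_mono zle)
  also have "\<dots> \<le> Bm * Bk * ?M" using mu_pair(9) kappa_pair(9) by (intro mult_left_mono diag) auto
  also have "?M = N * (2 * Km powr (1 / p) * Ks powr (1 - 1 / q)) * ?Z powr s"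
    unfolding q'(1) s_eq powr_add powr_mult by (simp only: mult_ac)
  finally have le: "?Z \<le> (Lc * N) * ?Z powr s" by (simp add: Lc_def mult_ac)
  show ?thesis
  proof (cases "?Z = 0")
    case True
    have "0 \<le> Lc * N" using N(2) mu_pair(9) kappa_pair(9) by (simp add: Lc_def)
    then show ?thesis using True unfolding z_def by simp
  next
    case False
    then have Zp: "0 < ?Z" using Z0 by simp
    have "?Z powr (1 / r) * ?Z powr s = ?Z"
      unfolding powr_add[symmetric] sr using Zp by simp
    then have "?Z powr (1 / r) * ?Z powr s \<le> (Lc * N) * ?Z powr s" using le by simp
    then have "?Z powr (1 / r) \<le> Lc * N" using Zp by (simp only: mult_le_cancel_right_pos powr_gt_zero)
    then show ?thesis unfolding z_def .
  qed
qed

text \<open>Over finitely many cubes the maximal function is dominated by a sum over principal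
  cubes, to which \<open>sharp_sum_lower\<close> applies. Exhausting the countable lattice by finite
  sets, monotone convergence yields the full supremum.\<close>

theorem sharp_maximal_le_para_bound:
  assumes r: "1 / r = 1 / q - 1 / p" "0 < r" and b: "locally_integrable b" and N: "para_bound b N"
  shows "wLp_norm r \<nu> (sharp_maximal D \<nu> b) \<le> ennreal (Afac * Lc) * N"
proof -
  obtain n where n: "N = ennreal n" "0 \<le> n" using N by (cases N) (auto simp: para_bound_def)
  have Nn: "para_bound b (ennreal n)" using N n by simp
  have L0: "0 \<le> Lc * n" using n mu_pair(9) kappa_pair(9) by (simp add: Lc_def)
  have A0: "0 \<le> Afac" using Afac(1) by simp
  let ?B = "ennreal ((Afac * (Lc * n)) powr r)"
  \<comment> \<open>With the power \<open>r\<close> inside, the supremum increases with the set of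
    cubes and is measurable for finite sets.\<close>
  define h where "h QQ x = (SUP Q\<in>QQ. ennreal (sharp b Q powr r) * indicator Q x)" for QQ x
  have fin: "(\<integral>\<^sup>+x. h QQ x * ennreal (\<nu> x) \<partial>lebesgue) \<le> ?B" if QQ: "finite QQ" "QQ \<subseteq> D" for QQ
  proof -
    obtain F where F: "F \<subseteq> QQ" "sparse F" "\<And>Q. Q \<in> QQ \<Longrightarrow> \<exists>S\<in>F. Q \<subseteq> S \<and> sharp b Q \<le> Afac * sharp b S"
      using principal_cubes[OF b QQ] by blast
    have fF: "finite F" and FD: "F \<subseteq> D" using F(1) QQ by (auto intro: finite_subset)
    have "(\<integral>\<^sup>+x. h QQ x * ennreal (\<nu> x) \<partial>lebesgue) \<le> (\<integral>\<^sup>+x. (\<Sum>S\<in>F. ennreal ((Afac * sharp b S) powr r) * (ennreal (\<nu> x) * indicator S x)) \<partial>lebesgue)"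
    proof (rule nn_integral_mono)
      fix x
      have "h QQ x \<le> (\<Sum>S\<in>F. ennreal ((Afac * sharp b S) powr r) * indicator S x)"
        unfolding h_def
      proof (rule SUP_least)
        fix Q assume Q: "Q \<in> QQ"
        obtain S where S: "S \<in> F" "Q \<subseteq> S" "sharp b Q \<le> Afac * sharp b S" using F(3)[OF Q] by blast
        have "ennreal (sharp b Q powr r) * indicator Q x \<le> ennreal ((Afac * sharp b S) powr r) * indicator S x"
        proof (rule mult_mono)
          show "ennreal (sharp b Q powr r) \<le> ennreal ((Afac * sharp b S) powr r)"
            using S(3) sharp_nonneg r(2) by (intro ennreal_leI powr_mono2) auto
          show "indicator Q x \<le> (indicator S x :: ennreal)" using S(2) by (auto simp: indicator_def)
        qed auto
        also have "\<dots> \<le> (\<Sum>S\<in>F. ennreal ((Afac * sharp b S) powr r) * indicator S x)"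
          using fF S(1) by (intro member_le_sum) auto
        finally show "ennreal (sharp b Q powr r) * indicator Q x \<le> (\<Sum>S\<in>F. ennreal ((Afac * sharp b S) powr r) * indicator S x)" .
      qed
      then have "h QQ x * ennreal (\<nu> x) \<le> (\<Sum>S\<in>F. ennreal ((Afac * sharp b S) powr r) * indicator S x) * ennreal (\<nu> x)"
        by (rule mult_right_mono) simp
      then show "h QQ x * ennreal (\<nu> x) \<le> (\<Sum>S\<in>F. ennreal ((Afac * sharp b S) powr r) * (ennreal (\<nu> x) * indicator S x))"
        unfolding sum_distrib_right by (simp only: mult_ac)
    qed
    also have "\<dots> = (\<Sum>S\<in>F. ennreal ((Afac * sharp b S) powr r) * (\<integral>\<^sup>+x. ennreal (\<nu> x) * indicator S x \<partial>lebesgue))"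
    proof -
      have vm: "(\<lambda>x. ennreal (\<nu> x) * indicator S x) \<in> borel_measurable lebesgue" if "S \<in> F" for S
        using that FD by (intro borel_measurable_times_ennreal measurable_compose[OF locally_integrable_measurable[OF nu_li] measurable_ennreal]
          borel_measurable_indicator D_sets) auto
      have "(\<integral>\<^sup>+x. (\<Sum>S\<in>F. ennreal ((Afac * sharp b S) powr r) * (ennreal (\<nu> x) * indicator S x)) \<partial>lebesgue)
        = (\<Sum>S\<in>F. \<integral>\<^sup>+x. ennreal ((Afac * sharp b S) powr r) * (ennreal (\<nu> x) * indicator S x) \<partial>lebesgue)"
        by (rule nn_integral_sum) (rule borel_measurable_times_ennreal[OF borel_measurable_const vm])
      also have "\<dots> = (\<Sum>S\<in>F. ennreal ((Afac * sharp b S) powr r) * (\<integral>\<^sup>+x. ennreal (\<nu> x) * indicator S x \<partial>lebesgue))"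
        by (intro sum.cong refl nn_integral_cmult vm)
      finally show ?thesis .
    qed
    also have "\<dots> = (\<Sum>S\<in>F. ennreal (Afac powr r * (sharp b S powr r * wt \<nu> S)))"
    proof (intro sum.cong refl)
      fix S assume "S \<in> F"
      then have S: "S \<in> D" using FD by auto
      show "ennreal ((Afac * sharp b S) powr r) * (\<integral>\<^sup>+x. ennreal (\<nu> x) * indicator S x \<partial>lebesgue) = ennreal (Afac powr r * (sharp b S powr r * wt \<nu> S))"
        using nn_integral_wt[OF nu_li nu_nonneg D_sets[OF S] D_bounded[OF S]] wt_nonneg[of \<nu> S] nu_nonneg
        by (simp add: ennreal_mult[symmetric] powr_mult mult.assoc)
    qed
    also have "\<dots> = ennreal (Afac powr r * (\<Sum>S\<in>F. sharp b S powr r * wt \<nu> S))"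
      unfolding sum_distrib_left using nu_nonneg by (intro sum_ennreal mult_nonneg_nonneg wt_nonneg) auto
    also have "\<dots> \<le> ?B"
    proof (rule ennreal_leI)
      let ?Z = "\<Sum>S\<in>F. sharp b S powr r * wt \<nu> S"
      have Z0: "0 \<le> ?Z" using nu_nonneg by (intro sum_nonneg mult_nonneg_nonneg wt_nonneg) auto
      have "(?Z powr (1 / r)) powr r \<le> (Lc * n) powr r"
        using r(2) by (intro powr_mono2 sharp_sum_lower[OF r b Nn n(2) fF F(2)]) auto
      then have "?Z \<le> (Lc * n) powr r" unfolding powr_powr using r(2) Z0 by simp
      then show "Afac powr r * ?Z \<le> (Afac * (Lc * n)) powr r"
        unfolding powr_mult[of Afac "Lc * n"] by (rule mult_left_mono) simp
    qed
    finally show ?thesis .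
  qed
  have Dne: "D \<noteq> {}" using Dk_cover Dk_D by blast
  \<comment> \<open>The first \<open>i + 1\<close> members of an enumeration of the lattice, which
    is nonempty and countable.\<close>
  define QQ where "QQ i = from_nat_into D ` {..i}" for i :: nat
  have QQ: "finite (QQ i)" "QQ i \<subseteq> D" for i using from_nat_into[OF Dne] by (auto simp: QQ_def)
  have QU: "(\<Union>i. QQ i) = D"
    using from_nat_into_surj[OF countable_D] from_nat_into[OF Dne] by (fastforce simp: QQ_def)
  have vm: "(\<lambda>x. ennreal (\<nu> x)) \<in> borel_measurable lebesgue"
    by (rule measurable_compose[OF locally_integrable_measurable[OF nu_li] measurable_ennreal])
  have hm: "(\<lambda>x. h (QQ i) x * ennreal (\<nu> x)) \<in> borel_measurable lebesgue" for i
    unfolding h_def using QQ[of i]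
    by (intro borel_measurable_times_ennreal vm borel_measurable_SUP countable_finite borel_measurable_const
        borel_measurable_indicator D_sets) auto
  have le: "ennpowr (sharp_maximal D \<nu> b x) r * ennreal (\<nu> x) \<le> (SUP i. h (QQ i) x * ennreal (\<nu> x))" for x
  proof -
    let ?T = "SUP i. h (QQ i) x"
    have "sharp_maximal D \<nu> b x \<le> ennpowr ?T (1 / r)"
      unfolding sharp_maximal_def
    proof (rule SUP_least)
      fix Q assume Q: "Q \<in> D"
      then obtain i where i: "Q \<in> QQ i" using QU by blast
      have eq: "indicator Q x / wmass \<nu> Q * oscillation b Q = ennreal (sharp b Q) * indicator Q x"
      proof -
        have "1 / ennreal (wt \<nu> Q) = ennreal (1 / wt \<nu> Q)"
          using wt_nu_pos[OF Q] by (metis divide_ennreal ennreal_1 zero_le_one)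
        then show ?thesis
          using wt_nu_pos[OF Q] by (cases "x \<in> Q") (simp_all add: oscillation_eq[OF b Q] wmass_nu[OF Q] sharp_def ennreal_mult[symmetric] less_imp_le)
      qed
      have "ennreal (sharp b Q powr r) * indicator Q x \<le> h (QQ i) x" unfolding h_def by (rule SUP_upper[OF i])
      also have "\<dots> \<le> ?T" by (rule SUP_upper) simp
      finally have "ennpowr (ennreal (sharp b Q powr r) * indicator Q x) (1 / r) \<le> ennpowr ?T (1 / r)"
        using r(2) by (intro ennpowr_mono) auto
      moreover have "ennpowr (ennreal (sharp b Q powr r) * indicator Q x) (1 / r) = ennreal (sharp b Q) * indicator Q x"
        using r(2) sharp_nonneg[of b Q] by (cases "x \<in> Q") (simp_all add: powr_powr)
      ultimately show "indicator Q x / wmass \<nu> Q * oscillation b Q \<le> ennpowr ?T (1 / r)" unfolding eq by simp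
    qed
    then have "ennpowr (sharp_maximal D \<nu> b x) r \<le> ennpowr (ennpowr ?T (1 / r)) r"
      using r(2) by (intro ennpowr_mono) auto
    also have "\<dots> = ?T" using r(2) by simp
    finally have "ennpowr (sharp_maximal D \<nu> b x) r * ennreal (\<nu> x) \<le> ?T * ennreal (\<nu> x)" by (rule mult_right_mono) simp
    then show ?thesis by (simp add: SUP_mult_right_ennreal)
  qed
  have "(\<integral>\<^sup>+x. ennpowr (sharp_maximal D \<nu> b x) r * ennreal (\<nu> x) \<partial>lebesgue) \<le> (\<integral>\<^sup>+x. (SUP i. h (QQ i) x * ennreal (\<nu> x)) \<partial>lebesgue)"
    by (intro nn_integral_mono le)
  also have "\<dots> = (SUP i. \<integral>\<^sup>+x. h (QQ i) x * ennreal (\<nu> x) \<partial>lebesgue)"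
  proof (rule nn_integral_monotone_convergence_SUP[OF _ hm])
    show "incseq (\<lambda>i x. h (QQ i) x * ennreal (\<nu> x))"
    proof (intro incseq_SucI le_funI mult_right_mono)
      fix i x
      show "h (QQ i) x \<le> h (QQ (Suc i)) x" unfolding h_def QQ_def by (intro SUP_subset_mono) auto
    qed simp
  qed
  also have "\<dots> \<le> ?B" by (intro SUP_least fin QQ)
  finally have "wLp_norm r \<nu> (sharp_maximal D \<nu> b) \<le> ennpowr ?B (1 / r)"
    unfolding wLp_norm_def using r(2) by (intro ennpowr_mono) auto
  also have "\<dots> = ennreal (Afac * (Lc * n))"
    using r(2) A0 L0 by (simp add: powr_powr)
  also have "\<dots> = ennreal (Afac * Lc) * N"
    using n A0 mu_pair(9) kappa_pair(9) by (simp add: n(1) Lc_def ennreal_mult[symmetric] mult.assoc)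
  finally show ?thesis .
qed

end

section \<open>Assembly of the constants\<close>

context bloom
begin

text \<open>Exponent count: \<open>Bm\<close> enters once plainly and once to the power
  \<open>1 / (p - 1)\<close>, and \<open>1 / p + 1 / p * (1 / (p - 1))\<close> is
  \<open>1 / (p - 1)\<close>, the power of the characteristic of \<open>\<mu>\<close> in the
  theorem.\<close>

lemma Kf_eq:
  assumes "Bm = a powr (1 / p)" "0 \<le> a"
  shows "Kf = 2 powr (1 / (p - 1)) * (p / (p - 1)) * a powr (1 / (p - 1))"
proof -
  have "1 / p + 1 / p * (1 / (p - 1)) = 1 / (p - 1)" using p1 by (simp add: field_simps)
  then have "a powr (1 / p) * (a powr (1 / p)) powr (1 / (p - 1)) = a powr (1 / (p - 1))"
    by (simp only: powr_powr powr_add[symmetric])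
  moreover have "Kf = 2 powr (1 / (p - 1)) * (p / (p - 1)) * (a powr (1 / p) * (a powr (1 / p)) powr (1 / (p - 1)))"
    unfolding Kf_def unfolding assms(1) powr_mult by (simp only: mult_ac)
  ultimately show ?thesis by (simp only:)
qed

text \<open>Here the exponents \<open>1 / q\<close> and \<open>(q - 1) / q\<close> add up to 1, so
  the characteristic of \<open>\<kappa>\<close> enters linearly.\<close>

lemma Kg_eq:
  assumes "Bk = a powr (1 / q)" "0 \<le> a"
  shows "Kg = 2 powr (q - 1) * q * a"
proof -
  have "1 / q + 1 / q * (q - 1) = 1" using q1 by (simp add: field_simps)
  then have "a powr (1 / q) * (a powr (1 / q)) powr (q - 1) = a"
    unfolding powr_powr powr_add[symmetric] using assms(2) by simp
  moreover have "Kg = 2 powr (q - 1) * q * (a powr (1 / q) * (a powr (1 / q)) powr (q - 1))"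
    unfolding Kg_def unfolding assms(1) powr_mult by (simp only: mult_ac)
  ultimately show ?thesis by (simp only:)
qed

lemma bmo_norm_le_para_bound:
  assumes s: "s = 1 + \<alpha> / real CARD('n)" and b: "locally_integrable b" and N: "para_bound b N"
  shows "bmo_norm D \<alpha> \<nu> b \<le> ennreal (2 * Bm * Bk) * N"
  unfolding bmo_norm_def
proof (rule SUP_least)
  fix Q assume Q: "Q \<in> D"
  obtain n where n: "N = ennreal n" "0 \<le> n" using N by (cases N) (auto simp: para_bound_def)
  have L: "0 \<le> 2 * Bm * Bk" using mu_pair(9) kappa_pair(9) by simp
  have w: "0 < wt \<nu> Q powr s" using wt_nu_pos[OF Q] by simp
  have "ennreal (mea Q * osc Q b) \<le> ennreal (2 * Bm * Bk) * N * ennreal (wt \<nu> Q powr s)"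
    by (rule osc_le_para_bound[OF b N Q])
  then have "mea Q * osc Q b \<le> (2 * Bm * Bk) * n * wt \<nu> Q powr s"
  proof -
    assume le: "ennreal (mea Q * osc Q b) \<le> ennreal (2 * Bm * Bk) * N * ennreal (wt \<nu> Q powr s)"
    have "ennreal (2 * Bm * Bk) * N * ennreal (wt \<nu> Q powr s) = ennreal ((2 * Bm * Bk) * n * wt \<nu> Q powr s)"
      unfolding n(1) using L n(2) by (simp only: ennreal_mult mult_nonneg_nonneg powr_ge_zero)
    then show ?thesis using le L n(2) by (metis ennreal_le_iff mult_nonneg_nonneg powr_ge_zero)
  qed
  then have "mea Q * osc Q b / wt \<nu> Q powr s \<le> (2 * Bm * Bk) * n"
    using w by (simp add: pos_divide_le_eq)
  then have "ennreal (mea Q * osc Q b / wt \<nu> Q powr s) \<le> ennreal (2 * Bm * Bk) * N"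
    using n L by (subst n(1), subst ennreal_mult[symmetric]) (auto intro: ennreal_leI)
  moreover have "ennreal (mea Q * osc Q b) / ennreal (wt \<nu> Q powr s) = ennreal (mea Q * osc Q b / wt \<nu> Q powr s)"
    using w by (intro divide_ennreal) auto
  ultimately show "oscillation b Q / ennpowr (wmass \<nu> Q) (1 + \<alpha> / real CARD('n)) \<le> ennreal (2 * Bm * Bk) * N"
    unfolding s[symmetric] oscillation_eq[OF b Q] wmass_nu[OF Q] using wt_nu_pos[OF Q] by simp
qed

text \<open>The factor 2 stems from \<open>sharp_sum_le\<close> and is granted to the case
  \<open>p \<le> q\<close> as well, so that one constant serves both. If \<open>p > q\<close>, then
  \<open>1 / r\<close> lies between 0 and 1, which gives \<open>r \<ge> 1\<close>.\<close>

lemma form_bound_norm: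
  assumes r: "1 / r = 1 / q - 1 / p" and s: "s = 1 + \<alpha> / real CARD('n)" and b: "locally_integrable b"
    and X: "X = (if p \<le> q then bmo_norm D \<alpha> \<nu> b
            else ennpowr (Ainf_char D \<nu>) (1 / r) * wLp_norm r \<nu> (sharp_maximal D \<nu> b))" "X < \<infinity>"
  shows "form_bound (2 * enn2real X) b"
proof (cases "p \<le> q")
  case True
  show ?thesis
  proof (rule form_bound_bmo[OF True])
    fix Q assume Q: "Q \<in> D"
    have w: "0 < wt \<nu> Q powr s" using wt_nu_pos[OF Q] by simp
    have "oscillation b Q / ennpowr (wmass \<nu> Q) (1 + \<alpha> / real CARD('n)) \<le> X"
      unfolding X(1) bmo_norm_def using True by (auto intro: SUP_upper[OF Q])
    moreover have "ennreal (mea Q * osc Q b) / ennreal (wt \<nu> Q powr s) = ennreal (mea Q * osc Q b / wt \<nu> Q powr s)"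
      using w by (intro divide_ennreal) auto
    ultimately have "ennreal (mea Q * osc Q b / wt \<nu> Q powr s) \<le> ennreal (enn2real X)"
      unfolding s[symmetric] oscillation_eq[OF b Q] wmass_nu[OF Q] using wt_nu_pos[OF Q] X(2) by simp
    then have "mea Q * osc Q b / wt \<nu> Q powr s \<le> enn2real X" by (simp add: ennreal_le_iff)
    then have "mea Q * osc Q b \<le> enn2real X * wt \<nu> Q powr s" using w by (simp add: pos_divide_le_eq)
    also have "\<dots> \<le> 2 * enn2real X * wt \<nu> Q powr s" using w by simp
    finally show "mea Q * osc Q b \<le> 2 * enn2real X * wt \<nu> Q powr s" .
  qed simp
next
  case False
  then have qp: "1 / p < 1 / q" using p1 q1 by (simp add: frac_less2)
  have r0: "0 < r" using r qp by (metis diff_gt_0_iff_gt zero_less_divide_1_iff)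
  have "1 / r < 1"
  proof -
    have "1 / q < 1" "0 < 1 / p" using p1 q1 by auto
    then show ?thesis unfolding r by linarith
  qed
  then have r1: "1 \<le> r" using r0 by (simp add: divide_less_eq)
  show ?thesis
  proof (rule form_bound_sharp[OF r r0])
    fix F assume F: "finite F" "sparse F"
    have "ennreal ((\<Sum>S\<in>F. sharp b S powr r * wt \<nu> S) powr (1 / r)) \<le> 2 * X"
      using sharp_sum_le[OF F b r1] False unfolding X(1) by simp
    also have "\<dots> = ennreal (2 * enn2real X)" using X(2) by (simp add: ennreal_mult)
    finally show "(\<Sum>S\<in>F. sharp b S powr r * wt \<nu> S) powr (1 / r) \<le> 2 * enn2real X" by (simp add: ennreal_le_iff)
  qed simp
qed

lemma para_norm_lower:
  assumes r: "1 / r = 1 / q - 1 / p" and s: "s = 1 + \<alpha> / real CARD('n)"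
  shows "\<exists>c>0. \<forall>b :: real^'n \<Rightarrow> complex. locally_integrable b \<longrightarrow>
    ennreal c * (if p \<le> q then bmo_norm D \<alpha> \<nu> b else wLp_norm r \<nu> (sharp_maximal D \<nu> b)) \<le> para_norm D p \<mu> q \<kappa> b"
proof -
  \<comment> \<open>The constant of the theorem is \<open>1 / (L + 1)\<close>, well defined and
    positive as soon as \<open>L\<close> is nonnegative.\<close>
  define L where "L = (if p \<le> q then 2 * Bm * Bk else Afac * Lc)"
  have L0: "0 \<le> L" using mu_pair(9) kappa_pair(9) Afac(1) by (simp add: L_def Lc_def)
  have "ennreal (1 / (L + 1)) * (if p \<le> q then bmo_norm D \<alpha> \<nu> b else wLp_norm r \<nu> (sharp_maximal D \<nu> b)) \<le> para_norm D p \<mu> q \<kappa> b"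
    (is "_ * ?X \<le> _") if b: "locally_integrable b" for b :: "real^'n \<Rightarrow> complex"
  proof (rule para_norm_geI)
    fix N assume N: "para_bound b N"
    have "?X \<le> ennreal L * N"
    proof (cases "p \<le> q")
      case True
      then show ?thesis using bmo_norm_le_para_bound[OF s b N] by (simp add: L_def)
    next
      case False
      then have "1 / p < 1 / q" using p1 q1 by (simp add: frac_less2)
      then have "0 < r" using r by (metis diff_gt_0_iff_gt zero_less_divide_1_iff)
      then show ?thesis using sharp_maximal_le_para_bound[OF r _ b N] False by (simp add: L_def)
    qed
    then have "ennreal (1 / (L + 1)) * ?X \<le> ennreal (1 / (L + 1)) * (ennreal L * N)"
      by (rule mult_left_mono) simp
    also have "\<dots> = ennreal (L / (L + 1)) * N"
      using L0 by (simp add: ennreal_mult[symmetric] mult.assoc[symmetric])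
    also have "\<dots> \<le> 1 * N" using L0 by (intro mult_right_mono) (auto simp: ennreal_le_1)
    finally show "ennreal (1 / (L + 1)) * ?X \<le> N" by simp
  qed
  then show ?thesis using L0 by (intro exI[of _ "1 / (L + 1)"]) auto
qed

end

text \<open>For \<open>p = q\<close> the equation for \<open>r\<close> reads
  \<open>1 / r = 0\<close>, that is \<open>r = 0\<close> by the convention for division by zero; for
  \<open>p > q\<close> it gives \<open>r > 1\<close>.\<close>

theorem theoremB:
  fixes p q r \<alpha> :: real
  assumes "1 < p" and "1 < q"
    and "1 / r = 1 / q - 1 / p"
    and "\<alpha> / real CARD('n) = 1 / p - 1 / q"
  shows "\<exists>C>0. \<forall>(D :: (real^'n) set set) \<mu> \<kappa> \<nu>.
    dyadic_lattice D \<longrightarrow> Ap_weight D p \<mu> \<longrightarrow> Ap_weight D q \<kappa> \<longrightarrow>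
    (\<forall>x. \<nu> x > 0 \<and>
         \<nu> x powr (1 / p + 1 / conj_exp q) = \<mu> x powr (1 / p) * \<kappa> x powr (- 1 / q)) \<longrightarrow>
    (\<exists>c>0. \<forall>b :: real^'n \<Rightarrow> complex. locally_integrable b \<longrightarrow>
       para_norm D p \<mu> q \<kappa> b
         \<le> ennreal C * ennpowr (Ap_char D p \<mu>) (1 / (p - 1)) * Ap_char D q \<kappa> *
           (if p \<le> q then bmo_norm D \<alpha> \<nu> b
            else ennpowr (Ainf_char D \<nu>) (1 / r) * wLp_norm r \<nu> (sharp_maximal D \<nu> b)) \<and>
       para_norm D p \<mu> q \<kappa> b
         \<ge> ennreal c *
           (if p \<le> q then bmo_norm D \<alpha> \<nu> b
            else wLp_norm r \<nu> (sharp_maximal D \<nu> b)))"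
proof -
  \<comment> \<open>In this order: sparse domination, the parts of \<open>Kf\<close> and
    \<open>Kg\<close> free of the characteristics, and the 2 of
    \<open>form_bound_norm\<close>.\<close>
  let ?C0 = "64 * 2 ^ CARD('n) * (2 powr (1 / (p - 1)) * (p / (p - 1))) * (2 powr (q - 1) * q) * 2 :: real"
  have C0: "0 < ?C0" using assms(1,2) by simp
  have cq: "1 / conj_exp q = 1 - 1 / q" using assms(2) by (simp add: conj_exp_def field_simps)
  show ?thesis
  proof (rule exI[of _ ?C0], intro conjI C0 allI impI)
    fix D :: "(real^'n) set set" and \<mu> \<kappa> \<nu>
    assume D: "dyadic_lattice D" and mu: "Ap_weight D p \<mu>" and ka: "Ap_weight D q \<kappa>"
      and nu: "\<forall>x. 0 < \<nu> x \<and> \<nu> x powr (1 / p + 1 / conj_exp q) = \<mu> x powr (1 / p) * \<kappa> x powr (- 1 / q)"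
    obtain Dk where Dk: "D = (\<Union>k. Dk k)" "\<And>k. partition_on UNIV (Dk k)"
      "\<And>k Q. Q \<in> Dk k \<Longrightarrow> is_cube (2 powi (- k)) Q" "\<And>k. refines UNIV (Dk (k + 1)) (Dk k)"
      using D unfolding dyadic_lattice_def by blast
    interpret dyadic D Dk by unfold_locales (use Dk in auto)
    let ?a = "enn2real (Ap_char D p \<mu>)" and ?k = "enn2real (Ap_char D q \<kappa>)"
    have Am: "Apair p \<mu> (\<lambda>x. \<mu> x powr (- 1 / (p - 1))) (?a powr (1 / p))" and a1: "1 \<le> Ap_char D p \<mu>"
      using Ap_weight_Apair[OF mu assms(1)] by auto
    have Ak: "Apair q \<kappa> (\<lambda>x. \<kappa> x powr (- 1 / (q - 1))) (?k powr (1 / q))" and k1: "1 \<le> Ap_char D q \<kappa>"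
      using Ap_weight_Apair[OF ka assms(2)] by auto
    have fin: "Ap_char D p \<mu> < \<infinity>" "Ap_char D q \<kappa> < \<infinity>" using mu ka by (auto simp: Ap_weight_def)
    interpret bloom D Dk p q "1 / p + (1 - 1 / q)" \<mu> "\<lambda>x. \<mu> x powr (- 1 / (p - 1))" \<kappa> "\<lambda>x. \<kappa> x powr (- 1 / (q - 1))" \<nu>
      "?a powr (1 / p)" "?k powr (1 / q)"
      by unfold_locales (use Am Ak nu cq in auto)
    have s: "1 / p + (1 - 1 / q) = 1 + \<alpha> / real CARD('n)" using assms(4) by simp
    obtain c where c: "c > 0" "\<And>b :: real^'n \<Rightarrow> complex. locally_integrable b \<Longrightarrow>
        ennreal c * (if p \<le> q then bmo_norm D \<alpha> \<nu> b else wLp_norm r \<nu> (sharp_maximal D \<nu> b)) \<le> para_norm D p \<mu> q \<kappa> b"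
      using para_norm_lower[OF assms(3) s] by blast
    show "\<exists>c>0. \<forall>b :: real^'n \<Rightarrow> complex. locally_integrable b \<longrightarrow>
       para_norm D p \<mu> q \<kappa> b
         \<le> ennreal ?C0 * ennpowr (Ap_char D p \<mu>) (1 / (p - 1)) * Ap_char D q \<kappa> *
           (if p \<le> q then bmo_norm D \<alpha> \<nu> b
            else ennpowr (Ainf_char D \<nu>) (1 / r) * wLp_norm r \<nu> (sharp_maximal D \<nu> b)) \<and>
       para_norm D p \<mu> q \<kappa> b
         \<ge> ennreal c *
           (if p \<le> q then bmo_norm D \<alpha> \<nu> b
            else wLp_norm r \<nu> (sharp_maximal D \<nu> b))"
    proof (intro exI[of _ c] conjI allI impI c)
      fix b :: "real^'n \<Rightarrow> complex" assume b: "locally_integrable b"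
      let ?X = "if p \<le> q then bmo_norm D \<alpha> \<nu> b
            else ennpowr (Ainf_char D \<nu>) (1 / r) * wLp_norm r \<nu> (sharp_maximal D \<nu> b)"
      let ?A = "ennreal ?C0 * ennpowr (Ap_char D p \<mu>) (1 / (p - 1)) * Ap_char D q \<kappa>"
      show "para_norm D p \<mu> q \<kappa> b \<le> ?A * ?X"
      proof (cases "?X < \<infinity>")
        case True
        have "para_norm D p \<mu> q \<kappa> b \<le> ennreal (64 * 2 ^ CARD('n) * (2 * enn2real ?X * Kf * Kg))"
          by (rule para_norm_upper[OF form_bound_norm[OF assms(3) s b refl True] b])
        also have "64 * 2 ^ CARD('n) * (2 * enn2real ?X * Kf * Kg) = ?C0 * ?a powr (1 / (p - 1)) * ?k * enn2real ?X"
          unfolding Kf_eq[OF refl enn2real_nonneg] Kg_eq[OF refl enn2real_nonneg] by (simp only: mult_ac)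
        also have "ennreal \<dots> = ennreal ?C0 * ennreal (?a powr (1 / (p - 1))) * ennreal ?k * ennreal (enn2real ?X)"
          using C0 by (simp only: ennreal_mult mult_nonneg_nonneg less_imp_le powr_ge_zero enn2real_nonneg)
        also have "ennreal (enn2real ?X) = ?X" using True by (intro ennreal_enn2real) simp
        also have "ennreal ?k = Ap_char D q \<kappa>" using fin by (intro ennreal_enn2real) simp
        also have "ennreal (?a powr (1 / (p - 1))) = ennpowr (ennreal ?a) (1 / (p - 1))" by simp
        also have "ennreal ?a = Ap_char D p \<mu>" using fin by (intro ennreal_enn2real) simp
        finally show ?thesis .
      next
        \<comment> \<open>An infinite right side makes the claim trivial provided that the other
          factors are not 0, which holds because both characteristics are at least 1.\<close>
        case False
        have "?A \<noteq> 0" using C0 a1 k1 by auto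
        then have "?A * ?X = top" using False by (simp only: ennreal_mult_top not_less top_unique infinity_ennreal_def if_False)
        then show ?thesis by simp
      qed
    qed (use c in auto)
  qed
qed

end
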